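(* Let $H$ be a Hopf algebra over a field $\mathbf{k}$ with a bijective antipode and $B/A$ a faithfully flat $H$-Galois extension. Let $L_\bullet$ be a projective resolution of the trivial right $H$-module $\mathbf{k}$ and $K_\bullet$ a projective resolution of the left $\Gamma$-module $A$, and let $K'_\bullet$ be the complex $B^e\otimes_{A^e}K_\bullet$. Then the total complex $\operatorname{Tot}(L_\bullet\otimes_HK'_\bullet)$ of the bicomplex $L_\bullet\otimes_HK'_\bullet$ is a projective resolution of $B$ as a $(B,B)$-bimodule.
   Context: Unadorned $\otimes$ is over $\mathbf{k}$; $R^e=R\otimes R^{\mathrm{op}}$; Sweedler notation. $B$ is a right $H$-comodule algebra with coaction $\rho(b)=\sum b_{(0)}\otimes b_{(1)}$, $A=B^{\mathrm{co}H}=\{b\mid\rho(b)=b\otimes1\}$. $B/A$ is $H$-Galois if $\beta:B\otimes_AB\to B\otimes H$, $b\otimes_Ab'\mapsto\sum bb'_{(0)}\otimes b'_{(1)}$, is bijective; faithfully flat if moreover $B$ is faithfully flat as a left (equivalently right) $A$-module. Write $\beta^{-1}(1\otimes h)=\sum_il_i(h)\otimes_Ar_i(h)$. $\Gamma=\{\sum_pb_p\otimes b_p'^{\mathrm{op}}\in B^e\mid\sum_p(b_p)_{(0)}\otimes(b'_p)_{(0)}^{\mathrm{op}}\otimes(b_p)_{(1)}(b'_p)_{(1)}=\sum_pb_p\otimes b_p'^{\mathrm{op}}\otimes1_H\}$ is a subalgebra of $B^e$ containing $A^e$. For a left $\Gamma$-module $M$ write $\sum_px_pmy_p$ for $(\sum_px_p\otimes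 y_p^{\mathrm{op}})\cdot m$. $A$ is a left $\Gamma$-module via $(\sum_p x_p\otimes y_p^{\mathrm{op}})\cdot a=\sum_p x_pay_p$. For $h\in H$, the element $\sum_{i,j}l_i(h_{(1)})\otimes_A(r_i(h_{(1)})\otimes l_j(h_{(2)})^{\mathrm{op}})\otimes_Ar_j(h_{(2)})$ lies in $B\otimes_A\Gamma\otimes_AB$. For a left $\Gamma$-module $M$, $B^e\otimes_{A^e}M$ is a left $H$-module via $h\rightharpoonup((b\otimes b'^{\mathrm{op}})\otimes_{A^e}m)=\sum_{i,j}(bl_i(h_{(1)})\otimes(r_j(h_{(2)})b')^{\mathrm{op}})\otimes_{A^e}(r_i(h_{(1)})ml_j(h_{(2)}))$, commuting with the $(B,B)$-bimodule structure given by left multiplication by $B^e$, i.e. $c\cdot((b\otimes b'^{\mathrm{op}})\otimes m)\cdot c'=(cb\otimes(b'c')^{\mathrm{op}})\otimes m$. The total complex has $\operatorname{Tot}_n=\bigoplus_{p+q=n}L_p\otimes_HK'_q$ with differential $d(l\otimes x)=d^L(l)\otimes x+(-1)^pl\otimes d^{K'}(x)$ for $l\in L_p$. *)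

theory Defs
  imports "HOL-Algebra.Module" "HOL-Algebra.Free_Abelian_Groups"
begin

section \<open>Modules over noncommutative rings\<close>

text \<open>Right \<open>R\<close>-modules are left modules over \<open>opp R\<close>; for a right module \<open>M\<close>, the
  term \<open>r \<odot>\<^bsub>M\<^esub> m\<close> stands for \<open>m r\<close>.\<close>

definition opp :: "('a, 'z) ring_scheme \<Rightarrow> ('a, 'z) ring_scheme"
  where "opp R = R\<lparr>monoid.mult := (\<lambda>x y. y \<otimes>\<^bsub>R\<^esub> x)\<rparr>"

locale left_module = R?: ring R + M?: abelian_group M
  for R :: "('a, 'y) ring_scheme" (structure) and M :: "('a, 'm, 'z) module_scheme" (structure) +
  assumes smult_closed: "\<lbrakk>a \<in> carrier R; x \<in> carrier M\<rbrakk> \<Longrightarrow> a \<odot>\<^bsub>M\<^esub> x \<in> carrier M"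
    and smult_l_distr: "\<lbrakk>a \<in> carrier R; b \<in> carrier R; x \<in> carrier M\<rbrakk> \<Longrightarrow>
      (a \<oplus>\<^bsub>R\<^esub> b) \<odot>\<^bsub>M\<^esub> x = a \<odot>\<^bsub>M\<^esub> x \<oplus>\<^bsub>M\<^esub> b \<odot>\<^bsub>M\<^esub> x"
    and smult_r_distr: "\<lbrakk>a \<in> carrier R; x \<in> carrier M; y \<in> carrier M\<rbrakk> \<Longrightarrow>
      a \<odot>\<^bsub>M\<^esub> (x \<oplus>\<^bsub>M\<^esub> y) = a \<odot>\<^bsub>M\<^esub> x \<oplus>\<^bsub>M\<^esub> a \<odot>\<^bsub>M\<^esub> y"
    and smult_assoc1: "\<lbrakk>a \<in> carrier R; b \<in> carrier R; x \<in> carrier M\<rbrakk> \<Longrightarrow>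
      (a \<otimes>\<^bsub>R\<^esub> b) \<odot>\<^bsub>M\<^esub> x = a \<odot>\<^bsub>M\<^esub> (b \<odot>\<^bsub>M\<^esub> x)"
    and smult_one: "x \<in> carrier M \<Longrightarrow> \<one>\<^bsub>R\<^esub> \<odot>\<^bsub>M\<^esub> x = x"

definition lmod_hom ::
    "('a, 'y) ring_scheme \<Rightarrow> ('a, 'm, 'z) module_scheme \<Rightarrow> ('a, 'n, 'w) module_scheme \<Rightarrow> ('m \<Rightarrow> 'n) set"
  where "lmod_hom R M N = {f \<in> carrier M \<rightarrow> carrier N.
    (\<forall>x\<in>carrier M. \<forall>y\<in>carrier M. f (x \<oplus>\<^bsub>M\<^esub> y) = f x \<oplus>\<^bsub>N\<^esub> f y) \<and>
    (\<forall>a\<in>carrier R. \<forall>x\<in>carrier M. f (a \<odot>\<^bsub>M\<^esub> x) = a \<odot>\<^bsub>N\<^esub> f x)}"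

definition exact_at ::
    "('m, 'x) ring_scheme \<Rightarrow> ('m \<Rightarrow> 'n) \<Rightarrow> ('n, 'y) ring_scheme \<Rightarrow> ('n \<Rightarrow> 'p) \<Rightarrow> ('p, 'z) ring_scheme \<Rightarrow> bool"
  where "exact_at M f N g P \<longleftrightarrow> f ` carrier M = {x \<in> carrier N. g x = \<zero>\<^bsub>P\<^esub>}"

text \<open>Replace the scalar action of a module (or give one to an abelian group).\<close>

definition with_action :: "('m, 'z) ring_scheme \<Rightarrow> ('r \<Rightarrow> 'm \<Rightarrow> 'm) \<Rightarrow> ('r, 'm) module"
  where "with_action M act = \<lparr>carrier = carrier M, monoid.mult = monoid.mult M, one = \<one>\<^bsub>M\<^esub>,
    ring.zero = \<zero>\<^bsub>M\<^esub>, add = add M, smult = act\<rparr>"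

text \<open>The lifting property. HOL cannot quantify over types inside a definition, so the test
  modules range over fixed types; these are large enough to contain \<open>P\<close> and the free module on
  the set \<open>P\<close>, and \<open>projective_lift\<close> below recovers the lifting property for modules of arbitrary
  type.\<close>

definition projective_module :: "('r, 'y) ring_scheme \<Rightarrow> ('r, 'p, 'z) module_scheme \<Rightarrow> bool"
  where "projective_module R P \<longleftrightarrow> left_module R P \<and>
    (\<forall>(M :: ('r, 'p \<Rightarrow> 'r) module) (N :: ('r, 'p) module) g f.
       left_module R M \<and> left_module R N \<and>
       g \<in> lmod_hom R M N \<and> g ` carrier M = carrier N \<and> f \<in> lmod_hom R P N \<longrightarrow>
       (\<exists>h \<in> lmod_hom R P M. \<forall>x\<in>carrier P. g (h x) = f x))"

definition free_module :: "('r, 'y) ring_scheme \<Rightarrow> 'p set \<Rightarrow> ('r, 'p \<Rightarrow> 'r) module"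
  where "free_module R S =
    \<lparr>carrier = {c. finite {p. c p \<noteq> \<zero>\<^bsub>R\<^esub>} \<and> {p. c p \<noteq> \<zero>\<^bsub>R\<^esub>} \<subseteq> S \<and> range c \<subseteq> carrier R},
     monoid.mult = undefined, one = undefined, ring.zero = (\<lambda>_. \<zero>\<^bsub>R\<^esub>),
     add = (\<lambda>c d p. c p \<oplus>\<^bsub>R\<^esub> d p), smult = (\<lambda>a c p. a \<otimes>\<^bsub>R\<^esub> c p)\<rparr>"

lemma free_module_simps:
  "c \<in> carrier (free_module R S) \<longleftrightarrow>
    finite {p. c p \<noteq> \<zero>\<^bsub>R\<^esub>} \<and> {p. c p \<noteq> \<zero>\<^bsub>R\<^esub>} \<subseteq> S \<and> (\<forall>p. c p \<in> carrier R)"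
  "\<zero>\<^bsub>free_module R S\<^esub> = (\<lambda>_. \<zero>\<^bsub>R\<^esub>)"
  "c \<oplus>\<^bsub>free_module R S\<^esub> d = (\<lambda>p. c p \<oplus>\<^bsub>R\<^esub> d p)"
  "a \<odot>\<^bsub>free_module R S\<^esub> c = (\<lambda>p. a \<otimes>\<^bsub>R\<^esub> c p)"
  by (auto simp: free_module_def)

lemma free_moduleI:
  assumes "c \<in> carrier (free_module R S)" "d \<in> carrier (free_module R S)"
    and "\<And>p. e p \<in> carrier R" and "\<And>p. c p = \<zero>\<^bsub>R\<^esub> \<Longrightarrow> d p = \<zero>\<^bsub>R\<^esub> \<Longrightarrow> e p = \<zero>\<^bsub>R\<^esub>"
  shows "e \<in> carrier (free_module R S)"
proof -
  have "{p. e p \<noteq> \<zero>\<^bsub>R\<^esub>} \<subseteq> {p. c p \<noteq> \<zero>\<^bsub>R\<^esub>} \<union> {p. d p \<noteq> \<zero>\<^bsub>R\<^esub>}" using assms(4) by blast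
  moreover have "finite ({p. c p \<noteq> \<zero>\<^bsub>R\<^esub>} \<union> {p. d p \<noteq> \<zero>\<^bsub>R\<^esub>})"
    "{p. c p \<noteq> \<zero>\<^bsub>R\<^esub>} \<union> {p. d p \<noteq> \<zero>\<^bsub>R\<^esub>} \<subseteq> S"
    using assms(1,2) by (simp_all add: free_module_simps)
  ultimately show ?thesis using assms(3) unfolding free_module_simps by (meson finite_subset order_trans)
qed

lemma (in ring) free_module_left_module: "left_module R (free_module R S)"
proof -
  have val: "c p \<in> carrier R" if "c \<in> carrier (free_module R S)" for c p
    using that by (simp add: free_module_simps)
  have "abelian_group (free_module R S)"
  proof (rule abelian_groupI)
    fix c assume c: "c \<in> carrier (free_module R S)"
    have "(\<lambda>p. \<ominus> c p) \<in> carrier (free_module R S)"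
      by (rule free_moduleI[OF c c]) (simp_all add: val[OF c])
    then show "\<exists>d\<in>carrier (free_module R S). d \<oplus>\<^bsub>free_module R S\<^esub> c = \<zero>\<^bsub>free_module R S\<^esub>"
      by (rule bexI[rotated]) (simp add: free_module_simps(2,3) val[OF c] l_neg)
  next
    fix c d assume cd: "c \<in> carrier (free_module R S)" "d \<in> carrier (free_module R S)"
    show "c \<oplus>\<^bsub>free_module R S\<^esub> d \<in> carrier (free_module R S)"
      by (rule free_moduleI[OF cd]) (simp_all add: free_module_simps(3) val[OF cd(1)] val[OF cd(2)])
  qed (simp_all add: free_module_simps a_ac)
  moreover have "a \<odot>\<^bsub>free_module R S\<^esub> c \<in> carrier (free_module R S)"
    if a: "a \<in> carrier R" and c: "c \<in> carrier (free_module R S)" for a c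
    by (rule free_moduleI[OF c c]) (simp_all add: free_module_simps(4) a val[OF c])
  ultimately show ?thesis
    by (intro left_module.intro left_module_axioms.intro ring_axioms)
       (simp_all add: free_module_simps(3,4) val m_assoc l_distr r_distr)
qed

definition free_extend :: "('r, 'y) ring_scheme \<Rightarrow> ('r, 'm, 'z) module_scheme \<Rightarrow> ('p \<Rightarrow> 'm) \<Rightarrow> ('p \<Rightarrow> 'r) \<Rightarrow> 'm"
  where "free_extend R M \<phi> c = (\<Oplus>\<^bsub>M\<^esub>p\<in>{p. c p \<noteq> \<zero>\<^bsub>R\<^esub>}. c p \<odot>\<^bsub>M\<^esub> \<phi> p)"

context left_module
begin

lemma smult_zero_l: "x \<in> carrier M \<Longrightarrow> \<zero>\<^bsub>R\<^esub> \<odot>\<^bsub>M\<^esub> x = \<zero>\<^bsub>M\<^esub>"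
  by (metis M.add.l_cancel_one R.l_zero R.zero_closed smult_closed smult_l_distr)

lemma smult_zero_r: "a \<in> carrier R \<Longrightarrow> a \<odot>\<^bsub>M\<^esub> \<zero>\<^bsub>M\<^esub> = \<zero>\<^bsub>M\<^esub>"
  by (metis M.add.l_cancel_one M.l_zero M.zero_closed smult_closed smult_r_distr)

lemma smult_finsum:
  assumes "a \<in> carrier R" "\<phi> \<in> T \<rightarrow> carrier M" "finite T"
  shows "a \<odot>\<^bsub>M\<^esub> (\<Oplus>\<^bsub>M\<^esub>p\<in>T. \<phi> p) = (\<Oplus>\<^bsub>M\<^esub>p\<in>T. a \<odot>\<^bsub>M\<^esub> \<phi> p)"
  using assms(3,2)
proof (induction T)
  case empty then show ?case using assms(1) by (simp add: smult_zero_r)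
next
  case (insert x T)
  then have "\<phi> \<in> T \<rightarrow> carrier M" "\<phi> x \<in> carrier M" "(\<Oplus>\<^bsub>M\<^esub>p\<in>T. \<phi> p) \<in> carrier M" by auto
  with insert assms(1) show ?case by (simp add: smult_r_distr smult_closed Pi_def)
qed

lemma free_extend_superset:
  assumes "c \<in> carrier (free_module R S)" "{p. c p \<noteq> \<zero>\<^bsub>R\<^esub>} \<subseteq> T" "finite T" "T \<subseteq> S" "\<phi> \<in> S \<rightarrow> carrier M"
  shows "free_extend R M \<phi> c = (\<Oplus>\<^bsub>M\<^esub>p\<in>T. c p \<odot>\<^bsub>M\<^esub> \<phi> p)"
  unfolding free_extend_def
proof (rule M.add.finprod_mono_neutral_cong_left)
  show "\<And>i. i \<in> T - {p. c p \<noteq> \<zero>\<^bsub>R\<^esub>} \<Longrightarrow> c i \<odot>\<^bsub>M\<^esub> \<phi> i = \<zero>\<^bsub>M\<^esub>"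
    using assms(4,5) by (auto intro!: smult_zero_l)
  show "(\<lambda>p. c p \<odot>\<^bsub>M\<^esub> \<phi> p) \<in> T \<rightarrow> carrier M"
    using assms by (auto simp: free_module_def intro!: smult_closed)
qed (use assms in auto)

lemma free_extend_hom:
  assumes \<phi>: "\<phi> \<in> S \<rightarrow> carrier M"
  shows "free_extend R M \<phi> \<in> lmod_hom R (free_module R S) M"
proof -
  interpret F: left_module R "free_module R S" by (rule R.free_module_left_module)
  let ?supp = "\<lambda>c. {p. c p \<noteq> \<zero>\<^bsub>R\<^esub>}"
  have c: "finite (?supp c)" "?supp c \<subseteq> S" "\<And>p. c p \<in> carrier R" if "c \<in> carrier (free_module R S)" for c
    using that by (auto simp: free_module_def)
  have t: "(\<lambda>p. c p \<odot>\<^bsub>M\<^esub> \<phi> p) \<in> T \<rightarrow> carrier M" if "c \<in> carrier (free_module R S)" "T \<subseteq> S" for c T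
    using c[OF that(1)] that(2) \<phi> by (auto intro!: smult_closed)
  have "free_extend R M \<phi> c \<in> carrier M" if "c \<in> carrier (free_module R S)" for c
    unfolding free_extend_def using that t c by (intro M.finsum_closed) blast
  moreover have "free_extend R M \<phi> (c \<oplus>\<^bsub>free_module R S\<^esub> d) = free_extend R M \<phi> c \<oplus>\<^bsub>M\<^esub> free_extend R M \<phi> d"
    if cd: "c \<in> carrier (free_module R S)" "d \<in> carrier (free_module R S)" for c d
  proof -
    let ?T = "?supp c \<union> ?supp d"
    have T: "finite ?T" "?T \<subseteq> S" using c cd by auto
    have e: "c \<oplus>\<^bsub>free_module R S\<^esub> d = (\<lambda>p. c p \<oplus>\<^bsub>R\<^esub> d p)" by (simp add: free_module_def)
    have "?supp (c \<oplus>\<^bsub>free_module R S\<^esub> d) \<subseteq> ?T" unfolding e by auto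
    then have "free_extend R M \<phi> (c \<oplus>\<^bsub>free_module R S\<^esub> d) = (\<Oplus>\<^bsub>M\<^esub>p\<in>?T. (c p \<oplus>\<^bsub>R\<^esub> d p) \<odot>\<^bsub>M\<^esub> \<phi> p)"
      using free_extend_superset[OF F.M.add.m_closed[OF cd] _ T \<phi>] unfolding e by simp
    also have "\<dots> = (\<Oplus>\<^bsub>M\<^esub>p\<in>?T. c p \<odot>\<^bsub>M\<^esub> \<phi> p \<oplus>\<^bsub>M\<^esub> d p \<odot>\<^bsub>M\<^esub> \<phi> p)"
    proof (rule M.add.finprod_cong')
      show "(\<lambda>p. c p \<odot>\<^bsub>M\<^esub> \<phi> p \<oplus>\<^bsub>M\<^esub> d p \<odot>\<^bsub>M\<^esub> \<phi> p) \<in> ?T \<rightarrow> carrier M"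
        using t[OF cd(1) T(2)] t[OF cd(2) T(2)] by (auto intro!: M.add.m_closed)
      fix p assume "p \<in> ?T"
      then have "\<phi> p \<in> carrier M" using T \<phi> by blast
      then show "(c p \<oplus>\<^bsub>R\<^esub> d p) \<odot>\<^bsub>M\<^esub> \<phi> p = c p \<odot>\<^bsub>M\<^esub> \<phi> p \<oplus>\<^bsub>M\<^esub> d p \<odot>\<^bsub>M\<^esub> \<phi> p"
        using c(3)[OF cd(1)] c(3)[OF cd(2)] by (simp add: smult_l_distr)
    qed simp
    also have "\<dots> = free_extend R M \<phi> c \<oplus>\<^bsub>M\<^esub> free_extend R M \<phi> d"
      by (subst M.finsum_addf[OF t[OF cd(1) T(2)] t[OF cd(2) T(2)]])
         (simp add: free_extend_superset[OF cd(1) _ T \<phi>] free_extend_superset[OF cd(2) _ T \<phi>])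
    finally show ?thesis .
  qed
  moreover have "free_extend R M \<phi> (a \<odot>\<^bsub>free_module R S\<^esub> x) = a \<odot>\<^bsub>M\<^esub> free_extend R M \<phi> x"
    if ax: "a \<in> carrier R" "x \<in> carrier (free_module R S)" for a x
  proof -
    have e: "a \<odot>\<^bsub>free_module R S\<^esub> x = (\<lambda>p. a \<otimes>\<^bsub>R\<^esub> x p)" by (simp add: free_module_def)
    have "?supp (a \<odot>\<^bsub>free_module R S\<^esub> x) \<subseteq> ?supp x" unfolding e using ax by auto
    then have "free_extend R M \<phi> (a \<odot>\<^bsub>free_module R S\<^esub> x) = (\<Oplus>\<^bsub>M\<^esub>p\<in>?supp x. (a \<otimes>\<^bsub>R\<^esub> x p) \<odot>\<^bsub>M\<^esub> \<phi> p)"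
      using free_extend_superset[OF F.smult_closed[OF ax] _ c(1,2)[OF ax(2)] \<phi>] unfolding e by simp
    also have "\<dots> = (\<Oplus>\<^bsub>M\<^esub>p\<in>?supp x. a \<odot>\<^bsub>M\<^esub> (x p \<odot>\<^bsub>M\<^esub> \<phi> p))"
    proof (rule M.add.finprod_cong')
      fix p assume "p \<in> ?supp x"
      then have "\<phi> p \<in> carrier M" using c(2)[OF ax(2)] \<phi> by blast
      then show "(a \<otimes>\<^bsub>R\<^esub> x p) \<odot>\<^bsub>M\<^esub> \<phi> p = a \<odot>\<^bsub>M\<^esub> (x p \<odot>\<^bsub>M\<^esub> \<phi> p)"
        using ax c(3)[OF ax(2)] by (simp add: smult_assoc1)
    qed (use t[OF ax(2) c(2)[OF ax(2)]] ax(1) smult_closed in auto)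
    also have "\<dots> = a \<odot>\<^bsub>M\<^esub> free_extend R M \<phi> x"
      unfolding free_extend_def
      by (rule smult_finsum[symmetric, OF ax(1) t[OF ax(2) c(2)[OF ax(2)]] c(1)[OF ax(2)]])
    finally show ?thesis .
  qed
  ultimately show ?thesis unfolding lmod_hom_def by blast
qed

lemma free_extend_comp:
  assumes "left_module R N" "f \<in> lmod_hom R M N" "\<phi> \<in> S \<rightarrow> carrier M" "c \<in> carrier (free_module R S)"
  shows "f (free_extend R M \<phi> c) = free_extend R N (f \<circ> \<phi>) c"
proof -
  interpret N: left_module R N by (rule assms)
  have f: "f x \<in> carrier N" if "x \<in> carrier M" for x using assms(2) that by (auto simp: lmod_hom_def)
  have fz: "f \<zero>\<^bsub>M\<^esub> = \<zero>\<^bsub>N\<^esub>"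
  proof -
    have "f (\<zero>\<^bsub>R\<^esub> \<odot>\<^bsub>M\<^esub> \<zero>\<^bsub>M\<^esub>) = \<zero>\<^bsub>R\<^esub> \<odot>\<^bsub>N\<^esub> f \<zero>\<^bsub>M\<^esub>"
      using assms(2) by (auto simp: lmod_hom_def)
    then show ?thesis using f by (simp add: smult_zero_l N.smult_zero_l)
  qed
  have "f (\<Oplus>\<^bsub>M\<^esub>p\<in>T. c p \<odot>\<^bsub>M\<^esub> \<phi> p) = (\<Oplus>\<^bsub>N\<^esub>p\<in>T. c p \<odot>\<^bsub>N\<^esub> f (\<phi> p))" if "finite T" "T \<subseteq> S" for T
    using that
  proof (induction T)
    case empty then show ?case by (simp add: fz)
  next
    case (insert x T)
    have cl: "c p \<odot>\<^bsub>M\<^esub> \<phi> p \<in> carrier M" "c p \<odot>\<^bsub>N\<^esub> f (\<phi> p) \<in> carrier N"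
      "f (c p \<odot>\<^bsub>M\<^esub> \<phi> p) = c p \<odot>\<^bsub>N\<^esub> f (\<phi> p)" if "p \<in> S" for p
    proof -
      have 1: "c p \<in> carrier R" "\<phi> p \<in> carrier M" using that assms(3,4) by (auto simp: free_module_def)
      then show "c p \<odot>\<^bsub>M\<^esub> \<phi> p \<in> carrier M" "c p \<odot>\<^bsub>N\<^esub> f (\<phi> p) \<in> carrier N" 
        using smult_closed N.smult_closed f by auto
      show "f (c p \<odot>\<^bsub>M\<^esub> \<phi> p) = c p \<odot>\<^bsub>N\<^esub> f (\<phi> p)" using 1 assms(2) by (auto simp: lmod_hom_def)
    qed
    have s: "(\<Oplus>\<^bsub>M\<^esub>p\<in>T. c p \<odot>\<^bsub>M\<^esub> \<phi> p) \<in> carrier M" using insert cl by (intro M.finsum_closed) auto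
    have "f ((c x \<odot>\<^bsub>M\<^esub> \<phi> x) \<oplus>\<^bsub>M\<^esub> (\<Oplus>\<^bsub>M\<^esub>p\<in>T. c p \<odot>\<^bsub>M\<^esub> \<phi> p)) =
      f (c x \<odot>\<^bsub>M\<^esub> \<phi> x) \<oplus>\<^bsub>N\<^esub> f (\<Oplus>\<^bsub>M\<^esub>p\<in>T. c p \<odot>\<^bsub>M\<^esub> \<phi> p)"
      using assms(2) s cl(1)[of x] insert(4) by (auto simp: lmod_hom_def)
    moreover have "(\<Oplus>\<^bsub>M\<^esub>p\<in>insert x T. c p \<odot>\<^bsub>M\<^esub> \<phi> p) =
      (c x \<odot>\<^bsub>M\<^esub> \<phi> x) \<oplus>\<^bsub>M\<^esub> (\<Oplus>\<^bsub>M\<^esub>p\<in>T. c p \<odot>\<^bsub>M\<^esub> \<phi> p)"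
      by (rule M.finsum_insert) (use insert cl in auto)
    moreover have "(\<Oplus>\<^bsub>N\<^esub>p\<in>insert x T. c p \<odot>\<^bsub>N\<^esub> f (\<phi> p)) =
      (c x \<odot>\<^bsub>N\<^esub> f (\<phi> x)) \<oplus>\<^bsub>N\<^esub> (\<Oplus>\<^bsub>N\<^esub>p\<in>T. c p \<odot>\<^bsub>N\<^esub> f (\<phi> p))"
      by (rule N.M.finsum_insert) (use insert cl in auto)
    ultimately show ?case using insert cl by simp
  qed
  then show ?thesis using assms(4) by (simp add: free_extend_def free_module_def)
qed

end

lemma projective_lift:
  fixes P :: "('r, 'p, 'z) module_scheme"
    and M :: "('r, 'm, 'u) module_scheme" and N :: "('r, 'n, 'v) module_scheme"
  assumes "projective_module R P" and "left_module R M" and "left_module R N"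
    and "g \<in> lmod_hom R M N" and "g ` carrier M = carrier N" and "f \<in> lmod_hom R P N"
  shows "\<exists>h \<in> lmod_hom R P M. \<forall>x\<in>carrier P. g (h x) = f x"
proof -
  interpret M: left_module R M by (rule assms)
  interpret N: left_module R N by (rule assms)
  interpret P: left_module R P using assms(1) by (simp add: projective_module_def)
  let ?F = "free_module R (carrier P)"
  let ?P = "with_action P (smult P)"
  let ?\<pi> = "free_extend R P (\<lambda>x. x)"
  have \<pi>: "?\<pi> \<in> lmod_hom R ?F P" by (rule P.free_extend_hom) auto
  then have \<pi>': "?\<pi> \<in> lmod_hom R ?F ?P" by (simp add: lmod_hom_def with_action_def)
  have "?\<pi> ` carrier ?F = carrier P"
  proof
    show "?\<pi> ` carrier ?F \<subseteq> carrier P" using \<pi> by (auto simp: lmod_hom_def)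
    show "carrier P \<subseteq> ?\<pi> ` carrier ?F"
    proof
      fix x assume x: "x \<in> carrier P"
      let ?c = "\<lambda>p. if p = x then \<one>\<^bsub>R\<^esub> else \<zero>\<^bsub>R\<^esub>"
      have c: "?c \<in> carrier ?F" using x by (auto simp: free_module_def)
      have "?\<pi> ?c = (\<Oplus>\<^bsub>P\<^esub>p\<in>{x}. ?c p \<odot>\<^bsub>P\<^esub> p)"
        by (rule P.free_extend_superset[OF c]) (use x in auto)
      also have "\<dots> = x" using x by (simp add: P.smult_one)
      finally show "x \<in> ?\<pi> ` carrier ?F" using c by force
    qed
  qed
  moreover have "abelian_group ?P"
    by (rule abelian_groupI)
       (auto simp: with_action_def P.M.a_assoc P.M.a_comm P.M.a_lcomm intro: P.M.a_inv_closed P.M.l_neg)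
  then have "left_module R ?P"
    using P.left_module_axioms unfolding left_module_def left_module_axioms_def
    by (simp add: with_action_def)
  moreover have "(\<lambda>x. x) \<in> lmod_hom R P ?P" by (auto simp: lmod_hom_def with_action_def)
  moreover have "carrier ?P = carrier P" by (simp add: with_action_def)
  ultimately have hyps: "left_module R ?F \<and> left_module R ?P \<and> ?\<pi> \<in> lmod_hom R ?F ?P \<and>
      ?\<pi> ` carrier ?F = carrier ?P \<and> (\<lambda>x. x) \<in> lmod_hom R P ?P"
    using \<pi>' M.R.free_module_left_module[of "carrier P"] by (intro conjI) simp_all
  have "\<exists>s \<in> lmod_hom R P ?F. \<forall>x\<in>carrier P. ?\<pi> (s x) = x"
    by (rule assms(1)[unfolded projective_module_def, THEN conjunct2, THEN spec, THEN spec,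
          THEN spec, THEN spec, THEN mp, OF hyps])
  then obtain s where s: "s \<in> lmod_hom R P ?F" "\<And>x. x \<in> carrier P \<Longrightarrow> ?\<pi> (s x) = x" by blast
  have "\<exists>y. y \<in> carrier M \<and> g y = f p" if "p \<in> carrier P" for p
  proof -
    have "f p \<in> carrier N" using assms(6) that by (auto simp: lmod_hom_def)
    then have "f p \<in> g ` carrier M" using assms(5) by blast
    then show ?thesis by (elim imageE) metis
  qed
  then obtain m where m: "\<And>p. p \<in> carrier P \<Longrightarrow> m p \<in> carrier M \<and> g (m p) = f p" by metis
  let ?h = "free_extend R M m \<circ> s"
  have e: "free_extend R M m \<in> lmod_hom R ?F M" by (rule M.free_extend_hom) (use m in auto)
  have h: "?h \<in> lmod_hom R P M"
    using e s(1) unfolding lmod_hom_def by (simp add: Pi_iff)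
  moreover have "g (?h x) = f x" if x: "x \<in> carrier P" for x
  proof -
    have sx: "s x \<in> carrier ?F" using s(1) x by (auto simp: lmod_hom_def)
    have "g (?h x) = free_extend R N (g \<circ> m) (s x)"
      using M.free_extend_comp[OF assms(3,4) _ sx] m by auto
    also have "\<dots> = free_extend R N (f \<circ> (\<lambda>x. x)) (s x)"
      unfolding free_extend_def
    proof (rule N.M.add.finprod_cong')
      show "(\<lambda>p. s x p \<odot>\<^bsub>N\<^esub> (f \<circ> (\<lambda>x. x)) p) \<in> {p. s x p \<noteq> \<zero>\<^bsub>R\<^esub>} \<rightarrow> carrier N"
        using sx assms(6) by (auto simp: free_module_def lmod_hom_def intro!: N.smult_closed)
      fix p assume "p \<in> {p. s x p \<noteq> \<zero>\<^bsub>R\<^esub>}"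
      then have "p \<in> carrier P" using sx by (auto simp: free_module_def)
      then show "s x p \<odot>\<^bsub>N\<^esub> (g \<circ> m) p = s x p \<odot>\<^bsub>N\<^esub> (f \<circ> (\<lambda>x. x)) p" using m by simp
    qed simp
    also have "\<dots> = f x" using P.free_extend_comp[OF assms(3,6) _ sx, of "\<lambda>x. x"] s(2)[OF x] by auto
    finally show ?thesis .
  qed
  ultimately show ?thesis by blast
qed

text \<open>\<open>d n\<close> is the differential from degree \<open>n + 1\<close> to degree \<open>n\<close>.\<close>

definition projective_resolution ::
    "('r, 'y) ring_scheme \<Rightarrow> (nat \<Rightarrow> ('r, 'p, 'z) module_scheme) \<Rightarrow> (nat \<Rightarrow> 'p \<Rightarrow> 'p) \<Rightarrow>
     ('r, 'm, 'w) module_scheme \<Rightarrow> bool"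
  where "projective_resolution R P d M \<longleftrightarrow>
    left_module R M \<and>
    (\<forall>n. projective_module R (P n)) \<and>
    (\<forall>n. d n \<in> lmod_hom R (P (Suc n)) (P n)) \<and>
    (\<forall>n. exact_at (P (Suc (Suc n))) (d (Suc n)) (P (Suc n)) (d n) (P n)) \<and>
    (\<exists>aug \<in> lmod_hom R (P 0) M.
       exact_at (P (Suc 0)) (d 0) (P 0) aug M \<and> aug ` carrier (P 0) = carrier M)"


section \<open>Tensor products\<close>

type_synonym ('m, 'n) tens = "('m \<times> 'n \<Rightarrow>\<^sub>0 int) set"

text \<open>\<open>M \<otimes>\<^sub>R N\<close> for a right module \<open>M\<close> and a left module \<open>N\<close>: the free abelian group on
  \<open>M \<times> N\<close> modulo the usual relations.\<close>

definition tensor_relators ::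
    "('r, 'x) ring_scheme \<Rightarrow> ('r, 'm, 'y) module_scheme \<Rightarrow> ('r, 'n, 'z) module_scheme \<Rightarrow>
     ('m \<times> 'n \<Rightarrow>\<^sub>0 int) set"
  where "tensor_relators R M N =
    {frag_of (x \<oplus>\<^bsub>M\<^esub> x', y) - frag_of (x, y) - frag_of (x', y) | x x' y.
       x \<in> carrier M \<and> x' \<in> carrier M \<and> y \<in> carrier N} \<union>
    {frag_of (x, y \<oplus>\<^bsub>N\<^esub> y') - frag_of (x, y) - frag_of (x, y') | x y y'.
       x \<in> carrier M \<and> y \<in> carrier N \<and> y' \<in> carrier N} \<union>
    {frag_of (r \<odot>\<^bsub>M\<^esub> x, y) - frag_of (x, r \<odot>\<^bsub>N\<^esub> y) | r x y.
       r \<in> carrier R \<and> x \<in> carrier M \<and> y \<in> carrier N}"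

definition tensor_null ::
    "('r, 'x) ring_scheme \<Rightarrow> ('r, 'm, 'y) module_scheme \<Rightarrow> ('r, 'n, 'z) module_scheme \<Rightarrow>
     ('m \<times> 'n \<Rightarrow>\<^sub>0 int) set"
  where "tensor_null R M N =
    generate (free_Abelian_group (carrier M \<times> carrier N)) (tensor_relators R M N)"

definition tensor ::
    "('r, 'x) ring_scheme \<Rightarrow> ('r, 'm, 'y) module_scheme \<Rightarrow> ('r, 'n, 'z) module_scheme \<Rightarrow>
     ('m, 'n) tens ring"
  where "tensor R M N =
    (let Q = free_Abelian_group (carrier M \<times> carrier N) Mod tensor_null R M N
     in \<lparr>carrier = carrier Q, monoid.mult = undefined, one = undefined,
         ring.zero = one Q, add = monoid.mult Q\<rparr>)"

definition pure_tensor ::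
    "('r, 'x) ring_scheme \<Rightarrow> ('r, 'm, 'y) module_scheme \<Rightarrow> ('r, 'n, 'z) module_scheme \<Rightarrow>
     'm \<Rightarrow> 'n \<Rightarrow> ('m, 'n) tens"
  where "pure_tensor R M N x y =
    tensor_null R M N #>\<^bsub>free_Abelian_group (carrier M \<times> carrier N)\<^esub> frag_of (x, y)"

text \<open>\<open>tens_lift P \<phi>\<close> is the additive map to \<open>P\<close> with \<open>x \<otimes> y \<mapsto> \<phi> x y\<close>, for balanced \<open>\<phi>\<close>
  (see \<open>tens_lift_pure\<close> and \<open>tens_lift_add\<close>). It also renders sums over tensors: the Sweedler
  expression \<open>\<Sum> \<phi> b\<^sub>(\<^sub>0\<^sub>) b\<^sub>(\<^sub>1\<^sub>)\<close> is \<open>tens_lift P \<phi> (\<rho> b)\<close>.\<close>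

definition tens_lift :: "('p, 'z) ring_scheme \<Rightarrow> ('m \<Rightarrow> 'n \<Rightarrow> 'p) \<Rightarrow> ('m, 'n) tens \<Rightarrow> 'p"
  where "tens_lift P \<phi> X = (let c = (SOME c. c \<in> X)
    in \<Oplus>\<^bsub>P\<^esub>z\<in>Poly_Mapping.keys c. [Poly_Mapping.lookup c z] \<cdot>\<^bsub>P\<^esub> \<phi> (fst z) (snd z))"

definition balanced ::
    "('r, 'x) ring_scheme \<Rightarrow> ('r, 'm, 'y) module_scheme \<Rightarrow> ('r, 'n, 'z) module_scheme \<Rightarrow>
     ('p, 'w) ring_scheme \<Rightarrow> ('m \<Rightarrow> 'n \<Rightarrow> 'p) \<Rightarrow> bool"
  where "balanced R M N P \<phi> \<longleftrightarrow>
    (\<forall>x\<in>carrier M. \<forall>y\<in>carrier N. \<phi> x y \<in> carrier P) \<and>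
    (\<forall>x\<in>carrier M. \<forall>x'\<in>carrier M. \<forall>y\<in>carrier N. \<phi> (x \<oplus>\<^bsub>M\<^esub> x') y = \<phi> x y \<oplus>\<^bsub>P\<^esub> \<phi> x' y) \<and>
    (\<forall>x\<in>carrier M. \<forall>y\<in>carrier N. \<forall>y'\<in>carrier N. \<phi> x (y \<oplus>\<^bsub>N\<^esub> y') = \<phi> x y \<oplus>\<^bsub>P\<^esub> \<phi> x y') \<and>
    (\<forall>r\<in>carrier R. \<forall>x\<in>carrier M. \<forall>y\<in>carrier N. \<phi> (r \<odot>\<^bsub>M\<^esub> x) y = \<phi> x (r \<odot>\<^bsub>N\<^esub> y))"

context
  fixes R :: "('r, 'x) ring_scheme" and M :: "('r, 'm, 'y) module_scheme"
    and N :: "('r, 'n, 'z) module_scheme"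
  assumes M: "left_module (opp R) M" and N: "left_module R N"
begin

lemma tensor_relators_subset:
  "tensor_relators R M N \<subseteq> carrier (free_Abelian_group (carrier M \<times> carrier N))"
proof -
  interpret M: left_module "opp R" M by (rule M)
  interpret N: left_module R N by (rule N)
  have "frag_of (a, b) - frag_of (c, d) - frag_of (e, f) \<in>
      carrier (free_Abelian_group (carrier M \<times> carrier N))"
    if "a \<in> carrier M" "b \<in> carrier N" "c \<in> carrier M" "d \<in> carrier N" "e \<in> carrier M" "f \<in> carrier N"
    for a b c d e f
    using that keys_diff[of "frag_of (a, b) - frag_of (c, d)" "frag_of (e, f)"]
      keys_diff[of "frag_of (a, b)" "frag_of (c, d)"] by auto
  moreover have "frag_of (a, b) - frag_of (c, d) \<in>
      carrier (free_Abelian_group (carrier M \<times> carrier N))"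
    if "a \<in> carrier M" "b \<in> carrier N" "c \<in> carrier M" "d \<in> carrier N" for a b c d
    using that keys_diff[of "frag_of (a, b)" "frag_of (c, d)"] by auto
  ultimately show ?thesis
    using M.smult_closed N.smult_closed unfolding tensor_relators_def opp_def
    by (auto simp del: carrier_free_Abelian_group_iff)
qed

lemma tensor_null_subgroup:
  "subgroup (tensor_null R M N) (free_Abelian_group (carrier M \<times> carrier N))"
  unfolding tensor_null_def
  by (rule group.generate_is_subgroup[OF group_free_Abelian_group tensor_relators_subset])

lemma tensor_abelian_group: "abelian_group (tensor R M N)"
proof -
  have "comm_group (free_Abelian_group (carrier M \<times> carrier N) Mod tensor_null R M N)" (is "comm_group ?Q")
    by (rule comm_group.abelian_FactGroup[OF abelian_free_Abelian_group tensor_null_subgroup])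
  moreover have "add_monoid (tensor R M N) = ?Q"
    by (simp add: tensor_def Let_def FactGroup_def)
  ultimately show ?thesis
    by (intro abelian_group.intro abelian_group_axioms.intro abelian_monoid.intro)
       (simp_all add: comm_group.axioms)
qed

lemma pure_tensor_closed:
  "\<lbrakk>x \<in> carrier M; y \<in> carrier N\<rbrakk> \<Longrightarrow> pure_tensor R M N x y \<in> carrier (tensor R M N)"
  by (auto simp: pure_tensor_def tensor_def Let_def FactGroup_def RCOSETS_def)

end

context
  fixes R :: "('r, 'x) ring_scheme" and M :: "('r, 'm, 'y) module_scheme"
    and N :: "('r, 'n, 'z) module_scheme" and P :: "('p, 'w) ring_scheme" and \<phi>
  assumes M: "left_module (opp R) M" and N: "left_module R N" and P: "abelian_group P"
    and \<phi>: "balanced R M N P \<phi>"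
begin

private abbreviation "F \<equiv> free_Abelian_group (carrier M \<times> carrier N)"

private definition ev :: "('m \<times> 'n \<Rightarrow>\<^sub>0 int) \<Rightarrow> 'p"
  where "ev c = (\<Oplus>\<^bsub>P\<^esub>z\<in>Poly_Mapping.keys c. [Poly_Mapping.lookup c z] \<cdot>\<^bsub>P\<^esub> \<phi> (fst z) (snd z))"

private lemma ev_superset:
  assumes "Poly_Mapping.keys c \<subseteq> T" "finite T" "T \<subseteq> carrier M \<times> carrier N"
  shows "ev c = (\<Oplus>\<^bsub>P\<^esub>z\<in>T. [Poly_Mapping.lookup c z] \<cdot>\<^bsub>P\<^esub> \<phi> (fst z) (snd z))"
proof -
  interpret P: abelian_group P by (rule P)
  show ?thesis unfolding ev_def
  proof (rule P.add.finprod_mono_neutral_cong_left)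
    show "(\<lambda>z. [poly_mapping.lookup c z] \<cdot>\<^bsub>P\<^esub> \<phi> (fst z) (snd z)) \<in> T \<rightarrow> carrier P"
      using assms(3) \<phi> unfolding balanced_def by fastforce
  next
    fix i assume "i \<in> T - Poly_Mapping.keys c"
    then have "poly_mapping.lookup c i = 0" by (simp add: in_keys_iff)
    then show "[poly_mapping.lookup c i] \<cdot>\<^bsub>P\<^esub> \<phi> (fst i) (snd i) = \<zero>\<^bsub>P\<^esub>"
      by (simp add: add_pow_def int_pow_def2)
  qed (use assms in auto)
qed

private lemma ev_hom: "ev \<in> hom F (add_monoid P)"
proof -
  interpret P: abelian_group P by (rule P)
  have cl: "\<phi> (fst z) (snd z) \<in> carrier P" if "z \<in> carrier M \<times> carrier N" for z
    using that \<phi> unfolding balanced_def by fastforce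
  show ?thesis
  proof (rule homI)
    fix c assume "c \<in> carrier F"
    then show "ev c \<in> carrier (add_monoid P)"
      unfolding ev_def using cl by (auto intro!: P.finsum_closed)
  next
    fix c d assume c: "c \<in> carrier F" and d: "d \<in> carrier F"
    let ?T = "Poly_Mapping.keys c \<union> Poly_Mapping.keys d"
    have T: "?T \<subseteq> carrier M \<times> carrier N" "finite ?T" using c d by auto
    have "ev (c + d) = (\<Oplus>\<^bsub>P\<^esub>z\<in>?T. [poly_mapping.lookup (c + d) z] \<cdot>\<^bsub>P\<^esub> \<phi> (fst z) (snd z))"
      by (rule ev_superset[OF keys_add T(2,1)])
    also have "\<dots> = (\<Oplus>\<^bsub>P\<^esub>z\<in>?T. [poly_mapping.lookup c z] \<cdot>\<^bsub>P\<^esub> \<phi> (fst z) (snd z) \<oplus>\<^bsub>P\<^esub>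
        [poly_mapping.lookup d z] \<cdot>\<^bsub>P\<^esub> \<phi> (fst z) (snd z))"
    proof (rule P.add.finprod_cong')
      fix z assume "z \<in> ?T"
      then have "\<phi> (fst z) (snd z) \<in> carrier P" using T cl by blast
      then show "[poly_mapping.lookup (c + d) z] \<cdot>\<^bsub>P\<^esub> \<phi> (fst z) (snd z) =
        [poly_mapping.lookup c z] \<cdot>\<^bsub>P\<^esub> \<phi> (fst z) (snd z) \<oplus>\<^bsub>P\<^esub>
        [poly_mapping.lookup d z] \<cdot>\<^bsub>P\<^esub> \<phi> (fst z) (snd z)"
        by (simp add: lookup_add P.add.int_pow_mult)
    qed (use T cl in \<open>auto intro!: P.add.m_closed\<close>)
    also have "\<dots> = ev c \<oplus>\<^bsub>P\<^esub> ev d"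
      using T cl by (subst P.finsum_addf) (auto simp: ev_superset[OF _ T(2,1)])
    finally show "ev (c \<otimes>\<^bsub>F\<^esub> d) = ev c \<otimes>\<^bsub>add_monoid P\<^esub> ev d" by simp
  qed
qed

private lemma ev_frag: "\<lbrakk>x \<in> carrier M; y \<in> carrier N\<rbrakk> \<Longrightarrow> ev (frag_of (x, y)) = \<phi> x y"
proof -
  interpret P: abelian_group P by (rule P)
  assume "x \<in> carrier M" "y \<in> carrier N"
  then have "\<phi> x y \<in> carrier P" using \<phi> unfolding balanced_def by blast
  then show ?thesis by (simp add: ev_def P.add.int_pow_1)
qed

private lemma ev_null: "c \<in> tensor_null R M N \<Longrightarrow> ev c = \<zero>\<^bsub>P\<^esub>"
proof -
  interpret P: abelian_group P by (rule P)
  interpret M: left_module "opp R" M by (rule M)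
  interpret N: left_module R N by (rule N)
  interpret ev: group_hom F "add_monoid P" ev
    by (intro group_hom.intro group_hom_axioms.intro ev_hom P.a_group) simp
  have diff: "ev (a - b) = ev a \<ominus>\<^bsub>P\<^esub> ev b" if "a \<in> carrier F" "b \<in> carrier F" for a b
  proof -
    have "ev a = ev ((a - b) \<otimes>\<^bsub>F\<^esub> b)" by simp
    also have "\<dots> = ev (a - b) \<oplus>\<^bsub>P\<^esub> ev b"
      using that keys_diff[of a b] by (subst ev.hom_mult) auto
    finally have "ev a = ev (a - b) \<oplus>\<^bsub>P\<^esub> ev b" .
    moreover have "a - b \<in> carrier F" using that keys_diff[of a b] by auto
    then have "ev (a - b) \<in> carrier P" using ev.hom_closed by simp
    moreover have "ev b \<in> carrier P" using ev.hom_closed[OF that(2)] by simp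
    ultimately show ?thesis by (simp add: P.minus_eq P.a_assoc P.r_neg)
  qed
  have cl: "\<phi> x y \<in> carrier P" if "x \<in> carrier M" "y \<in> carrier N" for x y
    using that \<phi> unfolding balanced_def by blast
  have fc: "frag_of (a, b) - frag_of (c, d) \<in> carrier F"
    if "a \<in> carrier M" "b \<in> carrier N" "c \<in> carrier M" "d \<in> carrier N" for a b c d
    using that keys_diff[of "frag_of (a, b)" "frag_of (c, d)"] by auto
  have z: "(a \<oplus>\<^bsub>P\<^esub> b) \<ominus>\<^bsub>P\<^esub> a \<ominus>\<^bsub>P\<^esub> b = \<zero>\<^bsub>P\<^esub>" if "a \<in> carrier P" "b \<in> carrier P" for a b
    using that by (metis P.add.inv_solve_right P.add.m_closed P.add.m_comm P.minus_eq P.r_neg P.add.inv_closed)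
  have "tensor_relators R M N \<subseteq> kernel F (add_monoid P) ev"
  proof
    fix c assume c: "c \<in> tensor_relators R M N"
    then have cF: "c \<in> carrier F" using tensor_relators_subset[OF M N] by blast
    have sc: "r \<odot>\<^bsub>M\<^esub> x \<in> carrier M" if "r \<in> carrier R" "x \<in> carrier M" for r x
      using M.smult_closed that by (simp add: opp_def)
    from c have "ev c = \<zero>\<^bsub>P\<^esub>"
      unfolding tensor_relators_def
    proof (elim UnE CollectE exE conjE)
      fix x x' y assume c: "c = frag_of (x \<oplus>\<^bsub>M\<^esub> x', y) - frag_of (x, y) - frag_of (x', y)"
        and m: "x \<in> carrier M" "x' \<in> carrier M" "y \<in> carrier N"
      then have "ev c = \<phi> (x \<oplus>\<^bsub>M\<^esub> x') y \<ominus>\<^bsub>P\<^esub> \<phi> x y \<ominus>\<^bsub>P\<^esub> \<phi> x' y"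
        using fc m by (simp add: diff ev_frag del: carrier_free_Abelian_group_iff)
      also have "\<phi> (x \<oplus>\<^bsub>M\<^esub> x') y = \<phi> x y \<oplus>\<^bsub>P\<^esub> \<phi> x' y" using \<phi> m unfolding balanced_def by blast
      finally show ?thesis using z cl m by simp
    next
      fix x y y' assume c: "c = frag_of (x, y \<oplus>\<^bsub>N\<^esub> y') - frag_of (x, y) - frag_of (x, y')"
        and m: "x \<in> carrier M" "y \<in> carrier N" "y' \<in> carrier N"
      then have "ev c = \<phi> x (y \<oplus>\<^bsub>N\<^esub> y') \<ominus>\<^bsub>P\<^esub> \<phi> x y \<ominus>\<^bsub>P\<^esub> \<phi> x y'"
        using fc m by (simp add: diff ev_frag del: carrier_free_Abelian_group_iff)
      also have "\<phi> x (y \<oplus>\<^bsub>N\<^esub> y') = \<phi> x y \<oplus>\<^bsub>P\<^esub> \<phi> x y'" using \<phi> m unfolding balanced_def by blast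
      finally show ?thesis using z cl m by simp
    next
      fix r x y assume c: "c = frag_of (r \<odot>\<^bsub>M\<^esub> x, y) - frag_of (x, r \<odot>\<^bsub>N\<^esub> y)"
        and m: "r \<in> carrier R" "x \<in> carrier M" "y \<in> carrier N"
      then have "ev c = \<phi> (r \<odot>\<^bsub>M\<^esub> x) y \<ominus>\<^bsub>P\<^esub> \<phi> x (r \<odot>\<^bsub>N\<^esub> y)"
        using sc N.smult_closed m by (simp add: diff ev_frag)
      also have "\<phi> (r \<odot>\<^bsub>M\<^esub> x) y = \<phi> x (r \<odot>\<^bsub>N\<^esub> y)" using \<phi> m unfolding balanced_def by blast
      finally show ?thesis using cl m N.smult_closed by (simp add: P.minus_eq P.r_neg)
    qed
    then show "c \<in> kernel F (add_monoid P) ev" using cF by (simp add: kernel_def)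
  qed
  then have "tensor_null R M N \<subseteq> kernel F (add_monoid P) ev"
    unfolding tensor_null_def
    by (rule group.generate_subgroup_incl[OF group_free_Abelian_group _ ev.subgroup_kernel])
  then show "ev c = \<zero>\<^bsub>P\<^esub>" if "c \<in> tensor_null R M N" using that by (auto simp: kernel_def)
qed

private lemma tens_lift_coset: "c \<in> carrier F \<Longrightarrow> tens_lift P \<phi> (tensor_null R M N #>\<^bsub>F\<^esub> c) = ev c"
proof -
  interpret P: abelian_group P by (rule P)
  interpret ev: group_hom F "add_monoid P" ev
    by (intro group_hom.intro group_hom_axioms.intro ev_hom P.a_group) simp
  assume c: "c \<in> carrier F"
  have sub: "subgroup (tensor_null R M N) F" by (rule tensor_null_subgroup[OF M N])
  define d where "d = (SOME d. d \<in> tensor_null R M N #>\<^bsub>F\<^esub> c)"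
  have "c \<in> tensor_null R M N #>\<^bsub>F\<^esub> c" by (rule group.rcos_self[OF group_free_Abelian_group c sub])
  then have "d \<in> tensor_null R M N #>\<^bsub>F\<^esub> c" unfolding d_def by (rule someI)
  then obtain n where n: "n \<in> tensor_null R M N" "d = n \<otimes>\<^bsub>F\<^esub> c" by (auto simp: r_coset_def)
  have "n \<in> carrier F" using n(1) sub subgroup.subset by blast
  then have "ev d = ev n \<oplus>\<^bsub>P\<^esub> ev c" unfolding n(2) using c by (subst ev.hom_mult) auto
  also have "\<dots> = ev c" using ev_null[OF n(1)] ev.hom_closed[OF c] by simp
  finally show ?thesis by (simp add: tens_lift_def Let_def flip: d_def ev_def)
qed

private lemma carrier_tensorE:
  assumes "u \<in> carrier (tensor R M N)"
  obtains c where "c \<in> carrier F" "u = tensor_null R M N #>\<^bsub>F\<^esub> c"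
  using assms by (auto simp: tensor_def Let_def FactGroup_def RCOSETS_def)

lemma tens_lift_closed: "u \<in> carrier (tensor R M N) \<Longrightarrow> tens_lift P \<phi> u \<in> carrier P"
  using ev_hom by (auto elim!: carrier_tensorE simp: tens_lift_coset hom_def
      simp del: carrier_free_Abelian_group_iff)

lemma tens_lift_pure:
  "\<lbrakk>x \<in> carrier M; y \<in> carrier N\<rbrakk> \<Longrightarrow> tens_lift P \<phi> (pure_tensor R M N x y) = \<phi> x y"
  by (simp add: pure_tensor_def tens_lift_coset ev_frag)

lemma tens_lift_add:
  assumes "u \<in> carrier (tensor R M N)" "v \<in> carrier (tensor R M N)"
  shows "tens_lift P \<phi> (u \<oplus>\<^bsub>tensor R M N\<^esub> v) = tens_lift P \<phi> u \<oplus>\<^bsub>P\<^esub> tens_lift P \<phi> v"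
proof -
  obtain c d where c: "c \<in> carrier F" "u = tensor_null R M N #>\<^bsub>F\<^esub> c"
    and d: "d \<in> carrier F" "v = tensor_null R M N #>\<^bsub>F\<^esub> d"
    using assms by (elim carrier_tensorE)
  have nrm: "tensor_null R M N \<lhd> F"
    by (rule comm_group.subgroup_imp_normal[OF abelian_free_Abelian_group tensor_null_subgroup[OF M N]])
  have "u \<oplus>\<^bsub>tensor R M N\<^esub> v = tensor_null R M N #>\<^bsub>F\<^esub> (c \<otimes>\<^bsub>F\<^esub> d)"
    using normal.rcos_sum[OF nrm c(1) d(1)] c(2) d(2)
    by (simp add: tensor_def Let_def FactGroup_def)
  moreover have "c \<otimes>\<^bsub>F\<^esub> d \<in> carrier F"
    using group.is_monoid[OF group_free_Abelian_group] c(1) d(1) by (rule monoid.m_closed)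
  ultimately show ?thesis
    using hom_mult[OF ev_hom c(1) d(1)] c d by (simp add: tens_lift_coset del: carrier_free_Abelian_group_iff mult_free_Abelian_group)
qed

end

definition tensor_map ::
    "('r, 'x) ring_scheme \<Rightarrow> ('r, 'm, 'y) module_scheme \<Rightarrow> ('r, 'n, 'z) module_scheme \<Rightarrow>
     ('m' \<Rightarrow> 'm) \<Rightarrow> ('n' \<Rightarrow> 'n) \<Rightarrow> ('m', 'n') tens \<Rightarrow> ('m, 'n) tens"
  where "tensor_map R M N f g = tens_lift (tensor R M N) (\<lambda>x y. pure_tensor R M N (f x) (g y))"

text \<open>\<open>N\<close> is faithfully flat if a sequence \<open>M\<^sub>1 \<rightarrow> M\<^sub>2 \<rightarrow> M\<^sub>3\<close> of right modules is exact iff the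
  sequence \<open>M\<^sub>1 \<otimes> N \<rightarrow> M\<^sub>2 \<otimes> N \<rightarrow> M\<^sub>3 \<otimes> N\<close> is. The test modules are carried by \<open>(nat \<Rightarrow> 'r) set\<close>,
  which up to isomorphism includes all countably generated modules (as quotients of the module of
  finitely supported sequences); since tensor products commute with directed unions, this is no
  restriction.\<close>

definition faithfully_flat :: "('r, 'x) ring_scheme \<Rightarrow> ('r, 'n, 'y) module_scheme \<Rightarrow> bool"
  where "faithfully_flat R N \<longleftrightarrow> left_module R N \<and>
    (\<forall>(M\<^sub>1 :: ('r, (nat \<Rightarrow> 'r) set) module) (M\<^sub>2 :: ('r, (nat \<Rightarrow> 'r) set) module)
      (M\<^sub>3 :: ('r, (nat \<Rightarrow> 'r) set) module) f g.
       left_module (opp R) M\<^sub>1 \<and> left_module (opp R) M\<^sub>2 \<and> left_module (opp R) M\<^sub>3 \<and>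
       f \<in> lmod_hom (opp R) M\<^sub>1 M\<^sub>2 \<and> g \<in> lmod_hom (opp R) M\<^sub>2 M\<^sub>3 \<longrightarrow>
       (exact_at M\<^sub>1 f M\<^sub>2 g M\<^sub>3 \<longleftrightarrow>
        exact_at (tensor R M\<^sub>1 N) (tensor_map R M\<^sub>2 N f id) (tensor R M\<^sub>2 N)
          (tensor_map R M\<^sub>3 N g id) (tensor R M\<^sub>3 N)))"


section \<open>Algebras over a field\<close>

locale k_algebra = field K + module K X + ring X
  for K :: "('k, 'c) ring_scheme" (structure) and X :: "('k, 'x, 'z) module_scheme" (structure) +
  assumes smult_mult_l: "\<lbrakk>a \<in> carrier K; x \<in> carrier X; y \<in> carrier X\<rbrakk> \<Longrightarrow>
      (a \<odot>\<^bsub>X\<^esub> x) \<otimes>\<^bsub>X\<^esub> y = a \<odot>\<^bsub>X\<^esub> (x \<otimes>\<^bsub>X\<^esub> y)"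
    and smult_mult_r: "\<lbrakk>a \<in> carrier K; x \<in> carrier X; y \<in> carrier X\<rbrakk> \<Longrightarrow>
      x \<otimes>\<^bsub>X\<^esub> (a \<odot>\<^bsub>X\<^esub> y) = a \<odot>\<^bsub>X\<^esub> (x \<otimes>\<^bsub>X\<^esub> y)"

definition alg_tensor ::
    "('k, 'c) ring_scheme \<Rightarrow> ('k, 'x, 'y) module_scheme \<Rightarrow> ('k, 'x', 'z) module_scheme \<Rightarrow>
     ('k, ('x, 'x') tens) module"
  where "alg_tensor K X Y =
    (let T = tensor K X Y
     in \<lparr>carrier = carrier T,
         monoid.mult = (\<lambda>u v. tens_lift T (\<lambda>x y. tens_lift T
            (\<lambda>x' y'. pure_tensor K X Y (x \<otimes>\<^bsub>X\<^esub> x') (y \<otimes>\<^bsub>Y\<^esub> y')) v) u),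
         one = pure_tensor K X Y \<one>\<^bsub>X\<^esub> \<one>\<^bsub>Y\<^esub>,
         ring.zero = \<zero>\<^bsub>T\<^esub>,
         add = add T,
         smult = (\<lambda>c. tens_lift T (\<lambda>x y. pure_tensor K X Y (c \<odot>\<^bsub>X\<^esub> x) y))\<rparr>)"

definition alg_hom :: "('k, 'c) ring_scheme \<Rightarrow> ('k, 'x, 'y) module_scheme \<Rightarrow>
     ('k, 'x', 'z) module_scheme \<Rightarrow> ('x \<Rightarrow> 'x') set"
  where "alg_hom K X Y = ring_hom X Y \<inter> lmod_hom K X Y"

definition enveloping :: "('k, 'c) ring_scheme \<Rightarrow> ('k, 'x, 'y) module_scheme \<Rightarrow>
     ('k, ('x, 'x) tens) module"
  where "enveloping K X = alg_tensor K X (opp X)"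


section \<open>Hopf algebras and comodule algebras\<close>

record ('k, 'h) hopf = "('k, 'h) module" +
  comult :: "'h \<Rightarrow> ('h, 'h) tens"
  counit :: "'h \<Rightarrow> 'k"
  antipode :: "'h \<Rightarrow> 'h"

record ('k, 'h, 'b) comod_alg = "('k, 'b) module" +
  coact :: "'b \<Rightarrow> ('b, 'h) tens"

locale hopf_algebra = k_algebra K H
  for K :: "('k, 'c) ring_scheme" (structure) and H :: "('k, 'h, 'z) hopf_scheme" (structure) +
  assumes comult_hom: "comult H \<in> alg_hom K H (alg_tensor K H H)"
    and counit_hom: "counit H \<in> ring_hom H K"
    and counit_smult: "\<lbrakk>a \<in> carrier K; h \<in> carrier H\<rbrakk> \<Longrightarrow>
      counit H (a \<odot>\<^bsub>H\<^esub> h) = a \<otimes>\<^bsub>K\<^esub> counit H h"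
    and coassoc: "h \<in> carrier H \<Longrightarrow>
      tens_lift (alg_tensor K (alg_tensor K H H) H)
        (\<lambda>x y. pure_tensor K (alg_tensor K H H) H (comult H x) y) (comult H h) =
      tens_lift (alg_tensor K (alg_tensor K H H) H)
        (\<lambda>x y. tens_lift (alg_tensor K (alg_tensor K H H) H)
           (\<lambda>y' y''. pure_tensor K (alg_tensor K H H) H (pure_tensor K H H x y') y'')
           (comult H y)) (comult H h)"
    and counit_l: "h \<in> carrier H \<Longrightarrow> tens_lift H (\<lambda>x y. counit H x \<odot>\<^bsub>H\<^esub> y) (comult H h) = h"
    and counit_r: "h \<in> carrier H \<Longrightarrow> tens_lift H (\<lambda>x y. counit H y \<odot>\<^bsub>H\<^esub> x) (comult H h) = h"
    and antipode_lin: "antipode H \<in> lmod_hom K H H"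
    and antipode_l: "h \<in> carrier H \<Longrightarrow>
      tens_lift H (\<lambda>x y. antipode H x \<otimes>\<^bsub>H\<^esub> y) (comult H h) = counit H h \<odot>\<^bsub>H\<^esub> \<one>\<^bsub>H\<^esub>"
    and antipode_r: "h \<in> carrier H \<Longrightarrow>
      tens_lift H (\<lambda>x y. x \<otimes>\<^bsub>H\<^esub> antipode H y) (comult H h) = counit H h \<odot>\<^bsub>H\<^esub> \<one>\<^bsub>H\<^esub>"

locale comodule_algebra = hopf_algebra K H + B: k_algebra K B
  for K :: "('k, 'c) ring_scheme" (structure) and H :: "('k, 'h, 'z) hopf_scheme" (structure)
    and B :: "('k, 'h, 'b, 'w) comod_alg_scheme" (structure) +
  assumes coact_hom: "coact B \<in> alg_hom K B (alg_tensor K B H)"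
    and coact_coassoc: "b \<in> carrier B \<Longrightarrow>
      tens_lift (alg_tensor K (alg_tensor K B H) H)
        (\<lambda>x h. pure_tensor K (alg_tensor K B H) H (coact B x) h) (coact B b) =
      tens_lift (alg_tensor K (alg_tensor K B H) H)
        (\<lambda>x h. tens_lift (alg_tensor K (alg_tensor K B H) H)
           (\<lambda>h' h''. pure_tensor K (alg_tensor K B H) H (pure_tensor K B H x h') h'')
           (comult H h)) (coact B b)"
    and coact_counit: "b \<in> carrier B \<Longrightarrow> tens_lift B (\<lambda>x h. counit H h \<odot>\<^bsub>B\<^esub> x) (coact B b) = b"

definition trivial_module :: "('k, 'c) ring_scheme \<Rightarrow> ('k, 'h, 'z) hopf_scheme \<Rightarrow> ('h, 'k) module"
  where "trivial_module K H = with_action K (\<lambda>h c. counit H h \<otimes>\<^bsub>K\<^esub> c)"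


section \<open>Hopf-Galois extensions\<close>

definition coinv :: "('k, 'c) ring_scheme \<Rightarrow> ('k, 'h, 'z) hopf_scheme \<Rightarrow>
     ('k, 'h, 'b, 'w) comod_alg_scheme \<Rightarrow> ('k, 'h, 'b, 'w) comod_alg_scheme"
  where "coinv K H B = B\<lparr>carrier := {b \<in> carrier B. coact B b = pure_tensor K B H b \<one>\<^bsub>H\<^esub>}\<rparr>"

definition left_reg :: "('b, 'w) ring_scheme \<Rightarrow> ('b, 'b) module"
  where "left_reg B = with_action B (\<lambda>a b. a \<otimes>\<^bsub>B\<^esub> b)"

definition right_reg :: "('b, 'w) ring_scheme \<Rightarrow> ('b, 'b) module"
  where "right_reg B = with_action B (\<lambda>a b. b \<otimes>\<^bsub>B\<^esub> a)"

definition tensor_BAB :: "('k, 'c) ring_scheme \<Rightarrow> ('k, 'h, 'z) hopf_scheme \<Rightarrow>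
     ('k, 'h, 'b, 'w) comod_alg_scheme \<Rightarrow> ('b, 'b) tens ring"
  where "tensor_BAB K H B = tensor (coinv K H B) (right_reg B) (left_reg B)"

definition galois_map :: "('k, 'c) ring_scheme \<Rightarrow> ('k, 'h, 'z) hopf_scheme \<Rightarrow>
     ('k, 'h, 'b, 'w) comod_alg_scheme \<Rightarrow> ('b, 'b) tens \<Rightarrow> ('b, 'h) tens"
  where "galois_map K H B = tens_lift (alg_tensor K B H)
    (\<lambda>b b'. tens_lift (alg_tensor K B H) (\<lambda>x h. pure_tensor K B H (b \<otimes>\<^bsub>B\<^esub> x) h) (coact B b'))"

locale hopf_galois = comodule_algebra K H B
  for K :: "('k, 'c) ring_scheme" (structure) and H :: "('k, 'h, 'z) hopf_scheme" (structure)
    and B :: "('k, 'h, 'b, 'w) comod_alg_scheme" (structure) +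
  assumes galois: "bij_betw (galois_map K H B) (carrier (tensor_BAB K H B)) (carrier (alg_tensor K B H))"

locale faithfully_flat_hopf_galois = hopf_galois K H B
  for K :: "('k, 'c) ring_scheme" (structure) and H :: "('k, 'h, 'z) hopf_scheme" (structure)
    and B :: "('k, 'h, 'b, 'w) comod_alg_scheme" (structure) +
  assumes faithfully_flat: "faithfully_flat (coinv K H B) (left_reg B)"

text \<open>\<open>h \<mapsto> \<beta>\<^sup>-\<^sup>1(1 \<otimes> h) = \<Sum>\<^sub>i l\<^sub>i(h) \<otimes>\<^sub>A r\<^sub>i(h)\<close>.\<close>

definition translation :: "('k, 'c) ring_scheme \<Rightarrow> ('k, 'h, 'z) hopf_scheme \<Rightarrow>
     ('k, 'h, 'b, 'w) comod_alg_scheme \<Rightarrow> 'h \<Rightarrow> ('b, 'b) tens"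
  where "translation K H B h =
    inv_into (carrier (tensor_BAB K H B)) (galois_map K H B) (pure_tensor K B H \<one>\<^bsub>B\<^esub> h)"


section \<open>The algebra \<open>\<Gamma>\<close>\<close>

text \<open>\<open>b \<otimes> b'\<^sup>o\<^sup>p \<mapsto> \<Sum> b\<^sub>(\<^sub>0\<^sub>) \<otimes> b'\<^sub>(\<^sub>0\<^sub>)\<^sup>o\<^sup>p \<otimes> b\<^sub>(\<^sub>1\<^sub>) b'\<^sub>(\<^sub>1\<^sub>)\<close>.\<close>

definition codiagonal :: "('k, 'c) ring_scheme \<Rightarrow> ('k, 'h, 'z) hopf_scheme \<Rightarrow>
     ('k, 'h, 'b, 'w) comod_alg_scheme \<Rightarrow> ('b, 'b) tens \<Rightarrow> (('b, 'b) tens, 'h) tens"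
  where "codiagonal K H B =
    (let E = enveloping K B; T = alg_tensor K E H
     in tens_lift T (\<lambda>b b'. tens_lift T (\<lambda>x h. tens_lift T
          (\<lambda>x' h'. pure_tensor K E H (pure_tensor K B (opp B) x x') (h \<otimes>\<^bsub>H\<^esub> h'))
          (coact B b')) (coact B b)))"

definition Gamma_alg :: "('k, 'c) ring_scheme \<Rightarrow> ('k, 'h, 'z) hopf_scheme \<Rightarrow>
     ('k, 'h, 'b, 'w) comod_alg_scheme \<Rightarrow> ('k, ('b, 'b) tens) module"
  where "Gamma_alg K H B = (enveloping K B)\<lparr>carrier :=
    {z \<in> carrier (enveloping K B). codiagonal K H B z = pure_tensor K (enveloping K B) H z \<one>\<^bsub>H\<^esub>}\<rparr>"

text \<open>\<open>(\<Sum> x\<^sub>p \<otimes> y\<^sub>p\<^sup>o\<^sup>p) \<cdot> b = \<Sum> x\<^sub>p b y\<^sub>p\<close>. With this action \<open>B\<close> is a left \<open>B\<^sup>e\<close>-module, that is, the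
  \<open>(B, B)\<close>-bimodule \<open>B\<close>, and \<open>A\<close> is a left \<open>\<Gamma>\<close>-module.\<close>

definition sandwich :: "('b, 'w) ring_scheme \<Rightarrow> ('b, 'b) tens \<Rightarrow> 'b \<Rightarrow> 'b"
  where "sandwich B z b = tens_lift B (\<lambda>x y. x \<otimes>\<^bsub>B\<^esub> b \<otimes>\<^bsub>B\<^esub> y) z"

definition regular_bimodule :: "('b, 'w) ring_scheme \<Rightarrow> (('b, 'b) tens, 'b) module"
  where "regular_bimodule B = with_action B (sandwich B)"

definition coinv_Gamma_module :: "('k, 'c) ring_scheme \<Rightarrow> ('k, 'h, 'z) hopf_scheme \<Rightarrow>
     ('k, 'h, 'b, 'w) comod_alg_scheme \<Rightarrow> (('b, 'b) tens, 'b) module"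
  where "coinv_Gamma_module K H B = with_action (coinv K H B) (sandwich B)"


section \<open>The functor \<open>B\<^sup>e \<otimes>\<^bsub>A\<^sup>e\<^esub> -\<close>\<close>

definition Ae_incl :: "('k, 'c) ring_scheme \<Rightarrow>
     ('k, 'h, 'b, 'w) comod_alg_scheme \<Rightarrow> ('b, 'b) tens \<Rightarrow> ('b, 'b) tens"
  where "Ae_incl K B = tens_lift (enveloping K B) (pure_tensor K B (opp B))"

definition Be_right :: "('k, 'c) ring_scheme \<Rightarrow> ('k, 'h, 'b, 'w) comod_alg_scheme \<Rightarrow>
     (('b, 'b) tens, ('b, 'b) tens) module"
  where "Be_right K B = with_action (enveloping K B) (\<lambda>r z. z \<otimes>\<^bsub>enveloping K B\<^esub> Ae_incl K B r)"

definition restrict_Ae :: "('k, 'c) ring_scheme \<Rightarrow> ('k, 'h, 'b, 'w) comod_alg_scheme \<Rightarrow>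
     (('b, 'b) tens, 'm, 'x) module_scheme \<Rightarrow> (('b, 'b) tens, 'm) module"
  where "restrict_Ae K B M = with_action M (\<lambda>r m. Ae_incl K B r \<odot>\<^bsub>M\<^esub> m)"

definition induced :: "('k, 'c) ring_scheme \<Rightarrow> ('k, 'h, 'z) hopf_scheme \<Rightarrow>
     ('k, 'h, 'b, 'w) comod_alg_scheme \<Rightarrow> (('b, 'b) tens, 'm, 'x) module_scheme \<Rightarrow>
     (('b, 'b) tens, 'm) tens ring"
  where "induced K H B M =
    tensor (enveloping K (coinv K H B)) (Be_right K B) (restrict_Ae K B M)"

definition induced_pure :: "('k, 'c) ring_scheme \<Rightarrow> ('k, 'h, 'z) hopf_scheme \<Rightarrow>
     ('k, 'h, 'b, 'w) comod_alg_scheme \<Rightarrow> (('b, 'b) tens, 'm, 'x) module_scheme \<Rightarrow>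
     ('b, 'b) tens \<Rightarrow> 'm \<Rightarrow> (('b, 'b) tens, 'm) tens"
  where "induced_pure K H B M =
    pure_tensor (enveloping K (coinv K H B)) (Be_right K B) (restrict_Ae K B M)"

text \<open>The \<open>(B, B)\<close>-bimodule structure, as a left \<open>B\<^sup>e\<close>-module structure.\<close>

definition induced_bimodule :: "('k, 'c) ring_scheme \<Rightarrow> ('k, 'h, 'z) hopf_scheme \<Rightarrow>
     ('k, 'h, 'b, 'w) comod_alg_scheme \<Rightarrow> (('b, 'b) tens, 'm, 'x) module_scheme \<Rightarrow>
     (('b, 'b) tens, (('b, 'b) tens, 'm) tens) module"
  where "induced_bimodule K H B M = with_action (induced K H B M)
    (\<lambda>e. tens_lift (induced K H B M) (\<lambda>z m. induced_pure K H B M (e \<otimes>\<^bsub>enveloping K B\<^esub> z) m))"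


section \<open>The action of \<open>H\<close> on \<open>B\<^sup>e \<otimes>\<^bsub>A\<^sup>e\<^esub> M\<close>\<close>

text \<open>\<open>(B \<otimes>\<^sub>A G) \<otimes>\<^sub>A B\<close> for \<open>G\<close> equal to \<open>B\<^sup>e\<close> or \<open>\<Gamma>\<close>, an \<open>(A, A)\<close>-bimodule via
  \<open>a \<cdot> (x \<otimes> y\<^sup>o\<^sup>p) \<cdot> a' = a x \<otimes> (y a')\<^sup>o\<^sup>p\<close>, that is, by left multiplication by
  \<open>a \<otimes> a'\<^sup>o\<^sup>p \<in> A\<^sup>e\<close>.\<close>

definition G_left :: "('k, 'c) ring_scheme \<Rightarrow> ('k, 'h, 'b, 'w) comod_alg_scheme \<Rightarrow>
     ('k, ('b, 'b) tens) module \<Rightarrow> ('b, ('b, 'b) tens) module"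
  where "G_left K B G = with_action G (\<lambda>a z. pure_tensor K B (opp B) a \<one>\<^bsub>B\<^esub> \<otimes>\<^bsub>G\<^esub> z)"

definition tensor_BG :: "('k, 'c) ring_scheme \<Rightarrow> ('k, 'h, 'z) hopf_scheme \<Rightarrow>
     ('k, 'h, 'b, 'w) comod_alg_scheme \<Rightarrow> ('k, ('b, 'b) tens) module \<Rightarrow>
     ('b, ('b, ('b, 'b) tens) tens) module"
  where "tensor_BG K H B G =
    (let A = coinv K H B; T = tensor A (right_reg B) (G_left K B G)
     in with_action T (\<lambda>a. tens_lift T (\<lambda>x z.
          pure_tensor A (right_reg B) (G_left K B G) x
            (pure_tensor K B (opp B) \<one>\<^bsub>B\<^esub> a \<otimes>\<^bsub>G\<^esub> z))))"

definition tensor_BGB :: "('k, 'c) ring_scheme \<Rightarrow> ('k, 'h, 'z) hopf_scheme \<Rightarrow>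
     ('k, 'h, 'b, 'w) comod_alg_scheme \<Rightarrow> ('k, ('b, 'b) tens) module \<Rightarrow>
     (('b, ('b, 'b) tens) tens, 'b) tens ring"
  where "tensor_BGB K H B G = tensor (coinv K H B) (tensor_BG K H B G) (left_reg B)"

definition pure_BGB :: "('k, 'c) ring_scheme \<Rightarrow> ('k, 'h, 'z) hopf_scheme \<Rightarrow>
     ('k, 'h, 'b, 'w) comod_alg_scheme \<Rightarrow> ('k, ('b, 'b) tens) module \<Rightarrow>
     'b \<Rightarrow> ('b, 'b) tens \<Rightarrow> 'b \<Rightarrow> (('b, ('b, 'b) tens) tens, 'b) tens"
  where "pure_BGB K H B G x z y = pure_tensor (coinv K H B) (tensor_BG K H B G) (left_reg B)
     (pure_tensor (coinv K H B) (right_reg B) (G_left K B G) x z) y"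

text \<open>The additive map out of \<open>B \<otimes>\<^sub>A G \<otimes>\<^sub>A B\<close> with \<open>x \<otimes> z \<otimes> y \<mapsto> \<phi> x z y\<close>.\<close>

definition lift_BGB :: "('p, 'v) ring_scheme \<Rightarrow> ('b \<Rightarrow> ('b, 'b) tens \<Rightarrow> 'b \<Rightarrow> 'p) \<Rightarrow>
     (('b, ('b, 'b) tens) tens, 'b) tens \<Rightarrow> 'p"
  where "lift_BGB P \<phi> = tens_lift P (\<lambda>u y. tens_lift P (\<lambda>x z. \<phi> x z y) u)"

text \<open>The element \<open>\<Sum> l\<^sub>i(h\<^sub>(\<^sub>1\<^sub>)) \<otimes>\<^sub>A (r\<^sub>i(h\<^sub>(\<^sub>1\<^sub>)) \<otimes> l\<^sub>j(h\<^sub>(\<^sub>2\<^sub>))\<^sup>o\<^sup>p) \<otimes>\<^sub>A r\<^sub>j(h\<^sub>(\<^sub>2\<^sub>))\<close>, first in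
  \<open>B \<otimes>\<^sub>A B\<^sup>e \<otimes>\<^sub>A B\<close>, then in \<open>B \<otimes>\<^sub>A \<Gamma> \<otimes>\<^sub>A B\<close>, which is contained in the former by flatness.\<close>

definition translation2_Be :: "('k, 'c) ring_scheme \<Rightarrow> ('k, 'h, 'z) hopf_scheme \<Rightarrow>
     ('k, 'h, 'b, 'w) comod_alg_scheme \<Rightarrow> 'h \<Rightarrow> (('b, ('b, 'b) tens) tens, 'b) tens"
  where "translation2_Be K H B h =
    (let E = enveloping K B; T = tensor_BGB K H B E
     in tens_lift T (\<lambda>h1 h2. tens_lift T (\<lambda>l r. tens_lift T
          (\<lambda>l' r'. pure_BGB K H B E l (pure_tensor K B (opp B) r l') r')
          (translation K H B h2)) (translation K H B h1)) (comult H h))"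

definition translation2 :: "('k, 'c) ring_scheme \<Rightarrow> ('k, 'h, 'z) hopf_scheme \<Rightarrow>
     ('k, 'h, 'b, 'w) comod_alg_scheme \<Rightarrow> 'h \<Rightarrow> (('b, ('b, 'b) tens) tens, 'b) tens"
  where "translation2 K H B h =
    (THE t. t \<in> carrier (tensor_BGB K H B (Gamma_alg K H B)) \<and>
       lift_BGB (tensor_BGB K H B (enveloping K B)) (pure_BGB K H B (enveloping K B)) t
         = translation2_Be K H B h)"

text \<open>If \<open>\<Sum> x \<otimes>\<^sub>A \<gamma> \<otimes>\<^sub>A y\<close>, with \<open>\<gamma> \<in> \<Gamma>\<close>, is the element above, then
  \<open>h \<rightharpoonup> ((b \<otimes> b'\<^sup>o\<^sup>p) \<otimes> m) = \<Sum> (b x \<otimes> (y b')\<^sup>o\<^sup>p) \<otimes> \<gamma> m\<close>.\<close>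

definition induced_H_action :: "('k, 'c) ring_scheme \<Rightarrow> ('k, 'h, 'z) hopf_scheme \<Rightarrow>
     ('k, 'h, 'b, 'w) comod_alg_scheme \<Rightarrow> (('b, 'b) tens, 'm, 'x) module_scheme \<Rightarrow>
     'h \<Rightarrow> (('b, 'b) tens, 'm) tens \<Rightarrow> (('b, 'b) tens, 'm) tens"
  where "induced_H_action K H B M h =
    (let T = induced K H B M
     in tens_lift T (\<lambda>w m. tens_lift T (\<lambda>b b'. lift_BGB T
          (\<lambda>x \<gamma> y. induced_pure K H B M
             (pure_tensor K B (opp B) (b \<otimes>\<^bsub>B\<^esub> x) (y \<otimes>\<^bsub>B\<^esub> b')) (\<gamma> \<odot>\<^bsub>M\<^esub> m))
          (translation2 K H B h)) w))"

definition induced_H_module :: "('k, 'c) ring_scheme \<Rightarrow> ('k, 'h, 'z) hopf_scheme \<Rightarrow>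
     ('k, 'h, 'b, 'w) comod_alg_scheme \<Rightarrow> (('b, 'b) tens, 'm, 'x) module_scheme \<Rightarrow>
     ('h, (('b, 'b) tens, 'm) tens) module"
  where "induced_H_module K H B M = with_action (induced K H B M) (induced_H_action K H B M)"

definition induced_map :: "('k, 'c) ring_scheme \<Rightarrow> ('k, 'h, 'z) hopf_scheme \<Rightarrow>
     ('k, 'h, 'b, 'w) comod_alg_scheme \<Rightarrow> (('b, 'b) tens, 'n, 'x) module_scheme \<Rightarrow>
     ('m \<Rightarrow> 'n) \<Rightarrow> (('b, 'b) tens, 'm) tens \<Rightarrow> (('b, 'b) tens, 'n) tens"
  where "induced_map K H B N f =
    tensor_map (enveloping K (coinv K H B)) (Be_right K B) (restrict_Ae K B N) id f"


section \<open>The total complex\<close>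

text \<open>\<open>L \<otimes>\<^sub>H (B\<^sup>e \<otimes>\<^bsub>A\<^sup>e\<^esub> M)\<close>, a left \<open>B\<^sup>e\<close>-module through the second factor.\<close>

definition bicomplex_term :: "('k, 'c) ring_scheme \<Rightarrow> ('k, 'h, 'z) hopf_scheme \<Rightarrow>
     ('k, 'h, 'b, 'w) comod_alg_scheme \<Rightarrow> ('h, 'l, 'y) module_scheme \<Rightarrow>
     (('b, 'b) tens, 'm, 'x) module_scheme \<Rightarrow>
     (('b, 'b) tens, ('l, (('b, 'b) tens, 'm) tens) tens) module"
  where "bicomplex_term K H B L M =
    with_action (tensor H L (induced_H_module K H B M))
      (\<lambda>e. tensor_map H L (induced_H_module K H B M) id (\<lambda>w. e \<odot>\<^bsub>induced_bimodule K H B M\<^esub> w))"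

text \<open>\<open>Tot\<^sub>n\<close> consists of the families \<open>t\<close> with \<open>t p \<in> L\<^sub>p \<otimes>\<^sub>H K'\<^bsub>n-p\<^esub>\<close> for \<open>p \<le> n\<close>.\<close>

definition Tot :: "('k, 'c) ring_scheme \<Rightarrow> ('k, 'h, 'z) hopf_scheme \<Rightarrow>
     ('k, 'h, 'b, 'w) comod_alg_scheme \<Rightarrow> (nat \<Rightarrow> ('h, 'l, 'y) module_scheme) \<Rightarrow>
     (nat \<Rightarrow> (('b, 'b) tens, 'm, 'x) module_scheme) \<Rightarrow> nat \<Rightarrow>
     (('b, 'b) tens, nat \<Rightarrow> ('l, (('b, 'b) tens, 'm) tens) tens) module"
  where "Tot K H B L C n =
    (let T = (\<lambda>p. bicomplex_term K H B (L p) (C (n - p)))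
     in \<lparr>carrier = (\<Pi>\<^sub>E p\<in>{..n}. carrier (T p)), monoid.mult = undefined, one = undefined,
         ring.zero = (\<lambda>p\<in>{..n}. \<zero>\<^bsub>T p\<^esub>),
         add = (\<lambda>s t. \<lambda>p\<in>{..n}. s p \<oplus>\<^bsub>T p\<^esub> t p),
         smult = (\<lambda>e t. \<lambda>p\<in>{..n}. e \<odot>\<^bsub>T p\<^esub> t p)\<rparr>)"

text \<open>The component in \<open>L\<^sub>p \<otimes>\<^sub>H K'\<^bsub>n-p\<^esub>\<close> of the differential of \<open>t \<in> Tot\<^bsub>n+1\<^esub>\<close> is
  \<open>(d\<^sup>L \<otimes> 1) t\<^bsub>p+1\<^esub> + (-1)\<^sup>p (1 \<otimes> d\<^sup>K\<^sup>') t\<^sub>p\<close>.\<close>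

definition Tot_diff :: "('k, 'c) ring_scheme \<Rightarrow> ('k, 'h, 'z) hopf_scheme \<Rightarrow>
     ('k, 'h, 'b, 'w) comod_alg_scheme \<Rightarrow>
     (nat \<Rightarrow> ('h, 'l, 'y) module_scheme) \<Rightarrow> (nat \<Rightarrow> 'l \<Rightarrow> 'l) \<Rightarrow>
     (nat \<Rightarrow> (('b, 'b) tens, 'm, 'x) module_scheme) \<Rightarrow> (nat \<Rightarrow> 'm \<Rightarrow> 'm) \<Rightarrow> nat \<Rightarrow>
     (nat \<Rightarrow> ('l, (('b, 'b) tens, 'm) tens) tens) \<Rightarrow> nat \<Rightarrow> ('l, (('b, 'b) tens, 'm) tens) tens"
  where "Tot_diff K H B L dL C dC n t = (\<lambda>p\<in>{..n}.
    (let K' = induced_H_module K H B (C (n - p));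
         T = bicomplex_term K H B (L p) (C (n - p))
     in tensor_map H (L p) K' (dL p) id (t (Suc p)) \<oplus>\<^bsub>T\<^esub>
        [((-1 :: int) ^ p)] \<cdot>\<^bsub>T\<^esub>
          (tensor_map H (L p) K' id (induced_map K H B (C (n - p)) (dC (n - p))) (t p))))"

end

theory Submission
  imports Defs
begin

text \<open>Write \<open>C\<close> for the resolution of \<open>A\<close> over \<open>\<Gamma>\<close>, and \<open>\<Sum> l(h) \<otimes> r(h)\<close> for the translation element \<open>\<tau>(h) = \<beta>\<^sup>-\<^sup>1(1 \<otimes> h)\<close>.
  The proof rests on an element \<open>\<nu>(b) \<in> \<Gamma> \<otimes>\<^sub>A B\<close> for every \<open>b \<in> B\<close>, the preimage of \<open>b \<otimes> 1\<close> under
  \<open>\<Gamma> \<otimes>\<^sub>A B \<rightarrow> B\<^sup>e\<close>, \<open>(x \<otimes> y\<^sup>o\<^sup>p) \<otimes> c \<mapsto> x \<otimes> (y c)\<^sup>o\<^sup>p\<close>. In \<open>B\<^sup>e \<otimes>\<^sub>A B\<close> it is \<open>\<Sum> (b\<^sub>(\<^sub>0\<^sub>) \<otimes> l(b\<^sub>(\<^sub>1\<^sub>))\<^sup>o\<^sup>p) \<otimes> r(b\<^sub>(\<^sub>1\<^sub>))\<close>; both coactions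
  agree on this element (\<open>vE_equalized\<close>), and because \<open>B\<close> is flat over \<open>A\<close> it therefore comes from \<open>\<Gamma> \<otimes>\<^sub>A B\<close>
  (\<open>vE_in_VG\<close>). The element of \<open>B \<otimes>\<^sub>A \<Gamma> \<otimes>\<^sub>A B\<close> that defines the action of \<open>H\<close> is then \<open>\<Sum> l(h) \<otimes> \<nu>(r(h))\<close>
  (\<open>translation2_eq\<close>), and all computations reduce to rules for \<open>\<tau>\<close> and \<open>\<nu>\<close>.

  Projectivity. For a \<open>B\<^sup>e\<close>-module \<open>N\<close>, the space \<open>Hom\<^sub>k(L, N)\<close> is a \<open>B\<^sup>e\<close>-module by
  \<open>((b \<otimes> c\<^sup>o\<^sup>p) \<phi>)(l) = \<Sum> b\<^sub>(\<^sub>0\<^sub>) \<phi>(l b\<^sub>(\<^sub>1\<^sub>)) c\<close>, and bimodule maps \<open>L \<otimes>\<^sub>H (B\<^sup>e \<otimes>\<^bsub>A\<^sup>e\<^esub> M) \<rightarrow> N\<close> correspond to \<open>\<Gamma>\<close>-linear maps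
  \<open>M \<rightarrow> Hom\<^sub>k(L, N)\<close> (\<open>HL_tbal\<close>, \<open>T_adjoint\<close>). The functor \<open>Hom\<^sub>k(L, -)\<close> preserves surjections since \<open>k\<close> is a field,
  so each term \<open>L \<otimes>\<^sub>H (B\<^sup>e \<otimes>\<^bsub>A\<^sup>e\<^esub> M)\<close> with projective \<open>M\<close> is projective (\<open>T_projective_lift\<close>), and so is the finite
  product \<open>Tot\<close> (\<open>prod_mod_lift\<close>).

  Exactness. The elements \<open>\<nu>(b)\<close> make \<open>M \<otimes>\<^sub>A B\<close> a left \<open>B\<close>-module, and there is an isomorphism
  \<open>L \<otimes>\<^sub>H (B\<^sup>e \<otimes>\<^bsub>A\<^sup>e\<^esub> M) \<cong> L \<otimes>\<^sub>k (M \<otimes>\<^sub>A B)\<close>, \<open>l \<otimes> (b \<otimes> b'\<^sup>o\<^sup>p) \<otimes> m \<mapsto> \<Sum> l S\<^sup>-\<^sup>1(b\<^sub>(\<^sub>1\<^sub>)) \<otimes> b\<^sub>(\<^sub>0\<^sub>) (m \<otimes> b')\<close>, natural in \<open>L\<close> and \<open>M\<close>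
  (\<open>PhiL_psi\<close>, \<open>PsiL_phi\<close>); here the inverse of the antipode enters. By flatness \<open>C \<otimes>\<^sub>A B\<close> is exact with augmentation
  onto \<open>A \<otimes>\<^sub>A B = B\<close> (\<open>V_exact\<close>), so over the field \<open>k\<close> both \<open>L \<rightarrow> k\<close> and \<open>C \<otimes>\<^sub>A B \<rightarrow> B\<close> have linear contractions
  (\<open>linear_contraction\<close>). These are transported to the bicomplex and show that its total complex is exact with
  augmentation onto \<open>B\<close> (\<open>tot_exact\<close>, \<open>Tot_resolution\<close>).\<close>

(* Elements of tensor products are cosets; equations between them must not be split into inclusions. *)
declare subset_antisym [rule del]

abbreviation elem_of :: "'a \<Rightarrow> ('a, 'z) partial_object_scheme \<Rightarrow> bool" (infix "<:" 50) where
 "x <: M \<equiv> x \<in> carrier M"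

abbreviation tsum :: "('p, 'z) ring_scheme \<Rightarrow> ('m \<Rightarrow> 'n \<Rightarrow> 'p) \<Rightarrow> ('m, 'n) tens \<Rightarrow> 'p" where
 "tsum \<equiv> tens_lift"

abbreviation "lhom \<equiv> lmod_hom"
abbreviation "pt \<equiv> pure_tensor"
abbreviation "tmap \<equiv> tensor_map"
abbreviation "lmod \<equiv> left_module"
abbreviation "abgrp \<equiv> abelian_group"
abbreviation smult_in ("(_ .\<^sub>_/ _)" [70, 1000, 71] 70) where "a .\<^sub>M x \<equiv> a \<odot>\<^bsub>M\<^esub> x"
abbreviation add_in ("(_ +\<^sub>_/ _)" [65, 1000, 66] 65) where "x +\<^sub>M y \<equiv> x \<oplus>\<^bsub>M\<^esub> y"
abbreviation mult_in ("(_ *\<^sub>_/ _)" [70, 1000, 71] 70) where "x *\<^sub>M y \<equiv> x \<otimes>\<^bsub>M\<^esub> y"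
abbreviation zero_in ("0\<^sub>_" [1000] 1000) where "0\<^sub>M \<equiv> \<zero>\<^bsub>M\<^esub>"
abbreviation one_in ("1\<^sub>_" [1000] 1000) where "1\<^sub>M \<equiv> \<one>\<^bsub>M\<^esub>"

section \<open>Additive maps\<close>

definition Hom :: "('m, 'x) ring_scheme \<Rightarrow> ('n, 'y) ring_scheme \<Rightarrow> ('m \<Rightarrow> 'n) set" where
 "Hom M N = {f \<in> carrier M \<rightarrow> carrier N.
   \<forall>x\<in>carrier M. \<forall>y\<in>carrier M. f (x +\<^sub>M y) = f x +\<^sub>N f y}"

lemma HomI:
 assumes "!!x. x <: M ==> f x <: N"
  and "!!x y. [|x <: M; y <: M|] ==> f (x +\<^sub>M y) = f x +\<^sub>N f y"
 shows "f \<in> Hom M N"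
 using assms by (auto simp: Hom_def)

lemma Hom_closed: "[|f \<in> Hom M N; x <: M|] ==> f x <: N"
 by (auto simp: Hom_def)

lemma Hom_add:
 "[|f \<in> Hom M N; x <: M; y <: M|] ==> f (x +\<^sub>M y) = f x +\<^sub>N f y"
 by (auto simp: Hom_def)

lemma Hom_comp: "[|f \<in> Hom M N; g \<in> Hom N P|] ==> (%x. g (f x)) \<in> Hom M P"
 by (auto simp: Hom_def Pi_iff)

lemma Hom_id: "(%x. x) \<in> Hom M M"
 by (auto simp: Hom_def)

lemma Hom_cong:
 "[|f \<in> Hom M N; abgrp M; !!x. x <: M ==> f x = g x|] ==> g \<in> Hom M N"
 using abelian_groupE(1)[of M] by (auto simp: Hom_def Pi_iff)

lemma lin_Hom: "f \<in> lhom R M N ==> f \<in> Hom M N"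
 by (auto simp: Hom_def lmod_hom_def)

lemma linI:
 assumes "f \<in> Hom M N"
  and "!!a x. [|a <: R; x <: M|] ==> f (a .\<^sub>M x) = a .\<^sub>N f x"
 shows "f \<in> lhom R M N"
 using assms by (auto simp: Hom_def lmod_hom_def)

lemma lin_closed: "[|f \<in> lhom R M N; x <: M|] ==> f x <: N"
 by (auto simp: lmod_hom_def)

lemma lin_add:
 "[|f \<in> lhom R M N; x <: M; y <: M|] ==> f (x +\<^sub>M y) = f x +\<^sub>N f y"
 by (auto simp: lmod_hom_def)

lemma lin_smult:
 "[|f \<in> lhom R M N; a <: R; x <: M|] ==> f (a .\<^sub>M x) = a .\<^sub>N f x"
 by (auto simp: lmod_hom_def)

lemma Hom_group_hom:
 assumes "abgrp M" "abgrp N" "f \<in> Hom M N"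
 shows "group_hom (add_monoid M) (add_monoid N) f"
 using assms by (auto intro!: group_hom.intro group_hom_axioms.intro homI abelian_group.a_group
   simp: Hom_def)

lemma Hom_zero:
 assumes "abgrp M" "abgrp N" "f \<in> Hom M N"
 shows "f 0\<^sub>M = 0\<^sub>N"
 using group_hom.hom_one[OF Hom_group_hom[OF assms]] by simp

lemma Hom_neg:
 assumes "abgrp M" "abgrp N" "f \<in> Hom M N" "x <: M"
 shows "f (\<ominus>\<^bsub>M\<^esub> x) = \<ominus>\<^bsub>N\<^esub> f x"
 using group_hom.hom_inv[OF Hom_group_hom[OF assms(1-3)]] assms(4) by (simp add: a_inv_def)

lemma Hom_minus:
 assumes "abgrp M" "abgrp N" "f \<in> Hom M N" "x <: M" "y <: M"
 shows "f (x \<ominus>\<^bsub>M\<^esub> y) = f x \<ominus>\<^bsub>N\<^esub> f y"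
 using assms by (simp add: a_minus_def Hom_neg Hom_add abelian_group.a_inv_closed)

lemma Hom_int_pow:
 assumes "abgrp M" "abgrp N" "f \<in> Hom M N" "x <: M"
 shows "f ([(k::int)] \<cdot>\<^bsub>M\<^esub> x) = [k] \<cdot>\<^bsub>N\<^esub> f x"
 using group_hom.hom_int_pow[OF Hom_group_hom[OF assms(1-3)]] assms(4) by (simp add: add_pow_def)

lemma Hom_finsum:
 assumes M: "abgrp M" and N: "abgrp N" and f: "f \<in> Hom M N"
  and T: "finite T" and \<phi>: "\<phi> \<in> T \<rightarrow> carrier M"
 shows "f (\<Oplus>\<^bsub>M\<^esub>x\<in>T. \<phi> x) = (\<Oplus>\<^bsub>N\<^esub>x\<in>T. f (\<phi> x))"
 using T \<phi>
proof (induction T)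
 interpret M: abelian_group M by (rule M)
 interpret N: abelian_group N by (rule N)
 { case empty then show ?case using Hom_zero[OF M N f] by simp
 next
  case (insert x T)
  then show ?case
   using Hom_closed[OF f] Hom_add[OF f]
   by (simp add: Pi_iff M.finsum_closed) }
qed

section \<open>Tensor products\<close>

text \<open>The underlying abelian group of a tensor product only needs the two scalar actions to be
  closed, so that for many of the tensor products below no module axiom has to be verified.\<close>

definition tpair :: "('r, 'x) ring_scheme \<Rightarrow> ('r, 'm, 'y) module_scheme \<Rightarrow>
  ('r, 'n, 'z) module_scheme \<Rightarrow> bool" where
 "tpair R M N \<longleftrightarrow> abgrp M \<and> abgrp N \<and>
   (\<forall>r\<in>carrier R. \<forall>x\<in>carrier M. r .\<^sub>M x <: M) \<and>
   (\<forall>r\<in>carrier R. \<forall>y\<in>carrier N. r .\<^sub>N y <: N)"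

lemma balancedI:
 assumes "!!x y. [|x <: M; y <: N|] ==> \<phi> x y <: P"
  and "!!x x' y. [|x <: M; x' <: M; y <: N|] ==>
   \<phi> (x +\<^sub>M x') y = \<phi> x y +\<^sub>P \<phi> x' y"
  and "!!x y y'. [|x <: M; y <: N; y' <: N|] ==>
   \<phi> x (y +\<^sub>N y') = \<phi> x y +\<^sub>P \<phi> x y'"
  and "!!r x y. [|r <: R; x <: M; y <: N|] ==>
   \<phi> (r .\<^sub>M x) y = \<phi> x (r .\<^sub>N y)"
 shows "balanced R M N P \<phi>"
 using assms unfolding balanced_def by blast

lemma foldSetD_eq_if_eq: "[|(T, y) \<in> foldSetD D f e; \<forall>x\<in>T. f x = g x|] ==> (T, y) \<in> foldSetD D g e"
proof (induction rule: foldSetD.induct)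
 case (insertI x T y) then show ?case using foldSetD.insertI[of x T g y D e] by simp
qed (rule foldSetD.emptyI)

lemma foldD_eq_if_eq:
 assumes "\<forall>x\<in>T. f x = g x" shows "foldD D f e T = foldD D g e T"
proof -
 have "(T, y) \<in> foldSetD D f e \<longleftrightarrow> (T, y) \<in> foldSetD D g e" for y
  by (intro iffI; erule foldSetD_eq_if_eq) (simp_all add: assms)
 then show ?thesis by (simp add: foldD_def)
qed

text \<open>The folding relation behind a finite sum mentions only the values on the index set, so these may lie
  outside of the carrier.\<close>

lemma finsum_eq_if_eq: "(!!x. x \<in> T ==> f x = g x) ==> finsum P f T = finsum P g T"
 using foldD_eq_if_eq[of T "add P \<circ> f" "add P \<circ> g"] by (simp add: finsum_def finprod_def)

text \<open>A sum over a tensor is a finite sum over a chosen representative, so it is additive in the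
  summand and commutes with additive maps for every \<open>\<phi>\<close>, balanced or not.\<close>

lemma tens_lift_finsum:
 "tsum P \<phi> u = (\<Oplus>\<^bsub>P\<^esub>z\<in>Poly_Mapping.keys (SOME c. c \<in> u).
   [Poly_Mapping.lookup (SOME c. c \<in> u) z] \<cdot>\<^bsub>P\<^esub> \<phi> (fst z) (snd z))"
 by (simp add: tens_lift_def Let_def)

context
 fixes R :: "('r, 'x) ring_scheme" and M :: "('r, 'm, 'y) module_scheme"
  and N :: "('r, 'n, 'z) module_scheme"
 assumes MN: "tpair R M N"
begin

private abbreviation "F \<equiv> free_Abelian_group (carrier M \<times> carrier N)"

private lemma relators_closed: "tensor_relators R M N \<subseteq> carrier F"
proof -
 interpret M: abelian_group M using MN by (simp add: tpair_def)
 interpret N: abelian_group N using MN by (simp add: tpair_def)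
 have fr: "frag_of (x, y) <: F" if "x <: M" "y <: N" for x y
  using that by simp
 have df: "a - b <: F" if "a <: F" "b <: F" for a b
  using that keys_diff[of a b] by auto
 show ?thesis
  using MN unfolding tensor_relators_def tpair_def
  by (auto intro!: df fr simp del: carrier_free_Abelian_group_iff)
qed

lemma null_subgroup: "subgroup (tensor_null R M N) F"
 unfolding tensor_null_def
 by (rule group.generate_is_subgroup[OF group_free_Abelian_group relators_closed])

lemma tensor_ab: "abgrp (tensor R M N)"
proof -
 have "comm_group (F Mod tensor_null R M N)" (is "comm_group ?Q")
  by (rule comm_group.abelian_FactGroup[OF abelian_free_Abelian_group null_subgroup])
 moreover have "add_monoid (tensor R M N) = ?Q"
  by (simp add: tensor_def Let_def FactGroup_def)
 ultimately show ?thesis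
  by (intro abelian_group.intro abelian_group_axioms.intro abelian_monoid.intro)
    (simp_all add: comm_group.axioms)
qed

lemma tensorE:
 assumes "u <: tensor R M N"
 obtains c where "c <: F" "u = tensor_null R M N #>\<^bsub>F\<^esub> c"
 using assms by (auto simp: tensor_def Let_def FactGroup_def RCOSETS_def)

private lemma coset_add:
 assumes "c <: F" "d <: F"
 shows "(tensor_null R M N #>\<^bsub>F\<^esub> c) +\<^sub>(tensor R M N) (tensor_null R M N #>\<^bsub>F\<^esub> d) =
  tensor_null R M N #>\<^bsub>F\<^esub> (c + d)"
 using normal.rcos_sum[OF comm_group.subgroup_imp_normal[OF abelian_free_Abelian_group null_subgroup] assms]
 by (simp add: tensor_def Let_def FactGroup_def)

lemma coset_closed: "c <: F ==> tensor_null R M N #>\<^bsub>F\<^esub> c <: tensor R M N"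
 by (auto simp: tensor_def Let_def FactGroup_def RCOSETS_def)

lemma pure_closed:
 "[|x <: M; y <: N|] ==> pt R M N x y <: tensor R M N"
 unfolding pure_tensor_def by (rule coset_closed) simp

lemma coset_diff:
 assumes "c <: F" "d <: F"
 shows "tensor_null R M N #>\<^bsub>F\<^esub> (c - d) =
  (tensor_null R M N #>\<^bsub>F\<^esub> c) \<ominus>\<^bsub>tensor R M N\<^esub> (tensor_null R M N #>\<^bsub>F\<^esub> d)"
proof -
 interpret T: abelian_group "tensor R M N" by (rule tensor_ab)
 have f: "c - d <: F" using assms keys_diff[of c d] by auto
 show ?thesis using coset_add[OF f assms(2), symmetric] coset_closed[OF f] coset_closed[OF assms(2)]
  by (simp add: a_minus_def T.a_assoc T.r_neg)
qed

private lemma coset_eq: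
 assumes "c <: F" "d <: F" "c - d \<in> tensor_null R M N"
 shows "tensor_null R M N #>\<^bsub>F\<^esub> c = tensor_null R M N #>\<^bsub>F\<^esub> d"
proof -
 have "c = (c - d) *\<^sub>F d" by simp
 then have "c \<in> tensor_null R M N #>\<^bsub>F\<^esub> d" using assms(3) unfolding r_coset_def by blast
 then show ?thesis using group.repr_independence[OF group_free_Abelian_group _ assms(2) null_subgroup] by simp
qed

private lemma relator_null: "c \<in> tensor_relators R M N ==> c \<in> tensor_null R M N"
 unfolding tensor_null_def by (rule generate.incl)

lemma pure_add_l:
 assumes "x <: M" "x' <: M" "y <: N"
 shows "pt R M N (x +\<^sub>M x') y = pt R M N x y +\<^sub>(tensor R M N) pt R M N x' y"
proof -
 interpret M: abelian_group M using MN by (simp add: tpair_def)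
 have "frag_of (x +\<^sub>M x', y) - (frag_of (x, y) + frag_of (x', y)) \<in> tensor_null R M N"
  by (rule relator_null) (use assms in "auto simp: tensor_relators_def diff_diff_eq")
 moreover have "frag_of (x, y) + frag_of (x', y) <: F"
  using assms keys_add[of "frag_of (x, y)" "frag_of (x', y)"] by auto
 ultimately show ?thesis
  using assms by (simp add: pure_tensor_def coset_add del: carrier_free_Abelian_group_iff) (rule coset_eq; simp)
qed

lemma pure_add_r:
 assumes "x <: M" "y <: N" "y' <: N"
 shows "pt R M N x (y +\<^sub>N y') = pt R M N x y +\<^sub>(tensor R M N) pt R M N x y'"
proof -
 interpret N: abelian_group N using MN by (simp add: tpair_def)
 have "frag_of (x, y +\<^sub>N y') - (frag_of (x, y) + frag_of (x, y')) \<in> tensor_null R M N"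
  by (rule relator_null) (use assms in "auto simp: tensor_relators_def diff_diff_eq")
 moreover have "frag_of (x, y) + frag_of (x, y') <: F"
  using assms keys_add[of "frag_of (x, y)" "frag_of (x, y')"] by auto
 ultimately show ?thesis
  using assms by (simp add: pure_tensor_def coset_add del: carrier_free_Abelian_group_iff) (rule coset_eq; simp)
qed

lemma pure_move:
 assumes "r <: R" "x <: M" "y <: N"
 shows "pt R M N (r .\<^sub>M x) y = pt R M N x (r .\<^sub>N y)"
 unfolding pure_tensor_def
 by (rule coset_eq) (use assms MN in "auto simp: tensor_relators_def tpair_def intro!: relator_null")

lemma pure_balanced: "balanced R M N (tensor R M N) (pt R M N)"
 by (rule balancedI) (simp_all add: pure_closed pure_add_l pure_add_r pure_move)

lemma tensor_coset_hom:
 "group_hom F (add_monoid (tensor R M N)) (%c. tensor_null R M N #>\<^bsub>F\<^esub> c)"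
 by (intro group_hom.intro group_hom_axioms.intro abelian_group.a_group[OF tensor_ab] homI)
   (simp_all add: coset_closed coset_add del: carrier_free_Abelian_group_iff)

lemma tensor_coset_zero:
 assumes c: "c <: F"
 shows "tensor_null R M N #>\<^bsub>F\<^esub> c = 0\<^sub>(tensor R M N) \<longleftrightarrow> c \<in> tensor_null R M N"
proof -
 have z: "0\<^sub>(tensor R M N) = tensor_null R M N"
  by (simp add: tensor_def Let_def FactGroup_def)
 have "c \<in> tensor_null R M N #>\<^bsub>F\<^esub> c"
  by (rule group.rcos_self[OF group_free_Abelian_group c null_subgroup])
 then show ?thesis
  using group.coset_join2[OF group_free_Abelian_group c null_subgroup] by (auto simp only: z)
qed

private lemma rep:
 assumes "u <: tensor R M N"
 shows "(SOME c. c \<in> u) <: F" "u = tensor_null R M N #>\<^bsub>F\<^esub> (SOME c. c \<in> u)"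
proof -
 obtain c where c: "c <: F" "u = tensor_null R M N #>\<^bsub>F\<^esub> c" using assms by (rule tensorE)
 have "c \<in> u" using group.rcos_self[OF group_free_Abelian_group c(1) null_subgroup] c(2) by simp
 then have s: "(SOME c. c \<in> u) \<in> u" by (rule someI)
 moreover have "u \<subseteq> carrier F"
  unfolding c(2)
  by (rule monoid.r_coset_subset_G[OF group.is_monoid[OF group_free_Abelian_group] subgroup.subset[OF null_subgroup] c(1)])
 ultimately show "(SOME c. c \<in> u) <: F" by blast
 show "u = tensor_null R M N #>\<^bsub>F\<^esub> (SOME c. c \<in> u)"
  using group.repr_independence[OF group_free_Abelian_group s[unfolded c(2)] c(1) null_subgroup] c(2) by simp
qed

lemma keysD:
 assumes "u <: tensor R M N" "z \<in> Poly_Mapping.keys (SOME c. c \<in> u)"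
 shows "fst z <: M" "snd z <: N"
 using rep(1)[OF assms(1)] assms(2) by auto

lemma lift_closed:
 assumes "abgrp P" "u <: tensor R M N"
  and "!!x y. [|x <: M; y <: N|] ==> \<phi> x y <: P"
 shows "tsum P \<phi> u <: P"
proof -
 interpret P: abelian_group P by (rule assms)
 show ?thesis unfolding tens_lift_finsum
  using keysD[OF assms(2)] assms(3) by (auto intro!: P.finsum_closed)
qed

lemma lift_cong:
 assumes u: "u <: tensor R M N" and e: "!!x y. [|x <: M; y <: N|] ==> \<phi> x y = g x y"
 shows "tsum P \<phi> u = tsum P g u"
 unfolding tens_lift_finsum by (rule finsum_eq_if_eq) (simp add: e[OF keysD[OF u]])

lemma lift_hom:
 assumes "abgrp P" "abgrp Q" "h \<in> Hom P Q" "u <: tensor R M N"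
  and "!!x y. [|x <: M; y <: N|] ==> \<phi> x y <: P"
 shows "h (tsum P \<phi> u) = tsum Q (%x y. h (\<phi> x y)) u"
proof -
 interpret P: abelian_group P by (rule assms)
 interpret Q: abelian_group Q by (rule assms)
 note k = keysD[OF assms(4)]
 show ?thesis unfolding tens_lift_finsum
  apply (subst Hom_finsum[OF assms(1-3)])
  using k assms(5) apply (auto simp: Pi_iff)[2]
  apply (rule Q.add.finprod_cong')
  using k assms(5) by (auto simp: Hom_closed[OF assms(3)] Hom_int_pow[OF assms(1-3)])
qed

lemma lift_map:
 assumes "abgrp P" "abgrp Q" "h \<in> Hom P Q" "u <: tensor R M N"
  and "!!x y. [|x <: M; y <: N|] ==> \<phi> x y <: P" and "!!x y. [|x <: M; y <: N|] ==> h (\<phi> x y) = g x y"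
 shows "h (tsum P \<phi> u) = tsum Q g u"
 by (rule trans[OF lift_hom[OF assms(1-5)] lift_cong[OF assms(4)]]) (simp_all add: assms(6))

lemma lift_plus:
 assumes "abgrp P" "u <: tensor R M N"
  and "!!x y. [|x <: M; y <: N|] ==> \<phi> x y <: P"
  and "!!x y. [|x <: M; y <: N|] ==> g x y <: P"
 shows "tsum P (%x y. \<phi> x y +\<^sub>P g x y) u = tsum P \<phi> u +\<^sub>P tsum P g u"
proof -
 interpret P: abelian_group P by (rule assms)
 note k = keysD[OF assms(2)]
 have d: "[k] \<cdot>\<^bsub>P\<^esub> (a +\<^sub>P b) = [k] \<cdot>\<^bsub>P\<^esub> a +\<^sub>P [k] \<cdot>\<^bsub>P\<^esub> b"
  if "a <: P" "b <: P" for a b and k :: int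
  using that P.add.int_pow_distrib by (simp add: add_pow_def)
 have "tsum P (%x y. \<phi> x y +\<^sub>P g x y) u =
   (\<Oplus>\<^bsub>P\<^esub>z\<in>Poly_Mapping.keys (SOME c. c \<in> u).
    ([Poly_Mapping.lookup (SOME c. c \<in> u) z] \<cdot>\<^bsub>P\<^esub> \<phi> (fst z) (snd z)) +\<^sub>P
    ([Poly_Mapping.lookup (SOME c. c \<in> u) z] \<cdot>\<^bsub>P\<^esub> g (fst z) (snd z)))"
  unfolding tens_lift_finsum
  by (rule P.add.finprod_cong') (use k assms(3,4) d in auto)
 also have "... = tsum P \<phi> u +\<^sub>P tsum P g u"
  unfolding tens_lift_finsum by (rule P.finsum_addf) (use k assms(3,4) in auto)
 finally show ?thesis .
qed

context
 fixes P :: "('p, 'w) ring_scheme" and \<phi>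
 assumes P: "abgrp P" and \<phi>: "balanced R M N P \<phi>"
begin

private definition ev :: "('m \<times> 'n \<Rightarrow>\<^sub>0 int) \<Rightarrow> 'p" where
 "ev c = (\<Oplus>\<^bsub>P\<^esub>z\<in>Poly_Mapping.keys c. [Poly_Mapping.lookup c z] \<cdot>\<^bsub>P\<^esub> \<phi> (fst z) (snd z))"

private lemma \<phi>_closed: "z \<in> carrier M \<times> carrier N ==> \<phi> (fst z) (snd z) <: P"
 using \<phi> unfolding balanced_def by fastforce

private lemma ev_superset:
 assumes "Poly_Mapping.keys c \<subseteq> T" "finite T" "T \<subseteq> carrier M \<times> carrier N"
 shows "ev c = (\<Oplus>\<^bsub>P\<^esub>z\<in>T. [Poly_Mapping.lookup c z] \<cdot>\<^bsub>P\<^esub> \<phi> (fst z) (snd z))"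
proof -
 interpret P: abelian_group P by (rule P)
 have z: "[(0::int)] \<cdot>\<^bsub>P\<^esub> a = 0\<^sub>P" for a by (simp add: add_pow_def int_pow_def2)
 show ?thesis unfolding ev_def
  by (rule P.add.finprod_mono_neutral_cong_left)
    (use assms \<phi>_closed in "auto simp: in_keys_iff z")
qed

private lemma ev_hom: "ev \<in> hom F (add_monoid P)"
proof (rule homI)
 interpret P: abelian_group P by (rule P)
 show "ev c <: add_monoid P" if "c <: F" for c
  unfolding ev_def using that \<phi>_closed by (auto intro!: P.finsum_closed)
 fix c d assume cd: "c <: F" "d <: F"
 let ?T = "Poly_Mapping.keys c \<union> Poly_Mapping.keys d"
 have T: "?T \<subseteq> carrier M \<times> carrier N" "finite ?T" using cd by auto
 have "ev (c + d) = (\<Oplus>\<^bsub>P\<^esub>z\<in>?T. [Poly_Mapping.lookup c z] \<cdot>\<^bsub>P\<^esub> \<phi> (fst z) (snd z) +\<^sub>P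
    [Poly_Mapping.lookup d z] \<cdot>\<^bsub>P\<^esub> \<phi> (fst z) (snd z))"
  unfolding ev_superset[OF keys_add T(2,1)]
  by (rule P.add.finprod_cong')
    (use T \<phi>_closed in "auto simp: lookup_add P.add.int_pow_mult Pi_iff")
 also have "... = ev c +\<^sub>P ev d"
  using T \<phi>_closed by (subst P.finsum_addf) (auto simp: ev_superset[OF _ T(2,1)])
 finally show "ev (c *\<^sub>F d) = ev c *\<^sub>(add_monoid P) ev d" by simp
qed

private lemma ev_group_hom: "group_hom F (add_monoid P) ev"
 by (intro group_hom.intro group_hom_axioms.intro ev_hom abelian_group.a_group[OF P]) simp

private lemma ev_add: "[|c <: F; d <: F|] ==> ev (c + d) = ev c +\<^sub>P ev d"
 using hom_mult[OF ev_hom] by simp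

private lemma ev_closed: "c <: F ==> ev c <: P"
 using group_hom.hom_closed[OF ev_group_hom] by simp

private lemma ev_frag: "[|x <: M; y <: N|] ==> ev (frag_of (x, y)) = \<phi> x y"
proof -
 interpret P: abelian_group P by (rule P)
 assume "x <: M" "y <: N"
 then show ?thesis using \<phi>_closed[of "(x, y)"] by (simp add: ev_def P.add.int_pow_1)
qed

private lemma ev_diff0:
 assumes "c <: F" "d <: F" "ev c = ev d" shows "ev (c - d) = 0\<^sub>P"
proof -
 interpret P: abelian_group P by (rule P)
 have f: "c - d <: F" using assms keys_diff[of c d] by auto
 have "ev d = ev (c - d) +\<^sub>P ev d" using ev_add[OF f assms(2)] assms(3) by simp
 then show ?thesis using ev_closed[OF f] ev_closed[OF assms(2)] by (metis P.add.r_cancel_one')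
qed

private lemma ev_null: "c \<in> tensor_null R M N ==> ev c = 0\<^sub>P"
proof -
 interpret M: abelian_group M using MN by (simp add: tpair_def)
 interpret N: abelian_group N using MN by (simp add: tpair_def)
 have fr: "frag_of (x, y) <: F" if "x <: M" "y <: N" for x y
  using that by simp
 have ad: "a + b <: F" if "a <: F" "b <: F" for a b
  using that keys_add[of a b] by auto
 have "tensor_relators R M N \<subseteq> kernel F (add_monoid P) ev"
 proof
  fix c assume c: "c \<in> tensor_relators R M N"
  then have "ev c = 0\<^sub>P"
   using \<phi> MN unfolding tensor_relators_def tpair_def balanced_def
   by (auto simp: ev_add ev_frag diff_diff_eq simp del: carrier_free_Abelian_group_iff intro!: ev_diff0 fr ad)
  moreover have "c <: F" using relators_closed c by blast
  ultimately show "c \<in> kernel F (add_monoid P) ev" by (simp add: kernel_def)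
 qed
 then have "tensor_null R M N \<subseteq> kernel F (add_monoid P) ev"
  unfolding tensor_null_def
  by (rule group.generate_subgroup_incl[OF group_free_Abelian_group _ group_hom.subgroup_kernel[OF ev_group_hom]])
 then show "ev c = 0\<^sub>P" if "c \<in> tensor_null R M N" using that by (auto simp: kernel_def)
qed

private lemma lift_coset: "c <: F ==> tsum P \<phi> (tensor_null R M N #>\<^bsub>F\<^esub> c) = ev c"
proof -
 interpret P: abelian_group P by (rule P)
 assume c: "c <: F"
 define u where "u = tensor_null R M N #>\<^bsub>F\<^esub> c"
 define d where "d = (SOME d. d \<in> u)"
 have u: "u <: tensor R M N" unfolding u_def using c by (rule coset_closed)
 have d: "d <: F" "u = tensor_null R M N #>\<^bsub>F\<^esub> d" using rep[OF u] by (simp_all add: d_def)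
 have "c \<in> tensor_null R M N #>\<^bsub>F\<^esub> d"
  using group.rcos_self[OF group_free_Abelian_group c null_subgroup] d(2) by (simp add: u_def)
 then obtain n where n: "n \<in> tensor_null R M N" "c = n + d" by (auto simp: r_coset_def)
 have "n <: F" using n(1) null_subgroup subgroup.subset by blast
 then have "ev c = ev d" using ev_add[of n d] d(1) ev_null[OF n(1)] ev_closed[OF d(1)] n(2) by simp
 moreover have "tsum P \<phi> u = ev d" by (simp only: tens_lift_finsum ev_def d_def)
 ultimately show ?thesis by (simp only: u_def)
qed

text \<open>The universal property: a balanced map kills the relators, so every representative of a tensor
  gives the same sum.\<close>

lemma lift_pure:
 "[|x <: M; y <: N|] ==> tsum P \<phi> (pt R M N x y) = \<phi> x y"
 by (simp add: pure_tensor_def lift_coset ev_frag)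

lemma lift_Hom: "tsum P \<phi> \<in> Hom (tensor R M N) P"
proof (rule HomI)
 fix u v assume u: "u <: tensor R M N" and v: "v <: tensor R M N"
 obtain c where c: "c <: F" "u = tensor_null R M N #>\<^bsub>F\<^esub> c" using u by (rule tensorE)
 obtain d where d: "d <: F" "v = tensor_null R M N #>\<^bsub>F\<^esub> d" using v by (rule tensorE)
 have cd: "c + d <: F" using c(1) d(1) keys_add[of c d] by auto
 show "tsum P \<phi> (u +\<^sub>(tensor R M N) v) = tsum P \<phi> u +\<^sub>P tsum P \<phi> v"
  unfolding c(2) d(2) coset_add[OF c(1) d(1)] lift_coset[OF c(1)] lift_coset[OF d(1)] lift_coset[OF cd]
  by (rule ev_add[OF c(1) d(1)])
 show "tsum P \<phi> u <: P" if "u <: tensor R M N" for u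
  by (rule lift_closed[OF P that]) (use \<phi> in "simp add: balanced_def")
qed

end

lemma lift_id:
 assumes u: "u <: tensor R M N"
 shows "tsum (tensor R M N) (pt R M N) u = u"
proof -
 let ?q = "%c. tensor_null R M N #>\<^bsub>F\<^esub> c"
 have gh: "group_hom F (add_monoid (tensor R M N)) ?q" by (rule tensor_coset_hom)
 let ?L = "tsum (tensor R M N) (pt R M N)"
 have L: "?L \<in> Hom (tensor R M N) (tensor R M N)"
  by (rule lift_Hom[OF tensor_ab pure_balanced])
 have l: "c <: F \<and> ?L (?q c) = ?q c" if "Poly_Mapping.keys c \<subseteq> carrier M \<times> carrier N" for c
  using that
 proof (induction c rule: frag_induction)
  case zero
  have "?q 0 = 0\<^sub>(tensor R M N)" using group_hom.hom_one[OF gh] by simp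
  then show ?case using Hom_zero[OF tensor_ab tensor_ab L] by simp
 next
  case (one x)
  have "?q (frag_of x) = pt R M N (fst x) (snd x)" by (simp add: pure_tensor_def)
  moreover have "?L (pt R M N (fst x) (snd x)) = pt R M N (fst x) (snd x)"
   by (rule lift_pure[OF tensor_ab pure_balanced]) (use one in auto)
  moreover have "frag_of x <: F" using one by auto
  ultimately show ?case by (simp only:)
 next
  case (diff a b)
  then have "a - b <: F" using keys_diff[of a b] by auto
  then show ?case using diff Hom_minus[OF tensor_ab tensor_ab L] coset_closed
   by (simp add: coset_diff del: carrier_free_Abelian_group_iff)
 qed
 have "Poly_Mapping.keys (SOME c. c \<in> u) \<subseteq> carrier M \<times> carrier N" using rep(1)[OF u] by simp
 from l[OF this] show ?thesis by (simp only: rep(2)[OF u, symmetric])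
qed

lemma lift_zero:
 assumes "abgrp P" "u <: tensor R M N"
 shows "tsum P (%x y. 0\<^sub>P) u = 0\<^sub>P"
proof -
 interpret P: abelian_group P by (rule assms)
 show ?thesis unfolding tens_lift_finsum by (rule P.add.finprod_one_eqI) (use P.add.int_pow_one in "simp add: add_pow_def")
qed

lemma tensor_ext:
 assumes Q: "abgrp Q" and f: "f \<in> Hom (tensor R M N) Q" and g: "g \<in> Hom (tensor R M N) Q"
  and eq: "!!x y. [|x <: M; y <: N|] ==> f (pt R M N x y) = g (pt R M N x y)"
  and u: "u <: tensor R M N"
 shows "f u = g u"
proof -
 have "f u = tsum Q (%x y. f (pt R M N x y)) u"
  by (subst lift_id[OF u, symmetric]) (rule lift_hom[OF tensor_ab Q f u pure_closed])
 also have "... = tsum Q (%x y. g (pt R M N x y)) u"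
  by (rule lift_cong[OF u eq])
 also have "... = g u"
  by (subst (2) lift_id[OF u, symmetric]) (rule lift_hom[OF tensor_ab Q g u pure_closed, symmetric])
 finally show ?thesis .
qed

lemma tensor_Hom_lift:
 assumes "abgrp Q" "f \<in> Hom (tensor R M N) Q" "u <: tensor R M N"
 shows "f u = tsum Q (%x y. f (pt R M N x y)) u"
 by (subst lift_id[OF assms(3), symmetric]) (rule lift_hom[OF tensor_ab assms pure_closed])

lemma tensor_pure_zero:
 assumes "x <: M" "y <: N"
 shows "pt R M N 0\<^sub>M y = 0\<^sub>(tensor R M N)" "pt R M N x 0\<^sub>N = 0\<^sub>(tensor R M N)"
proof -
 have M: "abgrp M" and N: "abgrp N" using MN by (auto simp: tpair_def)
 show "pt R M N 0\<^sub>M y = 0\<^sub>(tensor R M N)"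
  by (rule Hom_zero[OF M tensor_ab, of "%x. pt R M N x y"])
    (use assms in "auto intro!: HomI pure_closed pure_add_l")
 show "pt R M N x 0\<^sub>N = 0\<^sub>(tensor R M N)"
  by (rule Hom_zero[OF N tensor_ab, of "%y. pt R M N x y"])
    (use assms in "auto intro!: HomI pure_closed pure_add_r")
qed

text \<open>Negatives are pure tensors again, so closure under sums is enough for an induction.\<close>

lemma tensor_induct [consumes 1, case_names pure add]:
 assumes u: "u <: tensor R M N"
  and pure: "!!x y. [|x <: M; y <: N|] ==> Q (pt R M N x y)"
  and add: "!!u v. [|u <: tensor R M N; v <: tensor R M N; Q u; Q v|] ==>
   Q (u +\<^sub>(tensor R M N) v)"
 shows "Q u"
proof -
 interpret M: abelian_group M using MN by (simp add: tpair_def)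
 interpret N: abelian_group N using MN by (simp add: tpair_def)
 interpret T: abelian_group "tensor R M N" by (rule tensor_ab)
 have zero: "Q 0\<^sub>(tensor R M N)"
  using pure[of "0\<^sub>M" "0\<^sub>N"] tensor_pure_zero(1)[of "0\<^sub>M" "0\<^sub>N"] by simp
 have neg: "\<ominus>\<^bsub>tensor R M N\<^esub> pt R M N x y = pt R M N (\<ominus>\<^bsub>M\<^esub> x) y"
  if "x <: M" "y <: N" for x y
  by (rule Hom_neg[OF M.abelian_group_axioms tensor_ab, of "%x. pt R M N x y", symmetric])
    (use that in "auto intro!: HomI pure_closed pure_add_l")
 have pow: "Q ([k] \<cdot>\<^bsub>tensor R M N\<^esub> pt R M N x y) \<and> Q ([(- k)] \<cdot>\<^bsub>tensor R M N\<^esub> pt R M N x y)"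
  if xy: "x <: M" "y <: N" and k: "k \<ge> 0" for x y and k :: int
  using k
 proof (induction k rule: int_ge_induct)
  case base then show ?case using zero by (simp add: add_pow_def int_pow_def2)
 next
  case (step k)
  let ?p = "pt R M N x y"
  have p: "?p <: tensor R M N" using xy by (rule pure_closed)
  have "[(k + 1)] \<cdot>\<^bsub>tensor R M N\<^esub> ?p = [k] \<cdot>\<^bsub>tensor R M N\<^esub> ?p +\<^sub>(tensor R M N) ?p"
   by (simp add: T.add.int_pow_mult[OF p] T.add.int_pow_1[OF p])
  moreover have "[(- (k + 1))] \<cdot>\<^bsub>tensor R M N\<^esub> ?p =
    [(- k)] \<cdot>\<^bsub>tensor R M N\<^esub> ?p +\<^sub>(tensor R M N) pt R M N (\<ominus>\<^bsub>M\<^esub> x) y"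
   unfolding neg[OF xy, symmetric]
   using T.add.int_pow_mult[OF p, of "- k" "- 1"] T.add.int_pow_neg[OF p, of 1] by (simp add: T.add.int_pow_1[OF p])
  ultimately show ?case using step p xy by (auto intro!: add pure pure_closed T.add.int_pow_closed)
 qed
 let ?c = "SOME c. c \<in> u"
 have kz: "Q ([k] \<cdot>\<^bsub>tensor R M N\<^esub> pt R M N x y)"
  if "x <: M" "y <: N" for x y and k :: int
  using pow[OF that, of k] pow[OF that, of "- k"] by (cases "k \<ge> 0") auto
 have "Q (\<Oplus>\<^bsub>tensor R M N\<^esub>z\<in>T. [Poly_Mapping.lookup ?c z] \<cdot>\<^bsub>tensor R M N\<^esub> pt R M N (fst z) (snd z))"
  if "finite T" "T \<subseteq> Poly_Mapping.keys ?c" for T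
  using that
 proof (induction T)
  case empty then show ?case using zero by simp
 next
  case (insert z T)
  have "fst z <: M" "snd z <: N" using keysD[OF u] insert.prems by blast+
  moreover have "fst w <: M" "snd w <: N" if "w \<in> T" for w
   using keysD[OF u] insert.prems that by blast+
  ultimately have *: "pt R M N (fst w) (snd w) <: tensor R M N" "Q ([k] \<cdot>\<^bsub>tensor R M N\<^esub> pt R M N (fst w) (snd w))"
   if "w = z \<or> w \<in> T" for w and k :: int
   using that kz pure_closed by blast+
  have pi: "(%w. [Poly_Mapping.lookup ?c w] \<cdot>\<^bsub>tensor R M N\<^esub> pt R M N (fst w) (snd w)) \<in> T \<rightarrow> carrier (tensor R M N)"
   using *(1) by (intro Pi_I T.add.int_pow_closed) blast
  show ?case
   using insert pi *[of z] by (simp add: T.finsum_insert[OF _ _ pi] add T.finsum_closed[OF pi] T.add.int_pow_closed)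
 qed
 from this[of "Poly_Mapping.keys ?c"] show ?thesis
  using lift_id[OF u] unfolding tens_lift_finsum by simp
qed

end

text \<open>Fubini for the finite sums behind \<open>u\<close> and \<open>v\<close>.\<close>

lemma lift_swap:
 fixes R :: "('r, 'x) ring_scheme" and M :: "('r, 'm, 'y) module_scheme" and N :: "('r, 'n, 'z) module_scheme"
  and R' :: "('s, 'x1) ring_scheme" and M' :: "('s, 'm1, 'y1) module_scheme" and N' :: "('s, 'n1, 'z1) module_scheme"
 assumes MN: "tpair R M N" and MN': "tpair R' M' N'" and P: "abgrp P"
  and u: "u <: tensor R M N" and v: "v <: tensor R' M' N'"
  and \<phi>: "!!x y x' y'. [|x <: M; y <: N; x' <: M'; y' <: N'|] ==>
   \<phi> x y x' y' <: P"
 shows "tsum P (%x y. tsum P (%x' y'. \<phi> x y x' y') v) u =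
  tsum P (%x' y'. tsum P (%x y. \<phi> x y x' y') u) v"
proof -
 let ?S = "%w. tsum P (%x y. tsum P (%x' y'. \<phi> x y x' y') v) w"
 interpret P: abelian_group P by (rule P)
 have pw: "(%a. [k] \<cdot>\<^bsub>P\<^esub> a) \<in> Hom P P" for k :: int
  by (rule HomI) (use P.add.int_pow_distrib P.add.int_pow_closed in "auto simp: add_pow_def")
 let ?c = "SOME c. c \<in> u"
 have keys: "fst z <: M" "snd z <: N" if "z \<in> Poly_Mapping.keys ?c" for z
  using keysD[OF MN u that] by simp_all
 have "(\<Oplus>\<^bsub>P\<^esub>z\<in>T. [k z] \<cdot>\<^bsub>P\<^esub> tsum P (%x' y'. \<phi> (fst z) (snd z) x' y') v) =
   tsum P (%x' y'. \<Oplus>\<^bsub>P\<^esub>z\<in>T. [k z] \<cdot>\<^bsub>P\<^esub> \<phi> (fst z) (snd z) x' y') v"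
  if "finite T" "T \<subseteq> Poly_Mapping.keys ?c" for T and k :: "'m \<times> 'n \<Rightarrow> int"
  using that
 proof (induction T)
  case empty then show ?case using lift_zero[OF MN' P v] by simp
 next
  case (insert z T)
  have m: "fst w <: M" "snd w <: N" if "w \<in> insert z T" for w
   using keys insert.prems that by blast+
  have mz: "fst z <: M" "snd z <: N" using m by blast+
  let ?f = "%w x' y'. [k w] \<cdot>\<^bsub>P\<^esub> \<phi> (fst w) (snd w) x' y'"
  have c: "?f w x' y' <: P" if "w \<in> insert z T" "x' <: M'" "y' <: N'" for w x' y'
   using \<phi> m that by simp
  have lc: "[k w] \<cdot>\<^bsub>P\<^esub> tsum P (\<phi> (fst w) (snd w)) v <: P" if "w \<in> insert z T" for w
   using m[OF that] by (intro P.add.int_pow_closed lift_closed[OF MN' P v] \<phi>) simp_all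
  then have pi: "(%w. [k w] \<cdot>\<^bsub>P\<^esub> tsum P (\<phi> (fst w) (snd w)) v) \<in> T \<rightarrow> carrier P" by blast
  have "(\<Oplus>\<^bsub>P\<^esub>w\<in>insert z T. [k w] \<cdot>\<^bsub>P\<^esub> tsum P (%x' y'. \<phi> (fst w) (snd w) x' y') v) =
    [k z] \<cdot>\<^bsub>P\<^esub> tsum P (%x' y'. \<phi> (fst z) (snd z) x' y') v +\<^sub>P
    tsum P (%x' y'. \<Oplus>\<^bsub>P\<^esub>w\<in>T. ?f w x' y') v"
   using insert lc[of z] by (subst P.finsum_insert[OF _ _ pi]) simp_all
  also have "[k z] \<cdot>\<^bsub>P\<^esub> tsum P (%x' y'. \<phi> (fst z) (snd z) x' y') v = tsum P (?f z) v"
   by (rule lift_hom[OF MN' P P pw v]) (use m \<phi> in auto)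
  also have "... +\<^sub>P tsum P (%x' y'. \<Oplus>\<^bsub>P\<^esub>w\<in>T. ?f w x' y') v =
    tsum P (%x' y'. ?f z x' y' +\<^sub>P (\<Oplus>\<^bsub>P\<^esub>w\<in>T. ?f w x' y')) v"
   by (rule lift_plus[OF MN' P v, symmetric]) (use c in "auto intro!: P.finsum_closed")
  also have "... = tsum P (%x' y'. \<Oplus>\<^bsub>P\<^esub>w\<in>insert z T. ?f w x' y') v"
   by (rule lift_cong[OF MN' v])
     (use c insert in "auto intro!: P.finsum_closed P.finsum_insert[symmetric]")
  finally show ?case .
 qed
 from this[OF finite_keys subset_refl] show ?thesis unfolding tens_lift_finsum[of P _ u] by simp
qed

lemma with_action_simps [simp]:
 "carrier (with_action M act) = carrier M" "0\<^sub>(with_action M act) = 0\<^sub>M"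
 "1\<^sub>(with_action M act) = 1\<^sub>M" "monoid.mult (with_action M act) = monoid.mult M"
 "add (with_action M act) = add M" "smult (with_action M act) = act"
 by (simp_all add: with_action_def)

lemma opp_simps [simp]:
 "carrier (opp R) = carrier R" "0\<^sub>(opp R) = 0\<^sub>R" "1\<^sub>(opp R) = 1\<^sub>R"
 "monoid.mult (opp R) = (%x y. y \<otimes>\<^bsub>R\<^esub> x)" "add (opp R) = add R" "smult (opp X) = smult X"
 by (simp_all add: opp_def)

lemma abelian_group_cong:
 assumes "carrier X = carrier Y" "add X = add Y" "0\<^sub>X = 0\<^sub>Y"
 shows "abgrp X = abgrp Y"
proof
 show "abgrp Y" if "abgrp X"
  by (rule abelian_groupI) (use assms abelian_groupE[OF that] in auto)
 show "abgrp X" if "abgrp Y"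
  by (rule abelian_groupI) (use assms abelian_groupE[OF that] in auto)
qed

lemma int_pow_cong:
 assumes "carrier G = carrier G'" "monoid.mult G = monoid.mult G'" "1\<^sub>G = 1\<^sub>G'"
 shows "x [^]\<^bsub>G\<^esub> (k::int) = x [^]\<^bsub>G'\<^esub> k"
proof -
 have "m_inv G = m_inv G'" using assms by (intro ext) (simp add: m_inv_def)
 then show ?thesis using assms by (simp add: int_pow_def nat_pow_def Let_def)
qed

lemma tens_lift_target_cong:
 assumes "carrier X = carrier Y" "add X = add Y" "0\<^sub>X = 0\<^sub>Y"
 shows "tsum X = tsum Y"
proof (intro ext)
 fix f u
 have "[k] \<cdot>\<^bsub>X\<^esub> a = [k] \<cdot>\<^bsub>Y\<^esub> a" for k :: int and a
  unfolding add_pow_def by (rule int_pow_cong) (use assms in simp_all)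
 then show "tsum X f u = tsum Y f u"
  using assms by (simp add: tens_lift_finsum finsum_def finprod_def)
qed

lemma abelian_group_with_action [simp]: "abgrp (with_action M act) = abgrp M"
 by (rule abelian_group_cong) simp_all

lemma tens_lift_with_action [simp]: "tsum (with_action M act) = tsum M"
 by (rule tens_lift_target_cong) simp_all

lemma abelian_group_opp [simp]: "abgrp (opp M) = abgrp M"
 by (rule abelian_group_cong) simp_all

lemma lmod_ab: "lmod R M ==> abgrp M"
 by (simp add: left_module_def)

lemma lmod_tpair: "[|lmod R M; lmod R' N; carrier R' = carrier R|] ==> tpair R M N"
 by (auto simp: tpair_def lmod_ab left_module.smult_closed)

text \<open>For an action on a tensor product by additive maps, the module axioms can be checked on pure tensors.\<close>

lemma tensor_left_module:
 assumes MN: "tpair R M N" and S: "ring S"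
  and X: "carrier X = carrier (tensor R M N)" "add X = add (tensor R M N)" "0\<^sub>X = 0\<^sub>(tensor R M N)"
  and h: "!!a. a <: S ==> smult X a \<in> Hom (tensor R M N) (tensor R M N)"
  and p: "!!a b x y. [|a <: S; b <: S; x <: M; y <: N|] ==>
   (a +\<^sub>S b) .\<^sub>X pt R M N x y = a .\<^sub>X pt R M N x y +\<^sub>(tensor R M N) b .\<^sub>X pt R M N x y"
   "!!a b x y. [|a <: S; b <: S; x <: M; y <: N|] ==> (a *\<^sub>S b) .\<^sub>X pt R M N x y = a .\<^sub>X (b .\<^sub>X pt R M N x y)"
   "!!x y. [|x <: M; y <: N|] ==> 1\<^sub>S .\<^sub>X pt R M N x y = pt R M N x y"
 shows "lmod S X"
proof -
 interpret T: abelian_group "tensor R M N" by (rule tensor_ab[OF MN])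
 interpret S: ring S by (rule S)
 note t = T.abelian_group_axioms
 show ?thesis
 proof (intro left_module.intro left_module_axioms.intro S)
  show "abgrp X" by (subst abelian_group_cong[of _ "tensor R M N"]) (simp_all add: X t)
  fix a b x y assume a: "a <: S" and x: "x <: X"
  show "a .\<^sub>X x <: X" using Hom_closed[OF h[OF a]] x by (simp add: X)
  show "a .\<^sub>X (x +\<^sub>X y) = a .\<^sub>X x +\<^sub>X a .\<^sub>X y" if "y <: X" using Hom_add[OF h[OF a]] x that by (simp add: X)
  { assume b: "b <: S"
   have "(%x. a .\<^sub>X x +\<^sub>(tensor R M N) b .\<^sub>X x) \<in> Hom (tensor R M N) (tensor R M N)"
    by (rule HomI) (use Hom_closed[OF h] a b in "simp_all add: Hom_add[OF h] T.a_ac")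
   from tensor_ext[OF MN t h[OF S.a_closed[OF a b]] this p(1)[OF a b]]
   show "(a +\<^sub>S b) .\<^sub>X x = a .\<^sub>X x +\<^sub>X b .\<^sub>X x" using x by (simp add: X)
   from tensor_ext[OF MN t h[OF S.m_closed[OF a b]] Hom_comp[OF h[OF b] h[OF a]] p(2)[OF a b]]
   show "(a *\<^sub>S b) .\<^sub>X x = a .\<^sub>X (b .\<^sub>X x)" using x by (simp add: X) }
 next
  show "1\<^sub>S .\<^sub>X x = x" if x: "x <: X" for x
   using tensor_ext[OF MN t h[OF S.one_closed] Hom_id p(3)] x by (simp add: X)
 qed
qed

lemma lift_Hom_param:
 assumes "tpair R M N" "abgrp P" "u <: tensor R M N"
  and "!!y z. [|y <: M; z <: N|] ==> (%x. f x y z) \<in> Hom X P"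
 shows "(%x. tsum P (f x) u) \<in> Hom X P"
proof (rule HomI)
 note c = Hom_closed[OF assms(4)] and a = Hom_add[OF assms(4)]
 show "tsum P (f x) u <: P" if "x <: X" for x
  by (rule lift_closed[OF assms(1-3)]) (use c that in auto)
 fix x x' assume x: "x <: X" "x' <: X"
 have "tsum P (f (x +\<^sub>X x')) u = tsum P (%y z. f x y z +\<^sub>P f x' y z) u" (is "?a = _")
  by (rule lift_cong[OF assms(1,3), symmetric])
    (use a c x abelian_groupE(1)[OF assms(2)] in simp_all)
 also have "... = tsum P (f x) u +\<^sub>P tsum P (f x') u"
  by (rule lift_plus[OF assms(1-3)]) (use c x in auto)
 finally show "?a = ..." .
qed

section \<open>Multilinear maps over a commutative ring\<close>

lemma smult_Hom: "[|lmod K P; c <: K|] ==> (%x. c .\<^sub>P x) \<in> Hom P P"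
 by (auto intro!: HomI simp: left_module.smult_closed left_module.smult_r_distr)

lemma lin_lift_param:
 assumes "tpair R M N" "lmod K P" "u <: tensor R M N"
  and "!!y z. [|y <: M; z <: N|] ==> (%x. f x y z) \<in> lhom K X P"
 shows "(%x. tsum P (f x) u) \<in> lhom K X P"
proof (rule linI)
 note P = lmod_ab[OF assms(2)]
 show "(%x. tsum P (f x) u) \<in> Hom X P"
  by (rule lift_Hom_param[OF assms(1) P assms(3)]) (rule lin_Hom[OF assms(4)])
 fix a x assume a: "a <: K" "x <: X"
 have "tsum P (f (a .\<^sub>X x)) u = tsum P (%y z. a .\<^sub>P f x y z) u" (is "?a = _")
  by (rule lift_cong[OF assms(1) assms(3), symmetric])
    (use a lin_closed[OF assms(4)] lin_smult[OF assms(4)] left_module.smult_closed[OF assms(2)] in simp_all)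
 also have "... = a .\<^sub>P tsum P (f x) u"
  by (rule lift_hom[OF assms(1) P P smult_Hom[OF assms(2) a(1)] assms(3), symmetric])
    (use lin_closed[OF assms(4)] a in auto)
 finally show "?a = ..." .
qed

lemma lin_id: "(%x. x) \<in> lhom K X X"
 by (auto simp: lmod_hom_def)

lemma lin_comp: "[|g \<in> lhom K Y Z; f \<in> lhom K X Y|] ==> (%x. g (f x)) \<in> lhom K X Z"
 by (auto simp: lmod_hom_def Pi_iff)

lemma lin_cong:
 assumes "f \<in> lhom K X Y" "lmod K X" "!!x. x <: X ==> f x = g x"
 shows "g \<in> lhom K X Y"
 using assms abelian_groupE(1)[OF lmod_ab[OF assms(2)]] left_module.smult_closed[OF assms(2)]
 by (auto simp: lmod_hom_def Pi_iff)

definition bilin :: "('k, 'c) ring_scheme \<Rightarrow> ('k, 'm, 'x) module_scheme \<Rightarrow> ('k, 'n, 'y) module_scheme \<Rightarrow>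
  ('k, 'p, 'z) module_scheme \<Rightarrow> ('m \<Rightarrow> 'n \<Rightarrow> 'p) \<Rightarrow> bool" where
 "bilin K X Y P \<phi> \<longleftrightarrow> (\<forall>x\<in>carrier X. (%y. \<phi> x y) \<in> lhom K Y P) \<and>
   (\<forall>y\<in>carrier Y. (%x. \<phi> x y) \<in> lhom K X P)"

lemma bilinI:
 assumes "!!x. x <: X ==> (%y. f x y) \<in> lhom K Y P"
  and "!!y. y <: Y ==> (%x. f x y) \<in> lhom K X P"
 shows "bilin K X Y P f"
 using assms by (auto simp: bilin_def)

lemma bilin_closed: "[|bilin K X Y P f; x <: X; y <: Y|] ==> f x y <: P"
 by (auto simp: bilin_def lmod_hom_def Pi_iff)

lemma bilin_balanced: "bilin K X Y P f ==> balanced K X Y P f"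
 by (rule balancedI) (auto simp: bilin_def lmod_hom_def Pi_iff)

lemma alg_tensor_simps [simp]:
 "carrier (alg_tensor K X Y) = carrier (tensor K X Y)" "0\<^sub>(alg_tensor K X Y) = 0\<^sub>(tensor K X Y)"
 "add (alg_tensor K X Y) = add (tensor K X Y)" "1\<^sub>(alg_tensor K X Y) = pt K X Y 1\<^sub>X 1\<^sub>Y"
 by (simp_all add: alg_tensor_def Let_def)

lemma tens_lift_alg_tensor [simp]: "tsum (alg_tensor K X Y) = tsum (tensor K X Y)"
 by (rule tens_lift_target_cong) simp_all

lemma Hom_alg_tensor [simp]: "Hom (alg_tensor K X Y) P = Hom (tensor K X Y) P"
 "Hom P (alg_tensor K X Y) = Hom P (tensor K X Y)"
 by (simp_all add: Hom_def)

locale kmods = cring K for K :: "('k, 'c) ring_scheme" (structure) +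
 fixes X :: "('k, 'm, 'x) module_scheme" and Y :: "('k, 'n, 'y) module_scheme"
 assumes X: "lmod K X" and Y: "lmod K Y"
begin

lemma tp: "tpair K X Y" by (rule lmod_tpair[OF X Y refl])

lemma alg_smult_balanced: "c <: K ==>
  balanced K X Y (tensor K X Y) (%x y. pt K X Y (c .\<^sub>X x) y)"
proof (rule balancedI)
 interpret X: left_module K X by (rule X)
 interpret Y: left_module K Y by (rule Y)
 assume c: "c <: K"
 fix r x y assume r: "r <: K" "x <: X" "y <: Y"
 have "c .\<^sub>X (r .\<^sub>X x) = r .\<^sub>X (c .\<^sub>X x)"
  using c r by (simp add: X.smult_assoc1[symmetric] m_comm)
 then show "pt K X Y (c .\<^sub>X (r .\<^sub>X x)) y = pt K X Y (c .\<^sub>X x) (r .\<^sub>Y y)"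
  using r c pure_move[OF tp, of r "c .\<^sub>X x" y] by (simp add: X.smult_closed)
qed (simp_all add: pure_closed[OF tp] pure_add_l[OF tp] pure_add_r[OF tp]
    left_module.smult_closed[OF X] left_module.smult_r_distr[OF X])

lemma alg_smult_eq: "c .\<^sub>(alg_tensor K X Y) u = tsum (tensor K X Y) (%x y. pt K X Y (c .\<^sub>X x) y) u"
 by (simp add: alg_tensor_def Let_def)

lemma alg_smult_Hom: "c <: K ==> smult (alg_tensor K X Y) c \<in> Hom (tensor K X Y) (tensor K X Y)"
 using lift_Hom[OF tp tensor_ab[OF tp] alg_smult_balanced] by (simp add: alg_smult_eq[abs_def])

lemma alg_smult_pure: "[|c <: K; x <: X; y <: Y|] ==>
  c .\<^sub>(alg_tensor K X Y) pt K X Y x y = pt K X Y (c .\<^sub>X x) y"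
 by (simp add: alg_smult_eq lift_pure[OF tp tensor_ab[OF tp] alg_smult_balanced])

lemma alg_smult_pure_r: "[|c <: K; x <: X; y <: Y|] ==>
  c .\<^sub>(alg_tensor K X Y) pt K X Y x y = pt K X Y x (c .\<^sub>Y y)"
 by (simp add: alg_smult_pure pure_move[OF tp])

lemma alg_abelian: "abgrp (alg_tensor K X Y)"
 using tensor_ab[OF tp] by (subst abelian_group_cong[of _ "tensor K X Y"]) simp_all

lemma alg_left_module: "lmod K (alg_tensor K X Y)"
proof -
 interpret X: left_module K X by (rule X)
 show ?thesis
  by (rule tensor_left_module[OF tp ring_axioms])
   (simp_all add: alg_smult_Hom alg_smult_pure X.smult_closed X.smult_l_distr X.smult_assoc1 X.smult_one pure_add_l[OF tp])
qed

lemma pure_bilin: "bilin K X Y (alg_tensor K X Y) (pt K X Y)"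
 by (rule bilinI)
   (auto intro!: linI HomI simp: pure_closed[OF tp] pure_add_l[OF tp] pure_add_r[OF tp]
    alg_smult_pure alg_smult_pure_r[symmetric] simp flip: alg_smult_pure)

lemma lin_pure_l:
 "[|f \<in> lhom K Z X; y <: Y|] ==> (%z. pt K X Y (f z) y) \<in> lhom K Z (alg_tensor K X Y)"
 using pure_bilin lin_comp by (fastforce simp: bilin_def)

lemma lin_pure_r:
 "[|f \<in> lhom K Z Y; x <: X|] ==> (%z. pt K X Y x (f z)) \<in> lhom K Z (alg_tensor K X Y)"
 using pure_bilin lin_comp by (fastforce simp: bilin_def)

lemma lin_lift:
 assumes P: "lmod K P" and f: "bilin K X Y P f"
 shows "tsum P f \<in> lhom K (alg_tensor K X Y) P"
proof (rule linI)
 note Pa = lmod_ab[OF P]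
 have l: "tsum P f \<in> Hom (tensor K X Y) P" by (rule lift_Hom[OF tp Pa bilin_balanced[OF f]])
 then show "tsum P f \<in> Hom (alg_tensor K X Y) P" by simp
 have sm: "f (a .\<^sub>X x) y = a .\<^sub>P f x y" if "a <: K" "x <: X" "y <: Y" for a x y
  using f that lin_smult[of "%x. f x y" K X P] by (auto simp: bilin_def)
 fix c u assume c: "c <: K" and u: "u <: alg_tensor K X Y"
 show "tsum P f (c .\<^sub>(alg_tensor K X Y) u) = c .\<^sub>P tsum P f u"
  by (rule tensor_ext[OF tp Pa Hom_comp[OF alg_smult_Hom[OF c] l] Hom_comp[OF l smult_Hom[OF P c]]])
    (use u c f in "simp_all add: alg_smult_pure lift_pure[OF tp Pa bilin_balanced[OF f]]
     left_module.smult_closed[OF X] sm")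
qed

lemma lin_lift_arg:
 "[|lmod K P; bilin K X Y P f; g \<in> lhom K Z (alg_tensor K X Y)|] ==>
  (%z. tsum P f (g z)) \<in> lhom K Z P"
 by (rule lin_comp[OF lin_lift])

lemma lift_bilin_pure:
 "[|lmod K P; bilin K X Y P f; x <: X; y <: Y|] ==>
  tsum P f (pt K X Y x y) = f x y"
 by (rule lift_pure[OF tp lmod_ab bilin_balanced])

end

section \<open>Tensor products of algebras\<close>

lemma k_algebra_left_module: "k_algebra K X ==> lmod K X"
 by (auto simp: k_algebra_def left_module_def left_module_axioms_def module_def module_axioms_def
   field_def domain_def cring_def)

lemma k_algebra_ring: "k_algebra K X ==> ring X"
 by (simp add: k_algebra_def)

lemma k_algebra_cring: "k_algebra K X ==> cring K"
 by (simp add: k_algebra_def module_def)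

lemma k_algebraI:
 assumes "field K" "lmod K X" "ring X"
  and "!!a x y. [|a <: K; x <: X; y <: X|] ==>
   (a .\<^sub>X x) *\<^sub>X y = a .\<^sub>X (x *\<^sub>X y)"
  and "!!a x y. [|a <: K; x <: X; y <: X|] ==>
   x *\<^sub>X (a .\<^sub>X y) = a .\<^sub>X (x *\<^sub>X y)"
 shows "k_algebra K X"
 using assms by (auto simp: k_algebra_def k_algebra_axioms_def left_module_def left_module_axioms_def
   module_def module_axioms_def field_def domain_def)

lemma k_algebra_mult_l:
 assumes "k_algebra K X" "f \<in> lhom K Z X" "a <: X"
 shows "(%z. f z *\<^sub>X a) \<in> lhom K Z X"
proof -
 interpret X: k_algebra K X by (rule assms)
 show ?thesis using assms(2,3)
  by (auto simp: lmod_hom_def Pi_iff X.l_distr X.smult_mult_l)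
qed

lemma k_algebra_mult_r:
 assumes "k_algebra K X" "f \<in> lhom K Z X" "a <: X"
 shows "(%z. a *\<^sub>X f z) \<in> lhom K Z X"
proof -
 interpret X: k_algebra K X by (rule assms)
 show ?thesis using assms(2,3)
  by (auto simp: lmod_hom_def Pi_iff X.r_distr X.smult_mult_r)
qed

lemma opp_ring: "ring R ==> ring (opp R)"
proof -
 assume "ring R"
 then interpret R: ring R .
 show ?thesis
  by (rule ringI) (auto simp: R.is_abelian_group R.m_assoc R.l_distr R.r_distr intro!: monoid.intro)
qed

lemma opp_k_algebra: "k_algebra K X ==> k_algebra K (opp X)"
proof -
 assume X: "k_algebra K X"
 then interpret X: k_algebra K X .
 show ?thesis
  by (rule k_algebraI)
    (use k_algebra_left_module[OF X] in "auto simp: X.field_axioms opp_ring X.ring_axioms X.smult_mult_l X.smult_mult_r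
     left_module_def left_module_axioms_def")
qed

locale kalgs = X: k_algebra K X + Y: k_algebra K Y
 for K :: "('k, 'c) ring_scheme" (structure) and X :: "('k, 'm, 'x) module_scheme"
  and Y :: "('k, 'n, 'y) module_scheme"
begin

sublocale kmods K X Y
 by (intro kmods.intro kmods_axioms.intro k_algebra_cring[OF X.k_algebra_axioms] k_algebra_left_module X.k_algebra_axioms Y.k_algebra_axioms)

abbreviation "T \<equiv> alg_tensor K X Y"

lemma mult_inner_bilin: "[|x <: X; y <: Y|] ==>
  bilin K X Y T (%x' y'. pt K X Y (x *\<^sub>X x') (y *\<^sub>Y y'))"
 by (intro bilinI lin_pure_l lin_pure_r k_algebra_mult_r X.k_algebra_axioms Y.k_algebra_axioms lin_id)
   simp_all

lemma mult_outer_bilin: "v <: T ==>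
  bilin K X Y T (%x y. tsum T (%x' y'. pt K X Y (x *\<^sub>X x') (y *\<^sub>Y y')) v)"
 by (intro bilinI lin_lift_param[OF tp alg_left_module] lin_pure_l lin_pure_r k_algebra_mult_l
    X.k_algebra_axioms Y.k_algebra_axioms lin_id) simp_all

lemma mult_eq: "u *\<^sub>T v =
  tsum T (%x y. tsum T (%x' y'. pt K X Y (x *\<^sub>X x') (y *\<^sub>Y y')) v) u"
 by (simp only: tens_lift_alg_tensor) (simp add: alg_tensor_def Let_def)

lemma mult_lin_l: "v <: T ==> (%u. u *\<^sub>T v) \<in> lhom K T T"
 unfolding mult_eq by (rule lin_lift[OF alg_left_module mult_outer_bilin])

lemma mult_lin_r: "u <: T ==> (%v. u *\<^sub>T v) \<in> lhom K T T"
 unfolding mult_eq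
 by (rule lin_lift_param[OF tp alg_left_module]) (simp, rule lin_lift[OF alg_left_module mult_inner_bilin])

lemma mult_pure: "[|x <: X; y <: Y; x' <: X; y' <: Y|] ==>
  pt K X Y x y *\<^sub>T pt K X Y x' y' = pt K X Y (x *\<^sub>X x') (y *\<^sub>Y y')"
 using lift_bilin_pure[OF alg_left_module mult_outer_bilin, of "pt K X Y x' y'" x y]
  lift_bilin_pure[OF alg_left_module mult_inner_bilin, of x y x' y']
 by (simp add: mult_eq pure_closed[OF tp])

lemma pure_closed': "[|x <: X; y <: Y|] ==> pt K X Y x y <: tensor K X Y"
 by (rule pure_closed[OF tp])

lemma alg_ring: "ring T"
proof (rule ringI)
 note l = mult_lin_l[THEN lin_Hom, simplified]
  and r = mult_lin_r[THEN lin_Hom, simplified]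
 note cl = Hom_closed[OF l]
 show "abgrp T" by (rule alg_abelian)
 show "monoid T"
 proof (rule monoidI)
  fix u v w assume "u <: T" "v <: T" "w <: T"
  then have u: "u <: tensor K X Y" and v: "v <: tensor K X Y" and w: "w <: tensor K X Y"
   by simp_all
  show "u *\<^sub>T v <: T" using cl[OF v u] by simp
  show "(u *\<^sub>T v) *\<^sub>T w = u *\<^sub>T (v *\<^sub>T w)"
  proof (rule tensor_ext[OF tp tensor_ab[OF tp] _ _ _ u])
   show "(%u. (u *\<^sub>T v) *\<^sub>T w) \<in> Hom (tensor K X Y) (tensor K X Y)"
    by (rule Hom_comp[OF l[OF v] l[OF w]])
   show "(%u. u *\<^sub>T (v *\<^sub>T w)) \<in> Hom (tensor K X Y) (tensor K X Y)"
    by (rule l) (rule cl[OF w v])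
   fix x y assume x: "x <: X" "y <: Y"
   let ?u = "pt K X Y x y"
   note uc = pure_closed'[OF x]
   show "(?u *\<^sub>T v) *\<^sub>T w = ?u *\<^sub>T (v *\<^sub>T w)"
   proof (rule tensor_ext[OF tp tensor_ab[OF tp] Hom_comp[OF r[OF uc] l[OF w]] Hom_comp[OF l[OF w] r[OF uc]] _ v])
    fix x' y' assume x': "x' <: X" "y' <: Y"
    let ?v = "pt K X Y x' y'"
    note vc = pure_closed'[OF x']
    show "(?u *\<^sub>T ?v) *\<^sub>T w = ?u *\<^sub>T (?v *\<^sub>T w)"
     by (rule tensor_ext[OF tp tensor_ab[OF tp] r[OF cl[OF vc uc]] Hom_comp[OF r[OF vc] r[OF uc]] _ w])
       (use x x' in "simp add: mult_pure X.m_assoc Y.m_assoc")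
   qed
  qed
 next
  show "1\<^sub>T <: T" by (simp add: pure_closed')
  then have o: "1\<^sub>T <: tensor K X Y" by simp
  fix u assume "u <: T"
  then have u: "u <: tensor K X Y" by simp
  show "1\<^sub>T *\<^sub>T u = u"
   by (rule tensor_ext[OF tp tensor_ab[OF tp] r[OF o] Hom_id _ u]) (simp add: mult_pure)
  show "u *\<^sub>T 1\<^sub>T = u"
   by (rule tensor_ext[OF tp tensor_ab[OF tp] l[OF o] Hom_id _ u]) (simp add: mult_pure)
 qed
 show "(u +\<^sub>T v) *\<^sub>T w = u *\<^sub>T w +\<^sub>T v *\<^sub>T w"
  if "u <: T" "v <: T" "w <: T" for u v w
  using Hom_add[OF l, of w u v] that by simp
 show "w *\<^sub>T (u +\<^sub>T v) = w *\<^sub>T u +\<^sub>T w *\<^sub>T v"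
  if "u <: T" "v <: T" "w <: T" for u v w
  using Hom_add[OF r, of w u v] that by simp
qed

lemma alg_k_algebra: "k_algebra K T"
 by (rule k_algebraI[OF X.field_axioms alg_left_module alg_ring])
   (simp_all add: lin_smult[OF mult_lin_l] lin_smult[OF mult_lin_r])

end

section \<open>Exact sequences over a field split\<close>

lemma (in abelian_group) minus_eq_zero_iff: "[|x <: G; y <: G|] ==> x \<ominus> y = \<zero> \<longleftrightarrow> x = y"
 by (metis a_minus_def minus_equality minus_minus a_inv_closed r_neg)

lemma Hom_diff: "[|f \<in> Hom M N; g \<in> Hom M N; abgrp N|] ==> (%x. f x \<ominus>\<^bsub>N\<^esub> g x) \<in> Hom M N"
proof -
 assume f: "f \<in> Hom M N" "g \<in> Hom M N" and "abgrp N"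
 interpret N: abelian_group N by (rule \<open>abgrp N\<close>)
 show ?thesis
  by (rule HomI) (use Hom_closed[OF f(1)] Hom_closed[OF f(2)] in "simp_all add: Hom_add[OF f(1)] Hom_add[OF f(2)] a_minus_def N.minus_add N.a_ac")
qed

lemma (in left_module) smult_minus_one:
 assumes "x <: M"
 shows "(\<ominus>\<^bsub>R\<^esub> 1\<^sub>R) .\<^sub>M x = \<ominus>\<^bsub>M\<^esub> x"
proof -
 have "(\<ominus>\<^bsub>R\<^esub> 1\<^sub>R) .\<^sub>M x +\<^sub>M x = (\<ominus>\<^bsub>R\<^esub> 1\<^sub>R +\<^sub>R 1\<^sub>R) .\<^sub>M x"
  using assms by (simp add: smult_l_distr smult_one)
 then show ?thesis using assms by (simp add: M.minus_equality smult_closed R.l_neg smult_zero_l)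
qed

text \<open>A maximal subspace meeting the kernel of \<open>f\<close> trivially is mapped isomorphically onto the
  image of \<open>f\<close>.\<close>

lemma linear_section:
 fixes K :: "('k, 'c) ring_scheme" and X :: "('k, 'm, 'x) module_scheme" and Y :: "('k, 'n, 'y) module_scheme"
 assumes K: "field K" and X: "lmod K X" and Y: "lmod K Y" and f: "f \<in> lhom K X Y"
 obtains s where "s \<in> lhom K (Y\<lparr>carrier := f ` carrier X\<rparr>) X"
  and "!!y. y \<in> f ` carrier X ==> f (s y) = y"
proof -
 interpret K: field K by (rule K)
 interpret X: left_module K X by (rule X)
 interpret Y: left_module K Y by (rule Y)
 note fc = lin_closed[OF f] and fa = lin_add[OF f] and fs = lin_smult[OF f]
 note ab = X.M.abelian_group_axioms Y.M.abelian_group_axioms lin_Hom[OF f]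
 define S where "S = {G. G \<subseteq> carrier X \<and> 0\<^sub>X \<in> G \<and> (\<forall>u\<in>G. \<forall>v\<in>G. \<forall>a\<in>carrier K. u +\<^sub>X a .\<^sub>X v \<in> G) \<and>
  (\<forall>x\<in>G. f x = 0\<^sub>Y \<longrightarrow> x = 0\<^sub>X)}"
 have "{0\<^sub>X} \<in> S" by (simp add: S_def X.smult_zero_r)
 moreover have "\<Union>C \<in> S" if C: "C \<noteq> {}" "subset.chain S C" for C
 proof -
  have cS: "G \<in> S" if "G \<in> C" for G using C(2) that by (auto simp: subset.chain_def)
  have "u +\<^sub>X a .\<^sub>X v \<in> \<Union>C" if "u \<in> \<Union>C" "v \<in> \<Union>C" "a <: K" for u v a
  proof -
   obtain G G' where "G \<in> C" "u \<in> G" "G' \<in> C" "v \<in> G'" using \<open>u \<in> \<Union>C\<close> \<open>v \<in> \<Union>C\<close> by blast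
   moreover have "G \<subseteq> G' \<or> G' \<subseteq> G" using C(2) calculation by (auto simp: subset.chain_def)
   ultimately obtain M where "M \<in> C" "u \<in> M" "v \<in> M" by blast
   then show ?thesis using cS[of M] that(3) by (auto simp: S_def intro!: bexI[of _ M])
  qed
  moreover obtain G where "G \<in> C" using C(1) by (metis ex_in_conv)
  then have "0\<^sub>X \<in> \<Union>C" using cS[of G] by (auto simp: S_def intro!: bexI[of _ G])
  moreover have "x <: X \<and> (f x = 0\<^sub>Y \<longrightarrow> x = 0\<^sub>X)" if x: "x \<in> \<Union>C" for x
  proof -
   obtain G where "G \<in> C" "x \<in> G" using x by blast
   then show ?thesis using cS[of G] by (auto simp: S_def)
  qed
  ultimately show ?thesis by (simp add: S_def subset_iff)
 qed
 ultimately obtain G where G: "G \<in> S" and max: "!!G'. [|G' \<in> S; G \<subseteq> G'|] ==> G' = G"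
  using subset_Zorn_nonempty[of S] by (metis empty_iff)
 have Gc: "x <: X" if "x \<in> G" for x using G that by (auto simp: S_def)
 have G0: "0\<^sub>X \<in> G" and Ga: "!!u v a. [|u \<in> G; v \<in> G; a <: K|] ==> u +\<^sub>X a .\<^sub>X v \<in> G"
  and Gk: "!!x. [|x \<in> G; f x = 0\<^sub>Y|] ==> x = 0\<^sub>X"
  using G by (auto simp: S_def)
 have Gs: "a .\<^sub>X v \<in> G" if "v \<in> G" "a <: K" for v a
  using Ga[OF G0 that] that Gc by (simp add: X.smult_closed)
 have Gn: "\<ominus>\<^bsub>X\<^esub> v \<in> G" if "v \<in> G" for v
  using Gs[OF that, of "\<ominus>\<^bsub>K\<^esub> 1\<^sub>K"] that Gc by (simp add: X.smult_minus_one)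
 have Gp: "u +\<^sub>X v \<in> G" if "u \<in> G" "v \<in> G" for u v
  using Ga[OF that, of "1\<^sub>K"] that Gc by (simp add: X.smult_one)
 have im: "f x \<in> f ` G" if x: "x <: X" for x
 proof (rule ccontr)
  assume n: "f x \<notin> f ` G"
  define G' where "G' = {u +\<^sub>X a .\<^sub>X x | u a. u \<in> G \<and> a <: K}"
  have G'I: "u +\<^sub>X a .\<^sub>X x \<in> G'" if "u \<in> G" "a <: K" for u a using that by (auto simp: G'_def)
  have sub: "u \<in> G'" if "u \<in> G" for u using G'I[OF that K.zero_closed] x Gc[OF that] by (simp add: X.smult_zero_l)
  have "x \<in> G'" using G'I[OF G0 K.one_closed] x by (simp add: X.smult_one)
  have "G' \<in> S"
   unfolding S_def
  proof (intro CollectI conjI ballI impI)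
   show "G' \<subseteq> carrier X" using x Gc by (auto simp: G'_def X.smult_closed)
   show "0\<^sub>X \<in> G'" by (rule sub[OF G0])
  next
   fix y z c assume "y \<in> G'" "z \<in> G'" and c: "c <: K"
   then obtain u a v b where e: "u \<in> G" "a <: K" "v \<in> G" "b <: K"
    "y = u +\<^sub>X a .\<^sub>X x" "z = v +\<^sub>X b .\<^sub>X x" by (auto simp: G'_def)
   have "y +\<^sub>X c .\<^sub>X z = (u +\<^sub>X c .\<^sub>X v) +\<^sub>X (a +\<^sub>K c *\<^sub>K b) .\<^sub>X x"
    using e x c Gc by (simp add: X.smult_l_distr X.smult_r_distr X.smult_assoc1 X.M.a_ac X.smult_closed)
   then show "y +\<^sub>X c .\<^sub>X z \<in> G'" using G'I Ga e c by simp
  next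
   fix y assume y: "y \<in> G'" "f y = 0\<^sub>Y"
   then obtain u a where e: "u \<in> G" "a <: K" "y = u +\<^sub>X a .\<^sub>X x" by (auto simp: G'_def)
   show "y = 0\<^sub>X"
   proof (cases "a = 0\<^sub>K")
    case True
    then show ?thesis using Gk e y(2) x Gc by (simp add: X.smult_zero_l)
   next
    case False
    then have a: "a \<in> Units K" using e(2) K.field_Units by blast
    let ?v = "inv\<^bsub>K\<^esub> a .\<^sub>X u"
    have v: "?v \<in> G" "inv\<^bsub>K\<^esub> a <: K" using Gs e a K.Units_inv_closed by simp_all
    have "inv\<^bsub>K\<^esub> a .\<^sub>X y = x +\<^sub>X ?v"
     using e x a v Gc by (simp add: X.smult_r_distr X.smult_closed X.smult_assoc1[symmetric] X.smult_one X.M.a_comm)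
    moreover have "f (inv\<^bsub>K\<^esub> a .\<^sub>X y) = 0\<^sub>Y" using v e x Gc y(2) by (simp add: fs X.smult_closed Y.smult_zero_r)
    ultimately have "f x +\<^sub>Y f ?v = 0\<^sub>Y" using x v Gc by (simp add: fa)
    then have "f x = f (\<ominus>\<^bsub>X\<^esub> ?v)" using x v Gc fc Y.M.minus_equality by (simp add: Hom_neg[OF ab])
    then show ?thesis using n Gn[OF v(1)] by simp
   qed
  qed
  then have "G' = G" using max sub by blast
  then show False using \<open>x \<in> G'\<close> n by blast
 qed
 have inj: "inj_on f G"
 proof (rule inj_onI)
  fix u v assume uv: "u \<in> G" "v \<in> G" "f u = f v"
  then have "f (u \<ominus>\<^bsub>X\<^esub> v) = 0\<^sub>Y" using Gc fc by (simp add: Hom_minus[OF ab] Y.M.minus_eq_zero_iff)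
  then have "u \<ominus>\<^bsub>X\<^esub> v = 0\<^sub>X" using Gk Gp[OF uv(1) Gn[OF uv(2)]] by (simp add: a_minus_def)
  then show "u = v" using uv Gc by (simp add: X.M.minus_eq_zero_iff)
 qed
 define s where "s = inv_into G f"
 have s: "s y \<in> G" "f (s y) = y" if "y \<in> f ` carrier X" for y
  using im that by (auto simp: s_def f_inv_into_f inv_into_into)
 have su: "s y = u" if "u \<in> G" "f u = y" for y u
  using that inj by (auto simp: s_def inv_into_f_f)
 show ?thesis
 proof
  have "s (y +\<^sub>Y z) = s y +\<^sub>X s z" if "y \<in> f ` carrier X" "z \<in> f ` carrier X" for y z
   using s[OF that(1)] s[OF that(2)] Gc by (intro su) (simp_all add: fa Gp)
  moreover have "s (a .\<^sub>Y y) = a .\<^sub>X s y" if "a <: K" "y \<in> f ` carrier X" for a y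
   using s[OF that(2)] Gc that(1) by (intro su) (simp_all add: fs Gs)
  ultimately show "s \<in> lhom K (Y\<lparr>carrier := f ` carrier X\<rparr>) X"
   using s(1) Gc by (simp add: lmod_hom_def)
 qed (rule s(2))
qed

text \<open>\<open>y - g'(d y)\<close> is the projection of \<open>Y\<close> onto the cycles along the complement chosen by \<open>g'\<close>.\<close>

lemma contraction_step:
 assumes X: "lmod K X" and Y: "lmod K Y" and W: "lmod K W" and f: "f \<in> lhom K X Y" and d: "d \<in> lhom K Y W"
  and ex: "exact_at X f Y d W"
  and g: "g \<in> lhom K (Y\<lparr>carrier := f ` carrier X\<rparr>) X" "\<forall>y\<in>f ` carrier X. f (g y) = y"
  and g': "g' \<in> lhom K (W\<lparr>carrier := d ` carrier Y\<rparr>) Y" "\<forall>w\<in>d ` carrier Y. d (g' w) = w"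
 shows "(%y. g (y \<ominus>\<^bsub>Y\<^esub> g' (d y))) \<in> lhom K Y X"
  and "y <: Y ==> f (g (y \<ominus>\<^bsub>Y\<^esub> g' (d y))) +\<^sub>Y g' (d y) = y"
  and "x <: X ==> g (f x \<ominus>\<^bsub>Y\<^esub> g' (d (f x))) = g (f x)"
proof -
 interpret Y: left_module K Y by (rule Y)
 interpret W: left_module K W by (rule W)
 note ab = Y.M.abelian_group_axioms
 let ?c = "%y. g' (d y)"
 have c: "?c \<in> lhom K Y Y"
  by (rule lin_comp[OF g'(1)]) (use lin_add[OF d] lin_smult[OF d] in \<open>auto simp: lmod_hom_def\<close>)
 note cc = lin_closed[OF c]
 have im: "y \<ominus>\<^bsub>Y\<^esub> ?c y \<in> f ` carrier X" if y: "y <: Y" for y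
 proof -
  have "d (y \<ominus>\<^bsub>Y\<^esub> ?c y) = 0\<^sub>W"
   using y cc g'(2) lin_closed[OF d] by (simp add: Hom_minus[OF ab W.M.abelian_group_axioms lin_Hom[OF d]] W.M.minus_eq_zero_iff)
  then show ?thesis using y cc ex by (simp add: exact_at_def)
 qed
 have "(%y. y \<ominus>\<^bsub>Y\<^esub> ?c y) \<in> lhom K Y (Y\<lparr>carrier := f ` carrier X\<rparr>)"
  using im lin_add[OF c] lin_smult[OF c] cc Hom_neg[OF ab ab smult_Hom[OF Y]]
  by (simp add: lmod_hom_def a_minus_def Y.M.minus_add Y.M.a_ac Y.smult_r_distr)
 then show "(%y. g (y \<ominus>\<^bsub>Y\<^esub> ?c y)) \<in> lhom K Y X" by (rule lin_comp[OF g(1)])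
 show "f (g (y \<ominus>\<^bsub>Y\<^esub> ?c y)) +\<^sub>Y ?c y = y" if "y <: Y"
  using that cc bspec[OF g(2) im[OF that]] by (simp add: a_minus_def Y.M.a_assoc Y.M.l_neg)
 show "g (f x \<ominus>\<^bsub>Y\<^esub> ?c (f x)) = g (f x)" if "x <: X"
 proof -
  have "d (f x) = d 0\<^sub>Y" using ex that Hom_zero[OF ab W.M.abelian_group_axioms lin_Hom[OF d]] by (auto simp: exact_at_def)
  then show ?thesis using Hom_zero[OF ab ab lin_Hom[OF c]] lin_closed[OF f that] Y.M.add.inv_one by (simp add: a_minus_def a_inv_def)
 qed
qed

text \<open>With a section of every differential over its image, \<open>s n\<close> is the section of \<open>d n\<close> after the
  projection of \<open>P n\<close> onto the cycles.\<close>

lemma linear_contraction: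
 fixes K :: "('k, 'c) ring_scheme" and P :: "nat \<Rightarrow> ('k, 'm, 'x) module_scheme"
  and Z :: "('k, 'n, 'y) module_scheme"
 assumes K: "field K" and P: "!!n. lmod K (P n)" and Z: "lmod K Z"
  and d: "!!n. d n \<in> lhom K (P (Suc n)) (P n)" and aug: "aug \<in> lhom K (P 0) Z"
  and ex: "!!n. exact_at (P (Suc (Suc n))) (d (Suc n)) (P (Suc n)) (d n) (P n)"
  and ex0: "exact_at (P (Suc 0)) (d 0) (P 0) aug Z" and surj: "aug ` carrier (P 0) = carrier Z"
 obtains s r where "!!n. s n \<in> lhom K (P n) (P (Suc n))" and "r \<in> lhom K Z (P 0)"
  and "!!x. x <: P 0 ==> d 0 (s 0 x) +\<^sub>(P 0) r (aug x) = x"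
  and "!!n x. x <: P (Suc n) ==>
   d (Suc n) (s (Suc n) x) +\<^sub>(P (Suc n)) s n (d n x) = x"
proof -
 have "\<exists>g. g \<in> lhom K ((P n)\<lparr>carrier := d n ` carrier (P (Suc n))\<rparr>) (P (Suc n)) \<and>
   (\<forall>y\<in>d n ` carrier (P (Suc n)). d n (g y) = y)" for n
  using linear_section[OF K P P d[of n]] by metis
 then obtain g where g: "!!n. g n \<in> lhom K ((P n)\<lparr>carrier := d n ` carrier (P (Suc n))\<rparr>) (P (Suc n))"
  "!!n. \<forall>y\<in>d n ` carrier (P (Suc n)). d n (g n y) = y" by metis
 obtain r where r: "r \<in> lhom K (Z\<lparr>carrier := aug ` carrier (P 0)\<rparr>) (P 0)"
  "\<forall>y\<in>aug ` carrier (P 0). aug (r y) = y"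
  using linear_section[OF K P Z aug] by metis
 define s where "s n x = g n (x \<ominus>\<^bsub>P n\<^esub> (case n of 0 \<Rightarrow> r (aug x) | Suc m \<Rightarrow> g m (d m x)))" for n x
 note s0 = contraction_step[OF P P Z d aug ex0 g r] and sS = contraction_step[OF P P P d d ex g g]
 show ?thesis
 proof
  show "s n \<in> lhom K (P n) (P (Suc n))" for n
   using s0(1) sS(1) by (cases n) (simp_all add: s_def[abs_def])
  show "r \<in> lhom K Z (P 0)" using r(1) surj by (simp add: lmod_hom_def)
  show "d 0 (s 0 x) +\<^sub>(P 0) r (aug x) = x" if "x <: P 0" for x
   using s0(2)[OF that] by (simp add: s_def)
  have "s n (d n x) = g n (d n x)" if "x <: P (Suc n)" for n x
   using s0(3) sS(3) that by (cases n) (simp_all add: s_def)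
  then show "d (Suc n) (s (Suc n) x) +\<^sub>(P (Suc n)) s n (d n x) = x" if "x <: P (Suc n)" for n x
   using sS(2) that by (simp add: s_def)
 qed
qed

section \<open>Functoriality of the tensor product\<close>

lemma lin_opp [simp]: "lhom (opp R) M N = lhom R M N"
 by (simp add: lmod_hom_def)

context
 fixes R :: "('r, 'x) ring_scheme" and M :: "('r, 'm, 'y) module_scheme" and N :: "('r, 'n, 'z) module_scheme"
  and M' :: "('r, 'm1, 'y1) module_scheme" and N' :: "('r, 'n1, 'z1) module_scheme" and f g
 assumes MN: "tpair R M N" and MN': "tpair R M' N'" and f: "f \<in> lhom R M M'" and g: "g \<in> lhom R N N'"
begin

lemma tmap_balanced: "balanced R M N (tensor R M' N') (%x y. pt R M' N' (f x) (g y))"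
 by (rule balancedI)
   (simp_all add: pure_closed[OF MN'] pure_add_l[OF MN'] pure_add_r[OF MN'] pure_move[OF MN']
    lin_closed[OF f] lin_closed[OF g] lin_add[OF f] lin_add[OF g]
    lin_smult[OF f] lin_smult[OF g])

lemma tmap_pure: "[|x <: M; y <: N|] ==>
  tmap R M' N' f g (pt R M N x y) = pt R M' N' (f x) (g y)"
 unfolding tensor_map_def by (rule lift_pure[OF MN tensor_ab[OF MN'] tmap_balanced])

lemma tmap_Hom: "tmap R M' N' f g \<in> Hom (tensor R M N) (tensor R M' N')"
 unfolding tensor_map_def by (rule lift_Hom[OF MN tensor_ab[OF MN'] tmap_balanced])

end

section \<open>Flatness\<close>

lemma lmod_tpair_opp: "[|lmod (opp R) M; lmod R N|] ==> tpair R M N"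
 using left_module.smult_closed[of "opp R" M] left_module.smult_closed[of R N]
 by (auto simp: tpair_def lmod_ab)

text \<open>On formal sums, \<open>g \<otimes> 1\<close> is the substitution of symbols.\<close>

lemma tensor_map_coset:
 assumes MN: "tpair R M N" and MN': "tpair R M' N" and f: "f \<in> lhom R M M'" and c: "c <: (free_Abelian_group (carrier M \<times> carrier N))"
 defines "h \<equiv> frag_extend (%z. frag_of (f (fst z), snd z))"
 shows "h c <: (free_Abelian_group (carrier M' \<times> carrier N)) \<and> tmap R M' N f (%x. x) (tensor_null R M N #>\<^bsub>free_Abelian_group (carrier M \<times> carrier N)\<^esub> c) =
  tensor_null R M' N #>\<^bsub>free_Abelian_group (carrier M' \<times> carrier N)\<^esub> h c"
proof -
 let ?F = "free_Abelian_group (carrier M \<times> carrier N)" and ?F' = "free_Abelian_group (carrier M' \<times> carrier N)"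
 let ?t = "tmap R M' N f (%x. x)"
 note t = tmap_Hom[OF MN MN' f lin_id] and ab = tensor_ab[OF MN] tensor_ab[OF MN']
 have "Poly_Mapping.keys c \<subseteq> carrier M \<times> carrier N" using c by simp
 then have "c <: ?F \<and> h c <: ?F' \<and> ?t (tensor_null R M N #>\<^bsub>?F\<^esub> c) = tensor_null R M' N #>\<^bsub>?F'\<^esub> h c"
 proof (induction c rule: frag_induction)
  case zero
  show ?case using group_hom.hom_one[OF tensor_coset_hom[OF MN]] group_hom.hom_one[OF tensor_coset_hom[OF MN']] Hom_zero[OF ab t]
   by (simp add: h_def)
 next
  case (one x)
  then show ?case using tmap_pure[OF MN MN' f lin_id, of "fst x" "snd x"] lin_closed[OF f]
   by (auto simp: h_def pure_tensor_def)
 next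
  case (diff a b)
  moreover have "a - b <: ?F" "h a - h b <: ?F'" using diff keys_diff[of a b] keys_diff[of "h a" "h b"] by auto
  ultimately show ?case using Hom_minus[OF ab t] coset_closed[OF MN]
   by (simp add: h_def frag_extend_diff coset_diff[OF MN] coset_diff[OF MN'] del: carrier_free_Abelian_group_iff)
 qed
 then show ?thesis by simp
qed

lemma (in left_module) submodule_left_module:
 assumes "S \<subseteq> carrier M" "0\<^sub>M \<in> S" "!!x y. [|x \<in> S; y \<in> S|] ==> x +\<^sub>M y \<in> S"
  and "!!r x. [|r <: R; x \<in> S|] ==> r .\<^sub>M x \<in> S"
 shows "lmod R (M\<lparr>carrier := S\<rparr>)"
proof (intro left_module.intro left_module_axioms.intro R.ring_axioms)
 have sub: "x <: M" if "x \<in> S" for x using that assms(1) by blast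
 show "abgrp (M\<lparr>carrier := S\<rparr>)"
 proof (rule abelian_groupI)
  fix x assume x: "x <: (M\<lparr>carrier := S\<rparr>)"
  then have "(\<ominus>\<^bsub>R\<^esub> 1\<^sub>R) .\<^sub>M x \<in> S" using assms(4) by simp
  then have "\<ominus>\<^bsub>M\<^esub> x \<in> S" using x sub by (simp add: smult_minus_one)
  then show "\<exists>y\<in>carrier (M\<lparr>carrier := S\<rparr>). y +\<^sub>(M\<lparr>carrier := S\<rparr>) x = 0\<^sub>(M\<lparr>carrier := S\<rparr>)"
   using x sub by (auto intro!: bexI[of _ "\<ominus>\<^bsub>M\<^esub> x"] M.l_neg)
 qed (use assms sub in "auto simp: M.a_ac")
qed (use assms subsetD[OF assms(1)] in "auto simp: smult_l_distr smult_r_distr smult_assoc1 smult_one")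

definition transport :: "('m \<Rightarrow> 'n) \<Rightarrow> ('r, 'm, 'z) module_scheme \<Rightarrow> ('r, 'n) module" where
 "transport \<iota> M = \<lparr>carrier = \<iota> ` carrier M, monoid.mult = undefined, one = undefined, ring.zero = \<iota> 0\<^sub>M,
   add = (%a b. \<iota> (inv_into (carrier M) \<iota> a +\<^sub>M inv_into (carrier M) \<iota> b)),
   smult = (%r a. \<iota> (r .\<^sub>M inv_into (carrier M) \<iota> a))\<rparr>"

lemma transport_simps:
 assumes "inj_on \<iota> (carrier M)"
 shows "carrier (transport \<iota> M) = \<iota> ` carrier M" "0\<^sub>(transport \<iota> M) = \<iota> 0\<^sub>M"
  "[|x <: M; y <: M|] ==> \<iota> x +\<^sub>(transport \<iota> M) \<iota> y = \<iota> (x +\<^sub>M y)"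
  "x <: M ==> r .\<^sub>(transport \<iota> M) \<iota> x = \<iota> (r .\<^sub>M x)"
 using assms by (simp_all add: transport_def)

lemma transport_left_module:
 assumes M: "lmod R M" and i: "inj_on \<iota> (carrier M)"
 shows "lmod R (transport \<iota> M)" "\<iota> \<in> lhom R M (transport \<iota> M)"
proof -
 interpret M: left_module R M by (rule M)
 note t = transport_simps[OF i]
 have "abgrp (transport \<iota> M)"
 proof (rule abelian_groupI)
  fix x assume "x <: (transport \<iota> M)"
  then obtain y where y: "y <: M" "x = \<iota> y" by (auto simp: t)
  then show "\<exists>y\<in>carrier (transport \<iota> M). y +\<^sub>(transport \<iota> M) x = 0\<^sub>(transport \<iota> M)"
   by (intro bexI[of _ "\<iota> (\<ominus>\<^bsub>M\<^esub> y)"]) (simp_all add: t M.M.l_neg)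
 qed (auto simp: t M.M.a_ac)
 then show "lmod R (transport \<iota> M)"
  by (intro left_module.intro left_module_axioms.intro M.R.ring_axioms)
    (auto simp: t M.smult_closed M.smult_l_distr M.smult_r_distr M.smult_assoc1 M.smult_one)
 show "\<iota> \<in> lhom R M (transport \<iota> M)"
  using M.smult_closed by (auto simp: lmod_hom_def t)
qed

lemma transport_hom:
 assumes "inj_on \<iota> (carrier M)" "f \<in> lhom R M N" "lmod R M"
 shows "(%a. f (inv_into (carrier M) \<iota> a)) \<in> lhom R (transport \<iota> M) N"
proof -
 interpret M: left_module R M by (rule assms)
 show ?thesis using assms(1,2)
  by (auto simp: lmod_hom_def transport_def M.smult_closed)
qed

text \<open>A relation between tensors involves finitely many elements, so it already holds over a
  finitely generated submodule.\<close>

lemma tensor_null_finite: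
 assumes Z: "abgrp Z" and Zs: "!!r x. [|r <: R; x <: Z|] ==> r .\<^sub>Z x <: Z"
  and N: "abgrp N" and Ns: "!!r x. [|r <: R; x <: N|] ==> r .\<^sub>N x <: N"
  and c: "c \<in> tensor_null R Z N"
 shows "\<exists>F\<^sub>0. finite F\<^sub>0 \<and> F\<^sub>0 \<subseteq> carrier Z \<and>
  (\<forall>S. F\<^sub>0 \<subseteq> S \<longrightarrow> S \<subseteq> carrier Z \<longrightarrow> c \<in> tensor_null R (Z\<lparr>carrier := S\<rparr>) N)"
proof -
 let ?G = "%S. free_Abelian_group (S \<times> carrier N)"
 have rel: "\<exists>F\<^sub>0. finite F\<^sub>0 \<and> F\<^sub>0 \<subseteq> carrier Z \<and>
   (\<forall>S. F\<^sub>0 \<subseteq> S \<longrightarrow> S \<subseteq> carrier Z \<longrightarrow> h \<in> tensor_relators R (Z\<lparr>carrier := S\<rparr>) N \<and> h <: ?G S)"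
  if h: "h \<in> tensor_relators R Z N" for h
 proof -
  have fr: "frag_of (x, y) <: ?G S" if "x \<in> S" "y <: N" for x y S
   using that by simp
  have df: "a - b <: ?G S" if "a <: ?G S" "b <: ?G S" for a b S
   using that keys_diff[of a b] by auto
  from h[unfolded tensor_relators_def] show ?thesis
  proof (elim UnE CollectE exE conjE)
   fix x x' y assume "h = frag_of (x +\<^sub>Z x', y) - frag_of (x, y) - frag_of (x', y)"
    "x <: Z" "x' <: Z" "y <: N"
   then show ?thesis using abelian_groupE(1)[OF Z]
    by (intro exI[of _ "{x, x', x +\<^sub>Z x'}"]) (auto simp: tensor_relators_def intro!: df fr simp del: carrier_free_Abelian_group_iff)
  next
   fix x y y' assume "h = frag_of (x, y +\<^sub>N y') - frag_of (x, y) - frag_of (x, y')"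
    "x <: Z" "y <: N" "y' <: N"
   then show ?thesis using abelian_groupE(1)[OF N]
    by (intro exI[of _ "{x}"]) (auto simp: tensor_relators_def intro!: df fr simp del: carrier_free_Abelian_group_iff)
  next
   fix r x y assume "h = frag_of (r .\<^sub>Z x, y) - frag_of (x, r .\<^sub>N y)"
    "r <: R" "x <: Z" "y <: N"
   then show ?thesis using Zs Ns
    by (intro exI[of _ "{x, r .\<^sub>Z x}"]) (auto simp: tensor_relators_def intro!: df fr simp del: carrier_free_Abelian_group_iff)
  qed
 qed
 show ?thesis
  using c unfolding tensor_null_def
 proof (induction rule: generate.induct)
  case one
  have "1\<^sub>(?G (carrier Z)) \<in> generate (?G S) X" for S X
   using generate.one[of "?G S" X] by simp
  then show ?case by (intro exI[of _ "{}"]) simp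
 next
  case (incl h)
  from rel[OF this] obtain F\<^sub>0 where F: "finite F\<^sub>0" "F\<^sub>0 \<subseteq> carrier Z"
   "\<forall>S. F\<^sub>0 \<subseteq> S \<longrightarrow> S \<subseteq> carrier Z \<longrightarrow> h \<in> tensor_relators R (Z\<lparr>carrier := S\<rparr>) N \<and> h <: ?G S"
   by (elim exE conjE)
  show ?case
  proof (intro exI[of _ "F\<^sub>0"] conjI allI impI)
   fix S assume "F\<^sub>0 \<subseteq> S" "S \<subseteq> carrier Z"
   then have "h \<in> tensor_relators R (Z\<lparr>carrier := S\<rparr>) N" using F(3) by simp
   then show "h \<in> generate (?G (carrier (Z\<lparr>carrier := S\<rparr>))) (tensor_relators R (Z\<lparr>carrier := S\<rparr>) N)"
    by (rule generate.incl)
  qed (use F in auto)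
 next
  case (inv h)
  from rel[OF this] obtain F\<^sub>0 where F: "finite F\<^sub>0" "F\<^sub>0 \<subseteq> carrier Z"
   "\<forall>S. F\<^sub>0 \<subseteq> S \<longrightarrow> S \<subseteq> carrier Z \<longrightarrow> h \<in> tensor_relators R (Z\<lparr>carrier := S\<rparr>) N \<and> h <: ?G S"
   by (elim exE conjE)
  show ?case
  proof (intro exI[of _ "F\<^sub>0"] conjI allI impI)
   fix S assume S: "F\<^sub>0 \<subseteq> S" "S \<subseteq> carrier Z"
   then have h: "h \<in> tensor_relators R (Z\<lparr>carrier := S\<rparr>) N" "h <: ?G S" using F(3) by simp_all
   have "Poly_Mapping.keys h \<subseteq> S \<times> carrier N" using h(2) by simp
   moreover from this have "Poly_Mapping.keys h \<subseteq> carrier Z \<times> carrier N" using S(2) by blast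
   ultimately have "inv\<^bsub>?G (carrier Z)\<^esub> h = inv\<^bsub>?G (carrier (Z\<lparr>carrier := S\<rparr>))\<^esub> h" by simp
   then show "inv\<^bsub>?G (carrier Z)\<^esub> h \<in> generate (?G (carrier (Z\<lparr>carrier := S\<rparr>))) (tensor_relators R (Z\<lparr>carrier := S\<rparr>) N)"
    using generate.inv[OF h(1), of "?G (carrier (Z\<lparr>carrier := S\<rparr>))"] by simp
  qed (use F in auto)
 next
  case (eng h1 h2)
  let ?X = "%S. tensor_relators R (Z\<lparr>carrier := S\<rparr>) N"
  from eng.IH obtain F1 F2 where F: "finite F1" "F1 \<subseteq> carrier Z" "finite F2" "F2 \<subseteq> carrier Z"
   and 1: "\<forall>S. F1 \<subseteq> S \<longrightarrow> S \<subseteq> carrier Z \<longrightarrow> h1 \<in> generate (?G (carrier (Z\<lparr>carrier := S\<rparr>))) (?X S)"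
   and 2: "\<forall>S. F2 \<subseteq> S \<longrightarrow> S \<subseteq> carrier Z \<longrightarrow> h2 \<in> generate (?G (carrier (Z\<lparr>carrier := S\<rparr>))) (?X S)"
   by (elim exE conjE)
  show ?case
  proof (intro exI[of _ "F1 \<union> F2"] conjI allI impI)
   fix S assume S: "F1 \<union> F2 \<subseteq> S" "S \<subseteq> carrier Z"
   then have "h1 \<in> generate (?G S) (?X S)" "h2 \<in> generate (?G S) (?X S)" using 1 2 by simp_all
   from generate.eng[OF this]
   show "h1 *\<^sub>(?G (carrier Z)) h2 \<in> generate (?G (carrier (Z\<lparr>carrier := S\<rparr>))) (?X S)" by simp
  qed (use F in auto)
 qed
qed

lemma (in left_module) free_extend_delta:
 assumes "i \<in> S" "f \<in> S \<rightarrow> carrier M"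
 shows "(%p. if p = i then 1\<^sub>R else 0\<^sub>R) <: free_module R S"
  "free_extend R M f (%p. if p = i then 1\<^sub>R else 0\<^sub>R) = f i"
proof -
 let ?c = "%p. if p = i then 1\<^sub>R else 0\<^sub>R"
 show c: "?c <: free_module R S" using assms(1) by (auto simp: free_module_def)
 have i: "f i <: M" using assms by auto
 have "free_extend R M f ?c = (\<Oplus>\<^bsub>M\<^esub>p\<in>{i}. ?c p .\<^sub>M f p)"
  by (rule free_extend_superset[OF c]) (use assms in auto)
 then show "free_extend R M f ?c = f i" using i by (simp add: smult_one)
qed

text \<open>A finitely generated submodule is a quotient of a module \<open>R\<^sup>n\<close>, so that an element can be encoded by
  its fibre, a set of sequences in \<open>R\<close>.\<close>

lemma (in left_module) finite_subset_embeds: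
 assumes D: "finite D" "D \<subseteq> carrier M"
 obtains S and \<iota> :: "'m \<Rightarrow> (nat \<Rightarrow> 'a) set" where "D \<subseteq> S" "S \<subseteq> carrier M" "lmod R (M\<lparr>carrier := S\<rparr>)" "inj_on \<iota> S"
proof -
 obtain n and e :: "nat \<Rightarrow> 'm" where e: "D = e ` {i. i < n}" using finite_imp_nat_seg_image_inj_on[OF D(1)] by blast
 let ?F = "free_module R {..<n}"
 interpret F: left_module R ?F by (rule R.free_module_left_module)
 have pi: "e \<in> {..<n} \<rightarrow> carrier M" using D(2) e by auto
 define p where "p = free_extend R M e"
 have p: "p \<in> lhom R ?F M" unfolding p_def by (rule free_extend_hom[OF pi])
 define S where "S = p ` carrier ?F"
 have i: "p c \<in> S" if "c <: ?F" for c using that by (simp add: S_def)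
 show thesis
 proof
  have "e j \<in> S" if "j \<in> {..<n}" for j
   using free_extend_delta[OF that pi] i unfolding p_def by metis
  then show "D \<subseteq> S" by (auto simp: e)
  show sub: "S \<subseteq> carrier M" using lin_closed[OF p] by (auto simp: S_def)
  have "x +\<^sub>M y \<in> S" if "x \<in> S" "y \<in> S" for x y
   using that i[OF F.M.a_closed] by (auto simp: S_def lin_add[OF p])
  moreover have "r .\<^sub>M x \<in> S" if "r <: R" "x \<in> S" for r x
   using that i[OF F.smult_closed] by (auto simp: S_def lin_smult[OF p])
  moreover have "0\<^sub>M \<in> S"
   using i[OF F.M.zero_closed] Hom_zero[OF F.M.abelian_group_axioms M.abelian_group_axioms lin_Hom[OF p]] by simp
  ultimately show "lmod R (M\<lparr>carrier := S\<rparr>)" by (intro submodule_left_module sub)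
  show "inj_on (%x. {c \<in> carrier ?F. p c = x}) S" by (rule inj_onI) (auto simp: S_def)
 qed
qed

context
 fixes R :: "('r, 'x) ring_scheme" and N :: "('r, 'n, 'z) module_scheme"
 assumes ff: "faithfully_flat R N"
begin

private abbreviation "T M \<equiv> tensor R M N"
private abbreviation "tm M f \<equiv> tmap R M N f (%x. x)"
private abbreviation "ker Y Z g \<equiv> Y\<lparr>carrier := {y \<in> carrier Y. g y = 0\<^sub>Z}\<rparr>"

private lemma tp: "lmod (opp R) M ==> tpair R M N"
 using ff by (intro lmod_tpair_opp) (simp_all add: faithfully_flat_def)

private lemma tm_hom: "[|lmod (opp R) M; lmod (opp R) M'; f \<in> lhom R M M'|] ==> tm M' f \<in> Hom (T M) (T M')"
 by (rule tmap_Hom[OF tp tp _ lin_id])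

private lemma tm_comp:
 assumes "lmod (opp R) M" "lmod (opp R) M'" "lmod (opp R) M''" "f \<in> lhom R M M'" "g \<in> lhom R M' M''" "u <: T M"
  and "!!x. x <: M ==> g (f x) = h x"
 shows "tm M'' g (tm M' f u) = tm M'' h u"
proof -
 note a = tp[OF assms(1)] tp[OF assms(2)] tp[OF assms(3)]
 have "h \<in> lhom (opp R) M M''" by (rule lin_cong[OF lin_comp[of g _ _ _ f] assms(1,7)]) (use assms(4,5) in simp_all)
 then have h: "h \<in> lhom R M M''" by simp
 show ?thesis
  by (rule tensor_ext[OF a(1) tensor_ab[OF a(3)] Hom_comp[OF tm_hom[OF assms(1,2,4)] tm_hom[OF assms(2,3,5)]] tm_hom[OF assms(1,3) h] _ assms(6)])
   (use assms(7) lin_closed[OF assms(4)] in "simp add: tmap_pure[OF a(1) a(3) h lin_id] tmap_pure[OF a(1,2) assms(4) lin_id] tmap_pure[OF a(2,3) assms(5) lin_id]")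
qed

private lemma tm_id: "[|lmod (opp R) M; u <: T M|] ==> tm M (%x. x) u = u"
 unfolding tensor_map_def by (rule lift_id[OF tp])

private lemma ker_module:
 assumes "lmod (opp R) Y" "lmod (opp R) Z" "g \<in> lhom R Y Z"
 shows "lmod (opp R) (ker Y Z g)"
proof -
 interpret Y: left_module "opp R" Y by (rule assms)
 interpret Z: left_module "opp R" Z by (rule assms)
 show ?thesis
  by (rule Y.submodule_left_module)
   (use lin_smult[OF assms(3)] Y.smult_closed Z.smult_zero_r Hom_zero[OF Y.M.abelian_group_axioms Z.M.abelian_group_axioms lin_Hom[OF assms(3)]]
     in "auto simp: lin_add[OF assms(3)]")
qed

text \<open>Transported along the injections, the sequence \<open>ker g \<rightarrow> Y \<rightarrow> Z\<close> consists of test modules.\<close>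

private lemma flat_kernel_embedded:
 fixes \<iota> :: "'m \<Rightarrow> (nat \<Rightarrow> 'r) set" and \<kappa> :: "'p \<Rightarrow> (nat \<Rightarrow> 'r) set"
 assumes Y: "lmod (opp R) Y" and Z: "lmod (opp R) Z" and g: "g \<in> lhom R Y Z"
  and i: "inj_on \<iota> (carrier Y)" and k: "inj_on \<kappa> (carrier Z)" and u: "u <: T Y" "tm Z g u = 0\<^sub>(T Z)"
 obtains w where "w <: T (ker Y Z g)" "tm Y (%x. x) w = u"
proof -
 define Y0 where "Y0 = ker Y Z g"
 define j where "j = inv_into (carrier Y) \<iota>"
 define M1 where "M1 = transport \<iota> Y0"
 define M2 where "M2 = transport \<iota> Y"
 define M3 where "M3 = transport \<kappa> Z"
 define G where "G a = \<kappa> (g (j a))" for a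
 have Y0: "lmod (opp R) Y0" unfolding Y0_def by (rule ker_module[OF Y Z g])
 have i0: "inj_on \<iota> (carrier Y0)" using i by (auto simp: Y0_def inj_on_def)
 have ji: "j (\<iota> y) = y" if "y <: Y" for y using inv_into_f_f[OF i that] by (simp add: j_def)
 have j0: "inv_into (carrier Y0) \<iota> (\<iota> y) = j (\<iota> y)" if "y <: Y0" for y
  using inv_into_f_f[OF i0 that] that by (simp add: ji Y0_def)
 have c: "carrier M1 = \<iota> ` carrier Y0" "carrier M2 = \<iota> ` carrier Y" "0\<^sub>M3 = \<kappa> 0\<^sub>Z"
  by (simp_all add: M1_def M2_def M3_def transport_def)
 note m1 = transport_left_module[OF Y0 i0, folded M1_def, simplified] and m2 = transport_left_module[OF Y i, folded M2_def, simplified]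
  and m3 = transport_left_module[OF Z k, folded M3_def, simplified]
 have jh: "j \<in> lhom R M2 Y" using transport_hom[OF i lin_id Y] by (simp add: j_def M2_def)
 have "j \<in> lhom (opp R) M1 Y0" unfolding M1_def
  by (rule lin_cong[OF transport_hom[OF i0 lin_id Y0] m1(1)[unfolded M1_def]]) (auto simp: transport_def j0)
 then have j1: "j \<in> lhom R M1 Y0" by simp
 have I: "(%x. x) \<in> lhom R Y0 Y" by (auto simp: lmod_hom_def Y0_def)
 have "(%x. x) \<in> lhom (opp R) M1 M2"
  by (rule lin_cong[OF lin_comp[OF m2(2) lin_comp[OF I j1], folded lin_opp[of R]] m1(1)]) (auto simp: c ji Y0_def)
 then have id: "(%x. x) \<in> lhom R M1 M2" by simp
 have G: "G \<in> lhom R M2 M3" unfolding G_def[abs_def] by (rule lin_comp[OF m3(2) lin_comp[OF g jh]])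
 have "\<kappa> (g y) = \<kappa> 0\<^sub>Z \<longleftrightarrow> g y = 0\<^sub>Z" if "y <: Y" for y
  using inj_on_eq_iff[OF k] lin_closed[OF g that] abelian_groupE(2)[OF lmod_ab[OF Z]] by simp
 then have "exact_at M1 (%x. x) M2 G M3" unfolding exact_at_def c by (auto simp: G_def ji Y0_def intro!: equalityI)
 moreover have "lmod (opp R) M1 \<and> lmod (opp R) M2 \<and> lmod (opp R) M3 \<and>
   (%x. x) \<in> lhom (opp R) M1 M2 \<and> G \<in> lhom (opp R) M2 M3"
  using m1 m2 m3 id G by simp
 ultimately have ex: "exact_at (T M1) (tm M2 (%x. x)) (T M2) (tm M3 G) (T M3)"
  using ff[unfolded faithfully_flat_def, THEN conjunct2, THEN spec, THEN spec, THEN spec, THEN spec,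
    THEN spec, THEN mp] by (simp add: id_def)
 have "tm M3 G (tm M2 \<iota> u) = tm M3 (%y. \<kappa> (g y)) u"
  by (rule tm_comp[OF Y m2(1) m3(1) m2(2) G u(1)]) (simp add: G_def ji)
 also have "... = tm M3 \<kappa> (tm Z g u)" by (rule tm_comp[OF Y Z m3(1) g m3(2) u(1), symmetric]) simp
 also have "... = 0\<^sub>(T M3)"
  unfolding u(2) by (rule Hom_zero[OF tensor_ab[OF tp[OF Z]] tensor_ab[OF tp[OF m3(1)]] tm_hom[OF Z m3]])
 finally have "tm M2 \<iota> u \<in> tm M2 (%x. x) ` carrier (T M1)"
  unfolding ex[unfolded exact_at_def] using Hom_closed[OF tm_hom[OF Y m2] u(1)] by simp
 then obtain w where w: "w <: T M1" "tm M2 (%x. x) w = tm M2 \<iota> u" by (elim imageE) simp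
 have "tm Y (%x. x) (tm Y0 j w) = tm Y j w" by (rule tm_comp[OF m1(1) Y0 Y j1 I w(1)]) simp
 also have "... = tm Y j (tm M2 \<iota> u)" unfolding w(2)[symmetric] by (rule tm_comp[OF m1(1) m2(1) Y id jh w(1), symmetric]) simp
 also have "... = tm Y (%x. x) u" by (rule tm_comp[OF Y m2(1) Y m2(2) jh u(1)]) (rule ji)
 finally show thesis using that Hom_closed[OF tm_hom[OF m1(1) Y0 j1] w(1)] tm_id[OF Y u(1)] unfolding Y0_def by simp
qed

text \<open>The general case: the tensor \<open>u\<close> and the relation \<open>(g \<otimes> 1) u = 0\<close> live over finitely generated
  submodules of \<open>Y\<close> and \<open>Z\<close>, and these embed into the type of the test modules by sending an element
  to its set of representatives in a free module.\<close>

lemma flat_kernel: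
 assumes Y: "lmod (opp R) Y" and Z: "lmod (opp R) Z" and g: "g \<in> lhom R Y Z"
  and u: "u <: tensor R Y N" "tmap R Z N g (%x. x) u = 0\<^sub>(tensor R Z N)"
 shows "\<exists>w\<in>carrier (tensor R (Y\<lparr>carrier := {y \<in> carrier Y. g y = 0\<^sub>Z}\<rparr>) N).
  tmap R Y N (%x. x) (%x. x) w = u"
proof -
 interpret Y: left_module "opp R" Y by (rule Y)
 interpret Z: left_module "opp R" Z by (rule Z)
 interpret N: left_module R N using ff by (simp add: faithfully_flat_def)
 let ?F = "%S. free_Abelian_group (S \<times> carrier N)"
 obtain c where c: "c <: ?F (carrier Y)" "u = tensor_null R Y N #>\<^bsub>?F (carrier Y)\<^esub> c" using u(1) by (rule tensorE[OF tp[OF Y]])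
 let ?D = "fst ` Poly_Mapping.keys c"
 define d where "d = frag_extend (%z. frag_of (g (fst z), snd z)) c"
 note m = tensor_map_coset[OF tp[OF Y] tp[OF Z] g c(1), folded d_def c(2)]
 have d: "d \<in> tensor_null R Z N"
  by (rule tensor_coset_zero[OF tp[OF Z] conjunct1[OF m], THEN iffD1]) (use m u(2) in simp)
 obtain F0 where F0: "finite F0" "F0 \<subseteq> carrier Z" "!!S. [|F0 \<subseteq> S; S \<subseteq> carrier Z|] ==> d \<in> tensor_null R (Z\<lparr>carrier := S\<rparr>) N"
  using tensor_null_finite[OF Z.M.abelian_group_axioms _ N.M.abelian_group_axioms _ d] Z.smult_closed N.smult_closed by auto
 have D: "finite ?D" "?D \<subseteq> carrier Y" using c(1) by auto
 obtain S and \<iota> :: "_ \<Rightarrow> (nat \<Rightarrow> 'r) set" where S: "?D \<subseteq> S" "S \<subseteq> carrier Y" "lmod (opp R) (Y\<lparr>carrier := S\<rparr>)" "inj_on \<iota> S"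
  by (rule Y.finite_subset_embeds[OF D])
 have "finite (F0 \<union> g ` ?D)" "F0 \<union> g ` ?D \<subseteq> carrier Z" using F0(1,2) D lin_closed[OF g] by auto
 then obtain S' and \<kappa> :: "_ \<Rightarrow> (nat \<Rightarrow> 'r) set" where S': "F0 \<union> g ` ?D \<subseteq> S'" "S' \<subseteq> carrier Z" "lmod (opp R) (Z\<lparr>carrier := S'\<rparr>)" "inj_on \<kappa> S'"
  by (rule Z.finite_subset_embeds)
 define Y1 where "Y1 = Y\<lparr>carrier := {y \<in> S. g y \<in> S'}\<rparr>"
 define Z1 where "Z1 = Z\<lparr>carrier := S'\<rparr>"
 interpret S: left_module "opp R" "Y\<lparr>carrier := S\<rparr>" by (rule S)
 interpret Z1: left_module "opp R" Z1 unfolding Z1_def by (rule S')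
 have Sc: "x <: Y" if "x \<in> S" for x using S(2) that by blast
 have Y1: "lmod (opp R) Y1" unfolding Y1_def
  by (rule Y.submodule_left_module)
   (use S.M.zero_closed S.M.a_closed S.smult_closed Z1.M.zero_closed Z1.M.a_closed Z1.smult_closed Sc lin_smult[OF g]
      Hom_zero[OF Y.M.abelian_group_axioms Z.M.abelian_group_axioms lin_Hom[OF g]] in "auto simp: Z1_def lin_add[OF g]")
 have g1: "g \<in> lhom R Y1 Z1" using lin_add[OF g] lin_smult[OF g] Sc by (auto simp: lmod_hom_def Y1_def Z1_def)
 have I: "(%x. x) \<in> lhom R Y1 Y" "(%x. x) \<in> lhom R (ker Y1 Z1 g) (ker Y Z g)" "(%x. x) \<in> lhom R (ker Y Z g) Y"
   "(%x. x) \<in> lhom R (ker Y1 Z1 g) Y1"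
  using Sc by (auto simp: lmod_hom_def Y1_def Z1_def)
 have c1: "c <: ?F (carrier Y1)" using c(1) S(1) S'(1) by (force simp: Y1_def image_subset_iff)
 define u1 where "u1 = tensor_null R Y1 N #>\<^bsub>?F (carrier Y1)\<^esub> c"
 have u1: "u1 <: T Y1" unfolding u1_def by (rule coset_closed[OF tp[OF Y1] c1])
 note m1 = tensor_map_coset[OF tp[OF Y1] tp[OF Z1.left_module_axioms] g1 c1, folded d_def u1_def]
 have "d \<in> tensor_null R Z1 N" unfolding Z1_def by (rule F0(3)) (use S' in simp_all)
 with m1 have z: "tm Z1 g u1 = 0\<^sub>(T Z1)" using tensor_coset_zero[OF tp[OF Z1.left_module_axioms] conjunct1[OF m1]] by simp
 have i: "inj_on \<iota> (carrier Y1)" "inj_on \<kappa> (carrier Z1)" using S(4) S'(4) by (auto simp: Y1_def Z1_def inj_on_def)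
 obtain w where w: "w <: T (ker Y1 Z1 g)" "tm Y1 (%x. x) w = u1"
  by (rule flat_kernel_embedded[OF Y1 Z1.left_module_axioms g1 i u1 z])
 note k = ker_module[OF Y Z g] and k1 = ker_module[OF Y1 Z1.left_module_axioms g1]
 have "tm Y (%x. x) (tm (ker Y Z g) (%x. x) w) = tm Y (%x. x) w" by (rule tm_comp[OF k1 k Y I(2,3) w(1)]) simp
 also have "... = tm Y (%x. x) u1" unfolding w(2)[symmetric] by (rule tm_comp[OF k1 Y1 Y I(4,1) w(1), symmetric]) simp
 also have "... = u"
  using tensor_map_coset[OF tp[OF Y1] tp[OF Y] I(1) c1, folded u1_def] by (simp add: c(2) frag_expansion[symmetric])
 finally show ?thesis using Hom_closed[OF tm_hom[OF k1 k I(2)] w(1)] by blast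
qed

private lemma tm_minus: "[|lmod (opp R) Y; lmod (opp R) Z; g \<in> lhom R Y Z; u <: T Y; u' <: T Y|] ==>
  tm Z g (u \<ominus>\<^bsub>T Y\<^esub> u') = tm Z g u \<ominus>\<^bsub>T Z\<^esub> tm Z g u'"
 by (rule Hom_minus[OF tensor_ab[OF tp] tensor_ab[OF tp] tm_hom])

text \<open>An equalizer is the kernel of a difference.\<close>

lemma flat_equalizer:
 assumes Y: "lmod (opp R) Y" and Z: "lmod (opp R) Z" and f: "f \<in> lhom R Y Z" and g: "g \<in> lhom R Y Z"
  and u: "u <: tensor R Y N" "tmap R Z N f (%x. x) u = tmap R Z N g (%x. x) u"
 shows "\<exists>w\<in>carrier (tensor R (Y\<lparr>carrier := {y \<in> carrier Y. f y = g y}\<rparr>) N). tmap R Y N (%x. x) (%x. x) w = u"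
proof -
 interpret Z: left_module "opp R" Z by (rule Z)
 note Za = Z.M.abelian_group_axioms and tY = tp[OF Y] and tZ = tp[OF Z]
 interpret TZ: abelian_group "T Z" by (rule tensor_ab[OF tZ])
 let ?d = "%y. f y \<ominus>\<^bsub>Z\<^esub> g y"
 note fc = lin_closed[OF f] and gc = lin_closed[OF g]
 have d: "?d \<in> lhom R Y Z"
  by (rule linI[OF Hom_diff[OF lin_Hom[OF f] lin_Hom[OF g] Za]])
   (use fc gc lin_smult[OF f] lin_smult[OF g] Hom_minus[OF Za Za smult_Hom[OF Z]] in simp_all)
 have "tm Z ?d u = tm Z f u \<ominus>\<^bsub>T Z\<^esub> tm Z g u"
 proof (rule tensor_ext[OF tY TZ.abelian_group_axioms tm_hom[OF Y Z d] Hom_diff[OF tm_hom[OF Y Z f] tm_hom[OF Y Z g] TZ.abelian_group_axioms] _ u(1)])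
  fix y n assume n: "y <: Y" "n <: N"
  have "(%x. pt R Z N x n) \<in> Hom Z (T Z)" by (rule HomI) (use n in "simp_all add: pure_closed[OF tZ] pure_add_l[OF tZ]")
  from Hom_minus[OF Za TZ.abelian_group_axioms this, of "f y" "g y"]
  show "tm Z ?d (pt R Y N y n) = tm Z f (pt R Y N y n) \<ominus>\<^bsub>T Z\<^esub> tm Z g (pt R Y N y n)"
   using n fc gc by (simp add: tmap_pure[OF tY tZ d lin_id] tmap_pure[OF tY tZ f lin_id] tmap_pure[OF tY tZ g lin_id])
 qed
 also have "... = 0\<^sub>(T Z)" using u Hom_closed[OF tm_hom[OF Y Z g] u(1)] by (simp add: TZ.minus_eq_zero_iff)
 finally show ?thesis using flat_kernel[OF Y Z d u(1)] fc gc by (simp add: Z.M.minus_eq_zero_iff cong: conj_cong)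
qed

lemma flat_inj:
 assumes Y: "lmod (opp R) Y" and Z: "lmod (opp R) Z" and g: "g \<in> lhom R Y Z" and i: "!!y. [|y <: Y; g y = 0\<^sub>Z|] ==> y = 0\<^sub>Y"
  and u: "u <: tensor R Y N" "u' <: tensor R Y N" "tmap R Z N g (%x. x) u = tmap R Z N g (%x. x) u'"
 shows "u = u'"
proof -
 interpret TY: abelian_group "T Y" by (rule tensor_ab[OF tp[OF Y]])
 interpret TZ: abelian_group "T Z" by (rule tensor_ab[OF tp[OF Z]])
 note k = ker_module[OF Y Z g] and tk = tp[OF ker_module[OF Y Z g]] and tY = tp[OF Y]
 have I: "(%x. x) \<in> lhom R (ker Y Z g) Y" by (auto simp: lmod_hom_def)
 have z: "tm Z g (u \<ominus>\<^bsub>T Y\<^esub> u') = 0\<^sub>(T Z)"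
  using u Hom_closed[OF tm_hom[OF Y Z g] u(2)] by (simp add: tm_minus[OF Y Z g] TZ.minus_eq_zero_iff)
 obtain w where w: "w <: T (ker Y Z g)" "tm Y (%x. x) w = u \<ominus>\<^bsub>T Y\<^esub> u'"
  by (rule bexE[OF flat_kernel[OF Y Z g TY.minus_closed[OF u(1,2)] z]])
 have "tm Y (%x. x) w = 0\<^sub>(T Y)"
 proof (rule tensor_ext[OF tk TY.abelian_group_axioms tm_hom[OF k Y I] _ _ w(1)])
  show "(%_. 0\<^sub>(T Y)) \<in> Hom (T (ker Y Z g)) (T Y)" by (auto intro!: HomI)
  fix y n assume n: "y <: ker Y Z g" "n <: N"
  then have "y = 0\<^sub>Y" using i by simp
  then show "tm Y (%x. x) (pt R (ker Y Z g) N y n) = 0\<^sub>(T Y)"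
   using tmap_pure[OF tk tY I lin_id n] tensor_pure_zero(1)[OF tY abelian_groupE(2)[OF lmod_ab[OF Y]] n(2)] by simp
 qed
 then show ?thesis using w(2) u by (simp add: TY.minus_eq_zero_iff)
qed

end

section \<open>Sweedler calculus\<close>

definition trilin where
 "trilin K X Y Z P \<phi> \<longleftrightarrow> (\<forall>z\<in>carrier Z. bilin K X Y P (%x y. \<phi> x y z)) \<and>
   (\<forall>x\<in>carrier X. \<forall>y\<in>carrier Y. (%z. \<phi> x y z) \<in> lhom K Z P)"

lemma trilinI:
 assumes "!!y z. [|y <: Y; z <: Z|] ==> (%x. f x y z) \<in> lhom K X P"
  and "!!x z. [|x <: X; z <: Z|] ==> (%y. f x y z) \<in> lhom K Y P"
  and "!!x y. [|x <: X; y <: Y|] ==> (%z. f x y z) \<in> lhom K Z P"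
 shows "trilin K X Y Z P f"
 using assms by (auto simp: trilin_def bilin_def)

text \<open>Both the comodule \<open>B\<close> and \<open>H\<close> over itself are instances.\<close>

locale coaction = cring K + X: left_module K X + H: left_module K H
 for K :: "('k, 'c) ring_scheme" (structure) and X :: "('k, 'm, 'x) module_scheme"
  and H :: "('k, 'h, 'y) module_scheme" +
 fixes \<delta> :: "'m \<Rightarrow> ('m, 'h) tens" and \<Delta> :: "'h \<Rightarrow> ('h, 'h) tens"
 assumes \<delta>_lin: "\<delta> \<in> lhom K X (alg_tensor K X H)"
  and \<Delta>_lin: "\<Delta> \<in> lhom K H (alg_tensor K H H)"
  and coassociative: "b <: X ==>
   tsum (alg_tensor K (alg_tensor K X H) H)
    (%x h. pt K (alg_tensor K X H) H (\<delta> x) h) (\<delta> b) =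
   tsum (alg_tensor K (alg_tensor K X H) H)
    (%x h. tsum (alg_tensor K (alg_tensor K X H) H)
      (%h' h''. pt K (alg_tensor K X H) H (pt K X H x h') h'')
      (\<Delta> h)) (\<delta> b)"
begin

sublocale XH: kmods K X H by unfold_locales
sublocale HH: kmods K H H by unfold_locales
sublocale XHH: kmods K "alg_tensor K X H" H
 by (intro kmods.intro cring_axioms kmods_axioms.intro XH.alg_left_module H.left_module_axioms)

lemma \<delta>_closed: "b <: X ==> \<delta> b <: tensor K X H"
 using lin_closed[OF \<delta>_lin] by simp

lemma \<Delta>_closed: "h <: H ==> \<Delta> h <: tensor K H H"
 using lin_closed[OF \<Delta>_lin] by simp

text \<open>Sweedler indices may be renumbered under every trilinear map: it factors through a linear map, and
  this is evaluated on the two sides of the coassociativity law.\<close>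

lemma coassoc_apply:
 assumes P: "lmod K P" and f: "trilin K X H H P f" and b: "b <: X"
 shows "tsum P (%x h. tsum P (%x' h'. f x' h' h) (\<delta> x)) (\<delta> b) =
  tsum P (%x h. tsum P (%h' h''. f x h' h'') (\<Delta> h)) (\<delta> b)"
proof -
 let ?T = "alg_tensor K (alg_tensor K X H) H"
 let ?F = "%u h. tsum P (%x' h'. f x' h' h) u"
 note Pa = lmod_ab[OF P]
 have bil: "bilin K X H P (%x' h'. f x' h' h)" if "h <: H" for h using f that by (auto simp: trilin_def)
 have F: "bilin K (alg_tensor K X H) H P ?F"
 proof (rule bilinI)
  show "(%y. ?F x y) \<in> lhom K H P" if "x <: alg_tensor K X H" for x
   by (rule lin_lift_param[OF XH.tp P]) (use that f in "auto simp: trilin_def")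
  show "(%x. ?F x y) \<in> lhom K (alg_tensor K X H) P" if "y <: H" for y
   by (rule XH.lin_lift[OF P bil[OF that]])
 qed
 note L = XHH.lin_lift[OF P F, THEN lin_Hom, simplified]
 note Ta = tensor_ab[OF XHH.tp]
 have Fp: "tsum P ?F (pt K (alg_tensor K X H) H u h) = ?F u h"
  if "u <: tensor K X H" "h <: H" for u h
  by (rule XHH.lift_bilin_pure[OF P F]) (use that in simp_all)
 have pc: "pt K (alg_tensor K X H) H u h <: tensor K (alg_tensor K X H) H"
  if "u <: tensor K X H" "h <: H" for u h
  by (rule pure_closed[OF XHH.tp]) (use that in simp_all)
 have fc: "f x h h' <: P" if "x <: X" "h <: H" "h' <: H" for x h h'
  using bilin_closed[OF bil] that by simp
 have i: "tsum P ?F (tsum (tensor K (alg_tensor K X H) H) (%h' h''. pt K (alg_tensor K X H) H (pt K X H x h') h'') (\<Delta> h)) =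
   tsum P (%h' h''. f x h' h'') (\<Delta> h)" if x: "x <: X" "h <: H" for x h
  by (rule lift_map[OF HH.tp Ta Pa L \<Delta>_closed[OF x(2)]])
   (simp_all add: pc Fp XH.lift_bilin_pure[OF P bil] pure_closed[OF XH.tp] x)
 have "tsum P (%x h. ?F (\<delta> x) h) (\<delta> b) = tsum P ?F (tsum ?T (%x h. pt K (alg_tensor K X H) H (\<delta> x) h) (\<delta> b))"
  by (simp, rule lift_map[OF XH.tp Ta Pa L \<delta>_closed[OF b], symmetric]) (simp_all add: pc Fp \<delta>_closed)
 also have "... = tsum P (%x h. tsum P (%h' h''. f x h' h'') (\<Delta> h)) (\<delta> b)"
  unfolding coassociative[OF b]
  by (simp, rule lift_map[OF XH.tp Ta Pa L \<delta>_closed[OF b]]) (simp_all add: i lift_closed[OF HH.tp Ta \<Delta>_closed] pc pure_closed[OF XH.tp])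
 finally show ?thesis .
qed

end

lemma lift_mult:
 assumes "ring Q" "tpair R M N" "u <: tensor R M N" "a <: Q"
  and "!!x y. [|x <: M; y <: N|] ==> f x y <: Q"
 shows "a *\<^sub>Q tsum Q f u = tsum Q (%x y. a *\<^sub>Q f x y) u"
  "tsum Q f u *\<^sub>Q a = tsum Q (%x y. f x y *\<^sub>Q a) u"
proof -
 interpret Q: ring Q by (rule assms)
 show "a *\<^sub>Q tsum Q f u = tsum Q (%x y. a *\<^sub>Q f x y) u"
  by (rule lift_hom[OF assms(2) Q.is_abelian_group Q.is_abelian_group _ assms(3,5)])
    (use assms(4) in "auto intro!: HomI simp: Q.r_distr")
 show "tsum Q f u *\<^sub>Q a = tsum Q (%x y. f x y *\<^sub>Q a) u"
  by (rule lift_hom[OF assms(2) Q.is_abelian_group Q.is_abelian_group _ assms(3,5)])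
    (use assms(4) in "auto intro!: HomI simp: Q.l_distr")
qed

lemma alg_homD:
 assumes "f \<in> alg_hom K X Y"
 shows "f \<in> lhom K X Y"
  "[|x <: X; y <: X|] ==> f (x *\<^sub>X y) = f x *\<^sub>Y f y" "f 1\<^sub>X = 1\<^sub>Y"
 using assms by (auto simp: alg_hom_def ring_hom_def)

locale galois_ext = faithfully_flat_hopf_galois K H B
 for K :: "('k, 'c) ring_scheme" and H :: "('k, 'h, 'z) hopf_scheme"
  and B :: "('k, 'h, 'b, 'w) comod_alg_scheme" (structure) +
 assumes antipode_bij: "bij_betw (antipode H) (carrier H) (carrier H)"
begin

lemma K_field: "field K" by (rule field_axioms)

lemma H_alg: "k_algebra K H" by (rule k_algebra_axioms)
lemma B_alg: "k_algebra K B" by (rule B.k_algebra_axioms)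
lemma K_cring: "cring K" by (rule k_algebra_cring[OF H_alg])

lemma H_ring: "ring H" by (rule k_algebra_ring[OF H_alg])
lemma B_ring: "ring B" by (rule k_algebra_ring[OF B_alg])
lemmas Ha = ring.is_abelian_group[OF H_ring]
lemmas Ba = ring.is_abelian_group[OF B_ring]
lemmas B_assoc = monoid.m_assoc[OF ring.is_monoid[OF B_ring]]
sublocale Hm: left_module K H by (rule k_algebra_left_module[OF H_alg])
sublocale Bm: left_module K B by (rule k_algebra_left_module[OF B_alg])
sublocale BH: kalgs K B H by (intro kalgs.intro H_alg B_alg)
sublocale HH: kalgs K H H by (intro kalgs.intro H_alg)

abbreviation "\<rho> \<equiv> coact B"
abbreviation "\<Delta> \<equiv> comult H"
abbreviation "\<epsilon> \<equiv> counit H"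
abbreviation "S \<equiv> antipode H"
abbreviation "A \<equiv> coinv K H B"
abbreviation "BH \<equiv> alg_tensor K B H"
no_notation times_class.times (infixl "*" 70) and one_class.one ("1")
abbreviation multB (infixl "*" 70) where "x * y \<equiv> x \<otimes>\<^bsub>B\<^esub> y"
abbreviation oneB ("1") where "1 \<equiv> \<one>\<^bsub>B\<^esub>"
abbreviation multBH (infixl "\<bullet>" 70) where "u \<bullet> v \<equiv> u *\<^sub>(alg_tensor K B H) v"
abbreviation "BHt \<equiv> tensor K B H"
abbreviation "HHt \<equiv> tensor K H H"
abbreviation "lB \<equiv> left_reg B"
abbreviation "rB \<equiv> right_reg B"
abbreviation "HH \<equiv> alg_tensor K H H"

sublocale rho: coaction K B H \<rho> \<Delta>
 by (intro coaction.intro K_cring Bm.left_module_axioms Hm.left_module_axioms coaction_axioms.intro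
   alg_homD(1)[OF coact_hom] alg_homD(1)[OF comult_hom] coact_coassoc)

sublocale Delta: coaction K H H \<Delta> \<Delta>
 by (intro coaction.intro K_cring Hm.left_module_axioms coaction_axioms.intro
   alg_homD(1)[OF comult_hom] coassoc)

sublocale BHr: ring BH by (rule BH.alg_ring)

lemma BH_alg: "k_algebra K BH" by (rule BH.alg_k_algebra)

lemma rho_mult: "[|x <: B; y <: B|] ==> \<rho> (x * y) = \<rho> x \<bullet> \<rho> y"
 by (rule alg_homD(2)[OF coact_hom])

lemma rho_one: "\<rho> 1 = pt K B H 1 1\<^sub>H"
 using alg_homD(3)[OF coact_hom] by simp

lemma Delta_one: "\<Delta> 1\<^sub>H = pt K H H 1\<^sub>H 1\<^sub>H"
 using alg_homD(3)[OF comult_hom] by simp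

lemma rho_closed [simp]: "b <: B ==> \<rho> b <: BHt"
 by (rule rho.\<delta>_closed)

lemma Delta_closed [simp]: "h <: H ==> \<Delta> h <: HHt"
 by (rule Delta.\<delta>_closed)

lemma eps_closed [simp]: "h <: H ==> \<epsilon> h <: K"
 using counit_hom by (auto simp: ring_hom_def)

lemma S_closed [simp]: "h <: H ==> S h <: H"
 by (rule lin_closed[OF antipode_lin])

lemma BH_pure_closed [simp]: "[|x <: B; h <: H|] ==> pt K B H x h <: BHt"
 by (rule BH.pure_closed')

lemma BH_mult_closed [simp]: "[|u <: BHt; v <: BHt|] ==> u \<bullet> v <: BHt"
 using BHr.m_closed by simp

named_theorems lin_intro

lemmas [lin_intro] = lin_id
 BH.lin_pure_l BH.lin_pure_r HH.lin_pure_l HH.lin_pure_r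
 k_algebra_mult_l[OF H_alg] k_algebra_mult_r[OF H_alg] k_algebra_mult_l[OF B_alg] k_algebra_mult_r[OF B_alg]
 k_algebra_mult_l[OF BH_alg] k_algebra_mult_r[OF BH_alg]
 lin_comp[OF antipode_lin] lin_comp[OF rho.\<delta>_lin] lin_comp[OF rho.\<Delta>_lin]

lemmas BHa = tensor_ab[OF BH.tp]
lemmas BHm = BH.alg_left_module
lemma eps_one: "\<epsilon> 1\<^sub>H = 1\<^sub>K"
 using counit_hom by (auto simp: ring_hom_def)

lemma counit_apply_l:
 assumes P: "lmod K P" and f: "f \<in> lhom K H P" and h: "h <: H"
 shows "tsum P (%x y. \<epsilon> x .\<^sub>P f y) (\<Delta> h) = f h"
proof -
 have "f (tsum H (%x y. \<epsilon> x .\<^sub>H y) (\<Delta> h)) = tsum P (%x y. \<epsilon> x .\<^sub>P f y) (\<Delta> h)"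
  by (rule lift_map[OF HH.tp Ha lmod_ab[OF P] lin_Hom[OF f]]) (use h in "simp_all add: Hm.smult_closed lin_smult[OF f]")
 then show ?thesis using counit_l[OF h] by simp
qed

end

lemma reg_simps [simp]:
 "carrier (left_reg R) = carrier R" "add (left_reg R) = add R" "0\<^sub>(left_reg R) = 0\<^sub>R" "smult (left_reg R) = (%a b. a \<otimes>\<^bsub>R\<^esub> b)"
 "carrier (right_reg R) = carrier R" "add (right_reg R) = add R" "0\<^sub>(right_reg R) = 0\<^sub>R" "smult (right_reg R) = (%a b. b \<otimes>\<^bsub>R\<^esub> a)"
 by (simp_all add: left_reg_def right_reg_def)

context galois_ext
begin

section \<open>The coinvariants and tensor products over them\<close>

lemma A_simps [simp]:
 "add A = add B" "0\<^sub>A = \<zero>" "monoid.mult A = monoid.mult B" "1\<^sub>A = 1" "smult A = smult B"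
 by (simp_all add: coinv_def)

lemma A_carrier: "a <: A \<longleftrightarrow> a <: B \<and> \<rho> a = pt K B H a 1\<^sub>H"
 by (simp add: coinv_def)

lemma A_B [simp]: "a <: A ==> a <: B" by (simp add: A_carrier)
lemma rho_A: "a <: A ==> \<rho> a = pt K B H a 1\<^sub>H" by (simp add: A_carrier)

lemma A_lmod: "lmod A lB"
 using faithfully_flat by (simp add: faithfully_flat_def)

lemma A_ring: "ring A" using A_lmod by (simp add: left_module_def)

lemma A_smult_one: "c <: K ==> c \<odot> 1 <: A"
 by (simp add: A_carrier Bm.smult_closed lin_smult[OF rho.\<delta>_lin] rho_one BH.alg_smult_pure)

lemma A_rmod: "lmod (opp A) rB"
 by (intro left_module.intro left_module_axioms.intro opp_ring A_ring)
   (auto simp: Ba abelian_group_cong[of "rB" B] B.r_distr B.l_distr B_assoc)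

abbreviation "V M \<equiv> tensor A M lB"
abbreviation "pA M \<equiv> pt A M lB"

lemma tpA: "lmod (opp A) M ==> tpair A M lB"
 by (rule lmod_tpair_opp[OF _ A_lmod])

text \<open>Since \<open>M\<close> is only a right \<open>A\<close>-module, the scalars act through the factor \<open>B\<close>.\<close>

definition kV :: "('b, 'm, 'x) module_scheme \<Rightarrow> ('k, ('m, 'b) tens) module" where
 "kV M = with_action (V M) (%c. tmap A M lB (%x. x) (%b. c \<odot> b))"

lemma kV_simps [simp]: "carrier (kV M) = carrier (V M)" "add (kV M) = add (V M)" "0\<^sub>(kV M) = 0\<^sub>(V M)"
 "tsum (kV M) = tsum (V M)" "Hom (kV M) P = Hom (V M) P" "Hom P (kV M) = Hom P (V M)"
 by (simp_all add: kV_def Hom_def)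

lemma smult_lmod_hom: "c <: K ==> (%b. c \<odot> b) \<in> lhom A lB lB"
 by (auto simp: lmod_hom_def Bm.smult_closed Bm.smult_r_distr B.smult_mult_r)

lemma kV_pure: "[|lmod (opp A) M; c <: K; m <: M; b <: B|] ==>
  c .\<^sub>(kV M) pA M m b = pA M m (c \<odot> b)"
 unfolding kV_def by (simp add: tmap_pure[OF tpA tpA lin_id smult_lmod_hom])

lemma kV_Hom: "[|lmod (opp A) M; c <: K|] ==> smult (kV M) c \<in> Hom (V M) (V M)"
 unfolding kV_def by (simp, rule tmap_Hom[OF tpA tpA lin_id smult_lmod_hom])

lemma kV_left_module:
 assumes M: "lmod (opp A) M" shows "lmod K (kV M)"
 by (rule tensor_left_module[OF tpA[OF M] cring.axioms(1)[OF K_cring]])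
  (simp_all add: kV_Hom[OF M] kV_pure[OF M] Bm.smult_closed Bm.smult_l_distr Bm.smult_assoc1 Bm.smult_one
   pure_add_r[OF tpA[OF M], simplified] cring.cring_simprules(1,5,6)[OF K_cring])

lemma lin_pA_r [lin_intro]:
 assumes "lmod (opp A) M" "f \<in> lhom K Z B" "m <: M"
 shows "(%z. pA M m (f z)) \<in> lhom K Z (kV M)"
 using assms(2,3) unfolding lmod_hom_def
 by (auto simp: Pi_iff pure_closed[OF tpA[OF assms(1)]] pure_add_r[OF tpA[OF assms(1)], simplified] kV_pure[OF assms(1)])

lemma lin_pA_l:
 assumes M: "lmod (opp A) M" and f: "f \<in> Hom Z M" and b: "b <: B"
  and s: "!!c z. [|c <: K; z <: Z|] ==> f (c .\<^sub>Z z) = (c \<odot> 1) .\<^sub>M f z"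
 shows "(%z. pA M (f z) b) \<in> lhom K Z (kV M)"
proof (rule linI)
 note t = tpA[OF M]
 show "(%z. pA M (f z) b) \<in> Hom Z (kV M)"
  by (rule HomI) (use b in "simp_all add: Hom_add[OF f] Hom_closed[OF f] pure_closed[OF t] pure_add_l[OF t]")
 fix c z assume c: "c <: K" "z <: Z"
 have "pA M ((c \<odot> 1) .\<^sub>M f z) b = pA M (f z) (c \<odot> b)"
  using pure_move[OF t A_smult_one[OF c(1)] Hom_closed[OF f c(2)], of b] b c by (simp add: B.smult_mult_l)
 then show "pA M (f (c .\<^sub>Z z)) b = c .\<^sub>(kV M) pA M (f z) b"
  using b c by (simp add: s kV_pure[OF M] Hom_closed[OF f])
qed

abbreviation "BAB \<equiv> V rB"
abbreviation "pBAB \<equiv> pA rB"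

lemmas tpBAB = tpA[OF A_rmod]
lemmas BABa = tensor_ab[OF tpBAB]
lemmas kBABm = kV_left_module[OF A_rmod]

lemma pBAB_closed [simp]: "[|x <: B; y <: B|] ==> pBAB x y <: BAB"
 by (rule pure_closed[OF tpBAB]) simp_all

lemma lin_pBAB_l [lin_intro]:
 assumes f: "f \<in> lhom K Z B" and b: "b <: B"
 shows "(%z. pBAB (f z) b) \<in> lhom K Z (kV rB)"
proof (rule lin_pA_l[OF A_rmod _ b])
 show "f \<in> Hom Z rB" using lin_Hom[OF f] by (simp add: Hom_def)
qed (simp add: lin_smult[OF f] lin_closed[OF f] B.smult_mult_r)

section \<open>The Galois map and the translation map\<close>

abbreviation "pBH \<equiv> pt K B H"
abbreviation "\<beta> \<equiv> galois_map K H B"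
abbreviation "\<tau> \<equiv> translation K H B"

lemma BH_mult_pure_left:
 assumes b: "b <: B" and u: "u <: BHt"
 shows "tsum BHt (%x h. pBH (b * x) h) u = pBH b 1\<^sub>H \<bullet> u"
proof -
 have f: "(%u. pBH b 1\<^sub>H \<bullet> u) \<in> Hom BHt BHt"
  using BH.mult_lin_r[THEN lin_Hom] b by simp
 have "pBH b 1\<^sub>H \<bullet> u = tsum BHt (%x h. pBH b 1\<^sub>H \<bullet> pBH x h) u"
  by (rule tensor_Hom_lift[OF BH.tp BHa f u])
 also have "... = tsum BHt (%x h. pBH (b * x) h) u"
  by (rule lift_cong[OF BH.tp u]) (use b in "auto simp: BH.mult_pure")
 finally show ?thesis by simp
qed

lemma BH_pure_add_l: "[|x <: B; y <: B; h <: H|] ==>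
  pBH (x \<oplus> y) h = pBH x h +\<^sub>BHt pBH y h"
 by (rule pure_add_l[OF BH.tp])

lemma BH_distrib:
 assumes "u <: BHt" "v <: BHt" "w <: BHt"
 shows "u \<bullet> (v +\<^sub>BHt w) = u \<bullet> v +\<^sub>BHt u \<bullet> w"
  "(u +\<^sub>BHt v) \<bullet> w = u \<bullet> w +\<^sub>BHt v \<bullet> w"
 using BHr.r_distr[of v w u] BHr.l_distr[of u v w] assms by simp_all

lemma BH_assoc:
 assumes "u <: BHt" "v <: BHt" "w <: BHt"
 shows "u \<bullet> v \<bullet> w = u \<bullet> (v \<bullet> w)"
 using BHr.m_assoc assms by simp

lemma BH_one: "u <: BHt ==> pBH 1 1\<^sub>H \<bullet> u = u"
 "u <: BHt ==> u \<bullet> pBH 1 1\<^sub>H = u"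
 using BHr.l_one BHr.r_one by simp_all

lemmas BH_lift_mult = lift_mult[OF BHr.ring_axioms, unfolded tens_lift_alg_tensor alg_tensor_simps]

lemma rho_add: "[|x <: B; y <: B|] ==> \<rho> (x \<oplus> y) = \<rho> x +\<^sub>BHt \<rho> y"
 using lin_add[OF rho.\<delta>_lin] by simp

lemma beta_eq: "u <: BAB ==> \<beta> u = tsum BHt (%b b'. pBH b 1\<^sub>H \<bullet> \<rho> b') u"
 unfolding galois_map_def tens_lift_alg_tensor
 by (rule lift_cong[OF tpBAB]) (auto simp: BH_mult_pure_left)

lemma beta_balanced: "balanced A rB lB BHt (%b b'. pBH b 1\<^sub>H \<bullet> \<rho> b')"
proof (rule balancedI)
 fix r x y assume "r <: A" "x <: rB" "y <: lB"
 then show "pBH (r .\<^sub>rB x) 1\<^sub>H \<bullet> \<rho> y = pBH x 1\<^sub>H \<bullet> \<rho> (r .\<^sub>lB y)"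
  by (simp add: rho_mult rho_A BH_assoc[symmetric] BH.mult_pure)
qed (simp_all add: BH_pure_add_l BH_distrib rho_add)

lemma beta_Hom: "\<beta> \<in> Hom BAB BHt"
 by (rule Hom_cong[OF lift_Hom[OF tpBAB BHa beta_balanced] BABa]) (simp add: beta_eq)

lemma beta_pure: "[|b <: B; b' <: B|] ==> \<beta> (pBAB b b') = pBH b 1\<^sub>H \<bullet> \<rho> b'"
 using lift_pure[OF tpBAB BHa beta_balanced] by (simp add: beta_eq)

lemma beta_bij: "bij_betw \<beta> (carrier BAB) (carrier BHt)"
 using galois by (simp add: tensor_BAB_def)

lemma beta_inj: "[|u <: BAB; v <: BAB; \<beta> u = \<beta> v|] ==> u = v"
 using beta_bij by (auto simp: bij_betw_def inj_on_def)

lemma beta_closed [simp]: "u <: BAB ==> \<beta> u <: BHt"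
 by (rule Hom_closed[OF beta_Hom])

lemma tau_closed [simp]: "h <: H ==> \<tau> h <: BAB"
 and beta_tau: "h <: H ==> \<beta> (\<tau> h) = pBH 1 h"
proof -
 assume "h <: H"
 then have "pBH 1 h \<in> \<beta> ` carrier BAB" using beta_bij by (simp add: bij_betw_def)
 then show "\<tau> h <: BAB" "\<beta> (\<tau> h) = pBH 1 h"
  unfolding translation_def tensor_BAB_def by (auto intro: inv_into_into f_inv_into_f)
qed

lemma tau_one: "\<tau> 1\<^sub>H = pBAB 1 1"
 by (rule beta_inj) (simp_all add: beta_tau beta_pure rho_one BH_one)

lemma beta_lin: "\<beta> \<in> lhom K (kV rB) BH"
proof (rule linI)
 show "\<beta> \<in> Hom (kV rB) BH" using beta_Hom by simp
 fix c u assume c: "c <: K" and u: "u <: kV rB"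
 show "\<beta> (c .\<^sub>(kV rB) u) = c .\<^sub>BH \<beta> u"
 proof (rule tensor_ext[OF tpBAB BHa Hom_comp[OF kV_Hom[OF A_rmod c] beta_Hom] Hom_comp[OF beta_Hom BH.alg_smult_Hom[OF c]]])
  show "u <: BAB" using u by simp
  fix x y assume "x <: rB" "y <: lB"
  then show "\<beta> (c .\<^sub>(kV rB) pBAB x y) = c .\<^sub>BH \<beta> (pBAB x y)"
   using c lin_smult[OF BH.mult_lin_r, of "pBH x 1\<^sub>H" c "\<rho> y"]
   by (simp add: kV_pure[OF A_rmod] beta_pure Bm.smult_closed lin_smult[OF rho.\<delta>_lin])
 qed
qed

lemma tau_lin: "\<tau> \<in> lhom K H (kV rB)"
proof (rule linI[OF HomI])
 interpret V: left_module K "kV rB" by (rule kBABm)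
 fix x y assume h: "x <: H" "y <: H"
 show "\<tau> x <: kV rB" using h by simp
 have "\<tau> (x +\<^sub>H y) = \<tau> x +\<^sub>BAB \<tau> y"
 proof (rule beta_inj)
  show "\<tau> x +\<^sub>BAB \<tau> y <: BAB" using h abelian_groupE(1)[OF BABa] by simp
  show "\<beta> (\<tau> (x +\<^sub>H y)) = \<beta> (\<tau> x +\<^sub>BAB \<tau> y)"
   using h by (simp add: Hom_add[OF beta_Hom] beta_tau pure_add_r[OF BH.tp])
 qed (use h in simp)
 then show "\<tau> (x +\<^sub>H y) = \<tau> x +\<^sub>(kV rB) \<tau> y" by simp
next
 interpret V: left_module K "kV rB" by (rule kBABm)
 fix c h assume h: "c <: K" "h <: H"
 show "\<tau> (c .\<^sub>H h) = c .\<^sub>(kV rB) \<tau> h"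
 proof (rule beta_inj)
  show "c .\<^sub>(kV rB) \<tau> h <: BAB" using V.smult_closed[OF h(1), of "\<tau> h"] h by simp
  show "\<beta> (\<tau> (c .\<^sub>H h)) = \<beta> (c .\<^sub>(kV rB) \<tau> h)"
   using h lin_smult[OF beta_lin, of c "\<tau> h"]
   by (simp add: beta_tau Hm.smult_closed BH.alg_smult_pure_r)
 qed (use h in "simp add: Hm.smult_closed")
qed

abbreviation "lm x u \<equiv> tsum BAB (%l r. pBAB (x * l) r) u"
abbreviation "rm u y \<equiv> tsum BAB (%l r. pBAB l (r * y)) u"

lemma beta_lmul:
 assumes x: "x <: B" and u: "u <: BAB"
 shows "\<beta> (lm x u) = pBH x 1\<^sub>H \<bullet> \<beta> u"
proof -
 have "\<beta> (lm x u) = tsum BHt (%l r. pBH x 1\<^sub>H \<bullet> (pBH l 1\<^sub>H \<bullet> \<rho> r)) u"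
  by (rule lift_map[OF tpBAB BABa BHa beta_Hom u]) (use x in "simp_all add: beta_pure BH_assoc[symmetric] BH.mult_pure")
 then show ?thesis
  using x u BH_lift_mult(1)[OF tpBAB u, of "pBH x 1\<^sub>H" "%b b'. pBH b 1\<^sub>H \<bullet> \<rho> b'"] by (simp add: beta_eq)
qed

lemma beta_rmul:
 assumes y: "y <: B" and u: "u <: BAB"
 shows "\<beta> (rm u y) = \<beta> u \<bullet> \<rho> y"
proof -
 have "\<beta> (rm u y) = tsum BHt (%l r. (pBH l 1\<^sub>H \<bullet> \<rho> r) \<bullet> \<rho> y) u"
  by (rule lift_map[OF tpBAB BABa BHa beta_Hom u]) (use y in "simp_all add: beta_pure BH_assoc rho_mult")
 then show ?thesis
  using y u BH_lift_mult(2)[OF tpBAB u, of "\<rho> y" "%b b'. pBH b 1\<^sub>H \<bullet> \<rho> b'"] by (simp add: beta_eq)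
qed

lemma BAB_lift_closed:
 "[|tpair R M N; u <: tensor R M N; !!x y. [|x <: M; y <: N|] ==> f x y <: BAB|] ==>
  tsum BAB f u <: BAB"
 by (rule lift_closed[OF _ BABa])

lemma BAB_lmul_closed: "[|x <: B; u <: BAB|] ==> lm x u <: BAB"
 by (rule BAB_lift_closed[OF tpBAB]) simp_all

lemma BAB_rmul_closed: "[|y <: B; u <: BAB|] ==> rm u y <: BAB"
 by (rule BAB_lift_closed[OF tpBAB]) simp_all

text \<open>\<open>\<Sum> l b\<^sub>(\<^sub>0\<^sub>) l(b\<^sub>(\<^sub>1\<^sub>)) \<otimes> r(b\<^sub>(\<^sub>1\<^sub>)) = l \<otimes> b\<close>, as \<open>\<beta>\<close> sends both sides to \<open>\<Sum> l b\<^sub>(\<^sub>0\<^sub>) \<otimes> b\<^sub>(\<^sub>1\<^sub>)\<close>.\<close>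

lemma translation_absorb_left:
 assumes l: "l <: B" and b: "b <: B"
 shows "tsum BAB (%x h. lm (l * x) (\<tau> h)) (\<rho> b) = pBAB l b"
proof (rule beta_inj)
 show "tsum BAB (%x h. lm (l * x) (\<tau> h)) (\<rho> b) <: BAB"
  by (intro BAB_lift_closed[OF BH.tp] BAB_lmul_closed) (use l b in auto)
 have "\<beta> (tsum BAB (%x h. lm (l * x) (\<tau> h)) (\<rho> b)) = tsum BHt (%x h. pBH (l * x) h) (\<rho> b)" (is "?a = _")
  by (rule lift_map[OF BH.tp BABa BHa beta_Hom]) (use l b in "simp_all add: BAB_lmul_closed beta_lmul beta_tau BH.mult_pure")
 also have "... = \<beta> (pBAB l b)" using l b by (simp add: BH_mult_pure_left beta_pure)
 finally show "?a = ..." .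
qed (use l b in simp)

lemma translation_absorb: "b <: B ==> tsum BAB (%x h. lm x (\<tau> h)) (\<rho> b) = pBAB 1 b"
 by (subst translation_absorb_left[symmetric], simp, simp, rule lift_cong[OF BH.tp]) (simp_all add: BAB_lmul_closed)

text \<open>\<open>\<Sum> y\<^sub>(\<^sub>0\<^sub>) l(h y\<^sub>(\<^sub>1\<^sub>)) \<otimes> r(h y\<^sub>(\<^sub>1\<^sub>)) = \<Sum> l(h) \<otimes> r(h) y\<close>, as \<open>\<beta>\<close> sends both sides to \<open>\<Sum> y\<^sub>(\<^sub>0\<^sub>) \<otimes> h y\<^sub>(\<^sub>1\<^sub>)\<close>.\<close>

lemma translation_absorb_right:
 assumes y: "y <: B" and h: "h <: H"
 shows "tsum BAB (%x g. lm x (\<tau> (h *\<^sub>H g))) (\<rho> y) =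
  rm (\<tau> h) y"
proof (rule beta_inj)
 show "tsum BAB (%x g. lm x (\<tau> (h *\<^sub>H g))) (\<rho> y) <: BAB"
  by (intro BAB_lift_closed[OF BH.tp] BAB_lmul_closed) (use y h in auto)
 show "rm (\<tau> h) y <: BAB"
  by (rule BAB_rmul_closed) (use y h in auto)
 have "\<beta> (tsum BAB (%x g. lm x (\<tau> (h *\<^sub>H g))) (\<rho> y)) = tsum BHt (%x g. pBH 1 h \<bullet> pBH x g) (\<rho> y)" (is "?a = _")
  by (rule lift_map[OF BH.tp BABa BHa beta_Hom]) (use y h in "simp_all add: BAB_lmul_closed beta_lmul beta_tau BH.mult_pure")
 also have "... = pBH 1 h \<bullet> \<rho> y"
  using y h BH_lift_mult(1)[OF BH.tp, of "\<rho> y" "pBH 1 h" pBH] by (simp add: lift_id[OF BH.tp])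
 also have "... = \<beta> (rm (\<tau> h) y)"
  using y h by (simp add: beta_rmul beta_tau)
 finally show "?a = ..." .
qed

text \<open>\<open>\<Sum> l(h) r(h) = \<epsilon>(h)\<close> results from \<open>\<Sum> l(h) r(h)\<^sub>(\<^sub>0\<^sub>) \<otimes> r(h)\<^sub>(\<^sub>1\<^sub>) = 1 \<otimes> h\<close> by the counit.\<close>

lemma translation_mult:
 assumes h: "h <: H"
 shows "tsum B (%l r. l * r) (\<tau> h) = \<epsilon> h \<odot> 1"
proof -
 let ?e = "tsum B (%x h. \<epsilon> h \<odot> x)"
 have b: "bilin K B H B (%x h. \<epsilon> h \<odot> x)"
  by (rule bilinI; rule linI[OF HomI])
    (use counit_hom in "auto simp: ring_hom_def Bm.smult_closed Bm.smult_l_distr Bm.smult_r_distr counit_smult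
     Bm.smult_assoc1[symmetric] cring.cring_simprules(14)[OF K_cring]")
 have L: "?e \<in> Hom BHt B"
  using BH.lin_lift[OF Bm.left_module_axioms b, THEN lin_Hom] by simp
 have ep: "?e (pBH x g) = \<epsilon> g \<odot> x" if "x <: B" "g <: H" for x g
  by (rule BH.lift_bilin_pure[OF Bm.left_module_axioms b that])
 have em: "?e (pBH x 1\<^sub>H \<bullet> u) = x * ?e u" if x: "x <: B" and u: "u <: BHt" for x u
 proof (rule tensor_ext[OF BH.tp Ba _ _ _ u])
  show "(%u. ?e (pBH x 1\<^sub>H \<bullet> u)) \<in> Hom BHt B"
   using Hom_comp[OF BH.mult_lin_r[THEN lin_Hom, simplified] L] x by simp
  have "(%b. x * b) \<in> Hom B B" using x by (auto intro!: HomI simp: B.r_distr)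
  from Hom_comp[OF L this] show "(%u. x * ?e u) \<in> Hom BHt B" .
 qed (use x in "simp add: BH.mult_pure ep B.smult_mult_r")
 have "?e (\<beta> (\<tau> h)) = tsum B (%l r. l * r) (\<tau> h)"
  unfolding beta_eq[OF tau_closed[OF h]] by (rule lift_map[OF tpBAB BHa Ba L tau_closed[OF h]]) (simp_all add: em coact_counit)
 then show ?thesis using h by (simp add: beta_tau ep)
qed

end

context galois_ext
begin

lemmas rho_cong = lift_cong[OF BH.tp rho_closed] and rho_hom = lift_hom[OF BH.tp _ _ _ rho_closed]
 and rho_map = lift_map[OF BH.tp _ _ _ rho_closed] and rho_sum_closed = lift_closed[OF BH.tp _ rho_closed]
lemmas Delta_cong = lift_cong[OF HH.tp Delta_closed] and Delta_hom = lift_hom[OF HH.tp _ _ _ Delta_closed]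
 and Delta_map = lift_map[OF HH.tp _ _ _ Delta_closed]
lemmas tau_cong = lift_cong[OF tpBAB tau_closed, unfolded reg_simps] and tau_hom = lift_hom[OF tpBAB _ _ _ tau_closed, unfolded reg_simps]
 and tau_map = lift_map[OF tpBAB _ _ _ tau_closed, unfolded reg_simps] and tau_sum_closed = lift_closed[OF tpBAB _ tau_closed, unfolded reg_simps]

lemma coact_counit_pure:
 assumes b: "b <: B" and h: "h <: H"
 shows "tsum BHt (%x g. pBH x (\<epsilon> g .\<^sub>H h)) (\<rho> b) = pBH b h"
proof -
 have f: "(%x. pBH x h) \<in> Hom B BHt"
  using h by (auto intro!: HomI simp: BH_pure_add_l)
 have "tsum BHt (%x g. pBH x (\<epsilon> g .\<^sub>H h)) (\<rho> b) =
   tsum BHt (%x g. pBH (\<epsilon> g \<odot> x) h) (\<rho> b)"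
  by (rule rho_cong[OF b]) (use h pure_move[OF BH.tp] in "auto simp: Hm.smult_closed")
 also have "... = pBH (tsum B (%x g. \<epsilon> g \<odot> x) (\<rho> b)) h"
  by (rule lift_hom[OF BH.tp Ba BHa f, symmetric]) (use b in "auto simp: Bm.smult_closed")
 finally show ?thesis using b by (simp add: coact_counit)
qed

lemma lin_lift_BH_Delta [lin_intro]:
 assumes "lmod K P" "h <: H"
  and "!!y z. [|y <: H; z <: H|] ==> (%x. f x y z) \<in> lhom K X P"
 shows "(%x. tsum P (f x) (\<Delta> h)) \<in> lhom K X P"
 by (rule lin_lift_param[OF HH.tp assms(1)]) (use assms in auto)

lemma lin_lift_BH_rho [lin_intro]:
 assumes "lmod K P" "h <: B"
  and "!!y z. [|y <: B; z <: H|] ==> (%x. f x y z) \<in> lhom K X P"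
 shows "(%x. tsum P (f x) (\<rho> h)) \<in> lhom K X P"
 by (rule lin_lift_param[OF BH.tp assms(1)]) (use assms in auto)

lemma rho_expand:
 assumes P: "abgrp P" and f: "f \<in> Hom BHt P" and l: "l <: B" and r: "r <: B"
 shows "f (pBH l 1\<^sub>H \<bullet> \<rho> r) = tsum P (%x g. f (pBH (l * x) g)) (\<rho> r)"
 using rho_hom[OF BHa P f r, of "%x g. pBH (l * x) g"] l r
 by (simp add: BH_mult_pure_left)

lemma tau_expand:
 assumes P: "abgrp P" and f: "f \<in> Hom BHt P" and h: "h <: H"
 shows "tsum P (%l r. f (pBH l 1\<^sub>H \<bullet> \<rho> r)) (\<tau> h) = f (pBH 1 h)"
 using tau_hom[OF BHa P f h, of "%l r. pBH l 1\<^sub>H \<bullet> \<rho> r"] h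
 by (simp add: beta_eq[symmetric] beta_tau)

lemma pBH_Hom_r: "x <: B ==> (%h. pBH x h) \<in> Hom H BHt"
 by (auto intro!: HomI simp: pure_add_r[OF BH.tp])

lemma pBH_mult_l: "[|x <: B; y <: B|] ==> pBH (x * y) 1\<^sub>H = pBH x 1\<^sub>H \<bullet> pBH y 1\<^sub>H"
 by (simp add: BH.mult_pure)

lemma rho_mult_pure:
 assumes y: "y <: B" and k: "k <: H"
 shows "\<rho> y \<bullet> pBH 1 k = tsum BHt (%x g. pBH x (g *\<^sub>H k)) (\<rho> y)"
  and "pBH 1 k \<bullet> \<rho> y = tsum BHt (%x g. pBH x (k *\<^sub>H g)) (\<rho> y)"
proof -
 have u: "tsum BHt pBH (\<rho> y) = \<rho> y" using y by (simp add: lift_id[OF BH.tp])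
 have "tsum BHt pBH (\<rho> y) \<bullet> pBH 1 k = tsum BHt (%x g. pBH x (g *\<^sub>H k)) (\<rho> y)"
  "pBH 1 k \<bullet> tsum BHt pBH (\<rho> y) = tsum BHt (%x g. pBH x (k *\<^sub>H g)) (\<rho> y)"
  by (rule rho_map[OF BHa BHa _ y]; use BH.mult_lin_l[THEN lin_Hom] BH.mult_lin_r[THEN lin_Hom] k in "simp add: BH.mult_pure")+
 then show "\<rho> y \<bullet> pBH 1 k = tsum BHt (%x g. pBH x (g *\<^sub>H k)) (\<rho> y)"
  "pBH 1 k \<bullet> \<rho> y = tsum BHt (%x g. pBH x (k *\<^sub>H g)) (\<rho> y)" by (simp_all only: u)
qed

section \<open>The antipode and the translation map\<close>

text \<open>Two consecutive Sweedler components cancel when \<open>F\<close> takes \<open>\<Delta>(g)\<close> to \<open>\<epsilon>(g)\<close>; this is applied to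
  \<open>k S(g)\<close> and to \<open>S\<^sup>-\<^sup>1(g) k\<close>.\<close>

lemma coact_cancel:
 assumes F: "bilin K H H H F" and x: "x <: B"
  and e: "!!y g. [|y <: B; g <: H|] ==> tsum BHt (%k k'. pBH y (F k k')) (\<Delta> g) = pBH y (\<epsilon> g .\<^sub>H 1\<^sub>H)"
 shows "tsum BHt (%y g. tsum BHt (%y' k. pBH y' (F k g)) (\<rho> y)) (\<rho> x) = pBH x 1\<^sub>H"
proof -
 have tri: "trilin K B H H BH (%y k g. pBH y (F k g))"
  using F bilin_closed[OF F] by (intro trilinI lin_intro) (auto simp: bilin_def)
 have "tsum BHt (%y g. tsum BHt (%k k'. pBH y (F k k')) (\<Delta> g)) (\<rho> x) = tsum BHt (%y g. pBH y (\<epsilon> g .\<^sub>H 1\<^sub>H)) (\<rho> x)"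
  by (rule rho_cong[OF x]) (rule e)
 then show ?thesis using rho.coassoc_apply[OF BHm tri x] x by (simp add: coact_counit_pure)
qed

text \<open>\<open>\<Sum> x\<^sub>(\<^sub>0\<^sub>) \<otimes> x\<^sub>(\<^sub>1\<^sub>) S(x\<^sub>(\<^sub>2\<^sub>)) = x \<otimes> 1\<close>\<close>

lemma coact_antipode:
 assumes x: "x <: B"
 shows "tsum BHt (%y g. \<rho> y \<bullet> pBH 1 (S g)) (\<rho> x) = pBH x 1\<^sub>H"
proof -
 have b: "bilin K H H H (%k g. k *\<^sub>H S g)" by (intro bilinI lin_intro) auto
 have "tsum BHt (%y g. \<rho> y \<bullet> pBH 1 (S g)) (\<rho> x) = tsum BHt (%y g. tsum BHt (%y' k. pBH y' (k *\<^sub>H S g)) (\<rho> y)) (\<rho> x)"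
  by (rule rho_cong[OF x]) (simp add: rho_mult_pure)
 also have "... = pBH x 1\<^sub>H"
 proof (rule coact_cancel[OF b x])
  fix y g assume y: "y <: B" "g <: H"
  show "tsum BHt (%k k'. pBH y (k *\<^sub>H S k')) (\<Delta> g) = pBH y (\<epsilon> g .\<^sub>H 1\<^sub>H)"
   using y Delta_hom[OF Ha BHa pBH_Hom_r[OF y(1)] y(2), of "%k k'. k *\<^sub>H S k'"] by (simp add: antipode_r)
 qed
 finally show ?thesis .
qed

text \<open>\<open>\<Sum> l(h)\<^sub>(\<^sub>0\<^sub>) r(h) \<otimes> l(h)\<^sub>(\<^sub>1\<^sub>) = 1 \<otimes> S(h)\<close>: apply \<open>b \<otimes> k \<mapsto> \<rho>(b) (1 \<otimes> S(k))\<close> to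
  \<open>\<Sum> l r\<^sub>(\<^sub>0\<^sub>) \<otimes> r\<^sub>(\<^sub>1\<^sub>) = 1 \<otimes> h\<close>.\<close>

lemma translation_coact_left:
 assumes h: "h <: H"
 shows "tsum BHt (%l r. \<rho> l \<bullet> pBH r 1\<^sub>H) (\<tau> h) = pBH 1 (S h)"
proof -
 define f where "f = tsum BH (%b k. \<rho> b \<bullet> pBH 1 (S k))"
 have b: "bilin K B H BH (%b k. \<rho> b \<bullet> pBH 1 (S k))" by (intro bilinI lin_intro) auto
 have f: "f \<in> Hom BHt BHt" using BH.lin_lift[OF BHm b, THEN lin_Hom] by (simp add: f_def)
 have fp: "f (pBH x k) = \<rho> x \<bullet> pBH 1 (S k)" if "x <: B" "k <: H" for x k
  unfolding f_def by (rule BH.lift_bilin_pure[OF BHm b that])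
 have "\<rho> l \<bullet> pBH r 1\<^sub>H = f (pBH l 1\<^sub>H \<bullet> \<rho> r)" if l: "l <: B" and r: "r <: B" for l r
 proof -
  have "f (pBH l 1\<^sub>H \<bullet> \<rho> r) = tsum BHt (%x g. \<rho> l \<bullet> (\<rho> x \<bullet> pBH 1 (S g))) (\<rho> r)"
   unfolding rho_expand[OF BHa f l r] by (rule rho_cong[OF r]) (use l Hom_closed[OF f] in "simp_all add: fp rho_mult BH_assoc")
  also have "... = \<rho> l \<bullet> pBH r 1\<^sub>H"
   using BH_lift_mult(1)[OF BH.tp, of "\<rho> r" "\<rho> l" "%x g. \<rho> x \<bullet> pBH 1 (S g)"] l r by (simp add: coact_antipode)
  finally show ?thesis by simp
 qed
 then have "tsum BHt (%l r. \<rho> l \<bullet> pBH r 1\<^sub>H) (\<tau> h) = tsum BHt (%l r. f (pBH l 1\<^sub>H \<bullet> \<rho> r)) (\<tau> h)"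
  by (intro tau_cong[OF h]) (use Hom_closed[OF f] in simp_all)
 also have "... = pBH 1 (S h)"
  unfolding tau_expand[OF BHa f h] using h by (simp add: fp rho_one BH_one)
 finally show ?thesis .
qed

text \<open>The antipode reverses products, at least in \<open>1 \<otimes> H \<subseteq> B \<otimes> H\<close>, because
  \<open>\<tau>(g h) = \<Sum> l(h) l(g) \<otimes> r(g) r(h)\<close>.\<close>

lemma antipode_mult_pure:
 assumes g: "g <: H" and h: "h <: H"
 shows "pBH 1 (S (g *\<^sub>H h)) = pBH 1 (S h) \<bullet> pBH 1 (S g)"
proof -
 let ?f = "%l r. \<rho> l \<bullet> pBH r 1\<^sub>H" and ?w = "%x y. tsum BAB (%l r. pBAB (x * l) (r * y)) (\<tau> g)"
 have bal: "balanced A rB lB BHt ?f"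
 proof (rule balancedI)
  fix a x y assume "a <: A" "x <: rB" "y <: lB"
  then show "\<rho> (a .\<^sub>rB x) \<bullet> pBH y 1\<^sub>H = \<rho> x \<bullet> pBH (a .\<^sub>lB y) 1\<^sub>H"
   by (simp add: rho_mult rho_A BH_assoc BH.mult_pure)
 qed (simp_all add: BH_pure_add_l BH_distrib rho_add)
 note B' = lift_Hom[OF tpBAB BHa bal] and Bp = lift_pure[OF tpBAB BHa bal, simplified]
 have two: "tsum BHt (%l r. u \<bullet> (F l r \<bullet> v)) (\<tau> k) = u \<bullet> (tsum BHt F (\<tau> k) \<bullet> v)"
  if "u <: BHt" "v <: BHt" "k <: H" "!!l r. [|l <: B; r <: B|] ==> F l r <: BHt" for u v k F
 proof -
  have "(%z. u \<bullet> (z \<bullet> v)) \<in> Hom BHt BHt" by (rule HomI) (use that in "simp_all add: BH_distrib")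
  from tau_hom[OF BHa BHa this that(3,4)] show ?thesis by simp
 qed
 have wc: "?w x y <: BAB" if "x <: B" "y <: B" for x y by (rule tau_sum_closed[OF BABa g]) (use that in simp)
 have "\<beta> (?w x y) = pBH x 1\<^sub>H \<bullet> (\<beta> (\<tau> g) \<bullet> \<rho> y)" if "x <: B" "y <: B" for x y
 proof -
  have "\<beta> (?w x y) = tsum BHt (%l r. pBH x 1\<^sub>H \<bullet> ((pBH l 1\<^sub>H \<bullet> \<rho> r) \<bullet> \<rho> y)) (\<tau> g)"
   by (rule tau_map[OF BABa BHa beta_Hom g]) (use that in "simp_all add: beta_pure rho_mult BH_assoc pBH_mult_l")
  then show ?thesis using that g by (simp add: two beta_eq)
 qed
 moreover have "pBH x 1\<^sub>H \<bullet> (pBH 1 g \<bullet> v) = pBH 1 g \<bullet> (pBH x 1\<^sub>H \<bullet> v)" if "x <: B" "v <: BHt" for x v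
  using that g by (simp add: BH.mult_pure flip: BH_assoc)
 ultimately have \<beta>w: "\<beta> (?w x y) = pBH 1 g \<bullet> ((pBH x 1\<^sub>H \<bullet> \<rho> y) \<bullet> pBH 1 1\<^sub>H)" if "x <: B" "y <: B" for x y
  using that g by (simp add: beta_tau BH_one)
 have "tsum BAB ?w (\<tau> h) = \<tau> (g *\<^sub>H h)"
 proof (rule beta_inj)
  have "\<beta> (tsum BAB ?w (\<tau> h)) = tsum BHt (%x y. pBH 1 g \<bullet> ((pBH x 1\<^sub>H \<bullet> \<rho> y) \<bullet> pBH 1 1\<^sub>H)) (\<tau> h)"
   by (rule tau_map[OF BABa BHa beta_Hom h wc \<beta>w])
  also have "... = pBH 1 g \<bullet> (\<beta> (\<tau> h) \<bullet> pBH 1 1\<^sub>H)" using g h by (simp add: two beta_eq)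
  finally show "\<beta> (tsum BAB ?w (\<tau> h)) = \<beta> (\<tau> (g *\<^sub>H h))" using g h by (simp add: beta_tau BH_one BH.mult_pure)
 qed (use g h wc in "simp_all add: tau_sum_closed[OF BABa]")
 then have "pBH 1 (S (g *\<^sub>H h)) = tsum BHt ?f (tsum BAB ?w (\<tau> h))" using g h by (simp add: translation_coact_left)
 also have "... = tsum BHt (%x y. pBH 1 1\<^sub>H \<bullet> (?f x y \<bullet> pBH 1 (S g))) (\<tau> h)"
 proof (rule tau_map[OF BABa BHa B' h wc])
  fix x y assume x: "x <: B" and y: "y <: B"
  have "tsum BHt ?f (?w x y) = tsum BHt (%l r. \<rho> x \<bullet> (?f l r \<bullet> pBH y 1\<^sub>H)) (\<tau> g)"
   by (rule tau_map[OF BABa BHa B' g]) (use x y in "simp_all add: Bp rho_mult BH_assoc pBH_mult_l")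
  also have "... = \<rho> x \<bullet> (pBH 1 (S g) \<bullet> pBH y 1\<^sub>H)" using x y g by (simp add: two translation_coact_left)
  also have "... = pBH 1 1\<^sub>H \<bullet> (?f x y \<bullet> pBH 1 (S g))" using x y g by (simp add: BH_assoc BH.mult_pure BH_one)
  finally show "tsum BHt ?f (?w x y) = pBH 1 1\<^sub>H \<bullet> (?f x y \<bullet> pBH 1 (S g))" .
 qed
 also have "... = pBH 1 (S h) \<bullet> pBH 1 (S g)" using g h by (simp add: two translation_coact_left BH_one)
 finally show ?thesis .
qed

definition S' where "S' = inv_into (carrier H) S"

lemma S'_closed [simp]: "h <: H ==> S' h <: H"
 and S_S' [simp]: "h <: H ==> S (S' h) = h"
 and S'_S [simp]: "h <: H ==> S' (S h) = h"
 using antipode_bij unfolding S'_def bij_betw_def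
 by (auto simp: inv_into_f_f f_inv_into_f intro: inv_into_into)

lemma S_inj: "[|g <: H; h <: H; S g = S h|] ==> g = h"
 using antipode_bij by (auto simp: bij_betw_def inj_on_def)

lemma S'_lin: "S' \<in> lhom K H H"
proof (rule linI[OF HomI])
 fix x y assume "x <: H" "y <: H"
 then show "S' (x +\<^sub>H y) = S' x +\<^sub>H S' y"
  by - (rule S_inj, simp_all add: lin_add[OF antipode_lin])
next
 fix c x assume "c <: K" "x <: H"
 then show "S' (c .\<^sub>H x) = c .\<^sub>H S' x"
  by - (rule S_inj, simp_all add: lin_smult[OF antipode_lin] Hm.smult_closed)
qed simp

lemma S_one: "S 1\<^sub>H = 1\<^sub>H"
proof -
 have b: "bilin K H H H (%x y. S x *\<^sub>H y)" by (intro bilinI lin_intro) auto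
 show ?thesis
  using antipode_l[of "1\<^sub>H"] HH.lift_bilin_pure[OF Hm.left_module_axioms b, of "1\<^sub>H" "1\<^sub>H"]
  by (simp add: Delta_one eps_one Hm.smult_one)
qed

lemma S'_one: "S' 1\<^sub>H = 1\<^sub>H"
 by (rule S_inj) (simp_all add: S_one)

declare lin_comp[OF S'_lin, lin_intro]

text \<open>\<open>S\<^sup>-\<^sup>1\<close> is antimultiplicative since \<open>S\<close> is; equality is again only seen in \<open>B \<otimes> H\<close>.\<close>

lemma S'_mult_pure:
 assumes b: "b <: B" and g: "g <: H" and h: "h <: H"
 shows "pBH b (S' (g *\<^sub>H h)) = pBH b (S' h *\<^sub>H S' g)"
proof -
 have l: "bilin K B H BH (%x k. pBH (b * x) (S' k))" by (intro bilinI lin_intro) (use b in auto)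
 have "pBH 1 (g *\<^sub>H h) = pBH 1 (S (S' h *\<^sub>H S' g))" using g h by (simp add: antipode_mult_pure BH.mult_pure)
 then have "tsum BH (%x k. pBH (b * x) (S' k)) (pBH 1 (g *\<^sub>H h)) = tsum BH (%x k. pBH (b * x) (S' k)) (pBH 1 (S (S' h *\<^sub>H S' g)))"
  by simp
 then show ?thesis using b g h by (simp add: BH.lift_bilin_pure[OF BHm l] del: tens_lift_alg_tensor)
qed

text \<open>\<open>\<Sum> l(S\<^sup>-\<^sup>1(b\<^sub>(\<^sub>1\<^sub>))) \<otimes> r(S\<^sup>-\<^sup>1(b\<^sub>(\<^sub>1\<^sub>))) b\<^sub>(\<^sub>0\<^sub>) = b \<otimes> 1\<close>, as \<open>\<beta>\<close> sends the left-hand side to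
  \<open>\<Sum> b\<^sub>(\<^sub>0\<^sub>) \<otimes> S\<^sup>-\<^sup>1(b\<^sub>(\<^sub>2\<^sub>)) b\<^sub>(\<^sub>1\<^sub>) = b \<otimes> 1\<close>.\<close>

lemma translation_antipode_inv:
 assumes b: "b <: B"
 shows "tsum BAB (%x h. rm (\<tau> (S' h)) x) (\<rho> b) = pBAB b 1"
proof (rule beta_inj)
 show "tsum BAB (%x h. rm (\<tau> (S' h)) x) (\<rho> b) <: BAB"
  by (intro BAB_lift_closed[OF BH.tp] BAB_rmul_closed) (use b in auto)
 have l: "bilin K H H H (%k g. S' g *\<^sub>H k)" by (intro bilinI lin_intro) auto
 have "\<beta> (tsum BAB (%x h. rm (\<tau> (S' h)) x) (\<rho> b)) = tsum BHt (%x h. tsum BHt (%x' k. pBH x' (S' h *\<^sub>H k)) (\<rho> x)) (\<rho> b)"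
  by (rule rho_map[OF BABa BHa beta_Hom b]) (simp_all add: BAB_rmul_closed beta_rmul beta_tau rho_mult_pure)
 also have "... = pBH b 1\<^sub>H"
 proof (rule coact_cancel[OF l b])
  fix y g assume y: "y <: B" "g <: H"
  have f: "(%k. pBH y (S' k)) \<in> Hom H BHt" by (rule lin_Hom[OF BH.lin_pure_r[OF S'_lin y(1)], simplified])
  have "tsum BHt (%k k'. pBH y (S' k' *\<^sub>H k)) (\<Delta> g) = tsum BHt (%k k'. pBH y (S' (S k *\<^sub>H k'))) (\<Delta> g)"
   by (rule Delta_cong[OF y(2)]) (use y in "simp add: S'_mult_pure")
  also have "... = pBH y (\<epsilon> g .\<^sub>H 1\<^sub>H)"
   using y Delta_hom[OF Ha BHa f y(2), of "%k k'. S k *\<^sub>H k'"] by (simp add: antipode_l lin_smult[OF S'_lin] S'_one)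
  finally show "tsum BHt (%k k'. pBH y (S' k' *\<^sub>H k)) (\<Delta> g) = pBH y (\<epsilon> g .\<^sub>H 1\<^sub>H)" .
 qed
 finally show "\<beta> (tsum BAB (%x h. rm (\<tau> (S' h)) x) (\<rho> b)) = \<beta> (pBAB b 1)"
  using b by (simp add: beta_pure rho_one BH_one)
qed (use b in simp)

section \<open>The translation map and the coactions\<close>


lemmas BHHtp = rho.XHH.tp
lemmas BHHm = rho.XHH.alg_left_module
lemmas [lin_intro] = rho.XHH.lin_pure_l rho.XHH.lin_pure_r BHm BHHm kBABm Hm.left_module_axioms Bm.left_module_axioms

abbreviation "kBAB \<equiv> kV rB"

sublocale TH: kmods K kBAB H
 by (intro kmods.intro K_cring kmods_axioms.intro kBABm Hm.left_module_axioms)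

abbreviation "TH \<equiv> alg_tensor K kBAB H"
abbreviation "THt \<equiv> tensor K kBAB H"
abbreviation "pTH \<equiv> pt K kBAB H"
lemmas THa = tensor_ab[OF TH.tp]
lemmas [lin_intro] = TH.lin_pure_l TH.lin_pure_r

lemma TH_pure_closed [simp]: "[|u <: BAB; h <: H|] ==> pTH u h <: tensor K kBAB H"
 by (rule pure_closed[OF TH.tp]) simp_all

lemma kV_lift_lin:
 assumes M: "lmod (opp A) M" and P: "lmod K P"
  and f: "balanced A M lB P f" and s: "!!m. m <: M ==> (%b. f m b) \<in> lhom K B P"
 shows "tsum P f \<in> lhom K (kV M) P"
proof (rule linI)
 note t = tpA[OF M] and Pa = lmod_ab[OF P]
 have L: "tsum P f \<in> Hom (V M) P" by (rule lift_Hom[OF t Pa f])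
 then show "tsum P f \<in> Hom (kV M) P" by simp
 fix c u assume c: "c <: K" "u <: kV M"
 show "tsum P f (c .\<^sub>(kV M) u) = c .\<^sub>P tsum P f u"
  by (rule tensor_ext[OF t Pa Hom_comp[OF kV_Hom[OF M c(1)] L] Hom_comp[OF L smult_Hom[OF P c(1)]]])
    (use c lift_pure[OF t Pa f] in "simp_all add: kV_pure[OF M] Bm.smult_closed lin_smult[OF s]")
qed

lemma tau_lift_lin:
 assumes P: "lmod K P" and f: "balanced A rB lB P f"
  and s: "!!l. l <: B ==> (%r. f l r) \<in> lhom K B P"
 shows "(%h. tsum P f (\<tau> h)) \<in> lhom K H P"
 by (rule lin_comp[OF kV_lift_lin[OF A_rmod P f] tau_lin]) (simp add: s)

lemma kV_balanced [simp]: "balanced R M N (kV X) = balanced R M N (V X)"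
 by (intro HOL.ext) (simp add: balanced_def)

lemma lm_balanced: "x <: B ==> balanced A rB lB BAB (%l r. pBAB (x * l) r)"
 using pure_move[OF tpBAB, of _ "x * _"] pure_add_l[OF tpBAB, simplified] pure_add_r[OF tpBAB, simplified]
 by (intro balancedI) (simp_all add: B.r_distr B_assoc[symmetric])

lemma lm_tau_bilin:
 assumes f: "f \<in> lhom K B B"
 shows "bilin K B H kBAB (%y k. lm (f y) (\<tau> k))"
proof (rule bilinI)
 note fc = lin_closed[OF f]
 fix y assume y: "y <: B"
 show "(%k. lm (f y) (\<tau> k)) \<in> lhom K H kBAB"
  using tau_lift_lin[OF kBABm, of "%l r. pBAB (f y * l) r"] lm_balanced[OF fc[OF y]] fc[OF y]
  by (simp add: lin_pA_r[OF A_rmod] lin_id)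
next
 fix k assume k: "k <: H"
 have "(%y. tsum kBAB (%l r. pBAB (f y * l) r) (\<tau> k)) \<in> lhom K B kBAB"
  by (rule lin_lift_param[OF tpBAB kBABm tau_closed[OF k]]) (intro lin_intro f; simp)
 then show "(%y. lm (f y) (\<tau> k)) \<in> lhom K B kBAB" by simp
qed

lemma lm_one: "u <: BAB ==> lm 1 u = u"
 by (rule trans[OF lift_cong[OF tpBAB, of _ _ pBAB] lift_id[OF tpBAB]]) simp_all

text \<open>\<open>\<Sum> l(h) \<otimes> r(h)\<^sub>(\<^sub>0\<^sub>) \<otimes> r(h)\<^sub>(\<^sub>1\<^sub>) = \<Sum> l(h\<^sub>(\<^sub>1\<^sub>)) \<otimes> r(h\<^sub>(\<^sub>1\<^sub>)) \<otimes> h\<^sub>(\<^sub>2\<^sub>)\<close>: writing \<open>1 \<otimes> r\<close> as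
  \<open>\<Sum> r\<^sub>(\<^sub>0\<^sub>) \<tau>(r\<^sub>(\<^sub>1\<^sub>))\<close> turns the left-hand side into a function of \<open>\<Sum> l r\<^sub>(\<^sub>0\<^sub>) \<otimes> r\<^sub>(\<^sub>1\<^sub>) = 1 \<otimes> h\<close>.\<close>

lemma translation_coact_right:
 assumes h: "h <: H"
 shows "tsum TH (%l r. tsum TH (%x g. pTH (pBAB l x) g) (\<rho> r)) (\<tau> h) = tsum TH (%h1 h2. pTH (\<tau> h1) h2) (\<Delta> h)"
proof -
 note P = TH.alg_left_module
 have tri: "trilin K B H H TH (%y k g. pTH (lm (f y) (\<tau> k)) g)" if f: "f \<in> lhom K B B" for f
  using lm_tau_bilin[OF f] lin_closed[OF f]
  by (intro trilinI TH.lin_pure_l TH.lin_pure_r lin_id) (simp_all add: bilin_def BAB_lmul_closed)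
 have b: "bilin K B H TH (%x j. tsum TH (%k g. pTH (lm x (\<tau> k)) g) (\<Delta> j))"
  by (intro bilinI HH.lin_lift_arg[OF P _ rho.\<Delta>_lin] lin_lift_BH_Delta P)
    (use tri[OF lin_id] in "simp_all add: trilin_def bilin_def")
 define \<Omega> where "\<Omega> = tsum TH (%x j. tsum TH (%k g. pTH (lm x (\<tau> k)) g) (\<Delta> j))"
 have \<Omega>: "\<Omega> \<in> Hom BHt (tensor K kBAB H)"
  using BH.lin_lift[OF P b, THEN lin_Hom] by (simp add: \<Omega>_def)
 have \<Omega>p: "\<Omega> (pBH x j) = tsum TH (%k g. pTH (lm x (\<tau> k)) g) (\<Delta> j)" if "x <: B" "j <: H" for x j
  unfolding \<Omega>_def by (rule BH.lift_bilin_pure[OF P b that])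
 have eq: "tsum TH (%x g. pTH (pBAB l x) g) (\<rho> r) = \<Omega> (pBH l 1\<^sub>H \<bullet> \<rho> r)" if l: "l <: B" and r: "r <: B" for l r
 proof -
  have "tsum TH (%x g. pTH (pBAB l x) g) (\<rho> r) = tsum TH (%x g. tsum TH (%y k. pTH (lm (l * y) (\<tau> k)) g) (\<rho> x)) (\<rho> r)"
   unfolding tens_lift_alg_tensor
  proof (rule rho_cong[OF r])
   fix x g assume x: "x <: B" and g: "g <: H"
   have a: "(%u. pTH u g) \<in> Hom BAB (tensor K kBAB H)"
    using TH.lin_pure_l[OF lin_id g, THEN lin_Hom] by simp
   show "pTH (pBAB l x) g = tsum (tensor K kBAB H) (%y k. pTH (lm (l * y) (\<tau> k)) g) (\<rho> x)"
    unfolding translation_absorb_left[OF l x, symmetric]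
    by (rule rho_hom[OF BABa THa a x]) (use l in "simp add: BAB_lmul_closed")
  qed
  also have "... = tsum TH (%x j. tsum TH (%k g. pTH (lm (l * x) (\<tau> k)) g) (\<Delta> j)) (\<rho> r)"
   by (rule rho.coassoc_apply[OF P tri[OF k_algebra_mult_r[OF B_alg lin_id l]] r])
  also have "... = \<Omega> (pBH l 1\<^sub>H \<bullet> \<rho> r)"
   unfolding rho_expand[OF THa \<Omega> l r] tens_lift_alg_tensor
   by (rule rho_cong[OF r, symmetric]) (use l Hom_closed[OF \<Omega>] bilin_closed[OF b] in "simp_all add: \<Omega>p")
  finally show ?thesis .
 qed
 have "tsum TH (%l r. tsum TH (%x g. pTH (pBAB l x) g) (\<rho> r)) (\<tau> h) = tsum (tensor K kBAB H) (%l r. \<Omega> (pBH l 1\<^sub>H \<bullet> \<rho> r)) (\<tau> h)"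
  unfolding tens_lift_alg_tensor
  by (rule tau_cong[OF h, symmetric]) (use Hom_closed[OF \<Omega>] eq in simp_all)
 also have "... = tsum TH (%k g. pTH (lm 1 (\<tau> k)) g) (\<Delta> h)"
  unfolding tau_expand[OF THa \<Omega> h] by (rule \<Omega>p[OF B.one_closed h])
 also have "... = tsum TH (%h1 h2. pTH (\<tau> h1) h2) (\<Delta> h)"
  unfolding tens_lift_alg_tensor
  by (rule Delta_cong[OF h]) (simp_all add: lm_one)
 finally show ?thesis .
qed

lemma translation_absorb_apply:
 assumes P: "abgrp P" and f: "balanced A rB lB P f" and b: "b <: B"
 shows "tsum P (%x h. tsum P (%l r. f (x * l) r) (\<tau> h)) (\<rho> b) = f 1 b"
proof -
 note F = lift_Hom[OF tpBAB P f] and Fp = lift_pure[OF tpBAB P f]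
 have i: "tsum P f (lm x (\<tau> h)) = tsum P (%l r. f (x * l) r) (\<tau> h)" if "x <: B" "h <: H" for x h
  by (rule tau_map[OF BABa P F that(2)]) (use that in "simp_all add: Fp")
 have "tsum P f (tsum BAB (%x h. lm x (\<tau> h)) (\<rho> b)) = tsum P (%x h. tsum P (%l r. f (x * l) r) (\<tau> h)) (\<rho> b)"
  by (rule rho_map[OF BABa P F b]) (simp_all add: BAB_lmul_closed i)
 then show ?thesis using b by (simp add: translation_absorb Fp)
qed

lemma translation_coact_right_apply:
 assumes P: "abgrp P" and h: "h <: H"
  and bal: "!!g. g <: H ==> balanced A rB lB P (%l r. f l r g)"
  and add: "!!l r. [|l <: B; r <: B|] ==> (%g. f l r g) \<in> Hom H P"
  and move: "!!c l r g. [|c <: K; l <: B; r <: B; g <: H|] ==> f l (c \<odot> r) g = f l r (c .\<^sub>H g)"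
 shows "tsum P (%l r. tsum P (%x g. f l x g) (\<rho> r)) (\<tau> h) =
  tsum P (%h1 h2. tsum P (%l r. f l r h2) (\<tau> h1)) (\<Delta> h)"
proof -
 have c: "f l r g <: P" if "l <: B" "r <: B" "g <: H" for l r g
  using bal[OF that(3)] that by (simp add: balanced_def)
 define F where "F u g = tsum P (%l r. f l r g) u" for u g
 have Fa: "(%u. F u g) \<in> Hom BAB P" if "g <: H" for g
  unfolding F_def by (rule lift_Hom[OF tpBAB P bal[OF that]])
 have Fg: "(%g. F u g) \<in> Hom H P" if "u <: BAB" for u
  unfolding F_def by (rule lift_Hom_param[OF tpBAB P that]) (simp add: add)
 have Fp: "F (pBAB l r) g = f l r g" if "l <: B" "r <: B" "g <: H" for l r g
  unfolding F_def using lift_pure[OF tpBAB P bal[OF that(3)]] that by simp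
 have Fb: "balanced K kBAB H P F"
 proof (rule balancedI)
  fix k u g assume k: "k <: K" and u: "u <: kBAB" and g: "g <: H"
  show "F (k .\<^sub>kBAB u) g = F u (k .\<^sub>H g)"
   by (rule tensor_ext[OF tpBAB P Hom_comp[OF kV_Hom[OF A_rmod k] Fa[OF g]] Fa])
     (use k u g in "simp_all add: kV_pure[OF A_rmod] Fp Bm.smult_closed Hm.smult_closed move")
 qed (use Hom_closed[OF Fa] Hom_add[OF Fa] Hom_add[OF Fg] in simp_all)
 note L = lift_Hom[OF TH.tp P Fb] and Lp = lift_pure[OF TH.tp P Fb, simplified]
 have inner: "tsum (THt) (%x g. pTH (pBAB l x) g) (\<rho> r) <: THt"
  if "l <: B" "r <: B" for l r
  by (rule rho_sum_closed[OF THa that(2)]) (use that in simp)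
 have i: "tsum P F (tsum THt (%x g. pTH (pBAB l x) g) (\<rho> r)) = tsum P (%x g. f l x g) (\<rho> r)" if "l <: B" "r <: B" for l r
  by (rule rho_map[OF THa P L that(2)]) (use that in "simp_all add: Lp Fp")
 have "tsum P (%l r. tsum P (%x g. f l x g) (\<rho> r)) (\<tau> h) = tsum P F (tsum THt (%l r. tsum THt (%x g. pTH (pBAB l x) g) (\<rho> r)) (\<tau> h))"
  by (rule tau_map[OF THa P L h, symmetric]) (simp_all add: inner i)
 also have "... = tsum P F (tsum THt (%h1 h2. pTH (\<tau> h1) h2) (\<Delta> h))"
  by (simp only: translation_coact_right[OF h, unfolded tens_lift_alg_tensor])
 also have "... = tsum P (%h1 h2. tsum P (%l r. f l r h2) (\<tau> h1)) (\<Delta> h)"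
  by (rule Delta_map[OF THa P L h]) (simp_all add: Lp F_def)
 finally show ?thesis .
qed

end

locale galois_Gamma = galois_ext K H B
 for K :: "('k, 'c) ring_scheme" and H :: "('k, 'h, 'z) hopf_scheme"
  and B :: "('k, 'h, 'b, 'w) comod_alg_scheme" (structure) +
 assumes Gamma_ring: "ring (Gamma_alg K H B)"
begin

section \<open>The enveloping algebra and the codiagonal coaction\<close>

lemma oB_alg: "k_algebra K (opp B)" by (rule opp_k_algebra[OF B_alg])

sublocale Ek: kalgs K B "opp B" by (intro kalgs.intro B_alg oB_alg)

abbreviation "E \<equiv> alg_tensor K B (opp B)"
abbreviation multE (infixl "\<star>" 70) where "u \<star> v \<equiv> u *\<^sub>E v"
abbreviation "Et \<equiv> tensor K B (opp B)"
abbreviation "EHt \<equiv> tensor K (alg_tensor K B (opp B)) H"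
abbreviation "pE \<equiv> pt K B (opp B)"
abbreviation "G \<equiv> Gamma_alg K H B"

lemma enveloping_eq: "enveloping K B = E" by (simp add: enveloping_def)

sublocale Er: ring E by (rule Ek.alg_ring)

lemma E_alg: "k_algebra K E" by (rule Ek.alg_k_algebra)
lemmas Ea = tensor_ab[OF Ek.tp]
lemmas Em = Ek.alg_left_module

lemma pE_closed [simp]: "[|x <: B; y <: B|] ==> pE x y <: Et"
 by (rule Ek.pure_closed') simp_all

lemma E_mult_closed [simp]: "[|u <: Et; v <: Et|] ==> u \<star> v <: Et"
 using Er.m_closed by simp

lemma pE_mult: "[|x <: B; y <: B; x' <: B; y' <: B|] ==>
  pE x y \<star> pE x' y' = pE (x * x') (y' * y)"
 using Ek.mult_pure by simp

lemma E_assoc: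
 assumes "u <: Et" "v <: Et" "w <: Et"
 shows "u \<star> v \<star> w = u \<star> (v \<star> w)"
 using Er.m_assoc assms by simp

lemma E_one: "u <: Et ==> pE 1 1 \<star> u = u"
 "u <: Et ==> u \<star> pE 1 1 = u"
 using Er.l_one Er.r_one by simp_all

lemma E_distrib:
 assumes "u <: Et" "v <: Et" "w <: Et"
 shows "u \<star> (v +\<^sub>Et w) = u \<star> v +\<^sub>Et u \<star> w"
  "(u +\<^sub>Et v) \<star> w = u \<star> w +\<^sub>Et v \<star> w"
 using Er.r_distr[of v w u] Er.l_distr[of u v w] assms by simp_all

lemma pE_add_l: "[|x <: B; x' <: B; y <: B|] ==>
  pE (x \<oplus> x') y = pE x y +\<^sub>Et pE x' y"
 using pure_add_l[OF Ek.tp] by simp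

lemma pE_add_r: "[|x <: B; y <: B; y' <: B|] ==>
  pE x (y \<oplus> y') = pE x y +\<^sub>Et pE x y'"
 using pure_add_r[OF Ek.tp] by simp

lemma E_mult_Hom: "u <: Et ==> (%z. u \<star> z) \<in> Hom Et Et"
 "u <: Et ==> (%z. z \<star> u) \<in> Hom Et Et"
 by (auto intro!: HomI simp: E_distrib)

lemma lin_opp2: "lhom K Z (opp B) = lhom K Z B" "lhom K (opp B) Z = lhom K B Z"
 by (simp_all add: lmod_hom_def)

lemma lin_pE_l [lin_intro]: "[|f \<in> lhom K Z B; y <: B|] ==> (%z. pE (f z) y) \<in> lhom K Z E"
 by (rule Ek.lin_pure_l) simp_all

lemma lin_pE_r [lin_intro]: "[|f \<in> lhom K Z B; x <: B|] ==> (%z. pE x (f z)) \<in> lhom K Z E"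
 using Ek.lin_pure_r[of f Z x] by (simp add: lin_opp2)

lemmas [lin_intro] = k_algebra_mult_l[OF E_alg] k_algebra_mult_r[OF E_alg] Em

sublocale EHk: kalgs K E H by (intro kalgs.intro E_alg H_alg)

abbreviation "EH \<equiv> alg_tensor K E H"
abbreviation "pEH \<equiv> pt K E H"

sublocale EHr: ring EH by (rule EHk.alg_ring)

lemmas EHa = tensor_ab[OF EHk.tp]
lemmas EHm = EHk.alg_left_module
lemma EH_alg: "k_algebra K EH" by (rule EHk.alg_k_algebra)
lemmas [lin_intro] = EHk.lin_pure_l EHk.lin_pure_r k_algebra_mult_l[OF EH_alg] k_algebra_mult_r[OF EH_alg] EHm

lemma pEH_closed [simp]: "[|u <: Et; h <: H|] ==> pEH u h <: EHt"
 by (rule EHk.pure_closed') simp_all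

lemma pEH_mult: "[|u <: Et; v <: Et; g <: H; h <: H|] ==>
  pEH u g *\<^sub>EH pEH v h = pEH (u \<star> v) (g *\<^sub>H h)"
 by (rule EHk.mult_pure) simp_all

lemma EH_mult_closed [simp]: "[|u <: EHt; v <: EHt|] ==> u *\<^sub>EH v <: EHt"
 using EHr.m_closed by simp

abbreviation "cod \<equiv> codiagonal K H B"

text \<open>The codiagonal coaction of \<open>b \<otimes> b'\<^sup>o\<^sup>p\<close> as a function of \<open>\<rho>(b')\<close>, with \<open>x \<otimes> h\<close> in place of \<open>\<rho>(b)\<close>.\<close>

definition codq where "codq x h = tsum EH (%x' h'. pEH (pE x x') (h *\<^sub>H h'))"

lemma codq_bilin: "[|x <: B; h <: H|] ==> bilin K B H EH (%x' h'. pEH (pE x x') (h *\<^sub>H h'))"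
 by (intro bilinI lin_intro) auto

lemma codq_lin: "[|x <: B; h <: H|] ==> codq x h \<in> lhom K BH EH"
 unfolding codq_def by (rule BH.lin_lift[OF EHm codq_bilin])

lemma codq_Hom: "[|x <: B; h <: H|] ==> codq x h \<in> Hom BHt EHt"
 using codq_lin[THEN lin_Hom] by simp

lemma codq_closed [simp]: "[|x <: B; h <: H; u <: BHt|] ==> codq x h u <: EHt"
 by (rule Hom_closed[OF codq_Hom])

lemma codq_pure: "[|x <: B; h <: H; y <: B; g <: H|] ==>
  codq x h (pBH y g) = pEH (pE x y) (h *\<^sub>H g)"
 unfolding codq_def by (rule BH.lift_bilin_pure[OF EHm codq_bilin])

lemma codq_lin_l: "[|h <: H; y <: B|] ==> (%x. codq x h (\<rho> y)) \<in> lhom K B EH"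
 "[|x <: B; y <: B|] ==> (%h. codq x h (\<rho> y)) \<in> lhom K H EH"
 unfolding codq_def by (intro lin_lift_BH_rho lin_intro; simp)+

lemma codq_mult:
 assumes "x <: B" "h <: H" "a <: B" "w <: BHt"
 shows "codq x h (w \<bullet> pBH a 1\<^sub>H) = pEH (pE 1 a) 1\<^sub>H *\<^sub>EH codq x h w"
proof (rule tensor_ext[OF BH.tp EHa _ _ _ assms(4)])
 show "(%w. codq x h (w \<bullet> pBH a 1\<^sub>H)) \<in> Hom BHt EHt"
  using Hom_comp[OF BH.mult_lin_l[THEN lin_Hom, simplified] codq_Hom] assms by simp
 show "(%w. pEH (pE 1 a) 1\<^sub>H *\<^sub>EH codq x h w) \<in> Hom BHt EHt"
  using Hom_comp[OF codq_Hom EHk.mult_lin_r[THEN lin_Hom, simplified]] assms by simp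
qed (use assms in "simp add: BH.mult_pure codq_pure pEH_mult pE_mult")

lemma cod_bilin: "bilin K B B EH (%b b'. tsum EH (%x h. codq x h (\<rho> b')) (\<rho> b))"
proof (rule bilinI)
 fix x assume "x <: B"
 then show "(%y. tsum EH (%x h. codq x h (\<rho> y)) (\<rho> x)) \<in> lhom K B EH"
  by (intro lin_lift_BH_rho EHm lin_comp[OF codq_lin] rho.\<delta>_lin)
next
 fix y assume y: "y <: B"
 have "bilin K B H EH (%x h. codq x h (\<rho> y))" by (intro bilinI codq_lin_l) (use y in auto)
 then show "(%x. tsum EH (%x h. codq x h (\<rho> y)) (\<rho> x)) \<in> lhom K B EH"
  by (intro BH.lin_lift_arg EHm rho.\<delta>_lin)
qed

lemma cod_eq: "cod = tsum EH (%b b'. tsum EH (%x h. codq x h (\<rho> b')) (\<rho> b))"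
 by (simp add: codiagonal_def codq_def[abs_def] Let_def enveloping_eq)

lemma cod_bilin_opp: "bilin K B (opp B) EH (%b b'. tsum EH (%x h. codq x h (\<rho> b')) (\<rho> b))"
 using cod_bilin by (simp add: bilin_def lin_opp2)

lemma cod_lin: "cod \<in> lhom K E EH"
 unfolding cod_eq by (rule Ek.lin_lift[OF EHm cod_bilin_opp])

lemma cod_Hom: "cod \<in> Hom Et EHt"
 using cod_lin[THEN lin_Hom] by simp

lemma cod_closed [simp]: "z <: Et ==> cod z <: EHt"
 by (rule Hom_closed[OF cod_Hom])

lemma cod_pure: "[|b <: B; b' <: B|] ==> cod (pE b b') = tsum EHt (%x h. codq x h (\<rho> b')) (\<rho> b)"
 using Ek.lift_bilin_pure[OF EHm cod_bilin_opp] by (simp add: cod_eq)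

lemma cod_mult:
 assumes a: "a <: A" and z: "z <: Et"
 shows "cod (pE 1 a \<star> z) = pEH (pE 1 a) 1\<^sub>H *\<^sub>EH cod z"
proof (rule tensor_ext[OF Ek.tp EHa _ _ _ z])
 show "(%z. cod (pE 1 a \<star> z)) \<in> Hom Et EHt"
  using Hom_comp[OF E_mult_Hom(1) cod_Hom] a by simp
 have M: "(%w. pEH (pE 1 a) 1\<^sub>H *\<^sub>EH w) \<in> Hom EHt EHt"
  using EHk.mult_lin_r[THEN lin_Hom, simplified] a by simp
 show "(%z. pEH (pE 1 a) 1\<^sub>H *\<^sub>EH cod z) \<in> Hom Et EHt"
  by (rule Hom_comp[OF cod_Hom M])
 fix x y assume "x <: B" "y <: opp B"
 then have x: "x <: B" and y: "y <: B" by simp_all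
 have "cod (pE 1 a \<star> pE x y) = tsum EHt (%x h. codq x h (\<rho> y \<bullet> pBH a 1\<^sub>H)) (\<rho> x)" (is "?a = _")
  using a x y by (simp add: pE_mult cod_pure rho_mult rho_A)
 also have "... = tsum EHt (%x h. pEH (pE 1 a) 1\<^sub>H *\<^sub>EH codq x h (\<rho> y)) (\<rho> x)"
  by (rule rho_cong[OF x]) (use a y in "simp_all add: codq_mult")
 also have "... = pEH (pE 1 a) 1\<^sub>H *\<^sub>EH cod (pE x y)"
  unfolding cod_pure[OF x y] by (rule rho_hom[OF EHa EHa M x, symmetric]) (use y in simp)
 finally show "?a = ..." .
qed

section \<open>The algebra \<open>\<Gamma>\<close>\<close>

lemma G_simps [simp]: "add G = add Et" "0\<^sub>G = 0\<^sub>Et" "monoid.mult G = monoid.mult E"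
 "1\<^sub>G = pE 1 1" "smult G = smult E"
 by (simp_all add: Gamma_alg_def enveloping_eq)

lemma G_carrier: "z <: G \<longleftrightarrow> z <: Et \<and> cod z = pEH z 1\<^sub>H"
 by (simp add: Gamma_alg_def enveloping_eq)

lemma G_E [simp]: "z <: G ==> z <: Et" by (simp add: G_carrier)

sublocale Gr: ring G by (rule Gamma_ring)

lemma G_mult [simp]: "[|y <: G; z <: G|] ==> y \<star> z <: G"
 using Gr.m_closed by simp

lemma G_pure [simp]: assumes a: "a <: A" and a': "a' <: A" shows "pE a a' <: G"
proof -
 have b: "bilin K B H EH (%x h. codq x h (\<rho> a'))" by (intro bilinI codq_lin_l) (use a' in auto)
 show ?thesis
  using assms BH.lift_bilin_pure[OF EHm b, of a "1\<^sub>H"] by (simp add: G_carrier cod_pure rho_A codq_pure)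
qed

lemma G_one [simp]: "pE 1 1 <: G" using Gr.one_closed by simp

lemma one_A [simp]: "1 <: A" by (simp add: A_carrier rho_one)

text \<open>The right \<open>A\<close>-module structure \<open>(x \<otimes> y\<^sup>o\<^sup>p) a = x \<otimes> (y a)\<^sup>o\<^sup>p\<close>.\<close>

definition EA where "EA = with_action E (%a z. pE 1 a \<star> z)"
definition GA where "GA = EA\<lparr>carrier := carrier G\<rparr>"
definition EHA where "EHA = with_action EH (%a w. pEH (pE 1 a) 1\<^sub>H *\<^sub>EH w)"

lemma EA_simps [simp]: "carrier EA = carrier Et" "add EA = add Et"
 "0\<^sub>EA = 0\<^sub>Et" "smult EA = (%a z. pE 1 a \<star> z)"
 "carrier GA = carrier G" "add GA = add Et"
 "0\<^sub>GA = 0\<^sub>Et" "smult GA = (%a z. pE 1 a \<star> z)"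
 "carrier EHA = carrier EHt" "add EHA = add EHt"
 "0\<^sub>EHA = 0\<^sub>EHt" "smult EHA = (%a w. pEH (pE 1 a) 1\<^sub>H *\<^sub>EH w)"
 by (simp_all add: EA_def GA_def EHA_def)

lemma EA_rmod: "lmod (opp A) EA"
 by (intro left_module.intro left_module_axioms.intro opp_ring A_ring)
   (use Ea in \<open>auto simp: abelian_group_cong[of EA "Et"] E_distrib pE_add_r E_one pE_mult simp flip: E_assoc\<close>)

lemma GA_rmod: "lmod (opp A) GA"
 unfolding GA_def
 by (rule left_module.submodule_left_module[OF EA_rmod]) (use Gr.zero_closed Gr.a_closed in "auto")

lemma EH_distrib:
 assumes "u <: EHt" "v <: EHt" "w <: EHt"
 shows "u *\<^sub>EH (v +\<^sub>EHt w) = u *\<^sub>EH v +\<^sub>EHt u *\<^sub>EH w"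
  "(u +\<^sub>EHt v) *\<^sub>EH w = u *\<^sub>EH w +\<^sub>EHt v *\<^sub>EH w"
 using EHr.r_distr[of v w u] EHr.l_distr[of u v w] assms by simp_all

lemma EH_assoc:
 assumes "u <: EHt" "v <: EHt" "w <: EHt"
 shows "u *\<^sub>EH v *\<^sub>EH w = u *\<^sub>EH (v *\<^sub>EH w)"
 using EHr.m_assoc assms by simp

lemma EHA_rmod: "lmod (opp A) EHA"
proof (intro left_module.intro left_module_axioms.intro opp_ring A_ring)
 show "abgrp EHA" using EHa by (simp add: abelian_group_cong[of EHA "EHt"])
 have o: "pEH (pE 1 1) 1\<^sub>H *\<^sub>EH x = x" if "x <: EHt" for x
  using EHr.l_one that by simp
 fix x assume "x <: EHA"
 then show "1\<^sub>(opp A) .\<^sub>EHA x = x" by (simp add: o)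
next
 fix a b x assume "a <: opp A" "b <: opp A" "x <: EHA"
 then show "(a +\<^sub>(opp A) b) .\<^sub>EHA x = a .\<^sub>EHA x +\<^sub>EHA b .\<^sub>EHA x"
  using pure_add_l[OF EHk.tp, of "pE 1 a" "pE 1 b" "1\<^sub>H"] by (simp add: pE_add_r EH_distrib)
qed (simp_all add: EH_distrib pEH_mult pE_mult flip: EH_assoc)

abbreviation "VE \<equiv> V EA"
abbreviation "VG \<equiv> V GA"
abbreviation "VEH \<equiv> V EHA"
abbreviation "pVE \<equiv> pA EA"
abbreviation "pVG \<equiv> pA GA"
abbreviation "pVEH \<equiv> pA EHA"

lemmas tpVE = tpA[OF EA_rmod] and tpVG = tpA[OF GA_rmod] and tpVEH = tpA[OF EHA_rmod]
lemmas VEa = tensor_ab[OF tpVE] and VGa = tensor_ab[OF tpVG] and VEHa = tensor_ab[OF tpVEH]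
lemmas kVEm = kV_left_module[OF EA_rmod] and kVGm = kV_left_module[OF GA_rmod] and kVEHm = kV_left_module[OF EHA_rmod]

lemma pV_closed [simp]:
 "[|z <: Et; b <: B|] ==> pVE z b <: VE"
 "[|g <: G; b <: B|] ==> pVG g b <: VG"
 "[|w <: EHt; b <: B|] ==> pVEH w b <: VEH"
 by (auto intro: pure_closed[OF tpVE] pure_closed[OF tpVG] pure_closed[OF tpVEH])

lemma E_smult_mult: "[|c <: K; u <: Et|] ==> c .\<^sub>E u = pE 1 (c \<odot> 1) \<star> u"
 using lin_smult[OF Ek.mult_lin_l, of u c "pE 1 1"] by (simp add: E_one Ek.alg_smult_pure_r)

lemma EH_smult_mult: "[|c <: K; u <: EHt|] ==> c .\<^sub>EH u = pEH (pE 1 (c \<odot> 1)) 1\<^sub>H *\<^sub>EH u"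
proof -
 assume c: "c <: K" "u <: EHt"
 have o: "pEH (pE 1 1) 1\<^sub>H *\<^sub>EH u = u" using EHr.l_one c by simp
 show ?thesis using lin_smult[OF EHk.mult_lin_l, of u c "pEH (pE 1 1) 1\<^sub>H"] c
  by (simp add: o EHk.alg_smult_pure Ek.alg_smult_pure_r)
qed

lemma lin_pVE_l [lin_intro]:
 assumes f: "f \<in> lhom K Z E" and b: "b <: B"
 shows "(%z. pVE (f z) b) \<in> lhom K Z (kV EA)"
proof (rule lin_pA_l[OF EA_rmod _ b])
 show "f \<in> Hom Z EA" using lin_Hom[OF f] by (simp add: Hom_def)
qed (use lin_closed[OF f] in "simp add: lin_smult[OF f] E_smult_mult")

lemma lin_pVEH_l [lin_intro]:
 assumes f: "f \<in> lhom K Z EH" and b: "b <: B"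
 shows "(%z. pVEH (f z) b) \<in> lhom K Z (kV EHA)"
proof (rule lin_pA_l[OF EHA_rmod _ b])
 show "f \<in> Hom Z EHA" using lin_Hom[OF f] by (simp add: Hom_def)
qed (use lin_closed[OF f] in "simp add: lin_smult[OF f] EH_smult_mult")

end

context galois_Gamma
begin

section \<open>Elements of \<open>\<Gamma> \<otimes>\<^sub>A B\<close> attached to elements of \<open>B\<close>\<close>

lemma pVE_balanced:
 assumes "x <: B"
 shows "balanced A rB lB VE (%l r. pVE (pE x l) r)"
proof (rule balancedI)
 fix r l b assume "r <: A" "l <: rB" "b <: lB"
 then show "pVE (pE x (r .\<^sub>rB l)) b = pVE (pE x l) (r .\<^sub>lB b)"
  using pure_move[OF tpVE, of r "pE x l" b] assms by (simp add: pE_mult)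
qed (use assms pure_add_l[OF tpVE, simplified] pure_add_r[OF tpVE, simplified] in "simp_all add: pE_add_r")

lemma pVEH_balanced:
 assumes "x <: B" "s <: H"
 shows "balanced A rB lB VEH (%l r. pVEH (pEH (pE x l) s) r)"
proof (rule balancedI)
 fix r l b assume "r <: A" "l <: rB" "b <: lB"
 then show "pVEH (pEH (pE x (r .\<^sub>rB l)) s) b = pVEH (pEH (pE x l) s) (r .\<^sub>lB b)"
  using pure_move[OF tpVEH, of r "pEH (pE x l) s" b] assms by (simp add: pE_mult pEH_mult)
qed (use assms pure_add_l[OF tpVEH, simplified] pure_add_r[OF tpVEH, simplified] pure_add_l[OF EHk.tp, simplified] in "simp_all add: pE_add_r")

text \<open>\<open>\<Sum> (b\<^sub>(\<^sub>0\<^sub>) \<otimes> l(b\<^sub>(\<^sub>1\<^sub>))\<^sup>o\<^sup>p) \<otimes>\<^sub>A r(b\<^sub>(\<^sub>1\<^sub>))\<close>, the candidate for the element of \<open>\<Gamma> \<otimes>\<^sub>A B\<close> that corresponds to \<open>b \<otimes> 1 \<in> B\<^sup>e\<close>.\<close>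

definition vE where "vE b = tsum VE (%x h. tsum VE (%l r. pVE (pE x l) r) (\<tau> h)) (\<rho> b)"

lemma vE_inner_bilin: "bilin K B H (kV EA) (%x h. tsum VE (%l r. pVE (pE x l) r) (\<tau> h))"
proof (rule bilinI)
 fix x assume x: "x <: B"
 have "(%h. tsum (kV EA) (%l r. pVE (pE x l) r) (\<tau> h)) \<in> lhom K H (kV EA)"
  by (rule tau_lift_lin[OF kVEm]) (use x pVE_balanced in "auto intro!: lin_pA_r[OF EA_rmod] lin_id")
 then show "(%h. tsum VE (%l r. pVE (pE x l) r) (\<tau> h)) \<in> lhom K H (kV EA)" by simp
next
 fix h assume h: "h <: H"
 have "(%x. tsum (kV EA) (%l r. pVE (pE x l) r) (\<tau> h)) \<in> lhom K B (kV EA)"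
  by (rule lin_lift_param[OF tpBAB kVEm tau_closed[OF h]]) (intro lin_intro; simp)
 then show "(%x. tsum VE (%l r. pVE (pE x l) r) (\<tau> h)) \<in> lhom K B (kV EA)" by simp
qed

lemma vE_lin: "vE \<in> lhom K B (kV EA)"
proof -
 have "(%b. tsum (kV EA) (%x h. tsum VE (%l r. pVE (pE x l) r) (\<tau> h)) (\<rho> b)) \<in> lhom K B (kV EA)"
  by (rule BH.lin_lift_arg[OF kVEm vE_inner_bilin rho.\<delta>_lin])
 then show ?thesis by (simp add: vE_def[abs_def])
qed

lemma vE_closed [simp]: "b <: B ==> vE b <: VE"
 using lin_closed[OF vE_lin] by simp

lemma vE_inner_closed: "[|x <: B; h <: H|] ==> tsum VE (%l r. pVE (pE x l) r) (\<tau> h) <: VE"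
 using bilin_closed[OF vE_inner_bilin] by simp

lemma cod_lmod: "cod \<in> lhom A EA EHA"
 using cod_Hom by (auto simp: lmod_hom_def Hom_def cod_mult)

lemma triv_lmod: "(%z. pEH z 1\<^sub>H) \<in> lhom A EA EHA"
 using pure_add_l[OF EHk.tp, simplified] by (auto simp: lmod_hom_def pEH_mult)

text \<open>The two maps \<open>B\<^sup>e \<rightarrow> B\<^sup>e \<otimes> H\<close> whose equalizer is \<open>\<Gamma>\<close> agree on \<open>vE b\<close>: the coaction of \<open>l(h)\<close> is
  converted to \<open>S\<close> of a Sweedler component of \<open>h = b\<^sub>(\<^sub>1\<^sub>)\<close>, which cancels against the component that the coaction
  of \<open>b\<^sub>(\<^sub>0\<^sub>)\<close> contributes.\<close>

lemma vE_equalized: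
 assumes b: "b <: B"
 shows "tmap A EHA lB cod (%x. x) (vE b) =
  tmap A EHA lB (%z. pEH z 1\<^sub>H) (%x. x) (vE b)"
proof -
 \<comment> \<open>\<open>F x s g = \<Sum> ((x \<otimes> l(g)\<^sup>o\<^sup>p) \<otimes> s) \<otimes>\<^sub>A r(g)\<close>, so that the right-hand side is \<open>\<Sum> F b\<^sub>(\<^sub>0\<^sub>) 1 b\<^sub>(\<^sub>1\<^sub>)\<close>\<close>
 define F where "F x s g = tsum VEH (%l r. pVEH (pEH (pE x l) s) r) (\<tau> g)" for x s g
 have Fx: "(%x. F x s g) \<in> lhom K B (kV EHA)" if "s <: H" "g <: H" for s g
  using lin_lift_param[OF tpBAB kVEHm tau_closed[OF that(2)], of "%x l r. pVEH (pEH (pE x l) s) r" B] that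
  by (simp add: F_def lin_intro)
 have Fs: "(%s. F x s g) \<in> lhom K H (kV EHA)" if "x <: B" "g <: H" for x g
  using lin_lift_param[OF tpBAB kVEHm tau_closed[OF that(2)], of "%s l r. pVEH (pEH (pE x l) s) r" H] that
  by (simp add: F_def lin_intro)
 have Fg: "(%g. F x s g) \<in> lhom K H (kV EHA)" if "x <: B" "s <: H" for x s
  using tau_lift_lin[OF kVEHm, of "%l r. pVEH (pEH (pE x l) s) r"] that pVEH_balanced
  by (simp add: F_def lin_pA_r[OF EHA_rmod] lin_id)
 have Fc: "F x s g <: VEH" if "x <: B" "s <: H" "g <: H" for x s g
  using lin_closed[OF Fg[OF that(1,2)] that(3)] by simp
 define \<Phi> where "\<Phi> x k h = tsum VEH (%g1 g2. F x (k *\<^sub>H S g1) g2) (\<Delta> h)" for x k h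
 have Fb: "bilin K H H (kV EHA) (%g1 g2. F x (k *\<^sub>H S g1) g2)" if "x <: B" "k <: H" for x k
  by (rule bilinI) (use that in "auto intro!: Fg lin_comp[OF Fs] lin_intro")
 have tri: "trilin K B H H (kV EHA) \<Phi>"
 proof (rule trilinI)
  fix y z assume yz: "y <: H" "z <: H"
  show "(%x. \<Phi> x y z) \<in> lhom K B (kV EHA)"
   using lin_lift_param[OF HH.tp kVEHm Delta_closed[OF yz(2)], of "%x g1 g2. F x (y *\<^sub>H S g1) g2" B] yz
   by (simp add: \<Phi>_def Fx)
 next
  fix x z assume xz: "x <: B" "z <: H"
  have "(%y. F x (y *\<^sub>H S g1) g2) \<in> lhom K H (kV EHA)" if "g1 <: H" "g2 <: H" for g1 g2
   by (rule lin_comp[OF Fs], use xz that in simp_all) (intro lin_intro, simp)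
  then show "(%y. \<Phi> x y z) \<in> lhom K H (kV EHA)"
   using lin_lift_param[OF HH.tp kVEHm Delta_closed[OF xz(2)], of "%y g1 g2. F x (y *\<^sub>H S g1) g2" H]
   by (simp add: \<Phi>_def)
 next
  fix x y assume xy: "x <: B" "y <: H"
  show "(%z. \<Phi> x y z) \<in> lhom K H (kV EHA)"
   using HH.lin_lift_arg[OF kVEHm Fb[OF xy] rho.\<Delta>_lin] by (simp add: \<Phi>_def)
 qed
 have T: "tmap A EHA lB f (%x. x) (vE b) = tsum VEH (%x h. tsum VEH (%l r. pVEH (f (pE x l)) r) (\<tau> h)) (\<rho> b)"
  if f: "f \<in> lhom A EA EHA" for f
 proof -
  let ?T = "tmap A EHA lB f (%x. x)"
  note ta = tmap_Hom[OF tpVE tpVEH f lin_id] and tpu = tmap_pure[OF tpVE tpVEH f lin_id]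
  have i: "?T (tsum VE (%l r. pVE (pE x l) r) (\<tau> h)) = tsum VEH (%l r. pVEH (f (pE x l)) r) (\<tau> h)" if "x <: B" "h <: H" for x h
   by (rule tau_map[OF VEa VEHa ta that(2)]) (use that in "simp_all add: tpu")
  show ?thesis unfolding vE_def by (rule rho_map[OF VEa VEHa ta b]) (simp_all add: vE_inner_closed i)
 qed
 define Z where "Z w k = tsum VEH (%l r. pVEH (pEH (pE 1 l) 1\<^sub>H *\<^sub>EH w) r) (\<tau> k)" for w k
 have Zb: "balanced A rB lB VEH (%l r. pVEH (pEH (pE 1 l) 1\<^sub>H *\<^sub>EH w) r)" if "w <: EHt" for w
 proof (rule balancedI)
  fix a l r assume "a <: A" "l <: rB" "r <: lB"
  then show "pVEH (pEH (pE 1 (a .\<^sub>rB l)) 1\<^sub>H *\<^sub>EH w) r = pVEH (pEH (pE 1 l) 1\<^sub>H *\<^sub>EH w) (a .\<^sub>lB r)"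
   using pure_move[OF tpVEH, of a "pEH (pE 1 l) 1\<^sub>H *\<^sub>EH w" r] that by (simp add: pE_mult pEH_mult flip: EH_assoc)
 qed (use that pure_add_l[OF tpVEH, simplified] pure_add_r[OF tpVEH, simplified] pure_add_l[OF EHk.tp, simplified]
   in "simp_all add: pE_add_r EH_distrib")
 have Zk: "(%k. Z w k) \<in> lhom K H (kV EHA)" if "w <: EHt" for w
  using tau_lift_lin[OF kVEHm, of "%l r. pVEH (pEH (pE 1 l) 1\<^sub>H *\<^sub>EH w) r"] Zb[OF that] that
  by (simp add: Z_def lin_pA_r[OF EHA_rmod] lin_id)
 have Zw: "(%w. Z w k) \<in> lhom K EH (kV EHA)" if "k <: H" for k
  using lin_lift_param[OF tpBAB kVEHm tau_closed[OF that], of "%w l r. pVEH (pEH (pE 1 l) 1\<^sub>H *\<^sub>EH w) r" EH]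
  by (simp add: Z_def lin_intro)
 have ZF: "Z (pEH (pE x 1) s) k = F x s k" if "x <: B" "s <: H" "k <: H" for x s k
  unfolding Z_def F_def by (rule tau_cong[OF that(3)]) (use that in "simp_all add: pEH_mult pE_mult")
 \<comment> \<open>\<open>w \<otimes>\<^sub>A r\<close> becomes a function of \<open>r\<^sub>(\<^sub>0\<^sub>)\<close> and \<open>r\<^sub>(\<^sub>1\<^sub>)\<close>, so that \<open>r(h)\<close> meets \<open>l(h)\<^sub>(\<^sub>0\<^sub>)\<close>.\<close>
 have absorb: "tsum VEH (%y k. Z (pEH (pE 1 y) 1\<^sub>H *\<^sub>EH w) k) (\<rho> r) = pVEH w r" if w: "w <: EHt" and r: "r <: B" for w r
 proof -
  have o: "pEH (pE 1 1) 1\<^sub>H *\<^sub>EH w = w" using EHr.l_one w by simp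
  have "tsum VEH (%y k. Z (pEH (pE 1 y) 1\<^sub>H *\<^sub>EH w) k) (\<rho> r) =
    tsum VEH (%y k. tsum VEH (%l r. pVEH (pEH (pE 1 (y * l)) 1\<^sub>H *\<^sub>EH w) r) (\<tau> k)) (\<rho> r)"
   unfolding Z_def by (intro rho_cong[OF r] tau_cong) (use w in "simp_all add: pE_mult pEH_mult flip: EH_assoc")
  then show ?thesis using translation_absorb_apply[OF VEHa Zb[OF w] r] by (simp add: o)
 qed
 have Q: "tsum EHt (%l r. pEH (pE 1 r) 1\<^sub>H *\<^sub>EH cod (pE x l)) (\<tau> h) = tsum EHt (%x' k. pEH (pE x' 1) (k *\<^sub>H S h)) (\<rho> x)"
  if x: "x <: B" "h <: H" for x h
 proof -
  have "tsum EHt (%l r. pEH (pE 1 r) 1\<^sub>H *\<^sub>EH cod (pE x l)) (\<tau> h) =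
    tsum EHt (%l r. tsum EHt (%x' k. codq x' k (\<rho> l \<bullet> pBH r 1\<^sub>H)) (\<rho> x)) (\<tau> h)"
  proof (rule tau_cong[OF x(2)])
   fix l r assume l: "l <: B" "r <: B"
   have "pEH (pE 1 r) 1\<^sub>H *\<^sub>EH cod (pE x l) = tsum EHt (%x' k. pEH (pE 1 r) 1\<^sub>H *\<^sub>EH codq x' k (\<rho> l)) (\<rho> x)"
    using lift_mult(1)[OF EHr.ring_axioms BH.tp rho_closed[OF x(1)], of "pEH (pE 1 r) 1\<^sub>H" "%x' k. codq x' k (\<rho> l)"] x l by (simp add: cod_pure)
   also have "... = tsum EHt (%x' k. codq x' k (\<rho> l \<bullet> pBH r 1\<^sub>H)) (\<rho> x)"
    by (rule rho_cong[OF x(1)]) (use l in "simp add: codq_mult")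
   finally show "pEH (pE 1 r) 1\<^sub>H *\<^sub>EH cod (pE x l) = ..." .
  qed
  also have "... = tsum EHt (%x' k. tsum EHt (%l r. codq x' k (\<rho> l \<bullet> pBH r 1\<^sub>H)) (\<tau> h)) (\<rho> x)"
   by (rule lift_swap[OF tpBAB BH.tp EHa tau_closed[OF x(2)] rho_closed[OF x(1)]]) simp
  also have "... = tsum EHt (%x' k. pEH (pE x' 1) (k *\<^sub>H S h)) (\<rho> x)"
  proof (rule rho_cong[OF x(1)])
   fix x' k assume k: "x' <: B" "k <: H"
   show "tsum EHt (%l r. codq x' k (\<rho> l \<bullet> pBH r 1\<^sub>H)) (\<tau> h) = pEH (pE x' 1) (k *\<^sub>H S h)"
    using tau_hom[OF BHa EHa codq_Hom[OF k] x(2), of "%l r. \<rho> l \<bullet> pBH r 1\<^sub>H"] k x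
    by (simp add: translation_coact_left codq_pure)
  qed
  finally show ?thesis .
 qed
 have step1: "tsum VEH (%l r. pVEH (cod (pE x l)) r) (\<tau> h) = tsum VEH (%x' k. \<Phi> x' k h) (\<rho> x)"
  if x: "x <: B" "h <: H" for x h
 proof -
  let ?c = "%l y. pEH (pE 1 y) 1\<^sub>H *\<^sub>EH cod (pE x l)"
  have cl: "(%l. ?c l y) \<in> lhom K B EH" and cy: "(%y. ?c l y) \<in> lhom K B EH" if "l <: B" "y <: B" for l y
   using that x by (auto intro!: k_algebra_mult_r[OF EH_alg] k_algebra_mult_l[OF EH_alg] lin_comp[OF cod_lin] EHk.lin_pure_l lin_pE_r lin_id)
  have "tsum VEH (%l r. pVEH (cod (pE x l)) r) (\<tau> h) = tsum VEH (%l r. tsum VEH (%y k. Z (?c l y) k) (\<rho> r)) (\<tau> h)"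
   by (rule tau_cong[OF x(2)]) (use x in "simp_all add: absorb")
  also have "... = tsum VEH (%h1 h2. tsum VEH (%l r. Z (?c l r) h2) (\<tau> h1)) (\<Delta> h)"
  proof (rule translation_coact_right_apply[OF VEHa x(2)])
   fix g assume g: "g <: H"
   show "balanced A rB lB VEH (%l r. Z (?c l r) g)"
   proof (rule balancedI)
    fix a l r assume "a <: A" "l <: rB" "r <: lB"
    then show "Z (?c (a .\<^sub>rB l) r) g = Z (?c l (a .\<^sub>lB r)) g"
     using cod_mult[of a "pE x l"] x by (simp add: pE_mult pEH_mult flip: EH_assoc)
   qed (use x g in "simp_all add: lin_closed[OF Zw] lin_add[OF cl, simplified] lin_add[OF cy, simplified] lin_add[OF Zw, simplified]
     lin_closed[OF Zw, simplified]")
  next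
   fix l r assume lr: "l <: B" "r <: B"
   show "(%g. Z (?c l r) g) \<in> Hom H VEH" using Zk[of "?c l r", THEN lin_Hom] lr x by simp
   fix c g assume c: "c <: K" "g <: H"
   show "Z (?c l (c \<odot> r)) g = Z (?c l r) (c .\<^sub>H g)"
    using c lr x by (simp add: lin_smult[OF cy, simplified] lin_smult[OF Zw, simplified] lin_smult[OF Zk, simplified])
  qed
  also have "... = tsum VEH (%h1 h2. tsum VEH (%x' k. F x' (k *\<^sub>H S h1) h2) (\<rho> x)) (\<Delta> h)"
  proof (rule Delta_cong[OF x(2)])
   fix h1 h2 assume h: "h1 <: H" "h2 <: H"
   note Za = Zw[OF h(2), THEN lin_Hom, simplified]
   have "tsum VEH (%l r. Z (?c l r) h2) (\<tau> h1) = Z (tsum EHt (%l r. ?c l r) (\<tau> h1)) h2"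
    by (rule tau_hom[OF EHa VEHa Za h(1), symmetric]) (use x in simp)
   also have "... = tsum VEH (%x' k. F x' (k *\<^sub>H S h1) h2) (\<rho> x)"
    unfolding Q[OF x(1) h(1)] by (rule rho_map[OF EHa VEHa Za x(1)]) (use h in "simp_all add: ZF")
   finally show "tsum VEH (%l r. Z (?c l r) h2) (\<tau> h1) = ..." .
  qed
  also have "... = tsum VEH (%x' k. \<Phi> x' k h) (\<rho> x)"
   unfolding \<Phi>_def by (rule lift_swap[OF HH.tp BH.tp VEHa Delta_closed[OF x(2)] rho_closed[OF x(1)]]) (simp add: Fc)
  finally show ?thesis .
 qed
 have step2: "tsum VEH (%k h'. \<Phi> x k h') (\<Delta> h) = F x 1\<^sub>H h" if x: "x <: B" "h <: H" for x h
 proof -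
  have tri2: "trilin K H H H (kV EHA) (%k g1 g2. F x (k *\<^sub>H S g1) g2)"
   by (rule trilinI) (use x in "auto intro!: Fg lin_comp[OF Fs] lin_intro")
  have "tsum VEH (%k h'. \<Phi> x k h') (\<Delta> h) = tsum VEH (%a g. tsum VEH (%a1 a2. F x (a1 *\<^sub>H S a2) g) (\<Delta> a)) (\<Delta> h)"
   using Delta.coassoc_apply[OF kVEHm tri2 x(2)] by (simp add: \<Phi>_def)
  also have "... = tsum VEH (%a g. \<epsilon> a .\<^sub>(kV EHA) F x 1\<^sub>H g) (\<Delta> h)"
  proof (rule Delta_cong[OF x(2)])
   fix a g assume a: "a <: H" "g <: H"
   have f: "(%s. F x s g) \<in> Hom H VEH" using Fs[OF x(1) a(2), THEN lin_Hom] by simp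
   show "tsum VEH (%a1 a2. F x (a1 *\<^sub>H S a2) g) (\<Delta> a) = \<epsilon> a .\<^sub>(kV EHA) F x 1\<^sub>H g"
    using Delta_hom[OF Ha VEHa f a(1), of "%a1 a2. a1 *\<^sub>H S a2"] a
    by (simp add: antipode_r lin_smult[OF Fs[OF x(1) a(2)]])
  qed
  also have "... = F x 1\<^sub>H h"
   using counit_apply_l[OF kVEHm Fg x(2), of x "1\<^sub>H"] x by simp
  finally show ?thesis .
 qed
 have "tmap A EHA lB cod (%x. x) (vE b) = tsum VEH (%x h. tsum VEH (%l r. pVEH (cod (pE x l)) r) (\<tau> h)) (\<rho> b)"
  by (rule T[OF cod_lmod])
 also have "... = tsum VEH (%x h. tsum VEH (%x' k. \<Phi> x' k h) (\<rho> x)) (\<rho> b)" by (rule rho_cong[OF b step1])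
 also have "... = tsum VEH (%x h. tsum VEH (%k h'. \<Phi> x k h') (\<Delta> h)) (\<rho> b)"
  using rho.coassoc_apply[OF kVEHm tri b] by simp
 also have "... = tsum VEH (%x h. F x 1\<^sub>H h) (\<rho> b)" by (rule rho_cong[OF b step2])
 also have "... = tmap A EHA lB (%z. pEH z 1\<^sub>H) (%x. x) (vE b)"
  unfolding F_def by (rule T[OF triv_lmod, symmetric])
 finally show ?thesis .
qed

abbreviation "jGE \<equiv> tmap A EA lB (%x. x) (%x. x)"

lemma incl_lmod: "(%x. x) \<in> lhom A GA EA" by (auto simp: lmod_hom_def)

lemmas jGE_Hom = tmap_Hom[OF tpVG tpVE incl_lmod lin_id]

lemma jGE_closed [simp]: "u <: VG ==> jGE u <: VE"
 by (rule Hom_closed[OF jGE_Hom])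

lemma jGE_pure: "[|g <: G; b <: B|] ==> jGE (pVG g b) = pVE g b"
 using tmap_pure[OF tpVG tpVE incl_lmod lin_id] by simp

text \<open>\<open>\<Gamma>\<close> is the equalizer of two maps of right \<open>A\<close>-modules, and this is preserved by the flat module \<open>B\<close>.\<close>

lemma vE_in_VG:
 assumes b: "b <: B"
 shows "\<exists>u\<in>carrier VG. jGE u = vE b"
proof -
 have "{y \<in> carrier EA. cod y = pEH y 1\<^sub>H} = carrier G" by (rule Set.set_eqI) (simp add: G_carrier)
 then have "EA\<lparr>carrier := {y \<in> carrier EA. cod y = pEH y 1\<^sub>H}\<rparr> = GA" by (simp only: GA_def)
 then show ?thesis
  using flat_equalizer[OF faithfully_flat EA_rmod EHA_rmod cod_lmod triv_lmod vE_closed[OF b] vE_equalized[OF b]] by simp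
qed

lemma jGE_inj: "[|u <: VG; u' <: VG; jGE u = jGE u'|] ==> u = u'"
 by (rule flat_inj[OF faithfully_flat GA_rmod EA_rmod incl_lmod]) simp_all

end

context galois_ext
begin

section \<open>Right multiplication on \<open>M \<otimes>\<^sub>A B\<close>\<close>

definition rmul where "rmul M c = tmap A M lB (%x. x) (%y. y * c)"

lemma rmult_lmod: "c <: B ==> (%y. y * c) \<in> lhom A lB lB"
 by (auto simp: lmod_hom_def B.l_distr B_assoc)

lemma rmul_Hom: "[|lmod (opp A) M; c <: B|] ==> rmul M c \<in> Hom (V M) (V M)"
 unfolding rmul_def by (rule tmap_Hom[OF tpA tpA lin_id rmult_lmod])

lemma rmul_pure: "[|lmod (opp A) M; c <: B; m <: M; y <: B|] ==>
  rmul M c (pA M m y) = pA M m (y * c)"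
 unfolding rmul_def by (simp add: tmap_pure[OF tpA tpA lin_id rmult_lmod])

lemma rmul_closed [simp]: "[|lmod (opp A) M; c <: B; u <: V M|] ==> rmul M c u <: V M"
 by (rule Hom_closed[OF rmul_Hom])

lemma rmul_lin:
 assumes M: "lmod (opp A) M" and c: "c <: B"
 shows "rmul M c \<in> lhom K (kV M) (kV M)"
proof (rule linI)
 show "rmul M c \<in> Hom (kV M) (kV M)" using rmul_Hom[OF M c] by simp
 fix a u assume a: "a <: K" "u <: kV M"
 show "rmul M c (a .\<^sub>(kV M) u) = a .\<^sub>(kV M) rmul M c u"
  by (rule tensor_ext[OF tpA[OF M] tensor_ab[OF tpA[OF M]] Hom_comp[OF kV_Hom[OF M a(1)] rmul_Hom[OF M c]]
    Hom_comp[OF rmul_Hom[OF M c] kV_Hom[OF M a(1)]]])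
   (use a c in "simp_all add: rmul_pure[OF M] kV_pure[OF M] Bm.smult_closed B.smult_mult_l")
qed

lemma rmul_param_lin:
 assumes M: "lmod (opp A) M" and u: "u <: V M"
 shows "(%c. rmul M c u) \<in> lhom K B (kV M)"
proof -
 have "(%c. tsum (kV M) (%m y. pA M m (y * c)) u) \<in> lhom K B (kV M)"
  by (rule lin_lift_param[OF tpA[OF M] kV_left_module[OF M] u]) (intro lin_intro lin_pA_r[OF M]; simp)
 then show ?thesis by (simp add: rmul_def[abs_def] tensor_map_def)
qed

lemma rmul_comp:
 assumes M: "lmod (opp A) M" and c: "c <: B" "d <: B" and u: "u <: V M"
 shows "rmul M c (rmul M d u) = rmul M (d * c) u"
 by (rule tensor_ext[OF tpA[OF M] tensor_ab[OF tpA[OF M]] Hom_comp[OF rmul_Hom[OF M c(2)] rmul_Hom[OF M c(1)]] rmul_Hom[OF M B.m_closed[OF c(2,1)]] _ u])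
   (use c in "simp_all add: rmul_pure[OF M] B_assoc")

lemma balanced_rmul:
 assumes f: "balanced A M lB P f" and c: "c <: B"
 shows "balanced A M lB P (%m y. f m (y * c))"
 using f c unfolding balanced_def by (simp add: B.l_distr B_assoc)

lemma translation_absorb_right_apply:
 assumes P: "abgrp P" and f: "balanced A rB lB P f"
  and y: "y <: B" and h: "h <: H"
 shows "tsum P (%x g. tsum P (%l r. f (x * l) r) (\<tau> (h *\<^sub>H g))) (\<rho> y) =
  tsum P (%l r. f l (r * y)) (\<tau> h)"
proof -
 note F = lift_Hom[OF tpBAB P f] and Fp = lift_pure[OF tpBAB P f]
 have i: "tsum P f (lm x (\<tau> (h *\<^sub>H g))) = tsum P (%l r. f (x * l) r) (\<tau> (h *\<^sub>H g))" if "x <: B" "g <: H" for x g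
  by (rule lift_map[OF tpBAB BABa P F]) (use that h in "simp_all add: Fp")
 have "tsum P f (tsum BAB (%x g. lm x (\<tau> (h *\<^sub>H g))) (\<rho> y)) = tsum P (%x g. tsum P (%l r. f (x * l) r) (\<tau> (h *\<^sub>H g))) (\<rho> y)"
  by (rule rho_map[OF BABa P F y]) (use h in "simp_all add: BAB_lmul_closed i")
 moreover have "tsum P f (rm (\<tau> h) y) = tsum P (%l r. f l (r * y)) (\<tau> h)"
  by (rule tau_map[OF BABa P F h]) (use y in "simp_all add: Fp")
 ultimately show ?thesis by (simp add: translation_absorb_right[OF y h])
qed

end

context galois_Gamma
begin

section \<open>\<open>\<Gamma> \<otimes>\<^sub>A B\<close> is the enveloping algebra\<close>


text \<open>\<open>(x \<otimes> y\<^sup>o\<^sup>p) \<otimes> c \<mapsto> x \<otimes> (y c)\<^sup>o\<^sup>p\<close>; an isomorphism from \<open>\<Gamma> \<otimes>\<^sub>A B\<close> to \<open>B\<^sup>e\<close>.\<close>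

definition mu where "mu = tsum Et (%z c. pE 1 c \<star> z)"

lemma
 shows mu_balanced_E: "balanced A EA lB Et (%z c. pE 1 c \<star> z)"
  and mu_balanced: "balanced A GA lB Et (%z c. pE 1 c \<star> z)"
 by (auto intro!: balancedI simp: E_distrib pE_add_r pE_mult simp flip: E_assoc)

lemmas mu_Hom_E = lift_Hom[OF tpVE Ea mu_balanced_E, folded mu_def]
lemmas mu_Hom = lift_Hom[OF tpVG Ea mu_balanced, folded mu_def]

lemma mu_pure_E: "[|z <: Et; c <: B|] ==> mu (pVE z c) = pE 1 c \<star> z"
 using lift_pure[OF tpVE Ea mu_balanced_E] by (simp add: mu_def)

lemma mu_pure: "[|z <: G; c <: B|] ==> mu (pVG z c) = pE 1 c \<star> z"
 using lift_pure[OF tpVG Ea mu_balanced] by (simp add: mu_def)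

lemma mu_closed [simp]: "u <: VG ==> mu u <: Et"
 by (rule Hom_closed[OF mu_Hom])

lemma mu_lin: "mu \<in> lhom K (kV GA) E"
proof -
 have "tsum E (%z c. pE 1 c \<star> z) \<in> lhom K (kV GA) E"
 proof (rule kV_lift_lin[OF GA_rmod Em])
  show "balanced A GA lB E (%z c. pE 1 c \<star> z)" using mu_balanced by (simp add: balanced_def)
 qed (intro lin_intro; simp)
 then show ?thesis by (simp add: mu_def)
qed

lemma mu_jGE: "u <: VG ==> mu (jGE u) = mu u"
 by (rule tensor_ext[OF tpVG Ea Hom_comp[OF jGE_Hom mu_Hom_E] mu_Hom]) (simp_all add: jGE_pure mu_pure mu_pure_E)

lemma mu_vE:
 assumes b: "b <: B"
 shows "mu (vE b) = pE b 1"
proof -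
 have pEl: "(%z. pE x z) \<in> Hom B Et" if "x <: B" for x
  using that by (auto intro!: HomI simp: pE_add_r)
 have i: "mu (tsum VE (%l r. pVE (pE x l) r) (\<tau> h)) = pE (\<epsilon> h \<odot> x) 1" if x: "x <: B" "h <: H" for x h
 proof -
  have "mu (tsum VE (%l r. pVE (pE x l) r) (\<tau> h)) = tsum Et (%l r. pE x (l * r)) (\<tau> h)"
   by (rule tau_map[OF VEa Ea mu_Hom_E x(2)]) (use x in "simp_all add: mu_pure_E pE_mult")
  also have "... = pE x (tsum B (%l r. l * r) (\<tau> h))"
   by (rule tau_hom[OF Ba Ea pEl[OF x(1)] x(2), symmetric]) simp
  finally show ?thesis using x pure_move[OF Ek.tp, of "\<epsilon> h" x "1"] by (simp add: translation_mult)
 qed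
 have "mu (vE b) = tsum Et (%x h. pE (\<epsilon> h \<odot> x) 1) (\<rho> b)"
  unfolding vE_def by (rule rho_map[OF VEa Ea mu_Hom_E b]) (simp_all add: vE_inner_closed i)
 also have "... = pE (tsum B (%x h. \<epsilon> h \<odot> x) (\<rho> b)) 1"
  by (rule rho_hom[OF Ba Ea _ b, symmetric]) (auto intro!: HomI simp: pE_add_l Bm.smult_closed)
 finally show ?thesis using b by (simp add: coact_counit)
qed

text \<open>The candidate for the inverse of \<open>\<mu>\<close>, with values in \<open>B\<^sup>e \<otimes>\<^sub>A B\<close>.\<close>

definition Xi where "Xi = tsum VE (%x c. rmul EA c (vE x))"

lemma Xi_bilin: "bilin K B (opp B) (kV EA) (%x c. rmul EA c (vE x))"
 by (rule bilinI)
   (use vE_closed in "simp_all add: lin_opp2 rmul_param_lin[OF EA_rmod] lin_comp[OF rmul_lin[OF EA_rmod] vE_lin]")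

lemma Xi_Hom: "Xi \<in> Hom Et VE"
 using Ek.lin_lift[OF kVEm Xi_bilin, THEN lin_Hom] by (simp add: Xi_def)

lemma Xi_pure: "[|x <: B; c <: B|] ==> Xi (pE x c) = rmul EA c (vE x)"
 using Ek.lift_bilin_pure[OF kVEm Xi_bilin] by (simp add: Xi_def)

lemma rmul_vE:
 assumes x: "x <: B" and c: "c <: B"
 shows "rmul EA c (vE x) = tsum VE (%x h. tsum VE (%l r. pVE (pE x l) (r * c)) (\<tau> h)) (\<rho> x)"
proof -
 note R = rmul_Hom[OF EA_rmod c]
 have "rmul EA c (tsum VE (%l r. pVE (pE x l) r) (\<tau> h)) = tsum VE (%l r. pVE (pE x l) (r * c)) (\<tau> h)" if "x <: B" "h <: H" for x h
  by (rule tau_map[OF VEa VEa R that(2)]) (use that c in "simp_all add: rmul_pure[OF EA_rmod]")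
 then show ?thesis unfolding vE_def by (intro rho_map[OF VEa VEa R x]) (simp_all add: vE_inner_closed)
qed

lemma pVE_mult_balanced:
 assumes "z <: Et"
 shows "balanced A rB lB VE (%l r. pVE (pE 1 l \<star> z) r)"
proof (rule balancedI)
 fix r l b assume "r <: A" "l <: rB" "b <: lB"
 then show "pVE (pE 1 (r .\<^sub>rB l) \<star> z) b = pVE (pE 1 l \<star> z) (r .\<^sub>lB b)"
  using pure_move[OF tpVE, of r "pE 1 l \<star> z" b] assms by (simp add: pE_mult flip: E_assoc)
qed (use assms pure_add_l[OF tpVE, simplified] pure_add_r[OF tpVE, simplified] in "simp_all add: pE_add_r E_distrib")

text \<open>For every \<open>z \<in> B\<^sup>e\<close>, applying \<open>\<Xi>\<close> to the image of \<open>z \<otimes> c\<close> means to insert \<open>\<tau>\<close> of the \<open>H\<close>-component of the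
  codiagonal coaction of \<open>z\<close>; on \<open>\<Gamma>\<close> that component is \<open>1\<close>, and \<open>\<tau>(1) = 1 \<otimes> 1\<close>.\<close>

lemma mu_section:
 assumes u: "u <: VG"
 shows "Xi (mu u) = jGE u"
proof (rule tensor_ext[OF tpVG VEa Hom_comp[OF mu_Hom Xi_Hom] jGE_Hom _ u])
 fix v c assume "v <: GA" "c <: lB"
 then have v: "v <: G" and c: "c <: B" by simp_all
 define F where "F e h = tsum VE (%l r. pVE (pE 1 l \<star> e) (r * c)) (\<tau> h)" for e h
 have bal: "balanced A rB lB VE (%l r. pVE (pE 1 l \<star> e) (r * c))" if "e <: Et" for e
  by (rule balanced_rmul[OF pVE_mult_balanced[OF that] c])
 have Fb: "bilin K E H (kV EA) F"
 proof (rule bilinI)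
  fix e assume e: "e <: E"
  have "(%h. tsum (kV EA) (%l r. pVE (pE 1 l \<star> e) (r * c)) (\<tau> h)) \<in> lhom K H (kV EA)"
   by (rule tau_lift_lin[OF kVEm]) (use e c bal in "auto intro!: lin_pA_r[OF EA_rmod] lin_intro")
  then show "(%h. F e h) \<in> lhom K H (kV EA)" by (simp add: F_def)
 next
  fix h assume h: "h <: H"
  have "(%e. tsum (kV EA) (%l r. pVE (pE 1 l \<star> e) (r * c)) (\<tau> h)) \<in> lhom K E (kV EA)"
   by (rule lin_lift_param[OF tpBAB kVEm tau_closed[OF h]]) (use c in "intro lin_intro; simp")
  then show "(%e. F e h) \<in> lhom K E (kV EA)" by (simp add: F_def)
 qed
 let ?F = "tsum VE F"
 have Fa: "?F \<in> Hom EHt VE" using EHk.lin_lift[OF kVEm Fb, THEN lin_Hom] by simp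
 have Fp: "?F (pEH e h) = F e h" if "e <: Et" "h <: H" for e h
  using EHk.lift_bilin_pure[OF kVEm Fb] that by simp
 have Fc: "F e h <: VE" if "e <: Et" "h <: H" for e h
  using bilin_closed[OF Fb, of e h] that by simp
 have key: "Xi (pE 1 c \<star> z) = ?F (cod z)" if z: "z <: Et" for z
 proof (rule tensor_ext[OF Ek.tp VEa Hom_comp[OF E_mult_Hom(1) Xi_Hom] Hom_comp[OF cod_Hom Fa] _ z])
  show "pE 1 c <: Et" using c by simp
  fix x y assume "x <: B" "y <: opp B"
  then have x: "x <: B" and y: "y <: B" by simp_all
  have "Xi (pE 1 c \<star> pE x y) = tsum VE (%x h. tsum VE (%l r. pVE (pE x l) (r * (y * c))) (\<tau> h)) (\<rho> x)" (is "?a = _")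
   using x y c by (simp add: pE_mult Xi_pure rmul_vE)
  also have "... = tsum VE (%x h. ?F (codq x h (\<rho> y))) (\<rho> x)"
  proof (rule rho_cong[OF x])
   fix x h assume x: "x <: B" "h <: H"
   have i: "F (pE x y') (h *\<^sub>H g) = tsum VE (%l r. pVE (pE x (y' * l)) (r * c)) (\<tau> (h *\<^sub>H g))" if "y' <: B" "g <: H" for y' g
    unfolding F_def by (rule tau_cong) (use x that c in "simp_all add: pE_mult")
   have "?F (codq x h (\<rho> y)) = tsum VE (%y' g. tsum VE (%l r. pVE (pE x (y' * l)) (r * c)) (\<tau> (h *\<^sub>H g))) (\<rho> y)"
    unfolding codq_def tens_lift_alg_tensor by (rule rho_map[OF EHa VEa Fa y]) (use x in "simp_all add: Fp i")
   also have "... = tsum VE (%l r. pVE (pE x l) (r * y * c)) (\<tau> h)"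
    by (rule translation_absorb_right_apply[OF VEa balanced_rmul[OF pVE_balanced[OF x(1)] c] y x(2)])
   also have "... = tsum VE (%l r. pVE (pE x l) (r * (y * c))) (\<tau> h)"
    by (rule tau_cong[OF x(2)]) (use x y c in "simp_all add: B_assoc")
   finally show "tsum VE (%l r. pVE (pE x l) (r * (y * c))) (\<tau> h) = ?F (codq x h (\<rho> y))" by simp
  qed
  also have "... = ?F (cod (pE x y))"
   unfolding cod_pure[OF x y] by (rule rho_hom[OF EHa VEa Fa x, symmetric]) (use y in simp)
  finally show "?a = ..." .
 qed
 have "Xi (mu (pVG v c)) = ?F (cod v)" using v c by (simp add: mu_pure key)
 also have "... = F v 1\<^sub>H" using v Fp[of v "1\<^sub>H"] by (simp add: G_carrier)
 also have "... = pVE v c"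
  using lift_pure[OF tpBAB VEa bal[of v], of "1" "1"] v c by (simp add: F_def tau_one E_one)
 finally show "Xi (mu (pA GA v c)) = jGE (pA GA v c)" using v c by (simp add: jGE_pure)
qed

lemma mu_inj: "[|u <: VG; v <: VG; mu u = mu v|] ==> u = v"
 by (rule jGE_inj) (simp_all flip: mu_section)

text \<open>\<open>\<nu> b \<in> \<Gamma> \<otimes>\<^sub>A B\<close> corresponds to \<open>b \<otimes> 1 \<in> B\<^sup>e\<close>; in \<open>B\<^sup>e \<otimes>\<^sub>A B\<close> it is
  \<open>\<Sum> (b\<^sub>(\<^sub>0\<^sub>) \<otimes> l(b\<^sub>(\<^sub>1\<^sub>))) \<otimes> r(b\<^sub>(\<^sub>1\<^sub>))\<close>.\<close>

definition nu where "nu b = (SOME u. u <: VG \<and> jGE u = vE b)"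

lemma nu_closed [simp]: "b <: B ==> nu b <: VG"
 and jGE_nu: "b <: B ==> jGE (nu b) = vE b"
 using someI_ex[OF vE_in_VG[unfolded Bex_def], of b] unfolding nu_def by simp_all

lemma mu_nu: "b <: B ==> mu (nu b) = pE b 1"
 using mu_jGE[OF nu_closed, of b] by (simp add: jGE_nu mu_vE)

lemma nu_unique: "[|b <: B; u <: VG; mu u = pE b 1|] ==> nu b = u"
 by (rule mu_inj) (simp_all add: mu_nu)

lemma nu_lin: "nu \<in> lhom K B (kV GA)"
proof (rule linI[OF HomI])
 interpret VGm: left_module K "kV GA" by (rule kVGm)
 fix x y assume x: "x <: B" "y <: B"
 show "nu x <: kV GA" using x by simp
 have "nu x +\<^sub>VG nu y <: VG" using x abelian_groupE(1)[OF VGa] by simp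
 then show "nu (x \<oplus> y) = nu x +\<^sub>(kV GA) nu y"
  using x by (simp, intro nu_unique) (simp_all add: Hom_add[OF mu_Hom] mu_nu pE_add_l)
next
 interpret VGm: left_module K "kV GA" by (rule kVGm)
 fix c x assume x: "c <: K" "x <: B"
 have cl: "c .\<^sub>(kV GA) nu x <: VG" using VGm.smult_closed[of c "nu x"] x by simp
 show "nu (c \<odot> x) = c .\<^sub>(kV GA) nu x"
  by (rule nu_unique[OF _ cl])
    (use x in "simp_all add: Bm.smult_closed lin_smult[OF mu_lin] mu_nu Ek.alg_smult_pure")
qed

lemma nu_Hom: "nu \<in> Hom B VG" using lin_Hom[OF nu_lin] by simp

lemma nu_A: "a <: A ==> nu a = pVG (pE a 1) 1"
 by (rule nu_unique) (simp_all add: mu_pure pE_mult)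

lemma nu_expand:
 assumes P: "abgrp P" and f: "f \<in> Hom Et P" and b: "b <: B"
 shows "tsum P (%g y. f (pE 1 y \<star> g)) (nu b) = f (pE b 1)"
proof -
 have "f (mu (nu b)) = tsum P (%g y. f (pE 1 y \<star> g)) (nu b)"
  unfolding mu_def by (rule lift_hom[OF tpVG Ea P f nu_closed[OF b]]) simp
 then show ?thesis using b by (simp add: mu_nu)
qed

lemma mu_sum_nu:
 assumes b: "b <: B" and g: "g \<in> Hom Et Et" and f: "!!v y. [|v <: G; y <: B|] ==> f v y <: VG"
  "!!v y. [|v <: G; y <: B|] ==> mu (f v y) = g (pE 1 y \<star> v)"
 shows "tsum VG f (nu b) <: VG" "mu (tsum VG f (nu b)) = g (pE b 1)"
 using lift_closed[OF tpVG VGa nu_closed[OF b], of f] lift_map[OF tpVG VGa Ea mu_Hom nu_closed[OF b], of f] f nu_expand[OF Ea g b] by simp_all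

text \<open>Multiplicativity of \<open>\<nu>\<close> for the algebra structure that \<open>\<Gamma> \<otimes>\<^sub>A B\<close> inherits from \<open>B\<^sup>e\<close>, and the
  bimodule property over \<open>A\<close>; both can be read off after applying \<open>\<mu>\<close>.\<close>

lemma nu_mult:
 assumes b: "b <: B" and b': "b' <: B"
 shows "nu (b * b') = tsum VG (%v' y'. tsum VG (%v y. pVG (v \<star> v') (y * y')) (nu b)) (nu b')"
proof -
 have i: "tsum VG (%v y. pVG (v \<star> v') (y * y')) (nu b) <: VG"
  "mu (tsum VG (%v y. pVG (v \<star> v') (y * y')) (nu b)) = pE b 1 \<star> (pE 1 y' \<star> v')" if g: "v' <: G" "y' <: B" for v' y'
 proof -
  have f: "(%z. pE 1 y' \<star> z \<star> v') \<in> Hom Et Et" using g by (auto intro!: HomI simp: E_distrib)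
  note m = mu_sum_nu[OF b f, of "%v y. pVG (v \<star> v') (y * y')"]
  show "tsum VG (%v y. pVG (v \<star> v') (y * y')) (nu b) <: VG"
   "mu (tsum VG (%v y. pVG (v \<star> v') (y * y')) (nu b)) = pE b 1 \<star> (pE 1 y' \<star> v')"
   using m g b by (simp_all add: mu_pure pE_mult flip: E_assoc)
 qed
 have f: "(%z. pE b 1 \<star> z) \<in> Hom Et Et" by (rule E_mult_Hom(1)) (use b in simp)
 show ?thesis
  using mu_sum_nu[OF b' f, of "%v' y'. tsum VG (%v y. pVG (v \<star> v') (y * y')) (nu b)"] i b b'
  by (intro nu_unique) (simp_all add: pE_mult)
qed

lemma nu_A_mult:
 assumes a: "a <: A" and b: "b <: B"
 shows "nu (a * b) = tsum VG (%g y. pVG (pE a 1 \<star> g) y) (nu b)"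
 using mu_sum_nu[OF b E_mult_Hom(1), of "pE a 1" "%g y. pVG (pE a 1 \<star> g) y"] a b
 by (intro nu_unique) (simp_all add: mu_pure pE_mult flip: E_assoc)

lemma nu_mult_A:
 assumes a: "a <: A" and b: "b <: B"
 shows "nu (b * a) = tsum VG (%g y. pVG (g \<star> pE a 1) y) (nu b)"
 using mu_sum_nu[OF b E_mult_Hom(2), of "pE a 1" "%g y. pVG (g \<star> pE a 1) y"] a b
 by (intro nu_unique) (simp_all add: mu_pure pE_mult E_assoc)

lemma mu_rmul_nu: "[|b <: B; c <: B|] ==> mu (rmul GA c (nu b)) = pE b c"
 using mu_sum_nu(2)[of b "%z. pE 1 c \<star> z" "%g y. pVG g (y * c)"] E_mult_Hom(1)[of "pE 1 c"]
 by (simp add: rmul_def tensor_map_def mu_pure pE_mult flip: E_assoc)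

lemma nu_right_A:
 assumes a: "a <: A" and b: "b <: B"
 shows "tsum VG (%g y. pVG (g \<star> pE 1 a) y) (nu b) = rmul GA a (nu b)"
 using mu_sum_nu[OF b E_mult_Hom(2), of "pE 1 a" "%g y. pVG (g \<star> pE 1 a) y"] a b
 by (intro mu_inj) (simp_all add: rmul_closed[OF GA_rmod] mu_rmul_nu mu_pure pE_mult E_assoc)

lemma nu_rmul_bilin: "bilin K B (opp B) (kV GA) (%x y. rmul GA y (nu x))"
 by (rule bilinI)
   (simp_all add: lin_opp2 rmul_param_lin[OF GA_rmod] lin_comp[OF rmul_lin[OF GA_rmod] nu_lin])

text \<open>Both sides have the same image under \<open>\<mu>\<close>, namely the element of \<open>\<Gamma>\<close>.\<close>

lemma nu_Gamma:
 assumes z: "z <: G"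
 shows "tsum VG (%x y. rmul GA y (nu x)) z = pVG z 1"
proof (rule mu_inj)
 have cl: "rmul GA y (nu x) <: VG" if "x <: B" "y <: B" for x y
  using that by (simp add: rmul_closed[OF GA_rmod])
 show "tsum VG (%x y. rmul GA y (nu x)) z <: VG"
  by (rule lift_closed[OF Ek.tp VGa]) (use z cl in simp_all)
 have "mu (tsum VG (%x y. rmul GA y (nu x)) z) = tsum Et pE z"
  by (rule lift_map[OF Ek.tp VGa Ea mu_Hom]) (use z cl in "simp_all add: mu_rmul_nu")
 also have "... = z" using z by (simp add: lift_id[OF Ek.tp])
 finally show "mu (tsum VG (%x y. rmul GA y (nu x)) z) = mu (pVG z 1)" using z by (simp add: mu_pure E_one)
qed (use z in simp)

end

context galois_Gamma
begin

section \<open>The translation element in \<open>B \<otimes>\<^sub>A \<Gamma> \<otimes>\<^sub>A B\<close>\<close>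

lemmas nu_cong = lift_cong[OF tpVG nu_closed, unfolded reg_simps EA_simps] and nu_hom = lift_hom[OF tpVG _ _ _ nu_closed, unfolded reg_simps EA_simps]
 and nu_map = lift_map[OF tpVG _ _ _ nu_closed, unfolded reg_simps EA_simps] and nu_sum_closed = lift_closed[OF tpVG _ nu_closed, unfolded reg_simps EA_simps]

text \<open>\<open>X\<close> stands for \<open>\<Gamma>\<close> or \<open>B\<^sup>e\<close>.\<close>

definition Ae_stable where
 "Ae_stable X \<longleftrightarrow> abgrp X \<and> carrier X \<subseteq> carrier Et \<and> add X = add Et \<and> monoid.mult X = monoid.mult E \<and>
  (\<forall>a\<in>carrier A. \<forall>a'\<in>carrier A. \<forall>z\<in>carrier X. pE a a' \<star> z <: X)"

lemma Ae_stable_G: "Ae_stable G" and Ae_stable_E: "Ae_stable E"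
 unfolding Ae_stable_def using Gr.abelian_group_axioms Er.abelian_group_axioms
 by (auto simp: subset_iff)

text \<open>Maps of three arguments that factor through \<open>B \<otimes>\<^sub>A X \<otimes>\<^sub>A B\<close>.\<close>

definition trib where
 "trib X P \<phi> \<longleftrightarrow> (\<forall>x\<in>carrier B. \<forall>z\<in>carrier X. \<forall>y\<in>carrier B. \<phi> x z y <: P) \<and>
  (\<forall>z\<in>carrier X. \<forall>y\<in>carrier B. (%x. \<phi> x z y) \<in> Hom B P) \<and>
  (\<forall>x\<in>carrier B. \<forall>y\<in>carrier B. (%z. \<phi> x z y) \<in> Hom X P) \<and>
  (\<forall>x\<in>carrier B. \<forall>z\<in>carrier X. (%y. \<phi> x z y) \<in> Hom B P) \<and>
  (\<forall>a\<in>carrier A. \<forall>x\<in>carrier B. \<forall>z\<in>carrier X. \<forall>y\<in>carrier B.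
    \<phi> (x * a) z y = \<phi> x (pE a 1 \<star> z) y \<and> \<phi> x (pE 1 a \<star> z) y = \<phi> x z (a * y))"

abbreviation "BX X \<equiv> tensor A rB (G_left K B X)"
abbreviation "pBX X \<equiv> pt A rB (G_left K B X)"
abbreviation "BXr X \<equiv> tensor_BG K H B X"
abbreviation "BXB X \<equiv> tensor_BGB K H B X"
abbreviation "pBXB X \<equiv> pure_BGB K H B X"

lemma G_left_simps [simp]: "carrier (G_left K B X) = carrier X" "add (G_left K B X) = add X"
 "smult (G_left K B X) = (%a z. pE a 1 *\<^sub>X z)" "abgrp (G_left K B X) = abgrp X"
 by (simp_all add: G_left_def)

lemma BXr_simps [simp]: "carrier (BXr X) = carrier (BX X)" "add (BXr X) = add (BX X)" "0\<^sub>(BXr X) = 0\<^sub>(BX X)"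
 "abgrp (BXr X) = abgrp (BX X)" "Hom (BXr X) P = Hom (BX X) P"
 "smult (BXr X) a = tsum (BX X) (%x z. pBX X x (pE 1 a *\<^sub>X z))"
 by (simp_all add: tensor_BG_def Let_def Hom_def)

context
 fixes X :: "('k, ('b, 'b) tens) module"
 assumes X: "Ae_stable X"
begin

lemma Ae_stable_simps: "abgrp X" "add X = add Et" "monoid.mult X = monoid.mult E"
 "z <: X ==> z <: Et" "[|a <: A; a' <: A; z <: X|] ==> pE a a' \<star> z <: X"
 using X by (auto simp: Ae_stable_def)

lemma tpBX: "tpair A rB (G_left K B X)"
 using A_rmod by (auto simp: tpair_def lmod_ab Ae_stable_simps)

lemma BX_act_balanced:
 assumes a: "a <: A"
 shows "balanced A rB (G_left K B X) (BX X) (%x z. pBX X x (pE 1 a *\<^sub>X z))"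
proof (rule balancedI)
 fix r x z assume r: "r <: A" "x <: rB" "z <: G_left K B X"
 have "pE 1 a \<star> (pE r 1 \<star> z) = pE r 1 \<star> (pE 1 a \<star> z)"
  using a r by (simp add: pE_mult Ae_stable_simps flip: E_assoc)
 then show "pBX X (r .\<^sub>rB x) (pE 1 a *\<^sub>X z) = pBX X x (pE 1 a *\<^sub>X (r .\<^sub>(G_left K B X) z))"
  using pure_move[OF tpBX, of r x "pE 1 a \<star> z"] a r by (simp add: Ae_stable_simps)
qed (use a pure_add_r[OF tpBX, simplified] pure_add_l[OF tpBX, simplified] in "simp_all add: pure_closed[OF tpBX] Ae_stable_simps E_distrib")

lemma BX_act_Hom: "a <: A ==> smult (BXr X) a \<in> Hom (BX X) (BX X)"
 unfolding BXr_simps by (rule lift_Hom[OF tpBX tensor_ab[OF tpBX] BX_act_balanced])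

lemma BX_act_pure: "[|a <: A; x <: B; z <: X|] ==> a .\<^sub>(BXr X) pBX X x z = pBX X x (pE 1 a \<star> z)"
 using lift_pure[OF tpBX tensor_ab[OF tpBX] BX_act_balanced[of a], of x z] by (simp add: Ae_stable_simps)

lemma tpBXB: "tpair A (BXr X) lB"
proof -
 have "tpair A rB lB" by (rule tpBAB)
 then show ?thesis
  using tensor_ab[OF tpBX] Hom_closed[OF BX_act_Hom] unfolding tpair_def by auto
qed

lemma BXBa: "abgrp (BXB X)" unfolding tensor_BGB_def by (rule tensor_ab[OF tpBXB])

lemma pBX_closed: "[|x <: B; z <: X|] ==> pBX X x z <: BX X"
 by (simp add: pure_closed[OF tpBX])

lemma pBXB_closed: "[|x <: B; z <: X; y <: B|] ==> pBXB X x z y <: BXB X"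
 unfolding tensor_BGB_def pure_BGB_def by (simp add: pure_closed[OF tpBXB] pBX_closed)

lemma pBXB_trib: "trib X (BXB X) (pBXB X)"
 unfolding trib_def
proof (intro conjI ballI, goal_cases)
 case 1 then show ?case by (rule pBXB_closed)
next
 case 2 then show ?case using pure_add_l[OF tpBX, simplified] pure_add_l[OF tpBXB, simplified]
  by (intro HomI) (simp_all add: pBXB_closed pBX_closed pure_BGB_def tensor_BGB_def pure_closed[OF tpBXB])
next
 case 3 then show ?case using pure_add_r[OF tpBX, simplified] pure_add_l[OF tpBXB, simplified]
  by (intro HomI) (simp_all add: pBXB_closed pBX_closed pure_BGB_def tensor_BGB_def pure_closed[OF tpBXB])
next
 case 4 then show ?case using pure_add_r[OF tpBXB, simplified]
  by (intro HomI) (simp_all add: pBXB_closed pBX_closed pure_BGB_def tensor_BGB_def pure_closed[OF tpBXB])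
next
 case (5 a x z y) then show ?case using pure_move[OF tpBX, of a x z] by (simp add: pure_BGB_def Ae_stable_simps)
next
 case (6 a x z y) then show ?case using pure_move[OF tpBXB, of a "pBX X x z" y] BX_act_pure[of a x z] pBX_closed[of x z]
  by (simp add: pure_BGB_def del: BXr_simps(6))
qed

context
 fixes P :: "('p, 'q) ring_scheme" and \<phi>
 assumes P: "abgrp P" and \<phi>: "trib X P \<phi>"
begin

lemma trib_inner: "y <: B ==> balanced A rB (G_left K B X) P (%x z. \<phi> x z y)"
 using \<phi> unfolding trib_def by (intro balancedI) (auto simp: Hom_def Ae_stable_simps)

lemma trib_GA: "x <: B ==> X = G ==> balanced A GA lB P (%z y. \<phi> x z y)"
 using \<phi> unfolding trib_def by (intro balancedI) (auto simp: Hom_def)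

lemma trib_outer: "balanced A (BXr X) lB P (%u y. tsum P (%x z. \<phi> x z y) u)"
proof (rule balancedI)
 note F = lift_Hom[OF tpBX P trib_inner]
 { fix u y assume "u <: BXr X" "y <: lB"
  then show "tsum P (%x z. \<phi> x z y) u <: P" using Hom_closed[OF F] by simp }
 { fix u u' y assume "u <: BXr X" "u' <: BXr X" "y <: lB"
  then show "tsum P (%x z. \<phi> x z y) (u +\<^sub>(BXr X) u') = tsum P (%x z. \<phi> x z y) u +\<^sub>P tsum P (%x z. \<phi> x z y) u'"
   using Hom_add[OF F] by simp }
 { fix u y y' assume u: "u <: BXr X" "y <: lB" "y' <: lB"
  have "(%y. tsum P (%x z. \<phi> x z y) u) \<in> Hom B P"
   by (rule lift_Hom_param[OF tpBX P]) (use u \<phi> in "simp_all add: trib_def")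
  from Hom_add[OF this] show "tsum P (%x z. \<phi> x z (y +\<^sub>lB y')) u = tsum P (%x z. \<phi> x z y) u +\<^sub>P tsum P (%x z. \<phi> x z y') u"
   using u by simp }
 { fix a u y assume a: "a <: A" and u: "u <: BXr X" and y: "y <: lB"
  have y': "y <: B" and ay: "a * y <: B" using a y by simp_all
  have "tsum P (%x z. \<phi> x z y) (a .\<^sub>(BXr X) u) = tsum P (%x z. \<phi> x z (a * y)) u"
  proof (rule tensor_ext[OF tpBX P Hom_comp[OF BX_act_Hom[OF a] F[OF y']] F[OF ay]])
   show "u <: BX X" using u by simp
   fix x z assume "x <: rB" "z <: G_left K B X"
   then have x: "x <: B" and z: "z <: X" by simp_all
   have e: "\<phi> x (pE 1 a \<star> z) y = \<phi> x z (a * y)" using \<phi> a x z y' unfolding trib_def by blast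
   show "tsum P (%x z. \<phi> x z y) (a .\<^sub>(BXr X) pBX X x z) = tsum P (%x z. \<phi> x z (a * y)) (pBX X x z)"
    unfolding BX_act_pure[OF a x z]
    using lift_pure[OF tpBX P trib_inner[OF y'], of x "pE 1 a \<star> z"] lift_pure[OF tpBX P trib_inner[OF ay], of x z] a x z
    by (simp add: e Ae_stable_simps)
  qed
  then show "tsum P (%x z. \<phi> x z y) (a .\<^sub>(BXr X) u) = tsum P (%x z. \<phi> x z (a .\<^sub>lB y)) u"
   by (simp del: BXr_simps) }
qed

lemma lift_BGB_Hom: "lift_BGB P \<phi> \<in> Hom (BXB X) P"
 using lift_Hom[OF tpBXB P trib_outer] by (simp add: lift_BGB_def[abs_def] tensor_BGB_def)

lemma lift_BGB_pure: "[|x <: B; z <: X; y <: B|] ==> lift_BGB P \<phi> (pBXB X x z y) = \<phi> x z y"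
 using lift_pure[OF tpBXB P trib_outer, of "pBX X x z" y] lift_pure[OF tpBX P trib_inner, of y x z]
 by (simp add: lift_BGB_def pure_BGB_def pBX_closed)

end

lemma BXB_ext:
 assumes Q: "abgrp Q" and f: "f \<in> Hom (BXB X) Q" and g: "g \<in> Hom (BXB X) Q"
  and eq: "!!x z y. [|x <: B; z <: X; y <: B|] ==> f (pBXB X x z y) = g (pBXB X x z y)"
  and u: "u <: BXB X"
 shows "f u = g u"
proof (rule tensor_ext[OF tpBXB Q f[unfolded tensor_BGB_def] g[unfolded tensor_BGB_def] _ u[unfolded tensor_BGB_def]])
 fix v y assume v: "v <: BXr X" and y: "y <: lB"
 have p: "(%v. pt A (BXr X) lB v y) \<in> Hom (BX X) (BXB X)"
  by (rule HomI) (use y pure_add_l[OF tpBXB, simplified] pure_closed[OF tpBXB] in "simp_all add: tensor_BGB_def")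
 show "f (pt A (BXr X) lB v y) = g (pt A (BXr X) lB v y)"
  by (rule tensor_ext[OF tpBX Q Hom_comp[OF p f] Hom_comp[OF p g]])
    (use v y eq[unfolded pure_BGB_def] in simp_all)
qed

end

lemma trib_G_E: "trib E P \<phi> ==> trib G P \<phi>"
 by (simp add: trib_def Hom_def Pi_iff)

definition jBB where "jBB = lift_BGB (BXB E) (pBXB E)"

lemmas jBB_Hom = lift_BGB_Hom[OF Ae_stable_G BXBa[OF Ae_stable_E] trib_G_E[OF pBXB_trib[OF Ae_stable_E]], folded jBB_def]
lemmas jBB_pure = lift_BGB_pure[OF Ae_stable_G BXBa[OF Ae_stable_E] trib_G_E[OF pBXB_trib[OF Ae_stable_E]], folded jBB_def]

lemma Lam_Hom: "tsum VG (%x y. rmul GA y (nu x)) \<in> Hom Et VG"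
 using Ek.lin_lift[OF kVGm nu_rmul_bilin, THEN lin_Hom] by simp

lemma Lam_pure: "[|x <: B; y <: B|] ==> tsum VG (%x y. rmul GA y (nu x)) (pE x y) = rmul GA y (nu x)"
 using Ek.lift_bilin_pure[OF kVGm nu_rmul_bilin] by simp

lemma trib_lift_VG:
 assumes P: "abgrp P" and \<phi>: "trib G P \<phi>"
 shows "x <: B ==> tsum P (\<phi> x) \<in> Hom VG P"
  "[|x <: B; g <: G; y <: B|] ==> tsum P (\<phi> x) (pVG g y) = \<phi> x g y"
 using lift_Hom[OF tpVG P trib_GA[OF Ae_stable_G P \<phi> _ refl]] lift_pure[OF tpVG P trib_GA[OF Ae_stable_G P \<phi> _ refl]]
 by simp_all

text \<open>A retraction of \<open>B \<otimes>\<^sub>A \<Gamma> \<otimes>\<^sub>A B \<rightarrow> B \<otimes>\<^sub>A B\<^sup>e \<otimes>\<^sub>A B\<close> is \<open>x \<otimes> (b \<otimes> c\<^sup>o\<^sup>p) \<otimes> y \<mapsto> \<Sum> x \<otimes> \<nu>(b) c y\<close>, because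
  \<open>\<Sum> \<nu>(b) c = \<gamma> \<otimes> 1\<close> for \<open>\<gamma> = \<Sum> b \<otimes> c\<^sup>o\<^sup>p \<in> \<Gamma>\<close>.\<close>

lemma jBB_retract:
 obtains \<omega> where "\<omega> \<in> Hom (BXB E) (BXB G)" "!!t. t <: BXB G ==> \<omega> (jBB t) = t"
proof -
 let ?P = "BXB G"
 note P = BXBa[OF Ae_stable_G] and tr = pBXB_trib[OF Ae_stable_G]
 let ?L = "tsum VG (%x y. rmul GA y (nu x))"
 define Q where "Q x = tsum ?P (pBXB G x)" for x
 note Qa = trib_lift_VG(1)[OF P tr, folded Q_def] and Qp = trib_lift_VG(2)[OF P tr, folded Q_def]
 note ra = rmul_Hom[OF GA_rmod] and Lc = Hom_closed[OF Lam_Hom]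
 have LA: "?L (pE 1 a \<star> z) = rmul GA a (?L z)" if a: "a <: A" and z: "z <: Et" for a z
  by (rule tensor_ext[OF Ek.tp VGa Hom_comp[OF E_mult_Hom(1) Lam_Hom] Hom_comp[OF Lam_Hom ra] _ z])
    (use a in "simp_all add: pE_mult Lam_pure rmul_comp[OF GA_rmod]")
 have QA: "Q (x * a) (?L z) = Q x (?L (pE a 1 \<star> z))" if a: "a <: A" and x: "x <: B" and z: "z <: Et" for a x z
 proof (rule tensor_ext[OF Ek.tp P Hom_comp[OF Lam_Hom Qa] Hom_comp[OF Hom_comp[OF E_mult_Hom(1) Lam_Hom] Qa] _ z])
  fix b c assume "b <: B" "c <: opp B"
  then have b: "b <: B" and c: "c <: B" by simp_all
  have m: "Q x (rmul GA c (pVG (pE a 1 \<star> g) y)) = Q (x * a) (rmul GA c (pVG g y))" if "g <: G" "y <: B" for g y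
   using tr a x c that by (simp add: rmul_pure[OF GA_rmod] Qp trib_def)
  have "Q x (?L (pE a 1 \<star> pE b c)) = Q x (rmul GA c (nu (a * b)))"
   using a b c by (simp add: pE_mult Lam_pure)
  also have "... = tsum ?P (%g y. Q x (rmul GA c (pVG (pE a 1 \<star> g) y))) (nu b)"
   unfolding nu_A_mult[OF a b]
   by (rule nu_hom[OF VGa P Hom_comp[OF ra[OF c] Qa[OF x]] b]) (use a in simp)
  also have "... = tsum ?P (%g y. Q (x * a) (rmul GA c (pVG g y))) (nu b)"
   by (rule nu_cong[OF b])
     (use a x c m in "simp_all add: Hom_closed[OF Qa] rmul_closed[OF GA_rmod]")
  also have "... = Q (x * a) (rmul GA c (nu b))"
   by (rule tensor_Hom_lift[OF tpVG P Hom_comp[OF ra[OF c] Qa] nu_closed[OF b], symmetric]) (use a x in simp)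
  finally show "Q (x * a) (?L (pE b c)) = Q x (?L (pE a 1 \<star> pE b c))" using b c by (simp add: Lam_pure)
 qed (use a x in simp_all)
 define k where "k x z y = Q x (rmul GA y (?L z))" for x z y
 have rL: "rmul GA y (?L z) <: VG" if "y <: B" "z <: Et" for y z
  using that Lc by (simp add: rmul_closed[OF GA_rmod])
 have rLm: "rmul GA y (?L z) = ?L (pE 1 y \<star> z)" if y: "y <: B" and z: "z <: Et" for y z
  by (rule tensor_ext[OF Ek.tp VGa Hom_comp[OF Lam_Hom ra] Hom_comp[OF E_mult_Hom(1) Lam_Hom] _ z])
    (use y in "simp_all add: pE_mult Lam_pure rmul_comp[OF GA_rmod]")
 have psi: "trib E ?P k"
  unfolding trib_def
 proof (intro conjI ballI)
  fix x z y assume "x <: B" "z <: E" "y <: B"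
  then show "k x z y <: ?P" by (simp add: k_def rL Hom_closed[OF Qa])
 next
  fix z y assume zy: "z <: E" "y <: B"
  have "(%x. Q x w) \<in> Hom B ?P" if w: "w <: VG" for w
   unfolding Q_def by (rule lift_Hom_param[OF tpVG P w]) (use tr in "simp add: trib_def")
  then show "(%x. k x z y) \<in> Hom B ?P" using zy by (simp add: k_def rL)
 next
  fix x y assume x: "x <: B" "y <: B"
  show "(%z. k x z y) \<in> Hom E ?P"
   using Hom_comp[OF Hom_comp[OF Lam_Hom ra[OF x(2)]] Qa[OF x(1)]] by (simp add: k_def)
 next
  fix x z assume x: "x <: B" "z <: E"
  have "(%y. rmul GA y (?L z)) \<in> Hom B VG"
   using rmul_param_lin[OF GA_rmod, of "?L z", THEN lin_Hom] x Lc by simp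
  from Hom_comp[OF this Qa[OF x(1)]] show "(%y. k x z y) \<in> Hom B ?P" by (simp add: k_def)
 next
  fix a x z y assume a: "a <: A" and x: "x <: B" and z: "z <: E" and y: "y <: B"
  have e: "pE a 1 \<star> (pE 1 y \<star> z) = pE 1 y \<star> (pE a 1 \<star> z)"
   using a y z by (simp add: pE_mult flip: E_assoc)
  show "k (x * a) z y = k x (pE a 1 \<star> z) y"
   using a x y z QA[OF a x, of "pE 1 y \<star> z"] by (simp add: k_def rLm e)
  show "k x (pE 1 a \<star> z) y = k x z (a * y)"
   using a y z Lc by (simp add: k_def LA rmul_comp[OF GA_rmod])
 qed
 note W = lift_BGB_Hom[OF Ae_stable_E P psi] and Wp = lift_BGB_pure[OF Ae_stable_E P psi]
 have "lift_BGB ?P k (jBB t) = t" if t: "t <: BXB G" for t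
 proof (rule BXB_ext[OF Ae_stable_G P Hom_comp[OF jBB_Hom W] Hom_id _ t])
  fix x z y assume x: "x <: B" and z: "z <: G" and y: "y <: B"
  show "lift_BGB ?P k (jBB (pBXB G x z y)) = pBXB G x z y"
   using x y z by (simp add: jBB_pure Wp k_def nu_Gamma rmul_pure[OF GA_rmod] Qp)
 qed
 with W show thesis by (rule that)
qed

lemma jBB_inj: "[|t <: BXB G; t' <: BXB G; jBB t = jBB t'|] ==> t = t'"
 by (rule jBB_retract) metis

text \<open>In \<open>B \<otimes>\<^sub>A B\<^sup>e \<otimes>\<^sub>A B\<close> the right-hand side is \<open>\<Sum> l(h) \<otimes> (r(h)\<^sub>(\<^sub>0\<^sub>) \<otimes> l(r(h)\<^sub>(\<^sub>1\<^sub>))\<^sup>o\<^sup>p) \<otimes> r(r(h)\<^sub>(\<^sub>1\<^sub>))\<close>, and the coaction of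
  \<open>r(h)\<close> is \<open>\<Sum> l(h\<^sub>(\<^sub>1\<^sub>)) \<otimes> r(h\<^sub>(\<^sub>1\<^sub>)) \<otimes> h\<^sub>(\<^sub>2\<^sub>)\<close>. The equation descends because \<open>\<Gamma> \<otimes>\<close> embeds into \<open>B\<^sup>e \<otimes>\<close>.\<close>

theorem translation2_eq:
 assumes h: "h <: H"
 shows "translation2 K H B h = tsum (BXB G) (%l r. tsum (BXB G) (pBXB G l) (nu r)) (\<tau> h)"
proof -
 let ?t = "tsum (BXB G) (%l r. tsum (BXB G) (pBXB G l) (nu r)) (\<tau> h)"
 note GP = BXBa[OF Ae_stable_G] and EP = BXBa[OF Ae_stable_E] and trE = pBXB_trib[OF Ae_stable_E]
 note pcG = pBXB_closed[OF Ae_stable_G] and pcE = pBXB_closed[OF Ae_stable_E]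
 have inner: "tsum (BXB G) (pBXB G l) (nu r) <: BXB G" if "l <: B" "r <: B" for l r
  by (rule nu_sum_closed[OF GP that(2)]) (use that in "simp add: pcG")
 have t: "?t <: BXB G"
  by (rule tau_sum_closed[OF GP h]) (simp add: inner)
 have balE: "balanced A EA lB (BXB E) (pBXB E l)" if "l <: B" for l
  using trE that unfolding trib_def by (intro balancedI) (auto simp: Hom_def)
 have zadd: "(%z. pBXB E x z y) \<in> Hom E (BXB E)" if "x <: B" "y <: B" for x y
  using trE that by (simp add: trib_def)
 have ladd: "(%x. pBXB E x z y) \<in> Hom B (BXB E)" if "z <: Et" "y <: B" for z y
  using trE that by (simp add: trib_def)
 have move_l: "pBXB E (l * a) z y = pBXB E l (pE a 1 \<star> z) y"
  and move_r: "pBXB E l z (a * y) = pBXB E l (pE 1 a \<star> z) y"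
  if "a <: A" "l <: B" "z <: Et" "y <: B" for a l z y
  using trE that by (simp_all add: trib_def)
 have pEl: "(%x. pE x y) \<in> Hom B Et" and pEr: "(%x. pE y x) \<in> Hom B Et" if "y <: B" for y
  using that by (auto intro!: HomI simp: pE_add_l pE_add_r)
 have balT: "balanced A rB lB (BXB E) (%l' r'. pBXB E l (pE s l') r')"
  if l: "l <: B" "s <: B" for l s
 proof (rule balancedI)
  fix r x y assume "r <: A" "x <: rB" "y <: lB"
  then show "pBXB E l (pE s (r .\<^sub>rB x)) y = pBXB E l (pE s x) (r .\<^sub>lB y)"
   using l by (simp add: move_r pE_mult)
 next
  fix x y assume "x <: rB" "y <: lB"
  then show "pBXB E l (pE s x) y <: BXB E" using l by (simp add: pcE)
 next
  fix x x' y assume x: "x <: rB" "x' <: rB" "y <: lB"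
  then have "pE s x <: E" "pE s x' <: E" "y <: B" using l by simp_all
  from Hom_add[OF zadd[OF l(1) this(3)] this(1,2)]
  show "pBXB E l (pE s (x +\<^sub>rB x')) y = pBXB E l (pE s x) y +\<^sub>(BXB E) pBXB E l (pE s x') y"
   using l x by (simp add: pE_add_r)
 next
  fix x y y' assume x: "x <: rB" "y <: lB" "y' <: lB"
  have "(%y. pBXB E l (pE s x) y) \<in> Hom B (BXB E)" using trE l x by (simp add: trib_def)
  from Hom_add[OF this] show "pBXB E l (pE s x) (y +\<^sub>lB y') = pBXB E l (pE s x) y +\<^sub>(BXB E) pBXB E l (pE s x) y'"
   using x by simp
 qed
 have i: "jBB (tsum (BXB G) (pBXB G l) (nu r)) = tsum (BXB E) (%x g. tsum (BXB E) (%l' r'. pBXB E l (pE x l') r') (\<tau> g)) (\<rho> r)"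
  if l: "l <: B" and r: "r <: B" for l r
 proof -
  note Q = lift_Hom[OF tpVE EP balE[OF l]] and Qp = lift_pure[OF tpVE EP balE[OF l], simplified]
  have "jBB (tsum (BXB G) (pBXB G l) (nu r)) = tsum (BXB E) (%v y. tsum (BXB E) (pBXB E l) (pVE v y)) (nu r)"
   by (rule nu_map[OF GP EP jBB_Hom r]) (use l in "simp_all add: pcG jBB_pure Qp")
  also have "... = tsum (BXB E) (pBXB E l) (vE r)"
   unfolding jGE_nu[OF r, symmetric] tensor_map_def by (rule nu_hom[OF VEa EP Q r, symmetric]) simp
  also have "... = tsum (BXB E) (%x g. tsum (BXB E) (%l' r'. pBXB E l (pE x l') r') (\<tau> g)) (\<rho> r)"
   unfolding vE_def
  proof (rule rho_map[OF VEa EP Q r])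
   fix x g assume x: "x <: B" "g <: H"
   show "tsum (BXB E) (pBXB E l) (tsum VE (%l r. pVE (pE x l) r) (\<tau> g)) = tsum (BXB E) (%l' r'. pBXB E l (pE x l') r') (\<tau> g)"
    by (rule tau_map[OF VEa EP Q x(2)]) (use x in "simp_all add: Qp")
  qed (rule vE_inner_closed)
  finally show ?thesis .
 qed
 have "jBB ?t = tsum (BXB E) (%l r. tsum (BXB E) (%x g. tsum (BXB E) (%l' r'. pBXB E l (pE x l') r') (\<tau> g)) (\<rho> r)) (\<tau> h)"
  by (rule tau_map[OF GP EP jBB_Hom h]) (simp_all add: inner i)
 also have "... = tsum (BXB E) (%h1 h2. tsum (BXB E) (%l r. tsum (BXB E) (%l' r'. pBXB E l (pE r l') r') (\<tau> h2)) (\<tau> h1)) (\<Delta> h)"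
 proof (rule translation_coact_right_apply[OF EP h])
  fix g assume g: "g <: H"
  show "balanced A rB lB (BXB E) (%l r. tsum (BXB E) (%l' r'. pBXB E l (pE r l') r') (\<tau> g))" (is "balanced _ _ _ _ ?F")
  proof (rule balancedI)
   fix l r assume "l <: rB" "r <: lB"
   then show "?F l r <: BXB E" by (intro tau_sum_closed[OF EP g]) (simp add: pcE)
  next
   fix l l2 r assume l: "l <: rB" "l2 <: rB" "r <: lB"
   have "(%l. ?F l r) \<in> Hom B (BXB E)"
    by (rule lift_Hom_param[OF tpBAB EP tau_closed[OF g]]) (use l in "simp add: ladd")
   from Hom_add[OF this] show "?F (l +\<^sub>rB l2) r = ?F l r +\<^sub>(BXB E) ?F l2 r" using l by simp
  next
   fix l r r2 assume l: "l <: rB" "r <: lB" "r2 <: lB"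
   have "(%r. ?F l r) \<in> Hom B (BXB E)"
    by (rule lift_Hom_param[OF tpBAB EP tau_closed[OF g]], rule Hom_comp[OF pEl])
      (use l zadd in "simp_all add: pEl")
   from Hom_add[OF this] show "?F l (r +\<^sub>lB r2) = ?F l r +\<^sub>(BXB E) ?F l r2" using l by simp
  next
   fix a l r assume a: "a <: A" "l <: rB" "r <: lB"
   show "?F (a .\<^sub>rB l) r = ?F l (a .\<^sub>lB r)"
    by (rule tau_cong[OF g]) (use a in "simp_all add: pcE move_l pE_mult")
  qed
 next
  fix l r assume lr: "l <: B" "r <: B"
  show "(%g. tsum (BXB E) (%l' r'. pBXB E l (pE r l') r') (\<tau> g)) \<in> Hom H (BXB E)"
   using Hom_comp[OF lin_Hom[OF tau_lin, simplified] lift_Hom[OF tpBAB EP balT[OF lr]]] .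
 next
  fix c l r g assume c: "c <: K" "l <: B" "r <: B" "g <: H"
  show "tsum (BXB E) (%l' r'. pBXB E l (pE (c \<odot> r) l') r') (\<tau> g) =
   tsum (BXB E) (%l' r'. pBXB E l (pE r l') r') (\<tau> (c .\<^sub>H g))"
  proof -
   have cr: "c \<odot> r <: B" using c by (simp add: Bm.smult_closed)
   have t: "\<tau> (c .\<^sub>H g) = c .\<^sub>kBAB \<tau> g" using c lin_smult[OF tau_lin] by simp
   show ?thesis
    unfolding t
   proof (rule tensor_ext[OF tpBAB EP lift_Hom[OF tpBAB EP balT[OF c(2) cr]]
      Hom_comp[OF kV_Hom[OF A_rmod c(1)] lift_Hom[OF tpBAB EP balT[OF c(2,3)]]] _ tau_closed[OF c(4)]])
    fix x y assume "x <: rB" "y <: lB"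
    then have x: "x <: B" and y: "y <: B" by simp_all
    have yy: "c \<odot> y = (c \<odot> 1) * y" using c y by (simp add: B.smult_mult_l)
    have "pBXB E l (pE r x) (c \<odot> y) = pBXB E l (pE r (c \<odot> x)) y"
     unfolding yy using c x y A_smult_one[OF c(1)] by (simp add: move_r pE_mult B.smult_mult_r)
    also have "pE r (c \<odot> x) = pE (c \<odot> r) x" using pure_move[OF Ek.tp c(1,3), of x] x by simp
    finally have e: "pBXB E l (pE r x) (c \<odot> y) = pBXB E l (pE (c \<odot> r) x) y" .
    show "tsum (BXB E) (%l' r'. pBXB E l (pE (c \<odot> r) l') r') (pBAB x y) =
      tsum (BXB E) (%l' r'. pBXB E l (pE r l') r') (c .\<^sub>kBAB pBAB x y)"
     using lift_pure[OF tpBAB EP balT[OF c(2) cr], of x y] lift_pure[OF tpBAB EP balT[OF c(2,3)], of x "c \<odot> y"] c x y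
     by (simp add: kV_pure[OF A_rmod] Bm.smult_closed e)
   qed
  qed
 qed
 also have "... = translation2_Be K H B h"
  by (simp add: translation2_Be_def Let_def enveloping_eq)
 finally have e: "jBB ?t = translation2_Be K H B h" .
 show ?thesis
  unfolding translation2_def enveloping_eq
 proof (rule the_equality)
  show "?t <: BXB G \<and> lift_BGB (BXB E) (pBXB E) ?t = translation2_Be K H B h"
   by (rule conjI[OF t e[unfolded jBB_def]])
  fix s assume s: "s <: BXB G \<and> lift_BGB (BXB E) (pBXB E) s = translation2_Be K H B h"
  have "jBB s = jBB ?t" unfolding e using s[THEN conjunct2] by (simp only: jBB_def)
  with s[THEN conjunct1] t show "s = ?t" by (rule jBB_inj)
 qed
qed

lemma lift_BGB_translation2:
 assumes P: "abgrp P" and \<phi>: "trib G P \<phi>" and h: "h <: H"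
 shows "lift_BGB P \<phi> (translation2 K H B h) = tsum P (%l r. tsum P (\<phi> l) (nu r)) (\<tau> h)"
proof -
 note GP = BXBa[OF Ae_stable_G] and pcG = pBXB_closed[OF Ae_stable_G]
 note L = lift_BGB_Hom[OF Ae_stable_G P \<phi>] and Lp = lift_BGB_pure[OF Ae_stable_G P \<phi>]
 have inner: "tsum (BXB G) (pBXB G l) (nu r) <: BXB G" if "l <: B" "r <: B" for l r
  by (rule nu_sum_closed[OF GP that(2)]) (use that in "simp add: pcG")
 have i: "lift_BGB P \<phi> (tsum (BXB G) (pBXB G l) (nu r)) = tsum P (\<phi> l) (nu r)" if "l <: B" "r <: B" for l r
  by (rule nu_map[OF GP P L that(2)]) (use that in "simp_all add: pcG Lp")
 show ?thesis unfolding translation2_eq[OF h] by (rule tau_map[OF GP P L h]) (simp_all add: inner i)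
qed

end

context galois_Gamma
begin

section \<open>The module \<open>B\<^sup>e \<otimes>\<^bsub>A\<^sup>e\<^esub> M\<close> and the action of \<open>H\<close>\<close>

lemma A_smult_closed: "[|c <: K; a <: A|] ==> c \<odot> a <: A"
 using ring.ring_simprules(5)[OF A_ring A_smult_one, of c a] by (simp add: B.smult_mult_l)

lemma tpAA: "tpair K A (opp A)"
 using A_ring by (auto simp: tpair_def ring_def A_smult_closed)

abbreviation "incl \<equiv> Ae_incl K B"

lemma pE_A_balanced: "balanced K A (opp A) Et pE"
 using pure_move[OF Ek.tp] by (intro balancedI) (simp_all add: pE_add_l pE_add_r)

lemma incl_Hom: "incl \<in> Hom (tensor K A (opp A)) Et"
 using lift_Hom[OF tpAA Ea pE_A_balanced] by (simp add: Ae_incl_def[abs_def] enveloping_eq)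

lemma incl_pure: "[|a <: A; a' <: A|] ==> incl (pt K A (opp A) a a') = pE a a'"
 using lift_pure[OF tpAA Ea pE_A_balanced, of a a'] by (simp add: Ae_incl_def enveloping_eq)

lemma incl_closed [simp]: "r <: tensor K A (opp A) ==> incl r <: G"
proof (erule tensor_induct[OF tpAA, where Q="%r. incl r <: G"])
 fix u v assume "u <: tensor K A (opp A)" "v <: tensor K A (opp A)" "incl u <: G" "incl v <: G"
 then show "incl (u +\<^sub>(tensor K A (opp A)) v) <: G" using Gr.a_closed by (simp add: Hom_add[OF incl_Hom])
qed (simp add: incl_pure)

text \<open>Balanced maps on \<open>B\<^sup>e \<times> M\<close> over \<open>A\<^sup>e\<close>; on pure tensors of \<open>A\<^sup>e\<close> the condition is free of tensor products.\<close>

definition ebal where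
 "ebal M P f \<longleftrightarrow> (\<forall>z\<in>carrier Et. (%m. f z m) \<in> Hom M P) \<and> (\<forall>m\<in>carrier M. (%z. f z m) \<in> Hom Et P) \<and>
  (\<forall>a\<in>carrier A. \<forall>a'\<in>carrier A. \<forall>z\<in>carrier Et. \<forall>m\<in>carrier M. f (z \<star> pE a a') m = f z (pE a a' .\<^sub>M m))"

lemma ebalI:
 assumes "!!z. z <: Et ==> (%m. f z m) \<in> Hom M P" "!!m. m <: M ==> (%z. f z m) \<in> Hom Et P"
  "!!a a' z m. [|a <: A; a' <: A; z <: Et; m <: M|] ==> f (z \<star> pE a a') m = f z (pE a a' .\<^sub>M m)"
 shows "ebal M P f"
 using assms unfolding ebal_def by blast

lemma ebalD:
 assumes "ebal M P f"
 shows "z <: Et ==> (%m. f z m) \<in> Hom M P" "m <: M ==> (%z. f z m) \<in> Hom Et P"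
  "[|a <: A; a' <: A; z <: Et; m <: M|] ==> f (z \<star> pE a a') m = f z (pE a a' .\<^sub>M m)"
 using assms unfolding ebal_def by blast+

lemma ebal_closed: "[|ebal M P f; z <: Et; m <: M|] ==> f z m <: P"
 by (rule Hom_closed[OF ebalD(1)])

lemma ebal_comp:
 assumes "ebal M P f" "g \<in> Hom P Q"
 shows "ebal M Q (%z m. g (f z m))"
 using Hom_comp[OF ebalD(1)[OF assms(1)] assms(2)] Hom_comp[OF ebalD(2)[OF assms(1)] assms(2)] ebalD(3)[OF assms(1)]
 by (intro ebalI) simp_all

abbreviation "Ken \<equiv> enveloping K A"
abbreviation "Ber \<equiv> Be_right K B"

lemma Ken_carrier [simp]: "carrier Ken = carrier (tensor K A (opp A))" by (simp add: enveloping_def)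

lemma Ber_simps [simp]: "carrier Ber = carrier Et" "add Ber = add Et" "smult Ber = (%r z. z \<star> incl r)"
 "abgrp Ber = abgrp Et"
 using abelian_group_cong[of E Et] by (simp_all add: Be_right_def enveloping_eq fun_eq_iff)

lemma res_simps [simp]: "carrier (restrict_Ae K B M) = carrier M" "add (restrict_Ae K B M) = add M"
 "smult (restrict_Ae K B M) = (%r m. incl r .\<^sub>M m)" "abgrp (restrict_Ae K B M) = abgrp M"
 by (simp_all add: restrict_Ae_def)

abbreviation "KI M \<equiv> induced K H B M"
abbreviation "iP M \<equiv> induced_pure K H B M"

text \<open>The sum over \<open>\<Sum> l(h) \<otimes> \<nu>(r(h)) \<in> B \<otimes>\<^sub>A \<Gamma> \<otimes>\<^sub>A B\<close>.\<close>

definition HS where "HS P \<phi> h = tsum P (%l r. tsum P (\<phi> l) (nu r)) (\<tau> h)"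

lemma tau_central:
 assumes a: "a <: A" and h: "h <: H"
 shows "lm a (\<tau> h) = rm (\<tau> h) a"
proof (rule beta_inj)
 show "\<beta> (lm a (\<tau> h)) = \<beta> (rm (\<tau> h) a)"
  using a h by (simp add: beta_lmul beta_rmul beta_tau rho_A BH.mult_pure)
qed (use a h in "simp_all add: BAB_lmul_closed BAB_rmul_closed")

lemma HS_cong: "[|h <: H; !!l g y. [|l <: B; g <: G; y <: B|] ==> f l g y = k l g y|] ==> HS P f h = HS P k h"
 unfolding HS_def by (intro tau_cong nu_cong)

context
 fixes P :: "('p, 'q) ring_scheme"
 assumes P: "abgrp P"
begin

lemma tribD:
 assumes "trib G P f"
 shows "[|x <: B; z <: G; y <: B|] ==> f x z y <: P"
  "[|z <: G; y <: B|] ==> (%x. f x z y) \<in> Hom B P"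
  "[|x <: B; y <: B|] ==> (%z. f x z y) \<in> Hom G P"
  "[|x <: B; z <: G|] ==> (%y. f x z y) \<in> Hom B P"
  "[|a <: A; x <: B; z <: G; y <: B|] ==> f (x * a) z y = f x (pE a 1 \<star> z) y"
  "[|a <: A; x <: B; z <: G; y <: B|] ==> f x (pE 1 a \<star> z) y = f x z (a * y)"
 using assms unfolding trib_def by blast+

lemma trib_nu_closed: "[|trib G P f; l <: B; r <: B|] ==> tsum P (f l) (nu r) <: P"
 by (rule Hom_closed[OF trib_lift_VG(1)[OF P]]) simp_all

lemma trib_nu_balanced:
 assumes t: "trib G P f"
 shows "balanced A rB lB P (%l r. tsum P (f l) (nu r))"
proof (rule balancedI)
 fix l r assume "l <: rB" "r <: lB"
 then show "tsum P (f l) (nu r) <: P" using trib_nu_closed[OF t] by simp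
next
 fix l l' r assume l: "l <: rB" "l' <: rB" "r <: lB"
 have "(%l. tsum P (f l) (nu r)) \<in> Hom B P"
  by (rule lift_Hom_param[OF tpVG P]) (use l tribD(2)[OF t] in simp_all)
 from Hom_add[OF this] show "tsum P (f (l +\<^sub>rB l')) (nu r) = tsum P (f l) (nu r) +\<^sub>P tsum P (f l') (nu r)"
  using l by simp
next
 fix l r r' assume l: "l <: rB" "r <: lB" "r' <: lB"
 have "(%r. tsum P (f l) (nu r)) \<in> Hom B P"
  by (rule Hom_comp[OF nu_Hom trib_lift_VG(1)[OF P t]]) (use l in simp)
 from Hom_add[OF this] show "tsum P (f l) (nu (r +\<^sub>lB r')) = tsum P (f l) (nu r) +\<^sub>P tsum P (f l) (nu r')"
  using l by simp
next
 fix a l r assume "a <: A" "l <: rB" "r <: lB"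
 then have a: "a <: A" and l: "l <: B" and r: "r <: B" by simp_all
 have "tsum P (f (l * a)) (nu r) = tsum P (%g y. tsum P (f l) (pVG (pE a 1 \<star> g) y)) (nu r)"
  by (rule nu_cong[OF r]) (use a l in "simp add: trib_lift_VG(2)[OF P t] tribD(5)[OF t]")
 also have "... = tsum P (f l) (nu (a * r))"
  unfolding nu_A_mult[OF a r]
  by (rule nu_hom[OF VGa P trib_lift_VG(1)[OF P t l] r, symmetric]) (use a in simp)
 finally show "tsum P (f (a .\<^sub>rB l)) (nu r) = tsum P (f l) (nu (a .\<^sub>lB r))" by simp
qed

lemma HS_param:
 assumes h: "h <: H" and p: "!!l g y. [|l <: B; g <: G; y <: B|] ==> (%x. f x l g y) \<in> Hom X P"
 shows "(%x. HS P (f x) h) \<in> Hom X P"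
 unfolding HS_def
 by (rule lift_Hom_param[OF tpBAB P tau_closed[OF h]], rule lift_Hom_param[OF tpVG P nu_closed]) (simp_all add: p)

lemma HS_map:
 assumes t: "trib G P f" and h: "h <: H" and Q: "abgrp Q" and g: "g \<in> Hom P Q"
  and e: "!!l v y. [|l <: B; v <: G; y <: B|] ==> g (f l v y) = k l v y"
 shows "g (HS P f h) = HS Q k h"
proof -
 have i: "g (tsum P (f l) (nu r)) = tsum Q (k l) (nu r)" if "l <: B" "r <: B" for l r
  by (rule nu_map[OF P Q g that(2)]) (use that tribD(1)[OF t] e in simp_all)
 show ?thesis unfolding HS_def by (rule tau_map[OF P Q g h]) (simp_all add: trib_nu_closed[OF t] i)
qed

lemma tau_central_apply:
 assumes f: "balanced A rB lB P f" and a: "a <: A" and h: "h <: H"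
 shows "tsum P (%l r. f (a * l) r) (\<tau> h) = tsum P (%l r. f l (r * a)) (\<tau> h)"
proof -
 note F = lift_Hom[OF tpBAB P f] and Fp = lift_pure[OF tpBAB P f]
 have "tsum P f (lm a (\<tau> h)) = tsum P (%l r. f (a * l) r) (\<tau> h)" "tsum P f (rm (\<tau> h) a) = tsum P (%l r. f l (r * a)) (\<tau> h)"
  by (rule tau_map[OF BABa P F h]; use a in "simp add: Fp")+
 then show ?thesis by (simp only: tau_central[OF a h])
qed

text \<open>The source is \<open>\<Sum> a l(h) \<otimes> r(h) = \<Sum> l(h) \<otimes> r(h) a\<close> for \<open>a \<in> A\<close>; it makes the action of \<open>H\<close> well-defined
  over \<open>A\<^sup>e\<close>.\<close>

lemma HS_central:
 assumes t: "trib G P f" and a: "a <: A" "a' <: A" and h: "h <: H"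
 shows "HS P (%l v y. f (a * l) v (y * a')) h = HS P (%l v y. f l (v \<star> pE a a') y) h"
proof -
 have ts: "trib G P (%l v y. f l v (y * a'))"
 proof -
  have m: "(%y. y * a') \<in> Hom B B" using a by (auto intro!: HomI simp: B.l_distr)
  show ?thesis unfolding trib_def
   using tribD[OF t] Hom_comp[OF m tribD(4)[OF t]] a by (simp add: B_assoc)
 qed
 note L = trib_lift_VG(1)[OF P t] and Lp = trib_lift_VG(2)[OF P t]
 have "HS P (%l v y. f (a * l) v (y * a')) h = tsum P (%l r. tsum P (%v y. f l v (y * a')) (nu (r * a))) (\<tau> h)"
  unfolding HS_def by (rule tau_central_apply[OF trib_nu_balanced[OF ts] a(1) h])
 also have "... = HS P (%l v y. f l (v \<star> pE a a') y) h"
  unfolding HS_def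
 proof (rule tau_cong[OF h])
  fix l r assume l: "l <: B" and r: "r <: B"
  have ra: "r * a <: B" using a r by simp
  have "tsum P (%v y. f l v (y * a')) (nu (r * a)) = tsum P (f l) (rmul GA a' (nu (r * a)))" (is "?a = _")
   unfolding rmul_def tensor_map_def by (rule nu_map[OF VGa P L[OF l] ra, symmetric]) (use a l in "simp_all add: Lp")
  also have "... = tsum P (%v y. f l (v \<star> pE 1 a') y) (nu (r * a))"
   unfolding nu_right_A[OF a(2) ra, symmetric] by (rule nu_map[OF VGa P L[OF l] ra]) (use a l in "simp_all add: Lp")
  also have "... = tsum P (%v y. f l (v \<star> pE a a') y) (nu r)"
  proof -
   have b: "balanced A GA lB P (%v y. f l (v \<star> pE 1 a') y)"
   proof (rule balancedI)
    fix v v' y assume g: "v <: GA" "v' <: GA" "y <: lB"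
    then have "v \<star> pE 1 a' <: G" "v' \<star> pE 1 a' <: G" "y <: B" using a by simp_all
    from Hom_add[OF tribD(3)[OF t l this(3)] this(1,2)]
    show "f l ((v +\<^sub>GA v') \<star> pE 1 a') y = f l (v \<star> pE 1 a') y +\<^sub>P f l (v' \<star> pE 1 a') y"
     using g a by (simp add: E_distrib)
   next
    fix v y y' assume g: "v <: GA" "y <: lB" "y' <: lB"
    then have "v \<star> pE 1 a' <: G" "y <: B" "y' <: B" using a by simp_all
    from Hom_add[OF tribD(4)[OF t l this(1)] this(2,3)]
    show "f l (v \<star> pE 1 a') (y +\<^sub>lB y') = f l (v \<star> pE 1 a') y +\<^sub>P f l (v \<star> pE 1 a') y'"
     by simp
   next
    fix c v y assume g: "c <: A" "v <: GA" "y <: lB"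
    then have "v \<star> pE 1 a' <: G" "y <: B" using a by simp_all
    from tribD(6)[OF t g(1) l this]
    show "f l ((c .\<^sub>GA v) \<star> pE 1 a') y = f l (v \<star> pE 1 a') (c .\<^sub>lB y)"
     using g a by (simp add: E_assoc)
   qed (use a l in "simp add: tribD(1)[OF t]")
   show ?thesis
    unfolding nu_mult_A[OF a(1) r]
    by (rule nu_map[OF VGa P lift_Hom[OF tpVG P b] r]) (use a l lift_pure[OF tpVG P b] in "simp_all add: E_assoc pE_mult")
  qed
  finally show "?a = ..." .
 qed
 finally show ?thesis .
qed

end

context
 fixes M :: "(('b, 'b) tens, 'm, 'x) module_scheme"
 assumes M: "lmod G M"
begin

interpretation M: left_module G M by (rule M)

lemmas Ma = lmod_ab[OF M]

lemma tpI: "tpair Ken Ber (restrict_Ae K B M)"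
 using Ea Ma M.smult_closed by (simp add: tpair_def)

lemma KIa: "abgrp (KI M)" unfolding induced_def by (rule tensor_ab[OF tpI])

lemma iP_closed: "[|z <: Et; m <: M|] ==> iP M z m <: KI M"
 unfolding induced_def induced_pure_def by (rule pure_closed[OF tpI]) simp_all

lemma iP_ebal: "ebal M (KI M) (iP M)"
proof (rule ebalI)
 fix z assume "z <: Et"
 then show "(%m. iP M z m) \<in> Hom M (KI M)"
  using pure_add_r[OF tpI, simplified] by (intro HomI) (simp_all add: iP_closed, simp add: induced_pure_def induced_def)
next
 fix m assume "m <: M"
 then show "(%z. iP M z m) \<in> Hom Et (KI M)"
  using pure_add_l[OF tpI, simplified] by (intro HomI) (simp_all add: iP_closed, simp add: induced_pure_def induced_def)
next
 fix a a' z m assume a: "a <: A" "a' <: A" and z: "z <: Et" "m <: M"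
 have "pt K A (opp A) a a' <: Ken" using a pure_closed[OF tpAA] by simp
 from pure_move[OF tpI this, of z m] show "iP M (z \<star> pE a a') m = iP M z (pE a a' .\<^sub>M m)"
  using a z by (simp add: induced_pure_def incl_pure)
qed

context
 fixes P :: "('p, 'q) ring_scheme"
 assumes P: "abgrp P"
begin

lemma ebal_balanced:
 assumes f: "ebal M P f"
 shows "balanced Ken Ber (restrict_Ae K B M) P f"
proof (rule balancedI)
 fix r z m assume r: "r <: Ken" and z: "z <: Ber" and m: "m <: restrict_Ae K B M"
 have "r <: tensor K A (opp A)" using r by simp
 then have "\<forall>z\<in>carrier Et. \<forall>m\<in>carrier M. f (z \<star> incl r) m = f z (incl r .\<^sub>M m)"
 proof (rule tensor_induct[OF tpAA, where Q="%r. \<forall>z\<in>carrier Et. \<forall>m\<in>carrier M. f (z \<star> incl r) m = f z (incl r .\<^sub>M m)"])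
  fix x y assume "x <: A" "y <: opp A"
  then show "\<forall>z\<in>carrier Et. \<forall>m\<in>carrier M. f (z \<star> incl (pt K A (opp A) x y)) m = f z (incl (pt K A (opp A) x y) .\<^sub>M m)"
   using ebalD(3)[OF f] by (simp add: incl_pure)
 next
  fix u v assume 3: "u <: tensor K A (opp A)" "v <: tensor K A (opp A)"
   "\<forall>z\<in>carrier Et. \<forall>m\<in>carrier M. f (z \<star> incl u) m = f z (incl u .\<^sub>M m)"
   "\<forall>z\<in>carrier Et. \<forall>m\<in>carrier M. f (z \<star> incl v) m = f z (incl v .\<^sub>M m)"
  show "\<forall>z\<in>carrier Et. \<forall>m\<in>carrier M. f (z \<star> incl (u +\<^sub>(tensor K A (opp A)) v)) m = f z (incl (u +\<^sub>(tensor K A (opp A)) v) .\<^sub>M m)"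
  proof (intro ballI)
   fix z m assume z: "z <: Et" and m: "m <: M"
   have c: "incl u <: G" "incl v <: G" using 3 by simp_all
   have "f (z \<star> incl (u +\<^sub>(tensor K A (opp A)) v)) m = f (z \<star> incl u) m +\<^sub>P f (z \<star> incl v) m" (is "?a = _")
    using 3(1,2) c z m by (simp add: Hom_add[OF incl_Hom] E_distrib Hom_add[OF ebalD(2)[OF f m]])
   also have "... = f z (incl u .\<^sub>M m) +\<^sub>P f z (incl v .\<^sub>M m)" using 3(3,4) z m by simp
   also have "... = f z (incl (u +\<^sub>(tensor K A (opp A)) v) .\<^sub>M m)"
    using 3(1,2) c z m M.smult_l_distr[of "incl u" "incl v" m]
    by (simp add: Hom_add[OF incl_Hom] M.smult_closed Hom_add[OF ebalD(1)[OF f z], symmetric])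
   finally show "?a = ..." .
  qed
 qed
 then show "f (r .\<^sub>Ber z) m = f z (r .\<^sub>(restrict_Ae K B M) m)" using z m by simp
qed (use ebal_closed[OF f] Hom_add[OF ebalD(1)[OF f]] Hom_add[OF ebalD(2)[OF f]] in simp_all)

lemma KI_lift_Hom: "ebal M P f ==> tsum P f \<in> Hom (KI M) P"
 unfolding induced_def by (rule lift_Hom[OF tpI P ebal_balanced])

lemma KI_lift_pure: "[|ebal M P f; z <: Et; m <: M|] ==> tsum P f (iP M z m) = f z m"
 unfolding induced_pure_def by (rule lift_pure[OF tpI P ebal_balanced]) simp_all

lemma KI_ext:
 assumes "f \<in> Hom (KI M) P" "g \<in> Hom (KI M) P"
  and "!!z m. [|z <: Et; m <: M|] ==> f (iP M z m) = g (iP M z m)" "u <: KI M"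
 shows "f u = g u"
 by (rule tensor_ext[OF tpI P assms(1,2)[unfolded induced_def] _ assms(4)[unfolded induced_def]])
   (use assms(3) in "simp add: induced_pure_def")

lemma ebal_trib:
 assumes f: "ebal M P f" and z: "z <: Et" and m: "m <: M"
 shows "trib G P (%x v y. f (z \<star> pE x y) (v .\<^sub>M m))"
 unfolding trib_def
proof (intro conjI ballI)
 fix x v y assume "x <: B" "v <: G" "y <: B"
 then show "f (z \<star> pE x y) (v .\<^sub>M m) <: P" using z m by (simp add: ebal_closed[OF f] M.smult_closed)
next
 fix v y assume g: "v <: G" "y <: B"
 have "(%x. z \<star> pE x y) \<in> Hom B Et" using z g by (auto intro!: HomI simp: pE_add_l E_distrib)
 from Hom_comp[OF this ebalD(2)[OF f]] show "(%x. f (z \<star> pE x y) (v .\<^sub>M m)) \<in> Hom B P"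
  using g m by (simp add: M.smult_closed)
next
 fix x y assume x: "x <: B" "y <: B"
 have "(%v. v .\<^sub>M m) \<in> Hom G M" by (rule HomI) (use m M.smult_closed M.smult_l_distr in simp_all)
 from Hom_comp[OF this ebalD(1)[OF f]] show "(%v. f (z \<star> pE x y) (v .\<^sub>M m)) \<in> Hom G P" using x z by simp
next
 fix x v assume g: "x <: B" "v <: G"
 have "(%y. z \<star> pE x y) \<in> Hom B Et" using z g by (auto intro!: HomI simp: pE_add_r E_distrib)
 from Hom_comp[OF this ebalD(2)[OF f]] show "(%y. f (z \<star> pE x y) (v .\<^sub>M m)) \<in> Hom B P"
  using g m by (simp add: M.smult_closed)
next
 fix a x v y assume g: "a <: A" "x <: B" "v <: G" "y <: B"
 have e: "v' .\<^sub>M (v .\<^sub>M m) = (v' \<star> v) .\<^sub>M m" if "v' <: G" for v'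
  using M.smult_assoc1[OF that g(3) m] by simp
 show "f (z \<star> pE (x * a) y) (v .\<^sub>M m) = f (z \<star> pE x y) (pE a 1 \<star> v .\<^sub>M m)"
  using ebalD(3)[OF f g(1) one_A, of "z \<star> pE x y" "v .\<^sub>M m"] g z m by (simp add: M.smult_closed e E_assoc pE_mult)
 show "f (z \<star> pE x y) (pE 1 a \<star> v .\<^sub>M m) = f (z \<star> pE x (a * y)) (v .\<^sub>M m)"
  using ebalD(3)[OF f one_A g(1), of "z \<star> pE x y" "v .\<^sub>M m"] g z m by (simp add: M.smult_closed e E_assoc pE_mult)
qed

text \<open>The values of the \<open>H\<close>-action, for an arbitrary balanced map in place of the tensor product.\<close>

lemma ebal_HS:
 assumes f: "ebal M P f" and h: "h <: H"
 shows "ebal M P (%z m. HS P (%x v y. f (z \<star> pE x y) (v .\<^sub>M m)) h)"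
proof (rule ebalI)
 fix z assume z: "z <: Et"
 show "(%m. HS P (%x v y. f (z \<star> pE x y) (v .\<^sub>M m)) h) \<in> Hom M P"
 proof (rule HS_param[OF P h])
  fix l v y assume g: "l <: B" "v <: G" "y <: B"
  have "(%m. v .\<^sub>M m) \<in> Hom M M" using g by (auto intro!: HomI simp: M.smult_closed M.smult_r_distr)
  from Hom_comp[OF this ebalD(1)[OF f]] show "(%m. f (z \<star> pE l y) (v .\<^sub>M m)) \<in> Hom M P" using g z by simp
 qed
next
 fix m assume m: "m <: M"
 show "(%z. HS P (%x v y. f (z \<star> pE x y) (v .\<^sub>M m)) h) \<in> Hom Et P"
 proof (rule HS_param[OF P h])
  fix l v y assume g: "l <: B" "v <: G" "y <: B"
  from Hom_comp[OF E_mult_Hom(2) ebalD(2)[OF f]] show "(%z. f (z \<star> pE l y) (v .\<^sub>M m)) \<in> Hom Et P"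
   using g m by (simp add: M.smult_closed)
 qed
next
 fix a a' z m assume a: "a <: A" "a' <: A" and z: "z <: Et" and m: "m <: M"
 have z': "z \<star> pE a a' <: Et" using a z by simp
 have "HS P (%x v y. f (z \<star> pE a a' \<star> pE x y) (v .\<^sub>M m)) h =
   HS P (%x v y. f (z \<star> pE (a * x) (y * a')) (v .\<^sub>M m)) h" (is "?a = _")
  by (rule HS_cong[OF h]) (use a z m in "simp add: E_assoc pE_mult")
 also have "... = HS P (%x v y. f (z \<star> pE x y) ((v \<star> pE a a') .\<^sub>M m)) h"
  by (rule HS_central[OF P ebal_trib[OF f z m] a h])
 also have "... = HS P (%x v y. f (z \<star> pE x y) (v .\<^sub>M (pE a a' .\<^sub>M m))) h"
  by (rule HS_cong[OF h, symmetric]) (use a m M.smult_assoc1[of _ "pE a a'" m] in "simp_all add: M.smult_closed")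
 finally show "?a = ..." .
qed

end

abbreviation "hact \<equiv> induced_H_action K H B M"

lemma hact_eq:
 assumes h: "h <: H" and u: "u <: KI M"
 shows "hact h u = tsum (KI M) (%z m. HS (KI M) (%x g y. iP M (z \<star> pE x y) (g .\<^sub>M m)) h) u"
 unfolding induced_H_action_def Let_def
proof (rule lift_cong[OF tpI u[unfolded induced_def], symmetric])
 let ?f = "%z m. HS (KI M) (%x g y. iP M (z \<star> pE x y) (g .\<^sub>M m)) h"
 note eb = ebal_HS[OF KIa iP_ebal h]
 fix z m assume "z <: Ber" "m <: restrict_Ae K B M"
 then have z: "z <: Et" and m: "m <: M" by simp_all
 have "?f z m = tsum (KI M) (%b b'. ?f (pE b b') m) z"
  by (rule tensor_Hom_lift[OF Ek.tp KIa ebalD(2)[OF eb m] z])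
 also have "... = tsum (KI M) (%b b'. lift_BGB (KI M) (%x g y. iP M (pE (b * x) (y * b')) (g .\<^sub>M m)) (translation2 K H B h)) z"
 proof (rule lift_cong[OF Ek.tp z])
  fix b b' assume "b <: B" "b' <: opp B"
  then have b: "b <: B" "b' <: B" by simp_all
  then have bb: "pE b b' <: Et" by simp
  note t = ebal_trib[OF KIa iP_ebal bb m]
  have t': "trib G (KI M) (%x g y. iP M (pE (b * x) (y * b')) (g .\<^sub>M m))"
  proof -
   have e: "pE b b' \<star> pE x y = pE (b * x) (y * b')" if "x <: B" "y <: B" for x y
    using b that by (simp add: pE_mult)
   show ?thesis using t by (simp add: trib_def Hom_def Pi_iff e)
  qed
  show "?f (pE b b') m = lift_BGB (KI M) (%x g y. iP M (pE (b * x) (y * b')) (g .\<^sub>M m)) (translation2 K H B h)"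
   unfolding lift_BGB_translation2[OF KIa t' h] HS_def[symmetric]
   by (rule HS_cong[OF h]) (use b in "simp add: pE_mult")
 qed
 finally show "?f z m = tsum (KI M) (%b b'. lift_BGB (KI M) (%x g y. iP M (pE (b * x) (y * b')) (g .\<^sub>M m)) (translation2 K H B h)) z" .
qed

lemma hact_Hom: "h <: H ==> hact h \<in> Hom (KI M) (KI M)"
 by (rule Hom_cong[OF KI_lift_Hom[OF KIa ebal_HS[OF KIa iP_ebal]] KIa]) (simp_all add: hact_eq)

lemma hact_pure: "[|h <: H; z <: Et; m <: M|] ==>
  hact h (iP M z m) = HS (KI M) (%x g y. iP M (z \<star> pE x y) (g .\<^sub>M m)) h"
 by (simp add: hact_eq iP_closed KI_lift_pure[OF KIa ebal_HS[OF KIa iP_ebal]])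

end

end

lemma id_lmod: "id \<in> lhom R X X" by (simp add: id_def lin_id)

context galois_Gamma
begin

section \<open>The bimodules \<open>L \<otimes>\<^sub>H (B\<^sup>e \<otimes>\<^bsub>A\<^sup>e\<^esub> M)\<close>\<close>

abbreviation "iH M \<equiv> induced_H_module K H B M"
abbreviation "TT L M \<equiv> tensor H L (iH M)"
abbreviation "TM L M \<equiv> bicomplex_term K H B L M"

definition t3 where "t3 L M l z m = pt H L (iH M) l (iP M z m)"

lemma iH_simps [simp]: "carrier (iH M) = carrier (KI M)" "add (iH M) = add (KI M)" "0\<^sub>(iH M) = 0\<^sub>(KI M)"
 "smult (iH M) = induced_H_action K H B M" "abgrp (iH M) = abgrp (KI M)"
 "tsum (iH M) = tsum (KI M)" "Hom (iH M) P = Hom (KI M) P" "Hom P (iH M) = Hom P (KI M)"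
 by (simp_all add: induced_H_module_def Hom_def)

lemma TM_simps [simp]: "carrier (TM L M) = carrier (TT L M)" "add (TM L M) = add (TT L M)" "0\<^sub>(TM L M) = 0\<^sub>(TT L M)"
 "abgrp (TM L M) = abgrp (TT L M)"
 "tsum (TM L M) = tsum (TT L M)" "Hom (TM L M) P = Hom (TT L M) P" "Hom P (TM L M) = Hom P (TT L M)"
 by (simp_all add: bicomplex_term_def Hom_def)

text \<open>Maps of three arguments that factor through \<open>L \<otimes>\<^sub>H (B\<^sup>e \<otimes>\<^bsub>A\<^sup>e\<^esub> M)\<close>.\<close>

definition tbal where
 "tbal L M P f \<longleftrightarrow> (\<forall>l\<in>carrier L. ebal M P (f l)) \<and>
  (\<forall>z\<in>carrier Et. \<forall>m\<in>carrier M. (%l. f l z m) \<in> Hom L P) \<and>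
  (\<forall>h\<in>carrier H. \<forall>l\<in>carrier L. \<forall>z\<in>carrier Et. \<forall>m\<in>carrier M.
    f (h .\<^sub>L l) z m = HS P (%x \<gamma> y. f l (z \<star> pE x y) (\<gamma> .\<^sub>M m)) h)"

lemma tbalI:
 assumes "!!l. l <: L ==> ebal M P (f l)"
  and "!!z m. [|z <: Et; m <: M|] ==> (%l. f l z m) \<in> Hom L P"
  and "!!h l z m. [|h <: H; l <: L; z <: Et; m <: M|] ==>
    f (h .\<^sub>L l) z m = HS P (%x g y. f l (z \<star> pE x y) (g .\<^sub>M m)) h"
 shows "tbal L M P f"
 using assms unfolding tbal_def by blast

lemma tbalD:
 assumes "tbal L M P f"
 shows "l <: L ==> ebal M P (f l)"
  "[|z <: Et; m <: M|] ==> (%l. f l z m) \<in> Hom L P"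
  "[|h <: H; l <: L; z <: Et; m <: M|] ==>
    f (h .\<^sub>L l) z m = HS P (%x g y. f l (z \<star> pE x y) (g .\<^sub>M m)) h"
 using assms unfolding tbal_def by blast+

definition tlift where "tlift P f = tsum P (%l w. tsum P (f l) w)"

context
 fixes L :: "('h, 'l, 'y) module_scheme" and M :: "(('b, 'b) tens, 'm, 'x) module_scheme"
 assumes L: "lmod (opp H) L" and M: "lmod G M"
begin

interpretation L: left_module "opp H" L by (rule L)
interpretation M: left_module G M by (rule M)

lemmas La = lmod_ab[OF L]

lemma tpT: "tpair H L (iH M)"
 using L.smult_closed Hom_closed[OF hact_Hom[OF M]] La KIa[OF M] by (simp add: tpair_def)

lemmas TTa = tensor_ab[OF tpT]

lemma t3_closed: "[|l <: L; z <: Et; m <: M|] ==> t3 L M l z m <: TT L M"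
 unfolding t3_def by (rule pure_closed[OF tpT]) (simp_all add: iP_closed[OF M])

lemma pure_T_Hom: "l <: L ==> pt H L (iH M) l \<in> Hom (KI M) (TT L M)"
 using pure_add_r[OF tpT] pure_closed[OF tpT] by (intro HomI) simp_all

lemma t3_tbal: "tbal L M (TT L M) (t3 L M)"
proof (rule tbalI)
 fix l assume l: "l <: L"
 show "ebal M (TT L M) (t3 L M l)"
  unfolding t3_def[abs_def] by (rule ebal_comp[OF iP_ebal[OF M] pure_T_Hom[OF l]])
next
 fix z m assume "z <: Et" "m <: M"
 then show "(%l. t3 L M l z m) \<in> Hom L (TT L M)"
  using pure_add_l[OF tpT] pure_closed[OF tpT] iP_closed[OF M] by (intro HomI) (simp_all add: t3_def)
next
 fix h l z m assume h: "h <: H" and l: "l <: L" and z: "z <: Et" "m <: M"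
 have "t3 L M (h .\<^sub>L l) z m = pt H L (iH M) l (HS (KI M) (%x g y. iP M (z \<star> pE x y) (g .\<^sub>M m)) h)" (is "?a = _")
  using pure_move[OF tpT h l, of "iP M z m"] z h by (simp add: t3_def iP_closed[OF M] hact_pure[OF M])
 also have "... = HS (TT L M) (%x g y. t3 L M l (z \<star> pE x y) (g .\<^sub>M m)) h"
  unfolding t3_def by (rule HS_map[OF KIa[OF M] ebal_trib[OF M KIa[OF M] iP_ebal[OF M] z] h TTa pure_T_Hom[OF l] refl])
 finally show "?a = ..." .
qed

context
 fixes P :: "('p, 'q) ring_scheme"
 assumes P: "abgrp P"
begin

lemma tbal_balanced:
 assumes f: "tbal L M P f"
 shows "balanced H L (iH M) P (%l w. tsum P (f l) w)"
proof (rule balancedI)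
 note F = KI_lift_Hom[OF M P tbalD(1)[OF f]] and Fp = KI_lift_pure[OF M P tbalD(1)[OF f]]
 { fix l w assume "l <: L" "w <: iH M"
  then show "tsum P (f l) w <: P" by (simp add: Hom_closed[OF F]) }
 { fix l l' w assume l: "l <: L" "l' <: L" and w: "w <: iH M"
  have "(%l. tsum P (f l) w) \<in> Hom L P"
   by (rule lift_Hom_param[OF tpI[OF M] P]) (use w tbalD(2)[OF f] in "simp_all add: induced_def")
  from Hom_add[OF this l] show "tsum P (f (l +\<^sub>L l')) w = tsum P (f l) w +\<^sub>P tsum P (f l') w" . }
 { fix l w w' assume "l <: L" "w <: iH M" "w' <: iH M"
  then show "tsum P (f l) (w +\<^sub>(iH M) w') = tsum P (f l) w +\<^sub>P tsum P (f l) w'"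
   by (simp add: Hom_add[OF F]) }
 { fix h l w assume h: "h <: H" and l: "l <: L" and w: "w <: iH M"
  have hl: "h .\<^sub>L l <: L" using L.smult_closed h l by simp
  have "tsum P (f (h .\<^sub>L l)) w = tsum P (f l) (induced_H_action K H B M h w)"
  proof (rule KI_ext[OF M P F[OF hl] Hom_comp[OF hact_Hom[OF M h] F[OF l]]])
   show "w <: KI M" using w by simp
   fix z m assume z: "z <: Et" "m <: M"
   note eb = iP_ebal[OF M]
   note t = ebal_trib[OF M KIa[OF M] eb z]
   have "tsum P (f l) (induced_H_action K H B M h (iP M z m)) =
     HS P (%x g y. f l (z \<star> pE x y) (g .\<^sub>M m)) h"
    unfolding hact_pure[OF M h z]
    by (rule HS_map[OF KIa[OF M] t h P F[OF l]]) (use l z in "simp add: Fp M.smult_closed")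
   also have "... = tsum P (f (h .\<^sub>L l)) (iP M z m)"
    using tbalD(3)[OF f h l z] z hl by (simp add: Fp)
   finally show "tsum P (f (h .\<^sub>L l)) (iP M z m) = tsum P (f l) (induced_H_action K H B M h (iP M z m))" by simp
  qed
  then show "tsum P (f (h .\<^sub>L l)) w = tsum P (f l) (h .\<^sub>(iH M) w)" by simp }
qed

lemma tlift_Hom: "tbal L M P f ==> tlift P f \<in> Hom (TT L M) P"
 unfolding tlift_def by (rule lift_Hom[OF tpT P tbal_balanced])

lemma tlift_t3: "[|tbal L M P f; l <: L; z <: Et; m <: M|] ==> tlift P f (t3 L M l z m) = f l z m"
 using lift_pure[OF tpT P tbal_balanced, of f l "iP M z m"] KI_lift_pure[OF M P tbalD(1)]
 by (simp add: tlift_def t3_def iP_closed[OF M])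

lemma T_ext:
 assumes "f \<in> Hom (TT L M) P" "g \<in> Hom (TT L M) P"
  and eq: "!!l z m. [|l <: L; z <: Et; m <: M|] ==> f (t3 L M l z m) = g (t3 L M l z m)"
  and u: "u <: TT L M"
 shows "f u = g u"
proof (rule tensor_ext[OF tpT P assms(1,2) _ u])
 fix l w assume l: "l <: L" and w: "w <: iH M"
 show "f (pt H L (iH M) l w) = g (pt H L (iH M) l w)"
  by (rule KI_ext[OF M P Hom_comp[OF pure_T_Hom[OF l] assms(1)] Hom_comp[OF pure_T_Hom[OF l] assms(2)]])
    (use l w eq in "simp_all add: t3_def")
qed

end

lemma e_iP_ebal:
 assumes e: "e <: Et" shows "ebal M (KI M) (%z m. iP M (e \<star> z) m)"
proof (rule ebalI)
 note I = iP_ebal[OF M]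
 show "(%m. iP M (e \<star> z) m) \<in> Hom M (KI M)" if "z <: Et" for z using ebalD(1)[OF I] e that by simp
 show "(%z. iP M (e \<star> z) m) \<in> Hom Et (KI M)" if "m <: M" for m
  using Hom_comp[OF E_mult_Hom(1)[OF e] ebalD(2)[OF I that]] .
 fix a a' z m assume "a <: A" "a' <: A" "z <: Et" "m <: M"
 then show "iP M (e \<star> (z \<star> pE a a')) m = iP M (e \<star> z) (pE a a' .\<^sub>M m)"
  using ebalD(3)[OF I, of a a' "e \<star> z" m] e by (simp flip: E_assoc)
qed

lemma ibm_Hom: "e <: Et ==> smult (induced_bimodule K H B M) e \<in> Hom (KI M) (KI M)"
 using KI_lift_Hom[OF M KIa[OF M] e_iP_ebal] by (simp add: induced_bimodule_def enveloping_eq)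

lemma ibm_pure: "[|e <: Et; z <: Et; m <: M|] ==> e .\<^sub>(induced_bimodule K H B M) iP M z m = iP M (e \<star> z) m"
 using KI_lift_pure[OF M KIa[OF M] e_iP_ebal] by (simp add: induced_bimodule_def enveloping_eq)

lemma ibm_hom:
 assumes e: "e <: Et"
 shows "(%w. e .\<^sub>(induced_bimodule K H B M) w) \<in> lhom H (iH M) (iH M)"
proof (rule linI)
 note ah = ibm_Hom[OF e]
 show "(%w. e .\<^sub>(induced_bimodule K H B M) w) \<in> Hom (iH M) (iH M)" using ah by simp
 fix h w assume h: "h <: H" and w: "w <: iH M"
 have "e .\<^sub>(induced_bimodule K H B M) induced_H_action K H B M h w = induced_H_action K H B M h (e .\<^sub>(induced_bimodule K H B M) w)"
 proof (rule KI_ext[OF M KIa[OF M] Hom_comp[OF hact_Hom[OF M h] ah] Hom_comp[OF ah hact_Hom[OF M h]]])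
  show "w <: KI M" using w by simp
  fix z m assume z: "z <: Et" "m <: M"
  have ez: "e \<star> z <: Et" using e z by simp
  note t = ebal_trib[OF M KIa[OF M] iP_ebal[OF M]]
  have "e .\<^sub>(induced_bimodule K H B M) induced_H_action K H B M h (iP M z m) =
    HS (KI M) (%x g y. iP M (e \<star> z \<star> pE x y) (g .\<^sub>M m)) h" (is "?a = _")
   unfolding hact_pure[OF M h z]
   by (rule HS_map[OF KIa[OF M] t[OF z] h KIa[OF M] ah]) (use e z in "simp add: ibm_pure M.smult_closed E_assoc")
  also have "... = induced_H_action K H B M h (e .\<^sub>(induced_bimodule K H B M) iP M z m)"
   using e z by (simp add: ibm_pure hact_pure[OF M h])
  finally show "?a = ..." .
 qed
 then show "e .\<^sub>(induced_bimodule K H B M) (h .\<^sub>(iH M) w) = h .\<^sub>(iH M) (e .\<^sub>(induced_bimodule K H B M) w)" by simp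
qed

lemma TM_smult: "smult (TM L M) e = tmap H L (iH M) id (%w. e .\<^sub>(induced_bimodule K H B M) w)"
 by (simp add: bicomplex_term_def)

lemma TM_smult_Hom: "e <: Et ==> smult (TM L M) e \<in> Hom (TT L M) (TT L M)"
 unfolding TM_smult by (rule tmap_Hom[OF tpT tpT id_lmod ibm_hom])

lemma TM_smult_t3: "[|e <: Et; l <: L; z <: Et; m <: M|] ==>
  e .\<^sub>(TM L M) t3 L M l z m = t3 L M l (e \<star> z) m"
 unfolding TM_smult t3_def by (simp add: tmap_pure[OF tpT tpT id_lmod ibm_hom] iP_closed[OF M] ibm_pure)

lemma TM_left_module: "lmod E (TM L M)"
proof (intro left_module.intro left_module_axioms.intro Er.ring_axioms)
 interpret T: abelian_group "TT L M" by (rule TTa)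
 note s = TM_smult_Hom and p = TM_smult_t3 and tc = t3_closed and cl = Hom_closed[OF TM_smult_Hom]
 show "abgrp (TM L M)" using TTa by simp
 { fix a x assume "a <: E" "x <: TM L M"
  then show "a .\<^sub>(TM L M) x <: TM L M" using cl by simp }
 { fix a x y assume "a <: E" "x <: TM L M" "y <: TM L M"
  then show "a .\<^sub>(TM L M) (x +\<^sub>(TM L M) y) = a .\<^sub>(TM L M) x +\<^sub>(TM L M) a .\<^sub>(TM L M) y"
   using Hom_add[OF s] by simp }
 { fix a b x assume a: "a <: E" and b: "b <: E" and x: "x <: TM L M"
  have a': "a <: Et" "b <: Et" "x <: TT L M" "a +\<^sub>Et b <: Et"
   using a b x Er.a_closed[OF a b] by simp_all
  have 1: "(%x. a .\<^sub>(TM L M) x +\<^sub>(TT L M) b .\<^sub>(TM L M) x) \<in> Hom (TT L M) (TT L M)"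
   by (rule HomI) (use a' cl in "simp_all add: Hom_add[OF s] T.a_ac")
  have "(a +\<^sub>Et b) .\<^sub>(TM L M) x = a .\<^sub>(TM L M) x +\<^sub>(TT L M) b .\<^sub>(TM L M) x"
   by (rule T_ext[OF TTa s[OF a'(4)] 1 _ a'(3)])
     (use a' in "simp_all add: p E_distrib Hom_add[OF ebalD(2)[OF tbalD(1)[OF t3_tbal]]]")
  then show "(a +\<^sub>E b) .\<^sub>(TM L M) x = a .\<^sub>(TM L M) x +\<^sub>(TM L M) b .\<^sub>(TM L M) x" by simp
  show "(a \<star> b) .\<^sub>(TM L M) x = a .\<^sub>(TM L M) (b .\<^sub>(TM L M) x)"
   by (rule T_ext[OF TTa s Hom_comp[OF s[OF a'(2)] s[OF a'(1)]] _ a'(3)]) (use a' in "simp_all add: p E_assoc") }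
 { fix x assume x: "x <: TM L M"
  have "1\<^sub>E .\<^sub>(TM L M) x = x"
   by (rule T_ext[OF TTa s Hom_id]) (use x in "simp_all add: p E_one")
  then show "1\<^sub>E .\<^sub>(TM L M) x = x" . }
qed

lemma t3_one:
 assumes "l <: L" "z <: Et" "m <: M"
 shows "t3 L M l z m = z .\<^sub>(TM L M) t3 L M l (pE 1 1) m"
 using assms by (simp add: TM_smult_t3 E_one)

end

section \<open>Functoriality\<close>

definition mapL where "mapL L' M f = tmap H L' (iH M) f id"
definition mapM where "mapM L M' d = tmap H L (iH M') id (induced_map K H B M' d)"

lemma
 assumes M: "lmod G M" and M': "lmod G M'" and d: "d \<in> lhom G M M'"
 shows imap_pure: "[|z <: Et; m <: M|] ==> induced_map K H B M' d (iP M z m) = iP M' z (d m)"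
  and imap_hom: "induced_map K H B M' d \<in> lhom H (iH M) (iH M')"
proof -
 interpret M: left_module G M by (rule M)
 have d': "d \<in> lhom Ken (restrict_Ae K B M) (restrict_Ae K B M')"
  using d by (auto simp: lmod_hom_def)
 have ah: "induced_map K H B M' d \<in> Hom (KI M) (KI M')"
  unfolding induced_map_def induced_def by (rule tmap_Hom[OF tpI[OF M] tpI[OF M'] id_lmod d']) 
 show p: "induced_map K H B M' d (iP M z m) = iP M' z (d m)" if "z <: Et" "m <: M" for z m
  unfolding induced_map_def induced_pure_def
  using tmap_pure[OF tpI[OF M] tpI[OF M'] id_lmod d', of z m] that by simp
 show "induced_map K H B M' d \<in> lhom H (iH M) (iH M')"
 proof (rule linI)
  show "induced_map K H B M' d \<in> Hom (iH M) (iH M')" using ah by simp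
  fix h w assume h: "h <: H" and w: "w <: iH M"
  have "induced_map K H B M' d (induced_H_action K H B M h w) = induced_H_action K H B M' h (induced_map K H B M' d w)"
  proof (rule KI_ext[OF M KIa[OF M'] Hom_comp[OF hact_Hom[OF M h] ah] Hom_comp[OF ah hact_Hom[OF M' h]]])
   show "w <: KI M" using w by simp
   fix z m assume z: "z <: Et" "m <: M"
   have dm: "d m <: M'" by (rule lin_closed[OF d z(2)])
   note t = ebal_trib[OF M KIa[OF M] iP_ebal[OF M] z]
   have "induced_map K H B M' d (induced_H_action K H B M h (iP M z m)) =
     HS (KI M') (%x g y. iP M' (z \<star> pE x y) (g .\<^sub>M' d m)) h" (is "?a = _")
    unfolding hact_pure[OF M h z]
    by (rule HS_map[OF KIa[OF M] t h KIa[OF M'] ah]) (use z in "simp add: p M.smult_closed lin_smult[OF d]")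
   also have "... = induced_H_action K H B M' h (induced_map K H B M' d (iP M z m))"
    using z dm by (simp add: p hact_pure[OF M' h])
   finally show "?a = ..." .
  qed
  then show "induced_map K H B M' d (h .\<^sub>(iH M) w) = h .\<^sub>(iH M') induced_map K H B M' d w" by simp
 qed
qed

lemma mapL:
 assumes L: "lmod (opp H) L" and L': "lmod (opp H) L'" and M: "lmod G M" and f: "f \<in> lhom (opp H) L L'"
 shows mapL_t3: "[|l <: L; z <: Et; m <: M|] ==> mapL L' M f (t3 L M l z m) = t3 L' M (f l) z m"
  and mapL_Hom: "mapL L' M f \<in> Hom (TT L M) (TT L' M)"
  and mapL_hom: "mapL L' M f \<in> lhom E (TM L M) (TM L' M)"
proof -
 have f': "f \<in> lhom H L L'" using f by simp
 note fc = lin_closed[OF f]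
 show p: "mapL L' M f (t3 L M l z m) = t3 L' M (f l) z m" if "l <: L" "z <: Et" "m <: M" for l z m
  unfolding mapL_def t3_def using tmap_pure[OF tpT[OF L M] tpT[OF L' M] f' id_lmod] that by (simp add: iP_closed[OF M])
 show ah: "mapL L' M f \<in> Hom (TT L M) (TT L' M)"
  unfolding mapL_def by (rule tmap_Hom[OF tpT[OF L M] tpT[OF L' M] f' id_lmod])
 show "mapL L' M f \<in> lhom E (TM L M) (TM L' M)"
 proof (rule linI)
  show "mapL L' M f \<in> Hom (TM L M) (TM L' M)" using ah by simp
  fix e u assume e: "e <: E" and u: "u <: TM L M"
  show "mapL L' M f (e .\<^sub>(TM L M) u) = e .\<^sub>(TM L' M) mapL L' M f u"
   by (rule T_ext[OF L M TTa[OF L' M] Hom_comp[OF TM_smult_Hom[OF L M] ah] Hom_comp[OF ah TM_smult_Hom[OF L' M]]])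
     (use e u fc in "simp_all add: p TM_smult_t3[OF L M] TM_smult_t3[OF L' M]")
 qed
qed

lemma mapM:
 assumes L: "lmod (opp H) L" and M: "lmod G M" and M': "lmod G M'" and d: "d \<in> lhom G M M'"
 shows mapM_t3: "[|l <: L; z <: Et; m <: M|] ==> mapM L M' d (t3 L M l z m) = t3 L M' l z (d m)"
  and mapM_Hom: "mapM L M' d \<in> Hom (TT L M) (TT L M')"
  and mapM_hom: "mapM L M' d \<in> lhom E (TM L M) (TM L M')"
proof -
 note ih = imap_hom[OF M M' d] and dc = lin_closed[OF d]
 show p: "mapM L M' d (t3 L M l z m) = t3 L M' l z (d m)" if "l <: L" "z <: Et" "m <: M" for l z m
  unfolding mapM_def t3_def using tmap_pure[OF tpT[OF L M] tpT[OF L M'] id_lmod ih] that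
  by (simp add: iP_closed[OF M] imap_pure[OF M M' d])
 show ah: "mapM L M' d \<in> Hom (TT L M) (TT L M')"
  unfolding mapM_def by (rule tmap_Hom[OF tpT[OF L M] tpT[OF L M'] id_lmod ih])
 show "mapM L M' d \<in> lhom E (TM L M) (TM L M')"
 proof (rule linI)
  show "mapM L M' d \<in> Hom (TM L M) (TM L M')" using ah by simp
  fix e u assume e: "e <: E" and u: "u <: TM L M"
  show "mapM L M' d (e .\<^sub>(TM L M) u) = e .\<^sub>(TM L M') mapM L M' d u"
   by (rule T_ext[OF L M TTa[OF L M'] Hom_comp[OF TM_smult_Hom[OF L M] ah] Hom_comp[OF ah TM_smult_Hom[OF L M']]])
     (use e u dc in "simp_all add: p TM_smult_t3[OF L M] TM_smult_t3[OF L M']")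
 qed
qed

end

lemma left_module_pullback:
 assumes R': "ring R'" and M: "lmod R M"
  and j: "!!c. c <: R' ==> j c <: R" "j 1\<^sub>R' = 1\<^sub>R"
   "!!c d. [|c <: R'; d <: R'|] ==> j (c +\<^sub>R' d) = j c +\<^sub>R j d"
   "!!c d. [|c <: R'; d <: R'|] ==> j (c *\<^sub>R' d) = j c \<otimes>\<^bsub>R\<^esub> j d"
 shows "lmod R' (with_action M (%c x. j c .\<^sub>M x))"
proof -
 interpret M: left_module R M by (rule M)
 show ?thesis
  by (intro left_module.intro left_module_axioms.intro R')
    (use j M.M.abelian_group_axioms in "simp_all add: M.smult_closed M.smult_l_distr M.smult_r_distr M.smult_assoc1 M.smult_one")
qed

context galois_Gamma
begin

section \<open>The bimodule of linear maps from \<open>L\<close> to a bimodule\<close>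

text \<open>Restriction of scalars to \<open>K\<close>.\<close>

definition lk where "lk L = with_action L (%c l. (c .\<^sub>H 1\<^sub>H) .\<^sub>L l)"
definition nk where "nk N = with_action N (%c n. pE (c \<odot> 1) 1 .\<^sub>N n)"

lemma lk_simps [simp]: "carrier (lk L) = carrier L" "add (lk L) = add L" "0\<^sub>(lk L) = 0\<^sub>L"
 "smult (lk L) = (%c l. (c .\<^sub>H 1\<^sub>H) .\<^sub>L l)" "tsum (lk L) = tsum L"
 "Hom (lk L) X = Hom L X" "Hom X (lk L) = Hom X L"
 by (simp_all add: lk_def Hom_def)

lemma nk_simps [simp]: "carrier (nk N) = carrier N" "add (nk N) = add N" "0\<^sub>(nk N) = 0\<^sub>N"
 "smult (nk N) = (%c n. pE (c \<odot> 1) 1 .\<^sub>N n)" "tsum (nk N) = tsum N"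
 "Hom (nk N) X = Hom N X" "Hom X (nk N) = Hom X N"
 by (simp_all add: nk_def Hom_def)

lemma lk_left_module: "lmod (opp H) L ==> lmod K (lk L)"
 unfolding lk_def
 by (rule left_module_pullback[where R="opp H", OF cring.axioms(1)[OF K_cring]])
   (simp_all add: Hm.smult_closed Hm.smult_l_distr Hm.smult_one smult_mult_l Hm.smult_assoc1[symmetric] cring.cring_simprules(14)[OF K_cring])

lemma nk_left_module: "lmod E N ==> lmod K (nk N)"
 unfolding nk_def
 by (rule left_module_pullback[where R=E, OF cring.axioms(1)[OF K_cring]])
   (simp_all add: Bm.smult_closed Bm.smult_l_distr Bm.smult_one pE_add_l pE_mult B.smult_mult_l Bm.smult_assoc1[symmetric])

definition bact1 where "bact1 L N c k l = tsum N (%x h. pE x c .\<^sub>N k (h .\<^sub>L l))"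
definition bact where "bact L N z k l = tsum N (%b c. bact1 L N c k l (\<rho> b)) z"

text \<open>The action of \<open>b \<otimes> c\<^sup>o\<^sup>p\<close> on a linear map \<open>k\<close> is \<open>l \<mapsto> \<Sum> b\<^sub>(\<^sub>0\<^sub>) k(l b\<^sub>(\<^sub>1\<^sub>)) c\<close>.\<close>

definition HL :: "('h, 'l, 'y) module_scheme \<Rightarrow> (('b, 'b) tens, 'n, 'v) module_scheme \<Rightarrow> (('b, 'b) tens, 'l \<Rightarrow> 'n) module" where
 "HL L N = \<lparr>carrier = {k \<in> extensional (carrier L). k \<in> lhom K (lk L) (nk N)},
   monoid.mult = undefined, one = undefined, ring.zero = (\<lambda>l\<in>carrier L. 0\<^sub>N),
   add = (%k \<psi>. \<lambda>l\<in>carrier L. k l +\<^sub>N \<psi> l), smult = (%z k. \<lambda>l\<in>carrier L. bact L N z k l)\<rparr>"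

lemma HL_simps: "k <: HL L N \<longleftrightarrow> k \<in> extensional (carrier L) \<and> k \<in> lhom K (lk L) (nk N)"
 "0\<^sub>(HL L N) = (\<lambda>l\<in>carrier L. 0\<^sub>N)" "k +\<^sub>(HL L N) g = (\<lambda>l\<in>carrier L. k l +\<^sub>N g l)"
 "z .\<^sub>(HL L N) k = (\<lambda>l\<in>carrier L. bact L N z k l)"
 by (simp_all add: HL_def)

context
 fixes L :: "('h, 'l, 'y) module_scheme"
 assumes L: "lmod (opp H) L"
begin

interpretation L: left_module "opp H" L by (rule L)
interpretation Lk: left_module K "lk L" by (rule lk_left_module[OF L])

lemma L_smult [simp]: "[|h <: H; l <: L|] ==> h .\<^sub>L l <: L"
 using L.smult_closed by simp

lemma L_assoc: "[|g <: H; h <: H; l <: L|] ==> g .\<^sub>L (h .\<^sub>L l) = (h *\<^sub>H g) .\<^sub>L l"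
 using L.smult_assoc1[of g h l] by simp

lemma L_one: "l <: L ==> 1\<^sub>H .\<^sub>L l = l"
 using L.smult_one by simp

lemma lin_L_act: "l <: L ==> (%h. h .\<^sub>L l) \<in> lhom K H (lk L)"
 using L.smult_l_distr by (auto simp: lmod_hom_def L_assoc Hm.smult_closed smult_mult_r)

lemma lin_L_act2: "h <: H ==> (%l. h .\<^sub>L l) \<in> lhom K (lk L) (lk L)"
 using L.smult_r_distr by (auto simp: lmod_hom_def L_assoc Hm.smult_closed smult_mult_r smult_mult_l)

context
 fixes N :: "(('b, 'b) tens, 'n, 'v) module_scheme"
 assumes N: "lmod E N"
begin

interpretation N: left_module E N by (rule N)

lemmas Na = lmod_ab[OF N] and nkm = nk_left_module[OF N]

lemma N_smult [simp]: "[|z <: Et; n <: N|] ==> z .\<^sub>N n <: N"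
 using N.smult_closed by simp

lemma N_assoc: "[|z <: Et; z' <: Et; n <: N|] ==> z .\<^sub>N (z' .\<^sub>N n) = (z \<star> z') .\<^sub>N n"
 using N.smult_assoc1[of z z' n] by simp

lemma N_l_Hom: "n <: N ==> (%z. z .\<^sub>N n) \<in> Hom Et N"
 using N.smult_l_distr by (intro HomI) simp_all

lemma N_r_Hom: "z <: Et ==> (%n. z .\<^sub>N n) \<in> Hom N N"
 using N.smult_r_distr by (intro HomI) simp_all

lemma E_scalar_central: "[|c <: K; z <: Et|] ==> pE (c \<odot> 1) 1 \<star> z = z \<star> pE (c \<odot> 1) 1"
 "[|c <: K; z <: Et|] ==> pE (c \<odot> 1) 1 \<star> z = c .\<^sub>E z"
proof -
 assume c: "c <: K" and z: "z <: Et"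
 have p: "pE (c \<odot> 1) 1 = c .\<^sub>E pE 1 1" using c by (simp add: Ek.alg_smult_pure)
 show 2: "pE (c \<odot> 1) 1 \<star> z = c .\<^sub>E z"
  unfolding p using lin_smult[OF Ek.mult_lin_l, of z c "pE 1 1"] c z by (simp add: E_one)
 have "z \<star> pE (c \<odot> 1) 1 = c .\<^sub>E z"
  unfolding p using lin_smult[OF Ek.mult_lin_r, of z c "pE 1 1"] c z by (simp add: E_one)
 with 2 show "pE (c \<odot> 1) 1 \<star> z = z \<star> pE (c \<odot> 1) 1" by simp
qed

lemma lin_N_l: "[|f \<in> lhom K Z E; n <: N|] ==> (%x. f x .\<^sub>N n) \<in> lhom K Z (nk N)"
proof (rule linI)
 assume f: "f \<in> lhom K Z E" and n: "n <: N"
 note fc = lin_closed[OF f, simplified]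
 show "(%x. f x .\<^sub>N n) \<in> Hom Z (nk N)"
  using Hom_comp[OF lin_Hom[OF f, simplified] N_l_Hom[OF n]] by simp
 fix c x assume "c <: K" "x <: Z"
 then show "f (c .\<^sub>Z x) .\<^sub>N n = c .\<^sub>(nk N) (f x .\<^sub>N n)"
  using n fc by (simp add: lin_smult[OF f] N_assoc Bm.smult_closed E_scalar_central(2))
qed

lemma lin_N_r: "[|f \<in> lhom K Z (nk N); z <: Et|] ==> (%x. z .\<^sub>N f x) \<in> lhom K Z (nk N)"
proof (rule linI)
 assume f: "f \<in> lhom K Z (nk N)" and z: "z <: Et"
 note fc = lin_closed[OF f, simplified]
 show "(%x. z .\<^sub>N f x) \<in> Hom Z (nk N)"
  using Hom_comp[OF lin_Hom[OF f, simplified] N_r_Hom[OF z]] by simp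
 fix c x assume "c <: K" "x <: Z"
 then show "z .\<^sub>N f (c .\<^sub>Z x) = c .\<^sub>(nk N) (z .\<^sub>N f x)"
  using z fc by (simp add: lin_smult[OF f] N_assoc Bm.smult_closed E_scalar_central(1))
qed

context
 fixes k
 assumes k: "k \<in> lhom K (lk L) (nk N)"
begin

lemma k_closed [simp]: "l <: L ==> k l <: N"
 using lin_closed[OF k] by simp

lemma bact1_bilin:
 assumes c: "c <: B" and l: "l <: L"
 shows "bilin K B H (nk N) (%x h. pE x c .\<^sub>N k (h .\<^sub>L l))"
 by (rule bilinI)
   (use c l in "auto intro!: lin_N_r lin_comp[OF k] lin_L_act lin_N_l lin_intro")

lemma bact1_Hom: "[|c <: B; l <: L|] ==> bact1 L N c k l \<in> Hom BHt N"
 using BH.lin_lift[OF nkm bact1_bilin, THEN lin_Hom] by (simp add: bact1_def)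

lemma bact1_pure: "[|c <: B; l <: L; x <: B; h <: H|] ==>
  bact1 L N c k l (pBH x h) = pE x c .\<^sub>N k (h .\<^sub>L l)"
 using BH.lift_bilin_pure[OF nkm bact1_bilin] by (simp add: bact1_def)

lemma bact1_lin: "[|c <: B; u <: BHt|] ==> (%l. bact1 L N c k l u) \<in> lhom K (lk L) (nk N)"
 using lin_lift_param[OF BH.tp nkm, of u "%l x h. pE x c .\<^sub>N k (h .\<^sub>L l)" "lk L"]
 by (simp add: bact1_def lin_N_r lin_comp[OF k] lin_L_act2)

lemma bact_bilin:
 assumes l: "l <: L"
 shows "bilin K B (opp B) (nk N) (%b c. bact1 L N c k l (\<rho> b))"
proof (rule bilinI)
 fix b assume b: "b <: B"
 have "(%c. tsum (nk N) (%x h. pE x c .\<^sub>N k (h .\<^sub>L l)) (\<rho> b)) \<in> lhom K B (nk N)"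
  by (rule lin_lift_param[OF BH.tp nkm rho_closed[OF b]], rule lin_N_l) (use l in "auto intro!: lin_intro")
 then show "(%c. bact1 L N c k l (\<rho> b)) \<in> lhom K (opp B) (nk N)" by (simp add: bact1_def lin_opp2)
next
 fix c assume c: "c <: opp B"
 then show "(%b. bact1 L N c k l (\<rho> b)) \<in> lhom K B (nk N)"
  using BH.lin_lift_arg[OF nkm bact1_bilin rho.\<delta>_lin, of c l] l by (simp add: bact1_def)
qed

lemma bact_Hom: "l <: L ==> (%z. bact L N z k l) \<in> Hom Et N"
 using Ek.lin_lift[OF nkm bact_bilin, THEN lin_Hom] by (simp add: bact_def)

lemma bact_pure: "[|l <: L; b <: B; c <: B|] ==> bact L N (pE b c) k l = bact1 L N c k l (\<rho> b)"
 using Ek.lift_bilin_pure[OF nkm bact_bilin] by (simp add: bact_def)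

lemma bact_lin: "z <: Et ==> (%l. bact L N z k l) \<in> lhom K (lk L) (nk N)"
 using lin_lift_param[OF Ek.tp nkm, of z "%l b c. bact1 L N c k l (\<rho> b)" "lk L"]
 by (simp add: bact_def bact1_lin)

lemma bact_closed: "[|z <: Et; l <: L|] ==> bact L N z k l <: N"
 using Hom_closed[OF bact_Hom] by simp

lemma bact_A: "[|a <: A; c <: B; l <: L|] ==> bact L N (pE a c) k l = pE a c .\<^sub>N k l"
 by (simp add: bact_pure rho_A bact1_pure L_one)

lemma bact_restrict: "l <: L ==> z <: Et ==> bact L N z (\<lambda>l\<in>carrier L. k l) l = bact L N z k l"
 unfolding bact_def bact1_def
 by (rule lift_cong[OF Ek.tp], simp, rule rho_cong, simp_all)

end

text \<open>An action, because \<open>\<rho>\<close> is multiplicative.\<close>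

lemma bact_mult:
 assumes k: "k \<in> lhom K (lk L) (nk N)" and z: "z <: Et" and z': "z' <: Et" and l: "l <: L"
 shows "bact L N (z \<star> z') k l = bact L N z (bact L N z' k) l"
proof -
 note z'l = bact_lin[OF k]
 note kc = k_closed[OF k]
 have pure: "bact L N (z \<star> pE b' c') k l = bact L N z (bact L N (pE b' c') k) l" if b': "b' <: B" and c': "c' <: B" for b' c'
 proof -
  have q: "pE b' c' <: Et" using b' c' by simp
  show ?thesis
  proof (rule tensor_ext[OF Ek.tp Na Hom_comp[OF E_mult_Hom(2)[OF q] bact_Hom[OF k l]] bact_Hom[OF z'l[OF q] l] _ z])
   fix b c assume "b <: B" "c <: opp B"
   then have b: "b <: B" and c: "c <: B" by simp_all
   have cc: "c' * c <: B" using c c' by simp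
   let ?F = "bact1 L N (c' * c) k l"
   note F = bact1_Hom[OF k cc l] and Fp = bact1_pure[OF k cc l]
   have "bact L N (pE b c) (bact L N (pE b' c') k) l = tsum N (%x h. pE x c .\<^sub>N bact1 L N c' k (h .\<^sub>L l) (\<rho> b')) (\<rho> b)"
    unfolding bact_pure[OF z'l[OF q] l b c] unfolding bact1_def[of L N c]
    by (rule rho_cong[OF b]) (use b' c' c l bact_closed[OF k q] in "simp_all add: bact_pure[OF k]")
   also have "... = tsum N (%x h. ?F (pBH x h \<bullet> \<rho> b')) (\<rho> b)"
   proof (rule rho_cong[OF b])
    fix x h assume x: "x <: B" "h <: H"
    have hl: "h .\<^sub>L l <: L" using x l by simp
    note G = bact1_Hom[OF k c' hl] and Gp = bact1_pure[OF k c' hl]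
    have xc: "pE x c <: Et" using x c by simp
    have m: "(%u. pBH x h \<bullet> u) \<in> Hom BHt BHt"
     using BH.mult_lin_r[THEN lin_Hom] x by simp
    show "pE x c .\<^sub>N bact1 L N c' k (h .\<^sub>L l) (\<rho> b') = ?F (pBH x h \<bullet> \<rho> b')"
    proof (rule tensor_ext[OF BH.tp Na Hom_comp[OF G N_r_Hom[OF xc]] Hom_comp[OF m F] _ rho_closed[OF b']])
     fix y g assume y: "y <: B" "g <: H"
     show "pE x c .\<^sub>N bact1 L N c' k (h .\<^sub>L l) (pBH y g) = ?F (pBH x h \<bullet> pBH y g)"
      using x y c c' l kc by (simp add: Gp Fp BH.mult_pure N_assoc pE_mult L_assoc)
    qed
   qed
   also have "... = ?F (\<rho> b \<bullet> \<rho> b')"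
   proof -
    have m: "(%u. u \<bullet> \<rho> b') \<in> Hom BHt BHt"
     using BH.mult_lin_l[THEN lin_Hom] b' by simp
    show ?thesis by (rule tensor_Hom_lift[OF BH.tp Na Hom_comp[OF m F] rho_closed[OF b], symmetric])
   qed
   also have "... = bact L N (pE b c \<star> pE b' c') k l"
    using b c b' c' l by (simp add: pE_mult bact_pure[OF k] rho_mult)
   finally show "bact L N (pE b c \<star> pE b' c') k l = bact L N (pE b c) (bact L N (pE b' c') k) l" by simp
  qed
 qed
 have add: "(%z'. bact L N z (bact L N z' k) l) \<in> Hom Et N"
  unfolding bact_def[of L N z] bact1_def
 proof (rule lift_Hom_param[OF Ek.tp Na z])
  fix b c assume b: "b <: B" "c <: opp B"
  show "(%z'. tsum N (%x h. pE x c .\<^sub>N bact L N z' k (h .\<^sub>L l)) (\<rho> b)) \<in> Hom Et N"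
   by (rule lift_Hom_param[OF BH.tp Na rho_closed[OF b(1)]], rule Hom_comp[OF bact_Hom[OF k] N_r_Hom])
     (use l b in simp_all)
 qed
 show ?thesis
  by (rule tensor_ext[OF Ek.tp Na Hom_comp[OF E_mult_Hom(1)[OF z] bact_Hom[OF k l]] add _ z']) (simp add: pure)
qed

lemma HL_left_module: "lmod E (HL L N)"
proof (intro left_module.intro left_module_axioms.intro Er.ring_axioms)
 interpret nk: left_module K "nk N" by (rule nkm)
 have rl: "(\<lambda>l\<in>carrier L. f l) <: HL L N" if "f \<in> lhom K (lk L) (nk N)" for f
  using that lin_cong[OF that Lk.left_module_axioms, of "\<lambda>l\<in>carrier L. f l"] by (simp add: HL_simps)
 have pl: "(%l. k l +\<^sub>N g l) \<in> lhom K (lk L) (nk N)" if "k \<in> lhom K (lk L) (nk N)" "g \<in> lhom K (lk L) (nk N)" for k g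
  using nk.smult_r_distr by (intro linI HomI)
   (simp_all add: k_closed[OF that(1)] k_closed[OF that(2)] lin_add[OF that(1), simplified] lin_add[OF that(2), simplified]
    lin_smult[OF that(1), simplified] lin_smult[OF that(2), simplified] N.a_ac)
 have ext: "k = g" if "k <: HL L N" "g <: HL L N" "!!l. l <: L ==> k l = g l" for k g
  using that by (intro extensionalityI[of _ "carrier L"]) (simp_all add: HL_simps)
 have HLc: "k \<in> lhom K (lk L) (nk N)" if "k <: HL L N" for k using that by (simp add: HL_simps)
 have pc: "k +\<^sub>(HL L N) g <: HL L N" if "k <: HL L N" "g <: HL L N" for k g
  unfolding HL_simps(3) by (rule rl[OF pl[OF HLc[OF that(1)] HLc[OF that(2)]]])
 have vc: "k l <: N" if "k <: HL L N" "l <: L" for k l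
  by (rule k_closed[OF HLc[OF that(1)] that(2)])
 have zl: "(%_. 0\<^sub>N) \<in> lhom K (lk L) (nk N)"
  using nk.smult_zero_r by (intro linI HomI) simp_all
 note zc = rl[OF zl, folded HL_simps(2)[of L N]]
 show "abgrp (HL L N)"
 proof (rule abelian_groupI)
  fix x y z assume xyz: "x <: HL L N" "y <: HL L N" "z <: HL L N"
  show "x +\<^sub>(HL L N) y +\<^sub>(HL L N) z = x +\<^sub>(HL L N) (y +\<^sub>(HL L N) z)"
   by (rule ext[OF pc[OF pc[OF xyz(1,2)] xyz(3)] pc[OF xyz(1) pc[OF xyz(2,3)]]])
     (use xyz vc in "simp add: HL_simps(3) N.a_assoc")
 next
  fix x y assume xyz: "x <: HL L N" "y <: HL L N"
  show "x +\<^sub>(HL L N) y <: HL L N" by (rule pc[OF xyz])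
  show "x +\<^sub>(HL L N) y = y +\<^sub>(HL L N) x"
   by (rule ext[OF pc[OF xyz] pc[OF xyz(2,1)]]) (use xyz vc in "simp add: HL_simps(3) N.a_comm")
 next
  fix x assume x: "x <: HL L N"
  show "0\<^sub>(HL L N) +\<^sub>(HL L N) x = x"
   by (rule ext[OF pc[OF zc x] x]) (use x vc in "simp add: HL_simps")
  have nl: "(%l. \<ominus>\<^bsub>N\<^esub> x l) \<in> lhom K (lk L) (nk N)"
  proof (rule lin_comp[OF _ HLc[OF x]])
   show "(%n. \<ominus>\<^bsub>N\<^esub> n) \<in> lhom K (nk N) (nk N)"
    by (intro linI HomI) (use N_r_Hom in "simp_all add: N.minus_add Bm.smult_closed Hom_neg[OF Na Na]")
  qed
  show "\<exists>y\<in>carrier (HL L N). y +\<^sub>(HL L N) x = 0\<^sub>(HL L N)"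
  proof (rule bexI[OF _ rl[OF nl]])
   show "(\<lambda>l\<in>carrier L. \<ominus>\<^bsub>N\<^esub> x l) +\<^sub>(HL L N) x = 0\<^sub>(HL L N)"
    by (rule ext[OF pc[OF rl[OF nl] x] zc]) (use x vc in "simp add: HL_simps(2,3) N.l_neg")
  qed
 qed (rule zc)
 fix a k assume a: "a <: E" and f: "k <: HL L N"
 have a': "a <: Et" using a by simp
 show sc: "a .\<^sub>(HL L N) k <: HL L N" unfolding HL_simps(4) by (rule rl[OF bact_lin[OF HLc[OF f] a']])
 { fix b assume b: "b <: E"
  have b': "b <: Et" using b by simp
  have ab: "a +\<^sub>E b <: Et" "a \<star> b <: Et" using Er.a_closed[OF a b] a b by simp_all
  have c: "z .\<^sub>(HL L N) g <: HL L N" if "z <: Et" "g <: HL L N" for z g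
   unfolding HL_simps(4) by (rule rl[OF bact_lin[OF HLc[OF that(2)] that(1)]])
  show "(a +\<^sub>E b) .\<^sub>(HL L N) k = a .\<^sub>(HL L N) k +\<^sub>(HL L N) b .\<^sub>(HL L N) k"
   by (rule ext[OF c[OF ab(1) f] pc[OF c[OF a' f] c[OF b' f]]])
     (use a' b' Hom_add[OF bact_Hom[OF HLc[OF f]]] in "simp add: HL_simps(3,4)")
  show "(a \<star> b) .\<^sub>(HL L N) k = a .\<^sub>(HL L N) (b .\<^sub>(HL L N) k)"
  proof (rule ext[OF c[OF ab(2) f] c[OF a' c[OF b' f]]])
   fix l assume l: "l <: L"
   show "((a \<star> b) .\<^sub>(HL L N) k) l = (a .\<^sub>(HL L N) (b .\<^sub>(HL L N) k)) l"
    using l bact_mult[OF HLc[OF f] a' b' l] bact_restrict[OF bact_lin[OF HLc[OF f] b'] l a'] by (simp add: HL_simps(4))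
  qed }
 { fix g assume p: "g <: HL L N"
  have c: "z .\<^sub>(HL L N) g <: HL L N" if "z <: Et" "g <: HL L N" for z g
   unfolding HL_simps(4) by (rule rl[OF bact_lin[OF HLc[OF that(2)] that(1)]])
  have s: "bact L N a (\<lambda>l\<in>carrier L. k l +\<^sub>N g l) l = bact L N a k l +\<^sub>N bact L N a g l" if l: "l <: L" for l
  proof -
   have "bact L N a (\<lambda>l\<in>carrier L. k l +\<^sub>N g l) l = tsum N (%b c. bact1 L N c k l (\<rho> b) +\<^sub>N bact1 L N c g l (\<rho> b)) a"
    unfolding bact_restrict[OF pl[OF HLc[OF f] HLc[OF p]] l a'] unfolding bact_def
   proof (rule lift_cong[OF Ek.tp a'])
    fix b c assume "b <: B" "c <: opp B"
    then have b: "b <: B" and c: "c <: B" by simp_all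
    have "bact1 L N c (%l. k l +\<^sub>N g l) l (\<rho> b) = tsum N (%x h. pE x c .\<^sub>N k (h .\<^sub>L l) +\<^sub>N pE x c .\<^sub>N g (h .\<^sub>L l)) (\<rho> b)"
     unfolding bact1_def by (rule rho_cong[OF b]) (use l c vc[OF f] vc[OF p] Hom_add[OF N_r_Hom] in simp_all)
    also have "... = bact1 L N c k l (\<rho> b) +\<^sub>N bact1 L N c g l (\<rho> b)"
     unfolding bact1_def by (rule lift_plus[OF BH.tp Na rho_closed[OF b]]) (use l c vc[OF f] vc[OF p] in simp_all)
    finally show "bact1 L N c (%l. k l +\<^sub>N g l) l (\<rho> b) = bact1 L N c k l (\<rho> b) +\<^sub>N bact1 L N c g l (\<rho> b)" .
   qed
   also have "... = bact L N a k l +\<^sub>N bact L N a g l"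
    unfolding bact_def by (rule lift_plus[OF Ek.tp Na a']) (use l Hom_closed[OF bact1_Hom[OF HLc[OF f]]] Hom_closed[OF bact1_Hom[OF HLc[OF p]]] in simp_all)
   finally show ?thesis .
  qed
  show "a .\<^sub>(HL L N) (k +\<^sub>(HL L N) g) = a .\<^sub>(HL L N) k +\<^sub>(HL L N) a .\<^sub>(HL L N) g"
   by (rule ext[OF c[OF a' pc[OF f p]] pc[OF c[OF a' f] c[OF a' p]]]) (simp add: HL_simps(3,4) s) }
next
 fix k assume f: "k <: HL L N"
 have fl: "k \<in> lhom K (lk L) (nk N)" and fe: "k \<in> extensional (carrier L)" using f by (simp_all add: HL_simps)
 show "1\<^sub>E .\<^sub>(HL L N) k = k"
 proof (rule extensionalityI[of _ "carrier L"])
  show "1\<^sub>E .\<^sub>(HL L N) k \<in> extensional (carrier L)" by (simp add: HL_simps)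
  fix l assume l: "l <: L"
  show "(1\<^sub>E .\<^sub>(HL L N) k) l = k l"
   using l N.smult_one[OF k_closed[OF fl l]] by (simp add: HL_simps(4) bact_A[OF fl])
 qed (rule fe)
qed

end

end

end

context galois_Gamma
begin

section \<open>Projectivity of \<open>L \<otimes>\<^sub>H (B\<^sup>e \<otimes>\<^bsub>A\<^sup>e\<^esub> M)\<close>\<close>

lemma trib_shift:
 assumes t: "trib G P F" and c: "c <: B"
 shows "trib G P (%x g y. F x g (y * c))"
proof -
 have m: "(%y. y * c) \<in> Hom B B" using c by (auto intro!: HomI simp: B.l_distr)
 have f: "(%y. F x z (y * c)) \<in> Hom B P" if "x <: B" "z <: G" for x z
  by (rule Hom_comp[OF m]) (use t that in "simp add: trib_def")
 show ?thesis using t c f unfolding trib_def by (simp add: B_assoc)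
qed

lemma HS_scalar:
 assumes P: "abgrp P" and t: "trib G P f" and c: "c <: K"
 shows "HS P f (c .\<^sub>H 1\<^sub>H) = f 1 (pE (c \<odot> 1) 1) 1"
proof -
 have "\<tau> (c .\<^sub>H 1\<^sub>H) = pBAB 1 (c \<odot> 1)"
  using c lin_smult[OF tau_lin, of c "1\<^sub>H"] by (simp add: tau_one kV_pure[OF A_rmod])
 then show ?thesis
  using lift_pure[OF tpBAB P trib_nu_balanced[OF P t], of "1" "c \<odot> 1"] c A_smult_one[OF c]
  by (simp add: HS_def Bm.smult_closed nu_A trib_lift_VG(2)[OF P t])
qed

lemma left_module_Gamma:
 assumes N: "lmod E N" shows "lmod G N"
proof -
 interpret N: left_module E N by (rule N)
 show ?thesis
  by (intro left_module.intro left_module_axioms.intro Gr.ring_axioms N.M.abelian_group_axioms)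
    (use N.smult_closed N.smult_l_distr N.smult_r_distr N.smult_assoc1 N.smult_one in simp_all)
qed

lemma ebal_hom:
 assumes e: "ebal M' P f" and F: "F \<in> lhom G M M'"
 shows "ebal M P (%z m. f z (F m))"
 by (rule ebalI)
   (use Hom_comp[OF lin_Hom[OF F] ebalD(1)[OF e]] ebalD(2,3)[OF e] lin_closed[OF F] lin_smult[OF F] in simp_all)

lemma t3_scalar:
 assumes L: "lmod (opp H) L" and M: "lmod G M" and c: "c <: K" and l: "l <: L" and z: "z <: Et" and m: "m <: M"
 shows "t3 L M ((c .\<^sub>H 1\<^sub>H) .\<^sub>L l) z m = t3 L M l (z \<star> pE (c \<odot> 1) 1) m"
proof -
 let ?c = "pE (c \<odot> 1) 1"
 note tb = t3_tbal[OF L M] and eb = tbalD(1)[OF t3_tbal[OF L M] l] and T = TTa[OF L M]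
 have "t3 L M ((c .\<^sub>H 1\<^sub>H) .\<^sub>L l) z m = t3 L M l (z \<star> pE 1 1) (?c .\<^sub>M m)"
  using tbalD(3)[OF tb _ l z m, of "c .\<^sub>H 1\<^sub>H"] HS_scalar[OF T ebal_trib[OF M T eb z m] c] c
  by (simp add: Hm.smult_closed)
 also have "... = t3 L M l (z \<star> ?c) m"
  using ebalD(3)[OF eb A_smult_one[OF c] one_A z m] z by (simp add: E_one)
 finally show ?thesis .
qed

context
 fixes L :: "('h, 'l, 'y) module_scheme"
 assumes L: "lmod (opp H) L"
begin

context
 fixes N :: "(('b, 'b) tens, 'n, 'v) module_scheme"
 assumes N: "lmod E N"
begin

interpretation N: left_module E N by (rule N)
lemmas NA = N_assoc[OF L N] and Nab = Na[OF L N]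

lemma HL_lin: "g <: HL L N ==> g \<in> lhom K (lk L) (nk N)" by (simp add: HL_simps)

lemma HL_eval_closed: "[|g <: HL L N; l <: L|] ==> g l <: N"
 using lin_closed[OF HL_lin] by simp

lemma HL_smult_eval: "l <: L ==> (z .\<^sub>(HL L N) g) l = bact L N z g l"
 by (simp add: HL_simps)

lemma HL_eval_ebal:
 assumes l: "l <: L"
 shows "ebal (HL L N) N (%z g. z .\<^sub>N g l)"
proof (rule ebalI)
 interpret HLm: left_module E "HL L N" by (rule HL_left_module[OF L N])
 fix z assume z: "z <: Et"
 show "(%g. z .\<^sub>N g l) \<in> Hom (HL L N) N"
  by (rule Hom_comp[OF HomI N_r_Hom[OF L N z]]) (use l in "simp_all add: HL_eval_closed, simp add: HL_simps")
next
 fix g assume "g <: HL L N"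
 then show "(%z. z .\<^sub>N g l) \<in> Hom Et N" by (intro N_l_Hom[OF L N] HL_eval_closed l)
next
 fix a a' z g assume "a <: A" "a' <: A" "z <: Et" "g <: HL L N"
 then show "(z \<star> pE a a') .\<^sub>N g l = z .\<^sub>N (pE a a' .\<^sub>(HL L N) g) l"
  using l by (simp add: HL_smult_eval bact_A[OF L N HL_lin] NA HL_eval_closed)
qed

text \<open>By the defining property of \<open>\<nu>\<close> the inner sum over \<open>\<nu>(r)\<close> acts on \<open>g\<close> as \<open>r \<otimes> 1\<close>, which gives
  \<open>\<Sum> r\<^sub>(\<^sub>0\<^sub>) g(l r\<^sub>(\<^sub>1\<^sub>))\<close>; then \<open>\<Sum> l(h) r(h)\<^sub>(\<^sub>0\<^sub>) \<otimes> r(h)\<^sub>(\<^sub>1\<^sub>) = 1 \<otimes> h\<close>.\<close>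

lemma HL_eval_HS:
 assumes p: "j <: HL L N" and z: "z <: Et" and h: "h <: H" and l: "l <: L"
 shows "HS N (%x v y. (z \<star> pE x y) .\<^sub>N (v .\<^sub>(HL L N) j) l) h = z .\<^sub>N j (h .\<^sub>L l)"
proof -
 note pl = HL_lin[OF p]
 note b1 = bact1_Hom[OF L N pl B.one_closed l] and b1p = bact1_pure[OF L N pl B.one_closed l]
 note ba = bact_Hom[OF L N pl l] and bc = bact_closed[OF L N pl _ l]
 define J where "J u = z .\<^sub>N bact1 L N 1 j l u" for u
 have J: "J \<in> Hom BHt N"
  unfolding J_def by (rule Hom_comp[OF b1 N_r_Hom[OF L N z]])
 have Jp: "J (pBH x g) = (z \<star> pE x 1) .\<^sub>N j (g .\<^sub>L l)" if "x <: B" "g <: H" for x g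
  using that z l HL_eval_closed[OF p] by (simp add: J_def b1p NA L_smult[OF L])
 note t = ebal_trib[OF left_module_Gamma[OF HL_left_module[OF L N]] Nab HL_eval_ebal[OF l] z p]
 have "HS N (%x v y. (z \<star> pE x y) .\<^sub>N (v .\<^sub>(HL L N) j) l) h = tsum N (%x r. J (pBH x 1\<^sub>H \<bullet> \<rho> r)) (\<tau> h)"
  unfolding HS_def
 proof (rule tau_cong[OF h])
  fix x r assume x: "x <: B" and r: "r <: B"
  have zx: "z \<star> pE x 1 <: Et" using z x by simp
  let ?k = "%w. (z \<star> pE x 1) .\<^sub>N bact L N w j l"
  have k: "?k \<in> Hom Et N" by (rule Hom_comp[OF ba N_r_Hom[OF L N zx]])
  have "tsum N (%v y. (z \<star> pE x y) .\<^sub>N (v .\<^sub>(HL L N) j) l) (nu r) = tsum N (%v y. ?k (pE 1 y \<star> v)) (nu r)" (is "?a = _")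
  proof (rule nu_cong[OF r])
   fix v y assume "v <: G" "y <: B"
   then have g: "v <: Et" "v <: G" and y: "y <: B" by simp_all
   have "bact L N (pE 1 y \<star> v) j l = pE 1 y .\<^sub>N bact L N v j l"
    using bact_mult[OF L N pl _ g(1) l, of "pE 1 y"] bact_A[OF L N bact_lin[OF L N pl g(1)] one_A y l] y by simp
   then show "(z \<star> pE x y) .\<^sub>N (v .\<^sub>(HL L N) j) l = ?k (pE 1 y \<star> v)"
    using g y z x l bc[OF g(1)] by (simp add: HL_smult_eval NA E_assoc pE_mult)
  qed
  also have "... = ?k (pE r 1)" by (rule nu_expand[OF Nab k r])
  also have "... = (z \<star> pE x 1) .\<^sub>N bact1 L N 1 j l (\<rho> r)" using r l by (simp add: bact_pure[OF L N pl])
  also have "... = J (pBH x 1\<^sub>H \<bullet> \<rho> r)"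
  proof (rule tensor_ext[OF BH.tp Nab Hom_comp[OF b1 N_r_Hom[OF L N zx]] Hom_comp[OF _ J] _ rho_closed[OF r]])
   show "(%u. pBH x 1\<^sub>H \<bullet> u) \<in> Hom BHt BHt"
    using BH.mult_lin_r[THEN lin_Hom] x by simp
   fix y g assume y: "y <: B" "g <: H"
   show "(z \<star> pE x 1) .\<^sub>N bact1 L N 1 j l (pBH y g) = J (pBH x 1\<^sub>H \<bullet> pBH y g)"
    using x y z l HL_eval_closed[OF p] by (simp add: b1p Jp BH.mult_pure NA L_smult[OF L] E_assoc pE_mult)
  qed
  finally show "?a = ..." .
 qed
 also have "... = J (pBH 1 h)" by (rule tau_expand[OF Nab J h])
 also have "... = z .\<^sub>N j (h .\<^sub>L l)" using h z by (simp add: Jp E_one)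
 finally show ?thesis .
qed

context
 fixes M :: "(('b, 'b) tens, 'm, 'x) module_scheme"
 assumes M: "lmod G M"
begin

interpretation M: left_module G M by (rule M)

lemmas tb = t3_tbal[OF L M] and Tab = TTa[OF L M] and eb = tbalD(1)[OF t3_tbal[OF L M]]

text \<open>\<open>\<Gamma>\<close>-linear maps \<open>M \<rightarrow> Hom(L, N)\<close> correspond to bimodule maps \<open>L \<otimes>\<^sub>H (B\<^sup>e \<otimes>\<^bsub>A\<^sup>e\<^esub> M) \<rightarrow> N\<close>; the balancing
  over \<open>H\<close> is \<open>HL_eval\<^sub>HS\<close>.\<close>

lemma HL_tbal:
 assumes F: "F \<in> lhom G M (HL L N)"
 shows "tbal L M N (%l z m. z .\<^sub>N F m l)"
proof (rule tbalI)
 note Fc = lin_closed[OF F]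
 fix l assume l: "l <: L"
 show e: "ebal M N (%z m. z .\<^sub>N F m l)" by (rule ebal_hom[OF HL_eval_ebal[OF l] F])
 fix h z m assume h: "h <: H" and z: "z <: Et" and m: "m <: M"
 have "HS N (%x g y. (z \<star> pE x y) .\<^sub>N F (g .\<^sub>M m) l) h =
   HS N (%x g y. (z \<star> pE x y) .\<^sub>N (g .\<^sub>(HL L N) F m) l) h"
  by (rule HS_cong[OF h]) (simp add: lin_smult[OF F _ m])
 also have "... = z .\<^sub>N F m (h .\<^sub>L l)" by (rule HL_eval_HS[OF Fc[OF m] z h l])
 finally show "z .\<^sub>N F m (h .\<^sub>L l) = HS N (%x g y. (z \<star> pE x y) .\<^sub>N F (g .\<^sub>M m) l) h" by simp
next
 fix z m assume z: "z <: Et" and m: "m <: M"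
 have "F m \<in> Hom L N" using lin_Hom[OF HL_lin[OF lin_closed[OF F m]]] by simp
 then show "(%l. z .\<^sub>N F m l) \<in> Hom L N" by (rule Hom_comp[OF _ N_r_Hom[OF L N z]])
qed

context
 fixes f
 assumes f: "f \<in> lhom E (TM L M) N"
begin

lemmas fa = lin_Hom[OF f, simplified] and fE = lin_smult[OF f, simplified]

lemma f_t3: "[|l <: L; z <: Et; m <: M|] ==> f (t3 L M l z m) = z .\<^sub>N f (t3 L M l (pE 1 1) m)"
 using t3_one[OF L M, of l z m] fE[of z "t3 L M l (pE 1 1) m"] by (simp add: t3_closed[OF L M])

lemma f_t3_lin:
 assumes m: "m <: M"
 shows "(%l. f (t3 L M l (pE 1 1) m)) \<in> lhom K (lk L) (nk N)"
proof (rule linI)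
 show "(%l. f (t3 L M l (pE 1 1) m)) \<in> Hom (lk L) (nk N)"
  using Hom_comp[OF tbalD(2)[OF tb _ m] fa] by simp
 fix c l assume c: "c <: K" and l: "l <: lk L"
 then have l: "l <: L" by simp
 let ?c = "pE (c \<odot> 1) 1"
 have cG: "?c <: G" using A_smult_one[OF c] by simp
 show "f (t3 L M (c .\<^sub>(lk L) l) (pE 1 1) m) = c .\<^sub>(nk N) f (t3 L M l (pE 1 1) m)"
  using f_t3[OF l _ m, of ?c] t3_scalar[OF L M c l _ m, of "pE 1 1"] cG by (simp add: E_one)
qed

text \<open>The left-hand side makes sense for all of \<open>B\<^sup>e\<close>. For \<open>b \<otimes> c\<^sup>o\<^sup>p\<close> the translation elements that result from moving
  \<open>b\<^sub>(\<^sub>1\<^sub>)\<close> across \<open>\<otimes>\<^sub>H\<close> are absorbed by \<open>\<Sum> b\<^sub>(\<^sub>0\<^sub>) l(b\<^sub>(\<^sub>1\<^sub>)) \<otimes> r(b\<^sub>(\<^sub>1\<^sub>)) = 1 \<otimes> b\<close>, which leaves a sum over \<open>\<nu>(b) c\<close>;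
  for elements of \<open>\<Gamma>\<close> this is \<open>\<gamma> \<otimes> 1\<close>.\<close>

lemma bact_t3:
 assumes m: "m <: M" and v: "v <: G" and l: "l <: L"
 shows "bact L N v (%l. f (t3 L M l (pE 1 1) m)) l = f (t3 L M l (pE 1 1) (v .\<^sub>M m))"
proof -
 let ?F = "%l. f (t3 L M l (pE 1 1) m)" and ?L = "tsum VG (%x y. rmul GA y (nu x))"
 have one: "pE 1 1 <: Et" by simp
 note fl = f_t3_lin[OF m]
 define T' where "T' x g y = t3 L M l (pE 1 1 \<star> pE x y) (g .\<^sub>M m)" for x g y
 have t: "trib G (TT L M) T'" unfolding T'_def[abs_def] by (rule ebal_trib[OF M Tab eb[OF l] one m])
 note Q = trib_lift_VG(1)[OF Tab t] and Qp = trib_lift_VG(2)[OF Tab t]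
 have key: "bact L N z ?F l = f (tsum (TT L M) (T' 1) (?L z))" if z: "z <: Et" for z
 proof (rule tensor_ext[OF Ek.tp Nab bact_Hom[OF L N fl l] Hom_comp[OF Hom_comp[OF Lam_Hom Q] fa] _ z])
  show "1 <: B" by simp
  fix b c assume "b <: B" "c <: opp B"
  then have b: "b <: B" and c: "c <: B" by simp_all
  note tc = trib_shift[OF t c]
  let ?W = "%l' r. tsum (TT L M) (%g y. T' l' g (y * c)) (nu r)"
  have Wc: "?W l' r <: TT L M" if "l' <: B" "r <: B" for l' r
   by (rule trib_nu_closed[OF Tab tc that])
  have W2: "tsum (TT L M) (%l' r. ?W (x * l') r) (\<tau> h) <: TT L M" if "x <: B" "h <: H" for x h
   by (rule tau_sum_closed[OF Tab that(2)]) (use that Wc in simp)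
  have "bact L N (pE b c) ?F l = tsum N (%x h. f (tsum (TT L M) (%l' r. ?W (x * l') r) (\<tau> h))) (\<rho> b)"
   unfolding bact_pure[OF L N fl l b c] bact1_def
  proof (rule rho_cong[OF b])
   fix x h assume x: "x <: B" "h <: H"
   have xc: "pE x c <: Et" and hl: "h .\<^sub>L l <: L" using x c l L_smult[OF L] by simp_all
   have "pE x c .\<^sub>N f (t3 L M (h .\<^sub>L l) (pE 1 1) m) = f (t3 L M (h .\<^sub>L l) (pE x c) m)"
    by (rule f_t3[OF hl xc m, symmetric])
   also have "t3 L M (h .\<^sub>L l) (pE x c) m = HS (TT L M) (%x' g y. t3 L M l (pE x c \<star> pE x' y) (g .\<^sub>M m)) h"
    by (rule tbalD(3)[OF tb x(2) l xc m])
   also have "... = HS (TT L M) (%x' g y. T' (x * x') g (y * c)) h"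
    by (rule HS_cong[OF x(2)]) (use x c in "simp add: T'_def pE_mult")
   finally show "pE x c .\<^sub>N f (t3 L M (h .\<^sub>L l) (pE 1 1) m) = f (tsum (TT L M) (%l' r. ?W (x * l') r) (\<tau> h))"
    by (simp only: HS_def)
  qed
  also have "... = f (tsum (TT L M) (%x h. tsum (TT L M) (%l' r. ?W (x * l') r) (\<tau> h)) (\<rho> b))"
   by (rule rho_hom[OF Tab Nab fa b, symmetric]) (simp add: W2)
  also have "... = f (?W 1 b)"
   by (simp only: translation_absorb_apply[OF Tab trib_nu_balanced[OF Tab tc] b])
  also have "?W 1 b = tsum (TT L M) (T' 1) (rmul GA c (nu b))"
  proof -
   have "tsum (TT L M) (T' 1) (rmul GA c (nu b)) = tsum (TT L M) (%g y. tsum (TT L M) (T' 1) (rmul GA c (pVG g y))) (nu b)"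
    by (rule tensor_Hom_lift[OF tpVG Tab Hom_comp[OF rmul_Hom[OF GA_rmod c] Q] nu_closed[OF b]]) simp
   also have "... = ?W 1 b"
    by (rule nu_cong[OF b]) (use c tribD(1)[OF Tab t] in "simp_all add: rmul_pure[OF GA_rmod] Qp")
   finally show ?thesis by simp
  qed
  finally show "bact L N (pE b c) ?F l = f (tsum (TT L M) (T' 1) (?L (pE b c)))"
   using b c by (simp add: Lam_pure)
 qed
 have "bact L N v ?F l = f (T' 1 v 1)"
  using key[of v] v by (simp add: nu_Gamma Qp)
 then show ?thesis by (simp add: T'_def E_one)
qed

text \<open>The converse of \<open>HL_tbal\<close>.\<close>

lemma T_adjoint: "(%m. \<lambda>l\<in>carrier L. f (t3 L M l (pE 1 1) m)) \<in> lhom G M (HL L N)"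
proof (rule linI[OF HomI])
 have one: "pE 1 1 <: Et" by simp
 fix m assume m: "m <: M"
 show "(\<lambda>l\<in>carrier L. f (t3 L M l (pE 1 1) m)) <: HL L N"
  using lin_cong[OF f_t3_lin[OF m] lk_left_module[OF L], of "\<lambda>l\<in>carrier L. f (t3 L M l (pE 1 1) m)"]
  by (simp add: HL_simps)
 { fix m' assume m': "m' <: M"
  show "(\<lambda>l\<in>carrier L. f (t3 L M l (pE 1 1) (m +\<^sub>M m'))) =
    (\<lambda>l\<in>carrier L. f (t3 L M l (pE 1 1) m)) +\<^sub>(HL L N) (\<lambda>l\<in>carrier L. f (t3 L M l (pE 1 1) m'))"
   unfolding HL_simps(3)
   by (rule restrict_ext) (use m m' in "simp add: Hom_add[OF ebalD(1)[OF eb one]] Hom_add[OF fa] t3_closed[OF L M]") }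
 { fix g assume g: "g <: G"
  show "(\<lambda>l\<in>carrier L. f (t3 L M l (pE 1 1) (g .\<^sub>M m))) =
    g .\<^sub>(HL L N) (\<lambda>l\<in>carrier L. f (t3 L M l (pE 1 1) m))"
   unfolding HL_simps(4)
   by (rule restrict_ext) (use m g in "simp add: bact_restrict[OF L N f_t3_lin[OF m]] bact_t3") }
qed

end

end

end

text \<open>Lifting along a surjection \<open>N \<rightarrow> N'\<close> of bimodules becomes lifting a map on \<open>M\<close> along
  \<open>Hom(L, N) \<rightarrow> Hom(L, N')\<close>, which is onto because the surjection splits over the field.\<close>

theorem T_projective_lift:
 fixes N :: "(('b, 'b) tens, 'n, 'v) module_scheme" and N' :: "(('b, 'b) tens, 'n2, 'v2) module_scheme"
  and M :: "(('b, 'b) tens, 'm, 'x) module_scheme"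
 assumes M: "projective_module G M" and N: "lmod E N" and N': "lmod E N'"
  and g: "g \<in> lhom E N N'" and surj: "g ` carrier N = carrier N'" and f: "f \<in> lhom E (TM L M) N'"
 shows "\<exists>h\<in>lhom E (TM L M) N. \<forall>x\<in>carrier (TT L M). g (h x) = f x"
proof -
 have Mm: "lmod G M" using M by (simp add: projective_module_def)
 interpret N: left_module E N by (rule N)
 have one: "pE 1 1 <: Et" by simp
 note gc = lin_closed[OF g]
 note nkN = nk_left_module[OF N] and nkN' = nk_left_module[OF N'] and lkL = lk_left_module[OF L]
 have gk: "g \<in> lhom K (nk N) (nk N')"
  using lin_Hom[OF g] lin_smult[OF g] by (intro linI) (simp_all add: Bm.smult_closed)
 obtain s where s0: "s \<in> lhom K ((nk N')\<lparr>carrier := g ` carrier (nk N)\<rparr>) (nk N)" and gs0: "!!y. y \<in> g ` carrier (nk N) ==> g (s y) = y"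
  by (rule linear_section[OF K_field nkN nkN' gk]) blast
 have s: "s \<in> lhom K (nk N') (nk N)" and gs: "!!y. y <: N' ==> g (s y) = y"
  using s0 gs0 surj by (simp_all add: lmod_hom_def)
 define gg where "gg j = (\<lambda>l\<in>carrier L. g (j l))" for j
 note Nab' = Na[OF L N'] and Nab = Na[OF L N]
 have rl: "(\<lambda>l\<in>carrier L. w l) <: HL L N'" if "w \<in> lhom K (lk L) (nk N')" for w
  using that lin_cong[OF that lkL, of "\<lambda>l\<in>carrier L. w l"] by (simp add: HL_simps)
 have rl': "(\<lambda>l\<in>carrier L. w l) <: HL L N" if "w \<in> lhom K (lk L) (nk N)" for w
  using that lin_cong[OF that lkL, of "\<lambda>l\<in>carrier L. w l"] by (simp add: HL_simps)
 have gg: "gg \<in> lhom G (HL L N) (HL L N')"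
 proof (rule linI[OF HomI])
  fix j assume p: "j <: HL L N"
  note pl = HL_lin[OF N p] and pc = HL_eval_closed[OF N p]
  show "gg j <: HL L N'" unfolding gg_def by (rule rl[OF lin_comp[OF gk pl]])
  { fix w assume q: "w <: HL L N"
   show "gg (j +\<^sub>(HL L N) w) = gg j +\<^sub>(HL L N') gg w"
    unfolding gg_def HL_simps(3)
    by (rule restrict_ext) (simp add: lin_add[OF g] pc HL_eval_closed[OF N q]) }
  { fix k assume k: "k <: G"
   show "gg (k .\<^sub>(HL L N) j) = k .\<^sub>(HL L N') gg j"
    unfolding gg_def HL_simps(4)
   proof (rule restrict_ext)
    fix l assume l: "l <: L"
    note gl = lin_comp[OF gk pl]
    have "g (bact L N z j l) = bact L N' z (%l. g (j l)) l" if z: "z <: Et" for z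
    proof (rule tensor_ext[OF Ek.tp Nab' Hom_comp[OF bact_Hom[OF L N pl l] lin_Hom[OF g]] bact_Hom[OF L N' gl l] _ z])
     fix b c assume "b <: B" "c <: opp B"
     then have b: "b <: B" and c: "c <: B" by simp_all
     show "g (bact L N (pE b c) j l) = bact L N' (pE b c) (%l. g (j l)) l"
      unfolding bact_pure[OF L N pl l b c] bact_pure[OF L N' gl l b c]
      by (rule tensor_ext[OF BH.tp Nab' Hom_comp[OF bact1_Hom[OF L N pl c l] lin_Hom[OF g]] bact1_Hom[OF L N' gl c l] _ rho_closed[OF b]])
        (use c l pc in "simp add: bact1_pure[OF L N pl c l] bact1_pure[OF L N' gl c l] lin_smult[OF g] L_smult[OF L]")
    qed
    then show "g ((\<lambda>l\<in>carrier L. bact L N k j l) l) = bact L N' k (\<lambda>l\<in>carrier L. g (j l)) l"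
     using l k bact_restrict[OF L N' gl l, of k] by simp
   qed }
 qed
 have ggs: "gg ` carrier (HL L N) = carrier (HL L N')"
 proof (rule Set.set_eqI, rule iffI)
  fix w assume "w \<in> gg ` carrier (HL L N)"
  then show "w <: HL L N'" using lin_closed[OF gg] by (elim imageE) simp
 next
  fix w assume p: "w <: HL L N'"
  note pl = HL_lin[OF N' p] and pc = HL_eval_closed[OF N' p]
  have "gg (\<lambda>l\<in>carrier L. s (w l)) = w"
   by (rule extensionalityI[of _ "carrier L"]) (use p pc gs in "simp_all add: gg_def HL_simps(1)")
  then show "w \<in> gg ` carrier (HL L N)" using rl'[OF lin_comp[OF s pl]] by (metis imageI)
 qed
 obtain F where F: "F \<in> lhom G M (HL L N)"
  and gF: "\<forall>m\<in>carrier M. gg (F m) = (\<lambda>l\<in>carrier L. f (t3 L M l (pE 1 1) m))"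
  using projective_lift[OF M left_module_Gamma[OF HL_left_module[OF L N]] left_module_Gamma[OF HL_left_module[OF L N']] gg ggs T_adjoint[OF N' Mm f]]
  by blast
 have gF': "g (F m l) = f (t3 L M l (pE 1 1) m)" if "m <: M" "l <: L" for m l
  using fun_cong[OF bspec[OF gF that(1)], of l] that(2) by (simp add: gg_def)
 have Fc: "F m l <: N" if "m <: M" "l <: L" for m l
  by (rule HL_eval_closed[OF N lin_closed[OF F that(1)] that(2)])
 define h where "h = tlift N (%l z m. z .\<^sub>N F m l)"
 note tbF = HL_tbal[OF N Mm F]
 note ha = tlift_Hom[OF L Mm Nab tbF, folded h_def] and ht = tlift_t3[OF L Mm Nab tbF, folded h_def]
 have hE: "h \<in> lhom E (TM L M) N"
 proof (rule linI)
  show "h \<in> Hom (TM L M) N" using ha by simp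
  fix e u assume e: "e <: E" and u: "u <: TM L M"
  then have e': "e <: Et" and u': "u <: TT L M" by simp_all
  show "h (e .\<^sub>(TM L M) u) = e .\<^sub>N h u"
   by (rule T_ext[OF L Mm Nab Hom_comp[OF TM_smult_Hom[OF L Mm e'] ha] Hom_comp[OF ha N_r_Hom[OF L N e']] _ u'])
     (use e' Fc in "simp add: TM_smult_t3[OF L Mm] ht N_assoc[OF L N]")
 qed
 moreover have "g (h x) = f x" if x: "x <: TT L M" for x
 proof (rule T_ext[OF L Mm Nab' Hom_comp[OF ha lin_Hom[OF g]] _ _ x])
  show "f \<in> Hom (TT L M) N'" using lin_Hom[OF f] by simp
  fix l z m assume l: "l <: L" and z: "z <: Et" and m: "m <: M"
  show "g (h (t3 L M l z m)) = f (t3 L M l z m)"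
   using f_t3[OF N' Mm f l z m] l z m Fc by (simp add: ht lin_smult[OF g] gF')
 qed
 ultimately show ?thesis by blast
qed

end

end

context galois_ext
begin

lemma kV_map_lin:
 assumes M: "lmod (opp A) M" and M': "lmod (opp A) M'" and f: "f \<in> lhom A M M'"
 shows "tmap A M' lB f (%x. x) \<in> lhom K (kV M) (kV M')"
proof (rule linI)
 note a = tmap_Hom[OF tpA[OF M] tpA[OF M'] f lin_id] and p = tmap_pure[OF tpA[OF M] tpA[OF M'] f lin_id]
 show "tmap A M' lB f (%x. x) \<in> Hom (kV M) (kV M')" using a by simp
 fix c u assume c: "c <: K" and u: "u <: kV M"
 show "tmap A M' lB f (%x. x) (c .\<^sub>(kV M) u) = c .\<^sub>(kV M') tmap A M' lB f (%x. x) u"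
  by (rule tensor_ext[OF tpA[OF M] tensor_ab[OF tpA[OF M']] Hom_comp[OF kV_Hom[OF M c] a] Hom_comp[OF a kV_Hom[OF M' c]]])
    (use c u lin_closed[OF f] in "simp_all add: kV_pure[OF M] kV_pure[OF M'] p Bm.smult_closed")
qed

end

context galois_Gamma
begin

section \<open>The left \<open>B\<close>-module \<open>M \<otimes>\<^sub>A B\<close>\<close>

definition rA where "rA M = with_action M (%a m. pE 1 a .\<^sub>M m)"

lemma rA_simps [simp]: "carrier (rA M) = carrier M" "add (rA M) = add M" "0\<^sub>(rA M) = 0\<^sub>M"
 "smult (rA M) = (%a m. pE 1 a .\<^sub>M m)"
 by (simp_all add: rA_def)

abbreviation "VM M \<equiv> V (rA M)"
abbreviation "pVM M \<equiv> pA (rA M)"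

text \<open>\<open>b (m \<otimes> c)\<close> is the image of \<open>m\<close> under \<open>\<nu>(b) \<in> \<Gamma> \<otimes>\<^sub>A B\<close>, times \<open>c\<close>; this is an action because \<open>\<nu>\<close> is
  multiplicative.\<close>

definition Rm where "Rm M m = tmap A (rA M) lB (%\<gamma>. \<gamma> .\<^sub>M m) (%y. y)"
definition vact where "vact M b = tsum (VM M) (%m c. rmul (rA M) c (Rm M m (nu b)))"

context
 fixes M :: "(('b, 'b) tens, 'm, 'x) module_scheme"
 assumes M: "lmod G M"
begin

interpretation M: left_module G M by (rule M)

lemma M_smult [simp]: "[|g <: G; m <: M|] ==> g .\<^sub>M m <: M" by (rule M.smult_closed)

lemma M_assoc: "[|g <: G; g' <: G; m <: M|] ==> g .\<^sub>M (g' .\<^sub>M m) = (g \<star> g') .\<^sub>M m"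
 using M.smult_assoc1[of g g' m] by simp

lemma rA_rmod: "lmod (opp A) (rA M)"
proof (intro left_module.intro left_module_axioms.intro opp_ring A_ring)
 show "abgrp (rA M)" using M.M.abelian_group_axioms by (simp add: rA_def)
 fix a b x assume "a <: opp A" "b <: opp A" "x <: rA M"
 then show "(a +\<^sub>(opp A) b) .\<^sub>(rA M) x = a .\<^sub>(rA M) x +\<^sub>(rA M) b .\<^sub>(rA M) x"
  using M.smult_l_distr[of "pE 1 a" "pE 1 b" x] by (simp add: pE_add_r)
next
 fix x assume "x <: rA M"
 then show "1\<^sub>(opp A) .\<^sub>(rA M) x = x" using M.smult_one[of x] by simp
qed (simp_all add: M.smult_r_distr M_assoc pE_mult)

lemmas tpVM = tpA[OF rA_rmod]
lemmas VMa = tensor_ab[OF tpVM]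
lemmas kVMm = kV_left_module[OF rA_rmod]

lemma pVM_closed [simp]: "[|m <: M; c <: B|] ==> pVM M m c <: VM M"
 by (rule pure_closed[OF tpVM]) simp_all

lemma Rm_lmod: "m <: M ==> (%g. g .\<^sub>M m) \<in> lhom A GA (rA M)"
 using M.smult_l_distr by (auto simp: lmod_hom_def M_assoc)

lemma Rm_Hom: "m <: M ==> Rm M m \<in> Hom VG (VM M)"
 unfolding Rm_def by (rule tmap_Hom[OF tpVG tpVM Rm_lmod lin_id])

lemma Rm_closed: "[|m <: M; u <: VG|] ==> Rm M m u <: VM M"
 by (rule Hom_closed[OF Rm_Hom])

lemma Rm_pure: "[|m <: M; g <: G; y <: B|] ==> Rm M m (pVG g y) = pVM M (g .\<^sub>M m) y"
 unfolding Rm_def using tmap_pure[OF tpVG tpVM Rm_lmod lin_id] by simp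

lemma Rm_lin: "m <: M ==> Rm M m \<in> lhom K (kV GA) (kV (rA M))"
 unfolding Rm_def by (rule kV_map_lin[OF GA_rmod rA_rmod Rm_lmod])

lemma Rm_param: "u <: VG ==> (%m. Rm M m u) \<in> Hom M (VM M)"
 unfolding Rm_def tensor_map_def
proof (rule lift_Hom_param[OF tpVG VMa])
 fix v y assume g: "v <: GA" "y <: lB"
 then show "(%m. pVM M (v .\<^sub>M m) y) \<in> Hom M (VM M)"
  using pure_add_l[OF tpVM, simplified] by (intro HomI) (simp_all add: M.smult_r_distr)
qed

lemma Rm_rmul:
 assumes m: "m <: M" and c: "c <: B" and u: "u <: VG"
 shows "rmul (rA M) c (Rm M m u) = Rm M m (rmul GA c u)"
 by (rule tensor_ext[OF tpVG VMa Hom_comp[OF Rm_Hom[OF m] rmul_Hom[OF rA_rmod c]] Hom_comp[OF rmul_Hom[OF GA_rmod c] Rm_Hom[OF m]] _ u])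
   (use m c in "simp add: Rm_pure rmul_pure[OF rA_rmod] rmul_pure[OF GA_rmod]")

lemma Rm_nu_lift:
 assumes m: "m <: M" and u: "u <: VG" and c: "c <: B"
 shows "rmul (rA M) c (Rm M m u) = tsum (VM M) (%g y. pVM M (g .\<^sub>M m) (y * c)) u"
 by (subst lift_id[OF tpVG u, symmetric], rule lift_map[OF tpVG VGa VMa Hom_comp[OF Rm_Hom[OF m] rmul_Hom[OF rA_rmod c]] u])
  (use m c in "simp_all add: Rm_pure rmul_pure[OF rA_rmod]")

lemma Rm_act_A:
 assumes m: "m <: M" and a: "a <: A" and b: "b <: B"
 shows "Rm M (pE 1 a .\<^sub>M m) (nu b) = rmul (rA M) a (Rm M m (nu b))"
proof -
 have m': "pE 1 a .\<^sub>M m <: M" using m a by simp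
 have "Rm M (pE 1 a .\<^sub>M m) (nu b) = tsum (VM M) (%g y. pVM M ((g \<star> pE 1 a) .\<^sub>M m) y) (nu b)"
  by (subst lift_id[OF tpVG nu_closed[OF b], symmetric], rule nu_map[OF VGa VMa Rm_Hom[OF m'] b])
   (use m a m' in "simp_all add: Rm_pure M_assoc")
 also have "... = Rm M m (tsum VG (%g y. pVG (g \<star> pE 1 a) y) (nu b))"
  by (rule nu_map[OF VGa VMa Rm_Hom[OF m] b, symmetric]) (use m a in "simp_all add: Rm_pure M_assoc")
 also have "... = rmul (rA M) a (Rm M m (nu b))"
  using m a b by (simp add: nu_right_A Rm_rmul)
 finally show ?thesis .
qed

lemma vact_balanced:
 assumes b: "b <: B"
 shows "balanced A (rA M) lB (VM M) (%m c. rmul (rA M) c (Rm M m (nu b)))"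
proof (rule balancedI)
 note nb = nu_closed[OF b]
 fix m c assume "m <: rA M" "c <: lB"
 then have m: "m <: M" and c: "c <: B" by simp_all
 show "rmul (rA M) c (Rm M m (nu b)) <: VM M" by (rule rmul_closed[OF rA_rmod c Rm_closed[OF m nb]])
 { fix m' assume m': "m' <: rA M"
  have "(%m. rmul (rA M) c (Rm M m (nu b))) \<in> Hom M (VM M)" by (rule Hom_comp[OF Rm_param[OF nb] rmul_Hom[OF rA_rmod c]])
  from Hom_add[OF this m, of m'] m'
  show "rmul (rA M) c (Rm M (m +\<^sub>(rA M) m') (nu b)) = rmul (rA M) c (Rm M m (nu b)) +\<^sub>(VM M) rmul (rA M) c (Rm M m' (nu b))" by simp }
 { fix c' assume c': "c' <: lB"
  have "(%c. rmul (rA M) c (Rm M m (nu b))) \<in> Hom B (VM M)"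
   using lin_Hom[OF rmul_param_lin[OF rA_rmod Rm_closed[OF m nb]]] by simp
  from Hom_add[OF this c, of c'] c'
  show "rmul (rA M) (c +\<^sub>lB c') (Rm M m (nu b)) = rmul (rA M) c (Rm M m (nu b)) +\<^sub>(VM M) rmul (rA M) c' (Rm M m (nu b))" by simp }
 { fix a assume a: "a <: A"
  show "rmul (rA M) c (Rm M (a .\<^sub>(rA M) m) (nu b)) = rmul (rA M) (a .\<^sub>lB c) (Rm M m (nu b))"
   using a m c b by (simp add: Rm_act_A rmul_comp[OF rA_rmod] Rm_closed) }
qed

lemma vact_Hom: "b <: B ==> vact M b \<in> Hom (VM M) (VM M)"
 unfolding vact_def by (rule lift_Hom[OF tpVM VMa vact_balanced])

lemma vact_closed [simp]: "[|b <: B; w <: VM M|] ==> vact M b w <: VM M"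
 by (rule Hom_closed[OF vact_Hom])

lemma vact_pure: "[|b <: B; m <: M; c <: B|] ==> vact M b (pVM M m c) = rmul (rA M) c (Rm M m (nu b))"
 unfolding vact_def using lift_pure[OF tpVM VMa vact_balanced] by simp

lemma vact_lin:
 assumes b: "b <: B"
 shows "vact M b \<in> lhom K (kV (rA M)) (kV (rA M))"
proof -
 have "tsum (kV (rA M)) (%m c. rmul (rA M) c (Rm M m (nu b))) \<in> lhom K (kV (rA M)) (kV (rA M))"
  by (rule kV_lift_lin[OF rA_rmod kVMm])
    (use b vact_balanced in "simp_all add: rmul_param_lin[OF rA_rmod Rm_closed] balanced_def")
 then show ?thesis by (simp add: vact_def)
qed

lemma vact_param_lin:
 assumes w: "w <: VM M"
 shows "(%b. vact M b w) \<in> lhom K B (kV (rA M))"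
proof -
 have "(%b. tsum (kV (rA M)) (%m c. rmul (rA M) c (Rm M m (nu b))) w) \<in> lhom K B (kV (rA M))"
  by (rule lin_lift_param[OF tpVM kVMm w], rule lin_comp[OF rmul_lin[OF rA_rmod] lin_comp[OF Rm_lin nu_lin]]) simp_all
 then show ?thesis by (simp add: vact_def)
qed

lemma vact_rmul:
 assumes b: "b <: B" and c: "c <: B" and w: "w <: VM M"
 shows "vact M b (rmul (rA M) c w) = rmul (rA M) c (vact M b w)"
 by (rule tensor_ext[OF tpVM VMa Hom_comp[OF rmul_Hom[OF rA_rmod c] vact_Hom[OF b]] Hom_comp[OF vact_Hom[OF b] rmul_Hom[OF rA_rmod c]] _ w])
   (use b c in "simp add: rmul_pure[OF rA_rmod] vact_pure rmul_comp[OF rA_rmod] Rm_closed")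

lemma vact_mult:
 assumes b: "b <: B" and b': "b' <: B" and w: "w <: VM M"
 shows "vact M (b * b') w = vact M b (vact M b' w)"
proof (rule tensor_ext[OF tpVM VMa vact_Hom Hom_comp[OF vact_Hom[OF b'] vact_Hom[OF b]] _ w])
 show "b * b' <: B" using b b' by simp
 fix m c assume "m <: rA M" "c <: lB"
 then have m: "m <: M" and c: "c <: B" by simp_all
 have inner: "tsum VG (%v y. pVG (v \<star> v') (y * y')) (nu b) <: VG" if "v' <: G" "y' <: B" for v' y'
  by (rule nu_sum_closed[OF VGa b]) (use that in simp)
 have "Rm M m (nu (b * b')) = tsum (VM M) (%v' y'. Rm M m (tsum VG (%v y. pVG (v \<star> v') (y * y')) (nu b))) (nu b')"
  unfolding nu_mult[OF b b'] by (rule nu_hom[OF VGa VMa Rm_Hom[OF m] b']) (simp add: inner)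
 also have "... = tsum (VM M) (%v' y'. vact M b (Rm M m (pVG v' y'))) (nu b')"
 proof (rule nu_cong[OF b'])
  fix v' y' assume "v' <: G" "y' <: B"
  then have g: "v' <: G" and y': "y' <: B" by simp_all
  have "Rm M m (tsum VG (%v y. pVG (v \<star> v') (y * y')) (nu b)) = tsum (VM M) (%v y. pVM M (v .\<^sub>M (v' .\<^sub>M m)) (y * y')) (nu b)" (is "?a = _")
   by (rule nu_map[OF VGa VMa Rm_Hom[OF m] b]) (use g y' m in "simp_all add: Rm_pure M_assoc")
  also have "... = vact M b (Rm M m (pVG v' y'))"
   using Rm_nu_lift[OF _ nu_closed[OF b] y', of "v' .\<^sub>M m"] g y' m b by (simp add: Rm_pure vact_pure)
  finally show "?a = ..." .
 qed
 also have "... = vact M b (Rm M m (nu b'))"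
  by (rule tensor_Hom_lift[OF tpVG VMa Hom_comp[OF Rm_Hom[OF m] vact_Hom[OF b]] nu_closed[OF b'], symmetric])
 finally have e: "Rm M m (nu (b * b')) = vact M b (Rm M m (nu b'))" .
 show "vact M (b * b') (pVM M m c) = vact M b (vact M b' (pVM M m c))"
  using b b' m c by (simp add: vact_pure e vact_rmul Rm_closed)
qed

lemma vact_A: "[|a <: A; m <: M; c <: B|] ==> vact M a (pVM M m c) = pVM M (pE a 1 .\<^sub>M m) c"
 by (simp add: vact_pure nu_A Rm_pure rmul_pure[OF rA_rmod])

lemma vact_one: "w <: VM M ==> vact M 1 w = w"
 by (rule tensor_ext[OF tpVM VMa vact_Hom Hom_id]) (use M.smult_one in "simp_all add: vact_A")

end

section \<open>An isomorphism with \<open>L \<otimes> (M \<otimes>\<^sub>A B)\<close>\<close>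

abbreviation "LV L M \<equiv> tensor K (lk L) (kV (rA M))"
abbreviation "pLV L M \<equiv> pt K (lk L) (kV (rA M))"

text \<open>\<open>l \<otimes> (b \<otimes> b'\<^sup>o\<^sup>p) \<otimes> m \<mapsto> \<Sum> l S\<^sup>-\<^sup>1(b\<^sub>(\<^sub>1\<^sub>)) \<otimes> b\<^sub>(\<^sub>0\<^sub>) (m \<otimes> b')\<close> and \<open>l \<otimes> (m \<otimes> c) \<mapsto> l \<otimes> (1 \<otimes> c\<^sup>o\<^sup>p) \<otimes> m\<close> are inverse to
  each other.\<close>

definition psi0 where "psi0 L M l w = tsum (LV L M) (%x g. pLV L M (S' g .\<^sub>L l) (vact M x w))"
definition psi where "psi L M l z m = tsum (LV L M) (%b b'. psi0 L M l (pVM M m b') (\<rho> b)) z"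
definition phi where "phi L M l = tsum (TT L M) (%m c. t3 L M l (pE 1 c) m)"

context
 fixes L :: "('h, 'l, 'y) module_scheme" and M :: "(('b, 'b) tens, 'm, 'x) module_scheme"
 assumes L: "lmod (opp H) L" and M: "lmod G M"
begin

interpretation M: left_module G M by (rule M)

interpretation LV: kmods K "lk L" "kV (rA M)"
 by (intro kmods.intro kmods_axioms.intro K_cring lk_left_module[OF L] kVMm[OF M])

lemmas LVa = tensor_ab[OF LV.tp]
lemmas LVm = LV.alg_left_module

lemma pLV_closed: "[|l <: L; w <: VM M|] ==> pLV L M l w <: LV L M"
 by (rule pure_closed[OF LV.tp]) simp_all

abbreviation "LVk \<equiv> alg_tensor K (lk L) (kV (rA M))"

lemma S'_act_lin:
 assumes f: "f \<in> lhom K Z H" and l: "l <: L"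
 shows "(%g. S' (f g) .\<^sub>L l) \<in> lhom K Z (lk L)"
 by (rule lin_comp[OF lin_L_act[OF L l] lin_comp[OF S'_lin f]])

lemma psi0_bilin:
 assumes l: "l <: L" and w: "w <: VM M"
 shows "bilin K B H LVk (%x g. pLV L M (S' g .\<^sub>L l) (vact M x w))"
 by (rule bilinI)
   (use l w in "auto intro!: LV.lin_pure_l LV.lin_pure_r S'_act_lin[OF lin_id] vact_param_lin[OF M] simp: vact_closed[OF M] L_smult[OF L]")

lemma psi0_Hom: "[|l <: L; w <: VM M|] ==> psi0 L M l w \<in> Hom BHt (LV L M)"
 using BH.lin_lift[OF LVm psi0_bilin, THEN lin_Hom] by (simp add: psi0_def)

lemma psi0_pure: "[|l <: L; w <: VM M; x <: B; g <: H|] ==>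
  psi0 L M l w (pBH x g) = pLV L M (S' g .\<^sub>L l) (vact M x w)"
 using BH.lift_bilin_pure[OF LVm psi0_bilin] by (simp add: psi0_def)

text \<open>\<open>S\<^sup>-\<^sup>1\<close> is anti-multiplicative next to a tensor factor that is a \<open>B\<close>-module.\<close>

lemma pLV_antipode:
 assumes "l <: L" "w <: VM M" "x <: B" "g <: H" "h <: H"
 shows "pLV L M (S' (g *\<^sub>H S h) .\<^sub>L l) (vact M x w) = pLV L M (S' g .\<^sub>L (h .\<^sub>L l)) (vact M x w)"
proof -
 have b: "bilin K B H LVk (%x k. pLV L M (k .\<^sub>L l) (vact M x w))"
  by (rule bilinI)
   (use assms in "auto intro!: LV.lin_pure_l LV.lin_pure_r lin_L_act[OF L] vact_param_lin[OF M] simp: vact_closed[OF M] L_smult[OF L]")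
 show ?thesis
  using arg_cong[OF S'_mult_pure[of x g "S h"], of "tsum LVk (%x k. pLV L M (k .\<^sub>L l) (vact M x w))"] assms
  by (simp add: BH.lift_bilin_pure[OF LVm b] L_assoc[OF L] del: tens_lift_alg_tensor)
qed

lemma psi0_lin_w:
 assumes l: "l <: L" and u: "u <: BHt"
 shows "(%w. psi0 L M l w u) \<in> lhom K (kV (rA M)) LVk"
proof -
 have "(%w. tsum LVk (%x g. pLV L M (S' g .\<^sub>L l) (vact M x w)) u) \<in> lhom K (kV (rA M)) LVk"
  by (rule lin_lift_param[OF BH.tp LVm u], rule LV.lin_pure_r) (use l in "simp_all add: vact_lin[OF M] L_smult[OF L]")
 then show ?thesis by (simp add: psi0_def)
qed

lemma psi0_param_l:
 assumes w: "w <: VM M" and u: "u <: BHt"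
 shows "(%l. psi0 L M l w u) \<in> Hom L (LV L M)"
proof -
 have "(%l. tsum LVk (%x g. pLV L M (S' g .\<^sub>L l) (vact M x w)) u) \<in> lhom K (lk L) LVk"
  by (rule lin_lift_param[OF BH.tp LVm u], rule LV.lin_pure_l) (use w in "simp_all add: lin_L_act2[OF L] vact_closed[OF M]")
 from lin_Hom[OF this] show ?thesis by (simp add: psi0_def)
qed

lemma psi_bilin:
 assumes l: "l <: L" and m: "m <: M"
 shows "bilin K B (opp B) LVk (%b b'. psi0 L M l (pVM M m b') (\<rho> b))"
proof (rule bilinI)
 fix b assume b: "b <: B"
 have "(%b'. psi0 L M l (pVM M m b') (\<rho> b)) \<in> lhom K B LVk"
  by (rule lin_comp[OF psi0_lin_w[OF l rho_closed[OF b]] lin_pA_r[OF rA_rmod[OF M] lin_id]]) (use m in simp)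
 then show "(%b'. psi0 L M l (pVM M m b') (\<rho> b)) \<in> lhom K (opp B) LVk" by (simp add: lin_opp2)
next
 fix b' assume "b' <: opp B"
 then have w: "pVM M m b' <: VM M" using m by (simp add: pVM_closed[OF M])
 show "(%b. psi0 L M l (pVM M m b') (\<rho> b)) \<in> lhom K B LVk"
  using BH.lin_lift_arg[OF LVm psi0_bilin[OF l w] rho.\<delta>_lin] by (simp add: psi0_def)
qed

lemma psi_Hom: "[|l <: L; m <: M|] ==> (%z. psi L M l z m) \<in> Hom Et (LV L M)"
 using Ek.lin_lift[OF LVm psi_bilin, THEN lin_Hom] by (simp add: psi_def)

lemma psi_pure: "[|l <: L; m <: M; b <: B; b' <: B|] ==>
  psi L M l (pE b b') m = psi0 L M l (pVM M m b') (\<rho> b)"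
 using Ek.lift_bilin_pure[OF LVm psi_bilin] by (simp add: psi_def)

lemma psi_ebal:
 assumes l: "l <: L"
 shows "ebal M (LV L M) (psi L M l)"
proof (rule ebalI)
 fix z assume z: "z <: Et"
 show "(%m. psi L M l z m) \<in> Hom M (LV L M)"
  unfolding psi_def
 proof (rule lift_Hom_param[OF Ek.tp LVa z])
  fix b b' assume b: "b <: B" "b' <: opp B"
  have p: "(%m. pVM M m b') \<in> Hom M (VM M)"
   using pure_add_l[OF tpVM[OF M], simplified] b by (intro HomI) (simp_all add: pVM_closed[OF M])
  show "(%m. psi0 L M l (pVM M m b') (\<rho> b)) \<in> Hom M (LV L M)"
   using Hom_comp[OF p lin_Hom[OF psi0_lin_w[OF l rho_closed[OF b(1)]], simplified]] .
 qed
next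
 fix m assume m: "m <: M"
 show "(%z. psi L M l z m) \<in> Hom Et (LV L M)" by (rule psi_Hom[OF l m])
next
 fix a a' z m assume a: "a <: A" "a' <: A" and z: "z <: Et" and m: "m <: M"
 have aa: "pE a a' <: Et" and am: "pE a a' .\<^sub>M m <: M" using a m by (simp_all add: M_smult[OF M])
 show "psi L M l (z \<star> pE a a') m = psi L M l z (pE a a' .\<^sub>M m)"
 proof (rule tensor_ext[OF Ek.tp LVa Hom_comp[OF E_mult_Hom(2)[OF aa] psi_Hom[OF l m]] psi_Hom[OF l am] _ z])
  fix b b' assume "b <: B" "b' <: opp B"
  then have b: "b <: B" and b': "b' <: B" by simp_all
  have w: "pVM M m (a' * b') <: VM M" and w2: "pVM M (pE a a' .\<^sub>M m) b' <: VM M"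
   using a b' m am by (simp_all add: pVM_closed[OF M])
  have va: "vact M a (pVM M m (a' * b')) = pVM M (pE a a' .\<^sub>M m) b'"
   using pure_move[OF tpVM[OF M], of a' "pE a 1 .\<^sub>M m" b'] a m b'
   by (simp add: vact_A[OF M] M_assoc[OF M] M_smult[OF M] pE_mult)
  have mu': "(%u. u \<bullet> pBH a 1\<^sub>H) \<in> Hom BHt BHt"
   using BH.mult_lin_l[THEN lin_Hom] a by simp
  have "psi0 L M l (pVM M m (a' * b')) (\<rho> b \<bullet> pBH a 1\<^sub>H) = psi0 L M l (pVM M (pE a a' .\<^sub>M m) b') (\<rho> b)"
   by (rule tensor_ext[OF BH.tp LVa Hom_comp[OF mu' psi0_Hom[OF l w]] psi0_Hom[OF l w2] _ rho_closed[OF b]])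
     (use a l w w2 in "simp add: BH.mult_pure psi0_pure vact_mult[OF M] va")
  then show "psi L M l (pE b b' \<star> pE a a') m = psi L M l (pE b b') (pE a a' .\<^sub>M m)"
   using a b b' l m am by (simp add: pE_mult psi_pure rho_mult rho_A)
 qed
qed

text \<open>For the balancing over \<open>H\<close>, the translation element of \<open>h\<close> enters as
  \<open>\<Sum> \<rho>(l(h)) (r(h) \<otimes> 1) = 1 \<otimes> S(h)\<close>, and \<open>S\<^sup>-\<^sup>1(b\<^sub>(\<^sub>1\<^sub>) S(h)) = h S\<^sup>-\<^sup>1(b\<^sub>(\<^sub>1\<^sub>))\<close>.\<close>

lemma psi_tbal: "tbal L M (LV L M) (psi L M)"
proof (rule tbalI)
 fix l assume "l <: L" then show "ebal M (LV L M) (psi L M l)" by (rule psi_ebal)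
next
 fix z m assume z: "z <: Et" and m: "m <: M"
 show "(%l. psi L M l z m) \<in> Hom L (LV L M)"
  unfolding psi_def
  by (rule lift_Hom_param[OF Ek.tp LVa z]) (use m in "simp add: psi0_param_l pVM_closed[OF M]")
next
 fix h l z m assume h: "h <: H" and l: "l <: L" and z: "z <: Et" and m: "m <: M"
 have hl: "h .\<^sub>L l <: L" using h l by (simp add: L_smult[OF L])
 note eb = ebal_HS[OF M LVa psi_ebal[OF l] h]
 show "psi L M (h .\<^sub>L l) z m = HS (LV L M) (%x k y. psi L M l (z \<star> pE x y) (k .\<^sub>M m)) h"
 proof (rule tensor_ext[OF Ek.tp LVa psi_Hom[OF hl m] ebalD(2)[OF eb m] _ z])
  fix b b' assume "b <: B" "b' <: opp B"
  then have b: "b <: B" and b': "b' <: B" by simp_all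
  then have bb: "pE b b' <: Et" by simp
  let ?w = "pVM M m b'"
  have w: "?w <: VM M" using m b' by (simp add: pVM_closed[OF M])
  note t = ebal_trib[OF M LVa psi_ebal[OF l] bb m] and F = psi0_Hom[OF l w]
  have ml: "(%u. \<rho> b \<bullet> u) \<in> Hom BHt BHt" using BH.mult_lin_r[THEN lin_Hom] b by simp
  have mr: "(%u. u \<bullet> v) \<in> Hom BHt BHt" if "v <: BHt" for v using BH.mult_lin_l[THEN lin_Hom] that by simp
  have vr: "psi0 L M l (vact M r ?w) u = psi0 L M l ?w (u \<bullet> pBH r 1\<^sub>H)" if r: "r <: B" and u: "u <: BHt" for r u
   by (rule tensor_ext[OF BH.tp LVa psi0_Hom[OF l] Hom_comp[OF mr F] _ u])
     (use r l w in "simp_all add: BH.mult_pure psi0_pure vact_mult[OF M] vact_closed[OF M]")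
  have "HS (LV L M) (%x k y. psi L M l (pE b b' \<star> pE x y) (k .\<^sub>M m)) h =
    tsum (LV L M) (%x r. psi0 L M l ?w (\<rho> b \<bullet> (\<rho> x \<bullet> pBH r 1\<^sub>H))) (\<tau> h)"
   unfolding HS_def
  proof (rule tau_cong[OF h])
   fix x r assume x: "x <: B" and r: "r <: B"
   have bx': "b * x <: B" using b x by simp
   have wa: "(%w. psi0 L M l w (\<rho> (b * x))) \<in> Hom (VM M) (LV L M)"
    using lin_Hom[OF psi0_lin_w[OF l rho_closed[OF bx']]] by simp
   have "tsum (LV L M) (%k y. psi L M l (pE b b' \<star> pE x y) (k .\<^sub>M m)) (nu r) =
     psi0 L M l (tsum (VM M) (%k y. pVM M (k .\<^sub>M m) (y * b')) (nu r)) (\<rho> (b * x))" (is "?a = _")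
    by (rule nu_map[OF VMa[OF M] LVa wa r, symmetric]) (use b b' x m l in "simp_all add: pVM_closed[OF M] pE_mult psi_pure M_smult[OF M]")
   also have "... = psi0 L M l ?w (\<rho> b \<bullet> (\<rho> x \<bullet> pBH r 1\<^sub>H))"
    using Rm_nu_lift[OF M m nu_closed[OF r] b'] m r b b' x by (simp add: vr[symmetric] vact_pure[OF M] rho_mult flip: BH_assoc)
   finally show "?a = ..." .
  qed
  also have "... = psi0 L M l ?w (\<rho> b \<bullet> pBH 1 (S h))"
   unfolding translation_coact_left[OF h, symmetric]
   by (rule tau_hom[OF BHa LVa Hom_comp[OF ml F] h, symmetric]) simp_all
  also have "... = tsum (LV L M) (%x g. psi0 L M l ?w (pBH x g \<bullet> pBH 1 (S h))) (\<rho> b)"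
   by (rule tensor_Hom_lift[OF BH.tp LVa Hom_comp[OF mr F] rho_closed[OF b]]) (use h in simp)
  also have "... = psi0 L M (h .\<^sub>L l) ?w (\<rho> b)"
   unfolding psi0_def[of L M "h .\<^sub>L l"]
   by (rule rho_cong[OF b])
     (use h l w in "simp add: BH.mult_pure psi0_pure pLV_antipode vact_closed[OF M] L_smult[OF L]")
  finally show "psi L M (h .\<^sub>L l) (pE b b') m = HS (LV L M) (%x k y. psi L M l (pE b b' \<star> pE x y) (k .\<^sub>M m)) h"
   using hl m b b' by (simp add: psi_pure)
 qed
qed

end

end

context galois_Gamma
begin

definition PhiL where "PhiL L M = tsum (TT L M) (phi L M)"
definition PsiL where "PsiL L M = tlift (LV L M) (psi L M)"

context
 fixes L :: "('h, 'l, 'y) module_scheme" and M :: "(('b, 'b) tens, 'm, 'x) module_scheme"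
 assumes L: "lmod (opp H) L" and M: "lmod G M"
begin

interpretation M: left_module G M by (rule M)
interpretation LV: kmods K "lk L" "kV (rA M)"
 by (intro kmods.intro kmods_axioms.intro K_cring lk_left_module[OF L] kVMm[OF M])

lemmas Tab2 = TTa[OF L M] and tb2 = t3_tbal[OF L M] and VMab = VMa[OF M]
lemmas eb2 = tbalD(1)[OF t3_tbal[OF L M]]
lemmas LVab = LVa[OF L M]

lemma phi_balanced:
 assumes l: "l <: L"
 shows "balanced A (rA M) lB (TT L M) (%m c. t3 L M l (pE 1 c) m)"
proof (rule balancedI)
 have pEr: "(%c. pE 1 c) \<in> Hom B Et" by (auto intro!: HomI simp: pE_add_r)
 fix m c assume "m <: rA M" "c <: lB"
 then have m: "m <: M" and c: "c <: B" by simp_all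
 show "t3 L M l (pE 1 c) m <: TT L M" using l m c by (simp add: t3_closed[OF L M])
 { fix m' assume "m' <: rA M"
  then show "t3 L M l (pE 1 c) (m +\<^sub>(rA M) m') = t3 L M l (pE 1 c) m +\<^sub>(TT L M) t3 L M l (pE 1 c) m'"
   using m c by (simp add: Hom_add[OF ebalD(1)[OF eb2[OF l]]]) }
 { fix c' assume "c' <: lB"
  then show "t3 L M l (pE 1 (c +\<^sub>lB c')) m = t3 L M l (pE 1 c) m +\<^sub>(TT L M) t3 L M l (pE 1 c') m"
   using m c by (simp add: pE_add_r Hom_add[OF ebalD(2)[OF eb2[OF l]]]) }
 { fix a assume a: "a <: A"
  then show "t3 L M l (pE 1 c) (a .\<^sub>(rA M) m) = t3 L M l (pE 1 (a .\<^sub>lB c)) m"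
   using ebalD(3)[OF eb2[OF l] one_A a, of "pE 1 c" m] m c by (simp add: pE_mult) }
qed

lemma phi_Hom: "l <: L ==> phi L M l \<in> Hom (VM M) (TT L M)"
 unfolding phi_def by (rule lift_Hom[OF tpVM[OF M] Tab2 phi_balanced])

lemma phi_pure: "[|l <: L; m <: M; c <: B|] ==> phi L M l (pVM M m c) = t3 L M l (pE 1 c) m"
 unfolding phi_def using lift_pure[OF tpVM[OF M] Tab2 phi_balanced] by simp

lemma phi_closed: "[|l <: L; w <: VM M|] ==> phi L M l w <: TT L M"
 by (rule Hom_closed[OF phi_Hom])

lemma phi_param: "w <: VM M ==> (%l. phi L M l w) \<in> Hom L (TT L M)"
 unfolding phi_def by (rule lift_Hom_param[OF tpVM[OF M] Tab2]) (simp_all add: tbalD(2)[OF tb2])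

lemma phi_scalar:
 assumes c: "c <: K" and l: "l <: L" and w: "w <: VM M"
 shows "phi L M (c .\<^sub>(lk L) l) w = phi L M l (c .\<^sub>(kV (rA M)) w)"
proof (rule tensor_ext[OF tpVM[OF M] Tab2 phi_Hom Hom_comp[OF kV_Hom[OF rA_rmod[OF M] c] phi_Hom[OF l]] _ w])
 show cl: "c .\<^sub>(lk L) l <: L" using c l by (simp add: L_smult[OF L] Hm.smult_closed)
 fix m b assume "m <: rA M" "b <: lB"
 then have m: "m <: M" and b: "b <: B" by simp_all
 have e: "pE 1 b \<star> pE (c \<odot> 1) 1 = pE 1 (c \<odot> b)"
  using pure_move[OF Ek.tp c, of "1" b] b c by (simp add: pE_mult Bm.smult_closed)
 show "phi L M (c .\<^sub>(lk L) l) (pVM M m b) = phi L M l (c .\<^sub>(kV (rA M)) pVM M m b)"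
  unfolding phi_pure[OF cl m b] using m b c l t3_scalar[OF L M c l _ m, of "pE 1 b"]
  by (simp add: e kV_pure[OF rA_rmod[OF M]] phi_pure Bm.smult_closed)
qed

lemma phi_LV_balanced: "balanced K (lk L) (kV (rA M)) (TT L M) (phi L M)"
 by (rule balancedI)
   (simp_all add: phi_closed Hom_add[OF phi_Hom] Hom_add[OF phi_param] phi_scalar[simplified])

lemma PhiL_Hom: "PhiL L M \<in> Hom (LV L M) (TT L M)"
 unfolding PhiL_def by (rule lift_Hom[OF LV.tp Tab2 phi_LV_balanced])

lemma PhiL_pure: "[|l <: L; w <: VM M|] ==> PhiL L M (pLV L M l w) = phi L M l w"
 unfolding PhiL_def using lift_pure[OF LV.tp Tab2 phi_LV_balanced] by simp

lemmas PsiL_Hom = tlift_Hom[OF L M LVab psi_tbal[OF L M], folded PsiL_def]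
lemmas PsiL_t3 = tlift_t3[OF L M LVab psi_tbal[OF L M], folded PsiL_def]

lemma PsiL_phi:
 assumes l: "l <: L" and w: "w <: VM M"
 shows "PsiL L M (phi L M l w) = pLV L M l w"
proof (rule tensor_ext[OF tpVM[OF M] LVab Hom_comp[OF phi_Hom[OF l] PsiL_Hom] _ _ w])
 show "pLV L M l \<in> Hom (VM M) (LV L M)"
  using lin_Hom[OF LV.lin_pure_r[OF lin_id, of l]] l by simp
 fix m c assume "m <: rA M" "c <: lB"
 then have m: "m <: M" and c: "c <: B" by simp_all
 show "PsiL L M (phi L M l (pVM M m c)) = pLV L M l (pVM M m c)"
  using l m c by (simp add: phi_pure PsiL_t3 psi_pure[OF L M] rho_one psi0_pure[OF L M] pVM_closed[OF M] S'_one L_one[OF L] vact_one[OF M])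
qed

lemma translation_antipode_inv_apply:
 assumes P: "abgrp P" and f: "balanced A rB lB P f" and b: "b <: B"
 shows "tsum P (%x h. tsum P (%l r. f l (r * x)) (\<tau> (S' h))) (\<rho> b) = f b 1"
proof -
 note F = lift_Hom[OF tpBAB P f] and Fp = lift_pure[OF tpBAB P f]
 have "tsum P f (rm (\<tau> (S' h)) x) = tsum P (%l r. f l (r * x)) (\<tau> (S' h))" if "x <: B" "h <: H" for x h
  by (rule tau_map[OF BABa P F]) (use that in "simp_all add: Fp")
 then have "tsum P f (tsum BAB (%x h. rm (\<tau> (S' h)) x) (\<rho> b)) = tsum P (%x h. tsum P (%l r. f l (r * x)) (\<tau> (S' h))) (\<rho> b)"
  by (intro rho_map[OF BABa P F b]) (simp_all add: BAB_rmul_closed)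
 then show ?thesis using b by (simp add: translation_antipode_inv Fp)
qed

text \<open>Moving \<open>S\<^sup>-\<^sup>1(b\<^sub>(\<^sub>1\<^sub>))\<close> back across \<open>\<otimes>\<^sub>H\<close> produces its translation element next to the action of \<open>b\<^sub>(\<^sub>0\<^sub>)\<close>, and
  \<open>\<Sum> l(S\<^sup>-\<^sup>1(b\<^sub>(\<^sub>1\<^sub>))) \<otimes> r(S\<^sup>-\<^sup>1(b\<^sub>(\<^sub>1\<^sub>))) b\<^sub>(\<^sub>0\<^sub>) = b \<otimes> 1\<close>.\<close>

lemma PhiL_psi:
 assumes l: "l <: L" and z: "z <: Et" and m: "m <: M"
 shows "PhiL L M (psi L M l z m) = t3 L M l z m"
proof (rule tensor_ext[OF Ek.tp Tab2 Hom_comp[OF psi_Hom[OF L M l m] PhiL_Hom] ebalD(2)[OF eb2[OF l] m] _ z])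
 fix b b' assume "b <: B" "b' <: opp B"
 then have b: "b <: B" and b': "b' <: B" by simp_all
 let ?w = "pVM M m b'"
 have w: "?w <: VM M" using m b' by (simp add: pVM_closed[OF M])
 have one: "pE 1 1 <: Et" by simp
 define T' where "T' x g y = t3 L M l (pE 1 1 \<star> pE x (y * b')) (g .\<^sub>M m)" for x g y
 have t: "trib G (TT L M) T'"
  unfolding T'_def[abs_def] by (rule trib_shift[OF ebal_trib[OF M Tab2 eb2[OF l] one m] b'])
 note Q = trib_lift_VG(1)[OF Tab2 t] and Qp = trib_lift_VG(2)[OF Tab2 t]
 let ?W = "%x r. tsum (TT L M) (T' x) (nu r)"
 have Wc: "?W x r <: TT L M" if "x <: B" "r <: B" for x r by (rule trib_nu_closed[OF Tab2 t that])
 have step: "phi L M (S' g .\<^sub>L l) (vact M x ?w) = tsum (TT L M) (%x' r. ?W x' (r * x)) (\<tau> (S' g))"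
  if x: "x <: B" and g: "g <: H" for x g
 proof -
  have l1: "S' g .\<^sub>L l <: L" and S'g: "S' g <: H" using g l by (simp_all add: L_smult[OF L])
  have "phi L M (S' g .\<^sub>L l) (vact M x ?w) = phi L M (S' g .\<^sub>L l) (tsum (VM M) (%v y. pVM M (v .\<^sub>M m) (y * b')) (nu x))"
   using x m b' by (simp add: vact_pure[OF M] Rm_nu_lift[OF M])
  also have "... = tsum (TT L M) (%v y. tsum (TT L M) (%x' r. tsum (TT L M) (%v' y'. T' x' (v' \<star> v) (y' * y)) (nu r)) (\<tau> (S' g))) (nu x)"
  proof (rule nu_map[OF VMab Tab2 phi_Hom[OF l1] x])
   fix v y assume "v <: G" "y <: B"
   then have v: "v <: G" and y: "y <: B" by simp_all
   then have gm: "v .\<^sub>M m <: M" and yb: "y * b' <: B" and z': "pE 1 (y * b') <: Et"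
    using m b' by (simp_all add: M_smult[OF M])
   then show "pVM M (v .\<^sub>M m) (y * b') <: VM M" by (simp add: pVM_closed[OF M])
   have "phi L M (S' g .\<^sub>L l) (pVM M (v .\<^sub>M m) (y * b')) =
     HS (TT L M) (%x' v' y'. t3 L M l (pE 1 (y * b') \<star> pE x' y') (v' .\<^sub>M (v .\<^sub>M m))) (S' g)"
    unfolding phi_pure[OF l1 gm yb] by (rule tbalD(3)[OF tb2 S'g l z' gm])
   also have "... = HS (TT L M) (%x' v' y'. T' x' (v' \<star> v) (y' * y)) (S' g)"
    by (rule HS_cong[OF S'g])
      (use v y b' m in "simp add: T'_def pE_mult M_assoc[OF M] B_assoc")
   finally show "phi L M (S' g .\<^sub>L l) (pVM M (v .\<^sub>M m) (y * b')) =
     tsum (TT L M) (%x' r. tsum (TT L M) (%v' y'. T' x' (v' \<star> v) (y' * y)) (nu r)) (\<tau> (S' g))"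
    by (simp only: HS_def)
  qed
  also have "... = tsum (TT L M) (%x' r. tsum (TT L M) (%v y. tsum (TT L M) (%v' y'. T' x' (v' \<star> v) (y' * y)) (nu r)) (nu x)) (\<tau> (S' g))"
  proof (rule lift_swap[OF tpVG tpBAB Tab2 nu_closed[OF x] tau_closed[OF S'g]])
   fix v y x' r assume a: "v <: GA" "y <: lB" "x' <: rB" "r <: lB"
   then have r: "r <: B" by simp
   show "tsum (TT L M) (%v' y'. T' x' (v' \<star> v) (y' * y)) (nu r) <: TT L M"
    by (rule nu_sum_closed[OF Tab2 r]) (use a tribD(1)[OF Tab2 t] in simp)
  qed
  also have "... = tsum (TT L M) (%x' r. ?W x' (r * x)) (\<tau> (S' g))"
  proof (rule tau_cong[OF S'g, symmetric])
   fix x' r assume x': "x' <: B" and r: "r <: B"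
   have e: "tsum (TT L M) (T' x') (tsum VG (%v' y'. pVG (v' \<star> v) (y' * y)) (nu r)) = tsum (TT L M) (%v' y'. T' x' (v' \<star> v) (y' * y)) (nu r)"
    if "v <: G" "y <: B" for v y
    by (rule nu_map[OF VGa Tab2 Q[OF x'] r]) (use that x' in "simp_all add: Qp")
   show "?W x' (r * x) = tsum (TT L M) (%v y. tsum (TT L M) (%v' y'. T' x' (v' \<star> v) (y' * y)) (nu r)) (nu x)"
    unfolding nu_mult[OF r x] by (rule nu_map[OF VGa Tab2 Q[OF x'] x]) (simp_all add: nu_sum_closed[OF VGa r] e)
  qed
  finally show ?thesis .
 qed
 have "PhiL L M (psi L M l (pE b b') m) = PhiL L M (tsum (LV L M) (%x g. pLV L M (S' g .\<^sub>L l) (vact M x ?w)) (\<rho> b))" (is "?a = _")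
  using b b' l m by (simp add: psi_pure[OF L M] psi0_def)
 also have "... = tsum (TT L M) (%x g. tsum (TT L M) (%x' r. ?W x' (r * x)) (\<tau> (S' g))) (\<rho> b)"
 proof (rule rho_map[OF LVab Tab2 PhiL_Hom b])
  fix x g assume x: "x <: B" "g <: H"
  show "pLV L M (S' g .\<^sub>L l) (vact M x ?w) <: LV L M" using x l w by (simp add: pLV_closed[OF L M] vact_closed[OF M] L_smult[OF L])
  have "PhiL L M (pLV L M (S' g .\<^sub>L l) (vact M x ?w)) = phi L M (S' g .\<^sub>L l) (vact M x ?w)"
   by (rule PhiL_pure) (use x l w in "simp_all add: vact_closed[OF M] L_smult[OF L]")
  then show "PhiL L M (pLV L M (S' g .\<^sub>L l) (vact M x ?w)) = tsum (TT L M) (%x' r. ?W x' (r * x)) (\<tau> (S' g))"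
   by (rule trans[OF _ step[OF x]])
 qed
 also have "... = ?W b 1"
  by (rule translation_antipode_inv_apply[OF Tab2 trib_nu_balanced[OF Tab2 t] b])
 also have "... = t3 L M l (pE b b') m"
  using b b' M.smult_one[OF m] by (simp add: nu_A Qp, simp add: T'_def E_one)
 finally show "?a = ..." .
qed

lemma PhiL_PsiL: "u <: TT L M ==> PhiL L M (PsiL L M u) = u"
 by (rule T_ext[OF L M Tab2 Hom_comp[OF PsiL_Hom PhiL_Hom] Hom_id]) (simp_all add: PsiL_t3 PhiL_psi)

lemma phi_ext:
 assumes Q: "abgrp Q" and f: "f \<in> Hom (TT L M) Q" and g: "g \<in> Hom (TT L M) Q"
  and eq: "!!l w. [|l <: L; w <: VM M|] ==> f (phi L M l w) = g (phi L M l w)"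
  and u: "u <: TT L M"
 shows "f u = g u"
proof -
 have "f (PhiL L M (PsiL L M u)) = g (PhiL L M (PsiL L M u))"
  by (rule tensor_ext[OF LV.tp Q Hom_comp[OF PhiL_Hom f] Hom_comp[OF PhiL_Hom g] _ Hom_closed[OF PsiL_Hom u]])
    (simp add: PhiL_pure eq)
 then show ?thesis by (simp add: PhiL_PsiL[OF u])
qed

end

text \<open>Linear maps on the two factors of \<open>L \<otimes> (M \<otimes>\<^sub>A B)\<close>, transported.\<close>

definition cmap where "cmap L M L' M' \<sigma> t u = tsum (TT L' M') (%l w. phi L' M' (\<sigma> l) (t w)) (PsiL L M u)"

context
 fixes L :: "('h, 'l, 'y) module_scheme" and M :: "(('b, 'b) tens, 'm, 'x) module_scheme"
  and L' :: "('h, 'l2, 'y2) module_scheme" and M' :: "(('b, 'b) tens, 'm2, 'x2) module_scheme"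
 assumes L: "lmod (opp H) L" and M: "lmod G M"
  and L': "lmod (opp H) L'" and M': "lmod G M'"
begin

lemma cmap_balanced:
 assumes s: "\<sigma> \<in> lhom K (lk L) (lk L')" and t: "t \<in> lhom K (kV (rA M)) (kV (rA M'))"
 shows "balanced K (lk L) (kV (rA M)) (TT L' M') (%l w. phi L' M' (\<sigma> l) (t w))"
proof (rule balancedI)
 note sc = lin_closed[OF s, simplified] and tc = lin_closed[OF t, simplified]
 note sa = lin_add[OF s, simplified] and ta = lin_add[OF t, simplified]
 { fix l w assume "l <: lk L" "w <: kV (rA M)"
  then show "phi L' M' (\<sigma> l) (t w) <: TT L' M'" by (simp add: phi_closed[OF L' M'] sc tc) }
 { fix l l' w assume "l <: lk L" "l' <: lk L" "w <: kV (rA M)"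
  then show "phi L' M' (\<sigma> (l +\<^sub>(lk L) l')) (t w) = phi L' M' (\<sigma> l) (t w) +\<^sub>(TT L' M') phi L' M' (\<sigma> l') (t w)"
   by (simp add: sa sc tc Hom_add[OF phi_param[OF L' M']]) }
 { fix l w w' assume "l <: lk L" "w <: kV (rA M)" "w' <: kV (rA M)"
  then show "phi L' M' (\<sigma> l) (t (w +\<^sub>(kV (rA M)) w')) = phi L' M' (\<sigma> l) (t w) +\<^sub>(TT L' M') phi L' M' (\<sigma> l) (t w')"
   by (simp add: ta sc tc Hom_add[OF phi_Hom[OF L' M']]) }
 { fix c l w assume c: "c <: K" and l: "l <: lk L" and w: "w <: kV (rA M)"
  show "phi L' M' (\<sigma> (c .\<^sub>(lk L) l)) (t w) = phi L' M' (\<sigma> l) (t (c .\<^sub>(kV (rA M)) w))"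
   unfolding lin_smult[OF s c l] lin_smult[OF t c w]
   by (rule phi_scalar[OF L' M' c]) (use l w in "simp_all add: sc tc") }
qed

lemma LVtp': "tpair K (lk L) (kV (rA M))"
 by (rule kmods.tp[of K]) (intro kmods.intro kmods_axioms.intro K_cring lk_left_module[OF L] kVMm[OF M])

lemma cmap_Hom:
 assumes s: "\<sigma> \<in> lhom K (lk L) (lk L')" and t: "t \<in> lhom K (kV (rA M)) (kV (rA M'))"
 shows "cmap L M L' M' \<sigma> t \<in> Hom (TT L M) (TT L' M')"
 unfolding cmap_def[abs_def]
 by (rule Hom_comp[OF PsiL_Hom[OF L M] lift_Hom[OF LVtp' TTa[OF L' M'] cmap_balanced[OF s t]]])

lemma cmap_phi:
 assumes s: "\<sigma> \<in> lhom K (lk L) (lk L')" and t: "t \<in> lhom K (kV (rA M)) (kV (rA M'))"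
  and l: "l <: L" and w: "w <: VM M"
 shows "cmap L M L' M' \<sigma> t (phi L M l w) = phi L' M' (\<sigma> l) (t w)"
 using lift_pure[OF LVtp' TTa[OF L' M'] cmap_balanced[OF s t], of l w] l w
 by (simp add: cmap_def PsiL_phi[OF L M])

end

definition Vmap where "Vmap M' d = tmap A (rA M') lB d (%x. x)"

lemma rA_hom: "d \<in> lhom G M M' ==> d \<in> lhom A (rA M) (rA M')"
 by (auto simp: lmod_hom_def)

lemma Vmap_lin:
 assumes M: "lmod G M" and M': "lmod G M'" and d: "d \<in> lhom G M M'"
 shows "Vmap M' d \<in> lhom K (kV (rA M)) (kV (rA M'))"
 unfolding Vmap_def by (rule kV_map_lin[OF rA_rmod[OF M] rA_rmod[OF M'] rA_hom[OF d]])

lemma Vmap_pure: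
 assumes M: "lmod G M" and M': "lmod G M'" and d: "d \<in> lhom G M M'"
 shows "[|m <: M; c <: B|] ==> Vmap M' d (pVM M m c) = pVM M' (d m) c"
 unfolding Vmap_def using tmap_pure[OF tpVM[OF M] tpVM[OF M'] rA_hom[OF d] lin_id] by simp

lemma mapL_phi:
 assumes L: "lmod (opp H) L" and L': "lmod (opp H) L'" and M: "lmod G M" and f: "f \<in> lhom (opp H) L L'"
  and l: "l <: L" and w: "w <: VM M"
 shows "mapL L' M f (phi L M l w) = phi L' M (f l) w"
 by (rule tensor_ext[OF tpVM[OF M] TTa[OF L' M] Hom_comp[OF phi_Hom[OF L M l] mapL_Hom[OF L L' M f]] phi_Hom[OF L' M] _ w])
   (use l lin_closed[OF f] in "simp_all add: phi_pure[OF L M] phi_pure[OF L' M] mapL_t3[OF L L' M f]")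

lemma mapM_phi:
 assumes L: "lmod (opp H) L" and M: "lmod G M" and M': "lmod G M'" and d: "d \<in> lhom G M M'"
  and l: "l <: L" and w: "w <: VM M"
 shows "mapM L M' d (phi L M l w) = phi L M' l (Vmap M' d w)"
 by (rule tensor_ext[OF tpVM[OF M] TTa[OF L M'] Hom_comp[OF phi_Hom[OF L M l] mapM_Hom[OF L M M' d]]
    Hom_comp[OF lin_Hom[OF Vmap_lin[OF M M' d], simplified] phi_Hom[OF L M' l]] _ w])
   (use l lin_closed[OF d] in "simp_all add: phi_pure[OF L M] phi_pure[OF L M'] mapM_t3[OF L M M' d] Vmap_pure[OF M M' d]")

end

lemma exact_atI:
 assumes "!!x. x <: M ==> f x <: N" "!!x. x <: M ==> g (f x) = 0\<^sub>P" "!!y. [|y <: N; g y = 0\<^sub>P|] ==> y \<in> f ` carrier M"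
 shows "exact_at M f N g P"
 unfolding exact_at_def using assms by (intro equalityI subsetI) auto

lemma exact_atD:
 assumes "exact_at M f N g P"
 shows "x <: M ==> g (f x) = 0\<^sub>P" "[|y <: N; g y = 0\<^sub>P|] ==> y \<in> f ` carrier M"
proof -
 assume "x <: M"
 then have "f x \<in> f ` carrier M" by (rule imageI)
 then show "g (f x) = 0\<^sub>P" unfolding assms[unfolded exact_at_def] by simp
next
 assume "y <: N" "g y = 0\<^sub>P"
 then show "y \<in> f ` carrier M" unfolding assms[unfolded exact_at_def] by simp
qed

section \<open>Finite products of modules\<close>

definition prod_mod :: "nat \<Rightarrow> (nat \<Rightarrow> ('r, 'a, 'z) module_scheme) \<Rightarrow> ('r, nat \<Rightarrow> 'a) module" where
 "prod_mod n T = \<lparr>carrier = (\<Pi>\<^sub>E p\<in>{..n}. carrier (T p)), monoid.mult = undefined, one = undefined,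
   ring.zero = (\<lambda>p\<in>{..n}. 0\<^sub>(T p)), add = (%s t. \<lambda>p\<in>{..n}. s p +\<^sub>(T p) t p),
   smult = (%e t. \<lambda>p\<in>{..n}. e .\<^sub>(T p) t p)\<rparr>"

lemma prod_mod_simps:
 "carrier (prod_mod n T) = (\<Pi>\<^sub>E p\<in>{..n}. carrier (T p))" "0\<^sub>(prod_mod n T) = (\<lambda>p\<in>{..n}. 0\<^sub>(T p))"
 "s +\<^sub>(prod_mod n T) t = (\<lambda>p\<in>{..n}. s p +\<^sub>(T p) t p)" "e .\<^sub>(prod_mod n T) t = (\<lambda>p\<in>{..n}. e .\<^sub>(T p) t p)"
 by (simp_all add: prod_mod_def)

lemma prod_mod_ext: "[|s <: prod_mod n T; t <: prod_mod n T; !!p. p \<le> n ==> s p = t p|] ==> s = t"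
 by (rule PiE_ext[where k="{..n}"]) (simp_all add: prod_mod_simps)

lemma prod_mod_closed: "[|t <: prod_mod n T; p \<le> n|] ==> t p <: T p"
 by (auto simp: prod_mod_simps PiE_iff)

lemma restrict_prod_mod: "(!!p. p \<le> n ==> f p <: T p) ==> (\<lambda>p\<in>{..n}. f p) <: prod_mod n T"
 by (simp add: prod_mod_simps)

lemma prod_mod_left_module:
 assumes R: "ring R" and T: "!!p. p \<le> n ==> lmod R (T p)"
 shows "lmod R (prod_mod n T)"
proof (intro left_module.intro left_module_axioms.intro R)
 note ext = prod_mod_ext and cl = prod_mod_closed and rc = restrict_prod_mod
 note m = left_module.smult_closed[OF T] left_module.smult_l_distr[OF T] left_module.smult_r_distr[OF T]
  left_module.smult_assoc1[OF T] left_module.smult_one[OF T]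
 note g = abelian_groupE[OF lmod_ab[OF T]]
 have ac: "s +\<^sub>(prod_mod n T) t <: prod_mod n T" if "s <: prod_mod n T" "t <: prod_mod n T" for s t
  unfolding prod_mod_simps(3) by (rule rc) (simp add: g(1) cl[OF that(1)] cl[OF that(2)])
 have zc: "0\<^sub>(prod_mod n T) <: prod_mod n T"
  unfolding prod_mod_simps(2) by (rule rc) (rule g(2))
 have sc: "e .\<^sub>(prod_mod n T) t <: prod_mod n T" if "e <: R" "t <: prod_mod n T" for e t
  unfolding prod_mod_simps(4) by (rule rc) (simp add: m(1) that(1) cl[OF that(2)])
 show "abgrp (prod_mod n T)"
 proof (rule abelian_groupI)
  fix x y z assume c: "x <: prod_mod n T" "y <: prod_mod n T" "z <: prod_mod n T"
  show "x +\<^sub>(prod_mod n T) y +\<^sub>(prod_mod n T) z = x +\<^sub>(prod_mod n T) (y +\<^sub>(prod_mod n T) z)"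
   by (rule ext[OF ac[OF ac[OF c(1,2)] c(3)] ac[OF c(1) ac[OF c(2,3)]]])
     (simp add: prod_mod_simps(3) g(3) cl[OF c(1)] cl[OF c(2)] cl[OF c(3)])
 next
  fix x y assume c: "x <: prod_mod n T" "y <: prod_mod n T"
  show "x +\<^sub>(prod_mod n T) y <: prod_mod n T" by (rule ac[OF c])
  show "x +\<^sub>(prod_mod n T) y = y +\<^sub>(prod_mod n T) x"
   by (rule ext[OF ac[OF c] ac[OF c(2,1)]]) (simp add: prod_mod_simps(3) g(4) cl[OF c(1)] cl[OF c(2)])
 next
  fix x assume c: "x <: prod_mod n T"
  show "0\<^sub>(prod_mod n T) +\<^sub>(prod_mod n T) x = x"
   by (rule ext[OF ac[OF zc c] c]) (simp add: prod_mod_simps(2,3) g(5) cl[OF c])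
  have n: "(\<lambda>p\<in>{..n}. \<ominus>\<^bsub>T p\<^esub> x p) <: prod_mod n T"
   by (rule rc) (simp add: abelian_group.a_inv_closed[OF lmod_ab[OF T]] cl[OF c])
  show "\<exists>y\<in>carrier (prod_mod n T). y +\<^sub>(prod_mod n T) x = 0\<^sub>(prod_mod n T)"
   by (rule bexI[OF _ n], rule ext[OF ac[OF n c] zc])
     (simp add: prod_mod_simps(2,3) abelian_group.l_neg[OF lmod_ab[OF T]] cl[OF c])
 qed (rule zc)
 fix a x assume a: "a <: R" and x: "x <: prod_mod n T"
 show "a .\<^sub>(prod_mod n T) x <: prod_mod n T" by (rule sc[OF a x])
 { fix b assume b: "b <: R"
  have ab: "a +\<^sub>R b <: R" "a \<otimes>\<^bsub>R\<^esub> b <: R"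
   using ring.ring_simprules(1,5)[OF R a b] by simp_all
  show "(a +\<^sub>R b) .\<^sub>(prod_mod n T) x = a .\<^sub>(prod_mod n T) x +\<^sub>(prod_mod n T) b .\<^sub>(prod_mod n T) x"
   by (rule ext[OF sc[OF ab(1) x] ac[OF sc[OF a x] sc[OF b x]]]) (simp add: prod_mod_simps(3,4) m(2) a b cl[OF x])
  show "(a \<otimes>\<^bsub>R\<^esub> b) .\<^sub>(prod_mod n T) x = a .\<^sub>(prod_mod n T) (b .\<^sub>(prod_mod n T) x)"
   by (rule ext[OF sc[OF ab(2) x] sc[OF a sc[OF b x]]]) (simp add: prod_mod_simps(4) m(4) a b cl[OF x]) }
 { fix y assume y: "y <: prod_mod n T"
  show "a .\<^sub>(prod_mod n T) (x +\<^sub>(prod_mod n T) y) = a .\<^sub>(prod_mod n T) x +\<^sub>(prod_mod n T) a .\<^sub>(prod_mod n T) y"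
   by (rule ext[OF sc[OF a ac[OF x y]] ac[OF sc[OF a x] sc[OF a y]]]) (simp add: prod_mod_simps(3,4) m(3) a cl[OF x] cl[OF y]) }
next
 fix x assume x: "x <: prod_mod n T"
 have sc: "1\<^sub>R .\<^sub>(prod_mod n T) x <: prod_mod n T"
  unfolding prod_mod_simps(4)
  by (rule restrict_prod_mod) (simp add: left_module.smult_closed[OF T] ring.ring_simprules(6)[OF R] prod_mod_closed[OF x])
 show "1\<^sub>R .\<^sub>(prod_mod n T) x = x"
  by (rule prod_mod_ext[OF sc x]) (simp add: prod_mod_simps(4) left_module.smult_one[OF T] prod_mod_closed[OF x])
qed

lemma prod_mod_proj: "p \<le> n ==> (%t. t p) \<in> lhom R (prod_mod n T) (T p)"
 by (rule linI[OF HomI]) (simp_all add: prod_mod_closed, simp_all add: prod_mod_simps)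

lemma prod_mod_into:
 assumes "!!p. p \<le> n ==> f p \<in> lhom R X (T p)"
 shows "(%x. \<lambda>p\<in>{..n}. f p x) \<in> lhom R X (prod_mod n T)"
proof (rule linI[OF HomI])
 show "(\<lambda>p\<in>{..n}. f p x) <: prod_mod n T" if "x <: X" for x
  by (rule restrict_prod_mod) (rule lin_closed[OF assms that])
qed (simp_all add: prod_mod_simps lin_add[OF assms] lin_smult[OF assms] cong: restrict_cong)

lemma lmod_hom_plus:
 assumes N: "lmod R N" and f: "f \<in> lhom R X N" and g: "g \<in> lhom R X N"
 shows "(%x. f x +\<^sub>N g x) \<in> lhom R X N"
proof -
 interpret N: left_module R N by (rule N)
 note c = lin_closed[OF f] lin_closed[OF g]
 show ?thesis
  by (rule linI[OF HomI])
    (simp_all add: c lin_add[OF f] lin_add[OF g] lin_smult[OF f] lin_smult[OF g] N.smult_r_distr N.M.a_ac)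
qed

text \<open>A map out of a finite product is determined by its restrictions to the factors, so liftings can be
  chosen factor by factor.\<close>

lemma prod_mod_lift:
 assumes R: "ring R" and T: "!!p. lmod R (T p)" and N: "lmod R N" and N': "lmod R N'"
  and g: "g \<in> lhom R N N'"
  and lift: "!!p f. [|p \<le> n; f \<in> lhom R (T p) N'|] ==> \<exists>h\<in>lhom R (T p) N. \<forall>x\<in>carrier (T p). g (h x) = f x"
  and f: "f \<in> lhom R (prod_mod n T) N'"
 shows "\<exists>h\<in>lhom R (prod_mod n T) N. \<forall>x\<in>carrier (prod_mod n T). g (h x) = f x"
proof -
 interpret N: left_module R N by (rule N)
 interpret N': left_module R N' by (rule N')
 note Ta = lmod_ab[OF T] and Tz = abelian_groupE(2)[OF lmod_ab[OF T]]
 note tz = abelian_groupE(5)[OF lmod_ab[OF T]]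
 have tz2: "x +\<^sub>(T p) 0\<^sub>(T p) = x" if "x <: T p" for x p using abelian_groupE(4,5)[OF Ta] Tz that by metis
 define j where "j p x = (\<lambda>q\<in>{..n}. if q = p then x else 0\<^sub>(T q))" for p x
 have jc: "j p x <: prod_mod n T" if "x <: T p" for p x
  unfolding j_def by (rule restrict_prod_mod) (use that Tz in auto)
 have sz: "a .\<^sub>(T p) 0\<^sub>(T p) = 0\<^sub>(T p)" if "a <: R" for a p by (rule left_module.smult_zero_r[OF T that])
 have jh: "j p \<in> lhom R (T p) (prod_mod n T)" for p
 proof (rule linI[OF HomI])
  fix x y assume x: "x <: T p" "y <: T p"
  show "j p x <: prod_mod n T" by (rule jc[OF x(1)])
  show "j p (x +\<^sub>(T p) y) = j p x +\<^sub>(prod_mod n T) j p y"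
   by (rule ext) (simp add: prod_mod_simps(3) j_def tz[OF Tz])
 next
  fix a x assume "a <: R" "x <: T p"
  then show "j p (a .\<^sub>(T p) x) = a .\<^sub>(prod_mod n T) j p x"
   by (intro ext) (simp add: prod_mod_simps(4) j_def sz)
 qed
 have "\<exists>h\<in>lhom R (T p) N. \<forall>x\<in>carrier (T p). g (h x) = f (j p x)" if "p \<le> n" for p
  by (rule lift[OF that lin_comp[OF f jh]])
 then have "\<forall>p\<in>{..n}. \<exists>h. h \<in> lhom R (T p) N \<and> (\<forall>x\<in>carrier (T p). g (h x) = f (j p x))" by blast
 from bchoice[OF this] obtain h where h: "!!p. p \<le> n ==> h p \<in> lhom R (T p) N"
  and gh: "!!p x. [|p \<le> n; x <: T p|] ==> g (h p x) = f (j p x)" by auto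
 define trunc where "trunc k t = (\<lambda>q\<in>{..n}. if q < k then t q else 0\<^sub>(T q))" for k t
 have trc: "trunc k t <: prod_mod n T" if "t <: prod_mod n T" for k t
  unfolding trunc_def by (rule restrict_prod_mod) (use prod_mod_closed[OF that] Tz in auto)
 have main: "k \<le> Suc n ==> \<exists>hk\<in>lhom R (prod_mod n T) N. \<forall>t\<in>carrier (prod_mod n T). g (hk t) = f (trunc k t)" for k
 proof (induction k)
  case 0
  have z: "(%_. 0\<^sub>N) \<in> lhom R (prod_mod n T) N"
   by (rule linI[OF HomI]) (simp_all add: N.smult_zero_r)
  interpret Q: left_module R "prod_mod n T" by (rule prod_mod_left_module[OF R T])
  have t0: "trunc 0 t = 0\<^sub>(prod_mod n T)" for t by (simp add: trunc_def prod_mod_simps)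
  have "g 0\<^sub>N = f (trunc 0 t)" for t
   unfolding t0 using Hom_zero[OF N.M.abelian_group_axioms N'.M.abelian_group_axioms lin_Hom[OF g]]
    Hom_zero[OF Q.M.abelian_group_axioms N'.M.abelian_group_axioms lin_Hom[OF f]] by simp
  then show ?case by (intro bexI[OF _ z] ballI)
 next
  case (Suc k)
  then have k: "k \<le> n" by simp
  obtain hk where hk: "hk \<in> lhom R (prod_mod n T) N" and ghk: "!!t. t <: prod_mod n T ==> g (hk t) = f (trunc k t)"
   using Suc by auto
  note pk = prod_mod_proj[OF k, where T=T and R=R]
  let ?h = "%t. hk t +\<^sub>N h k (t k)"
  have hh: "?h \<in> lhom R (prod_mod n T) N" by (rule lmod_hom_plus[OF N hk lin_comp[OF h[OF k] pk]])
  have "g (?h t) = f (trunc (Suc k) t)" if t: "t <: prod_mod n T" for t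
  proof -
   note tk = prod_mod_closed[OF t k]
   have e: "trunc (Suc k) t = trunc k t +\<^sub>(prod_mod n T) j k (t k)"
    by (rule prod_mod_ext[OF trc[OF t]])
      (use t k tk prod_mod_closed[OF t] Tz tz tz2 in "auto simp: prod_mod_simps(3) trunc_def j_def less_Suc_eq intro!: restrict_prod_mod abelian_groupE(1)[OF Ta]")
   show ?thesis
    unfolding e lin_add[OF f trc[OF t] jc[OF tk]] ghk[OF t, symmetric] gh[OF k tk, symmetric]
    by (rule lin_add[OF g lin_closed[OF hk t] lin_closed[OF h[OF k] tk]])
  qed
  then show ?case by (intro bexI[OF _ hh] ballI)
 qed
 have e: "trunc (Suc n) t = t" if t: "t <: prod_mod n T" for t
  by (rule prod_mod_ext[OF trc[OF t] t]) (simp add: trunc_def)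
 show ?thesis using main[of "Suc n", OF le_refl] e by simp
qed

section \<open>Contracting a first quadrant bicomplex\<close>

text \<open>\<open>s\<close> contracts the horizontal differential down to the projections \<open>P\<close> of the column \<open>p = 0\<close>, on whose image
  \<open>\<theta>\<close> contracts the vertical differential down to \<open>\<eta>\<close>.\<close>

locale bicomplex_contraction =
 fixes T :: "nat \<Rightarrow> nat \<Rightarrow> ('r, 'a, 'z) module_scheme" and dh dv s and \<theta> P and \<eta> :: "'a \<Rightarrow> 'a"
 assumes T: "!!p q. abgrp (T p q)"
  and dh: "!!p q. dh p q \<in> Hom (T (Suc p) q) (T p q)"
  and dv: "!!p q. dv p q \<in> Hom (T p (Suc q)) (T p q)"
  and s: "!!p q. s p q \<in> Hom (T p q) (T (Suc p) q)"
  and \<theta>: "!!q. \<theta> q \<in> Hom (T 0 q) (T 0 (Suc q))"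
  and dh_dh: "!!p q x. x <: T (Suc (Suc p)) q ==> dh p q (dh (Suc p) q x) = 0\<^sub>(T p q)"
  and dv_dv: "!!p q x. x <: T p (Suc (Suc q)) ==> dv p q (dv p (Suc q) x) = 0\<^sub>(T p q)"
  and dh_dv: "!!p q x. x <: T (Suc p) (Suc q) ==> dh p q (dv (Suc p) q x) = dv p q (dh p (Suc q) x)"
  and s_dv: "!!p q x. x <: T p (Suc q) ==> s p q (dv p q x) = dv (Suc p) q (s p (Suc q) x)"
  and s_Suc: "!!p q x. x <: T (Suc p) q ==> dh (Suc p) q (s (Suc p) q x) +\<^sub>(T (Suc p) q) s p q (dh p q x) = x"
  and s_0: "!!q x. x <: T 0 q ==> dh 0 q (s 0 q x) +\<^sub>(T 0 q) P q x = x"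
  and \<theta>_dh: "!!q x. x <: T 1 q ==> \<theta> q (dh 0 q x) = 0\<^sub>(T 0 (Suc q))"
  and \<theta>_Suc: "!!q x. x <: T 0 (Suc q) ==> dv 0 (Suc q) (\<theta> (Suc q) x) +\<^sub>(T 0 (Suc q)) \<theta> q (dv 0 q x) = P (Suc q) x"
  and \<theta>_0: "!!x. x <: T 0 0 ==> dv 0 0 (\<theta> 0 x) +\<^sub>(T 0 0) \<eta> x = P 0 x"
begin

abbreviation "Tt n \<equiv> prod_mod n (%p. T p (n - p))"

definition sgn_pow where "sgn_pow p q k x = [((-1::int) ^ k)] \<cdot>\<^bsub>T p q\<^esub> x"

definition tot_d where
 "tot_d n t = (\<lambda>p\<in>{..n}. dh p (n - p) (t (Suc p)) +\<^sub>(T p (n - p)) sgn_pow p (n - p) p (dv p (n - p) (t p)))"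

definition tot_h where
 "tot_h n t = (\<lambda>p\<in>{..Suc n}. case p of 0 \<Rightarrow> \<theta> n (t 0) | Suc p' \<Rightarrow> s p' (n - p') (t p'))"

lemmas dh_closed = Hom_closed[OF dh] and dv_closed = Hom_closed[OF dv]
 and s_closed = Hom_closed[OF s] and \<theta>_closed = Hom_closed[OF \<theta>]

lemma sgn_pow_closed: "x <: T p q ==> sgn_pow p q k x <: T p q"
proof -
 interpret abelian_group "T p q" by (rule T)
 show "x <: T p q ==> sgn_pow p q k x <: T p q" by (simp add: sgn_pow_def)
qed

lemma sgn_pow_0: "x <: T p q ==> sgn_pow p q 0 x = x"
proof -
 interpret abelian_group "T p q" by (rule T)
 show "x <: T p q ==> sgn_pow p q 0 x = x" using add.int_pow_1[of x] by (simp add: sgn_pow_def add_pow_def)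
qed

lemma sgn_pow_Suc: "x <: T p q ==> sgn_pow p q (Suc k) x = \<ominus>\<^bsub>T p q\<^esub> sgn_pow p q k x"
proof -
 interpret abelian_group "T p q" by (rule T)
 show "x <: T p q ==> sgn_pow p q (Suc k) x = \<ominus>\<^bsub>T p q\<^esub> sgn_pow p q k x"
  using add.int_pow_neg[of x "(-1) ^ k"] by (simp add: sgn_pow_def add_pow_def a_inv_def)
qed

lemma sgn_pow_hom: "[|f \<in> Hom (T p q) (T p' q'); x <: T p q|] ==> f (sgn_pow p q k x) = sgn_pow p' q' k (f x)"
 unfolding sgn_pow_def by (rule Hom_int_pow[OF T T])

lemma sgn_pow_Hom: "sgn_pow p q k \<in> Hom (T p q) (T p q)"
proof -
 interpret abelian_group "T p q" by (rule T)
 show ?thesis using add.int_pow_distrib by (intro HomI sgn_pow_closed) (simp_all add: sgn_pow_def add_pow_def)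
qed

lemma Tt_closed: "[|t <: Tt n; p \<le> n|] ==> t p <: T p (n - p)"
 by (rule prod_mod_closed)

lemma Tt_comp:
 assumes t: "t <: Tt (Suc n)" and p: "p \<le> n"
 shows "t (Suc p) <: T (Suc p) (n - p)" "t p <: T p (Suc (n - p))"
 using prod_mod_closed[OF t, of "Suc p"] prod_mod_closed[OF t, of p] p by (simp_all add: Suc_diff_le)

lemma tot_d_closed: "t <: Tt (Suc n) ==> tot_d n t <: Tt n"
 unfolding tot_d_def
 by (rule restrict_prod_mod) (simp add: abelian_groupE(1)[OF T] dh_closed sgn_pow_closed dv_closed Tt_comp)

lemma tot_h_closed: "t <: Tt n ==> tot_h n t <: Tt (Suc n)"
 unfolding tot_h_def
 by (rule restrict_prod_mod) (use Tt_closed[of t n 0] Tt_closed[of t n] in "auto split: nat.split intro!: \<theta>_closed s_closed")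

lemma tot_d_tot_d:
 assumes t: "t <: Tt (Suc (Suc n))"
 shows "tot_d n (tot_d (Suc n) t) = 0\<^sub>(Tt n)"
proof -
 have "tot_d n (tot_d (Suc n) t) p = 0\<^sub>(T p (n - p))" if p: "p \<le> n" for p
 proof -
  let ?q = "n - p"
  interpret A: abelian_group "T p ?q" by (rule T)
  interpret A': abelian_group "T (Suc p) ?q" by (rule T)
  have q: "Suc n - p = Suc ?q" "Suc n - Suc p = ?q" using p by simp_all
  have c: "t (Suc (Suc p)) <: T (Suc (Suc p)) ?q" "t (Suc p) <: T (Suc p) (Suc ?q)" "t p <: T p (Suc (Suc ?q))"
   using prod_mod_closed[OF t, of "Suc (Suc p)"] prod_mod_closed[OF t, of "Suc p"] prod_mod_closed[OF t, of p] p
   by (simp_all add: Suc_diff_le)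
  let ?w = "sgn_pow p ?q p (dv p ?q (dh p (Suc ?q) (t (Suc p))))"
  have wc: "?w <: T p ?q" using c by (simp add: sgn_pow_closed dv_closed dh_closed)
  have "dh p ?q (tot_d (Suc n) t (Suc p)) = \<ominus>\<^bsub>T p ?q\<^esub> ?w"
   using p c by (simp add: tot_d_def q Hom_add[OF dh] dh_closed dv_closed sgn_pow_closed dh_dh sgn_pow_Suc
     Hom_neg[OF T T dh] sgn_pow_hom[OF dh] dh_dv)
  moreover have "sgn_pow p ?q p (dv p ?q (tot_d (Suc n) t p)) = ?w"
   using p c by (simp add: tot_d_def q Hom_add[OF dv] dh_closed dv_closed sgn_pow_closed dv_dv sgn_pow_hom[OF dv]
     Hom_add[OF sgn_pow_Hom] Hom_zero[OF T T sgn_pow_Hom])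
  ultimately show ?thesis using p wc by (simp add: tot_d_def A.l_neg)
 qed
 then show ?thesis
  using tot_d_closed[OF tot_d_closed[OF t]]
  by (intro prod_mod_ext[where n=n and T="%p. T p (n - p)"]) (simp_all add: prod_mod_simps(1,2) abelian_groupE(2)[OF T])
qed

text \<open>\<open>tot_h\<close> need not contract the total complex; it is only a section of the differential on cycles,
  which suffices for exactness.\<close>

lemma tot_h_cycle:
 assumes t: "t <: Tt (Suc n)" and z: "tot_d n t = 0\<^sub>(Tt n)"
 shows "tot_d (Suc n) (tot_h (Suc n) t) = t"
proof (rule prod_mod_ext[OF tot_d_closed[OF tot_h_closed[OF t]] t])
 have z': "dh p (n - p) (t (Suc p)) +\<^sub>(T p (n - p)) sgn_pow p (n - p) p (dv p (n - p) (t p)) = 0\<^sub>(T p (n - p))" if "p \<le> n" for p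
  using fun_cong[OF z, of p] that by (simp add: tot_d_def prod_mod_simps(2))
 fix p assume p: "p \<le> Suc n"
 show "tot_d (Suc n) (tot_h (Suc n) t) p = t p"
 proof (cases p)
  case 0
  interpret A: abelian_group "T 0 (Suc n)" by (rule T)
  have c: "t 0 <: T 0 (Suc n)" "t 1 <: T 1 n"
   using prod_mod_closed[OF t, of 0] prod_mod_closed[OF t, of 1] by simp_all
  have "\<theta> n (dh 0 n (t 1) +\<^sub>(T 0 n) dv 0 n (t 0)) = 0\<^sub>(T 0 (Suc n))"
   using z'[of 0] c by (simp add: sgn_pow_0 dv_closed Hom_zero[OF T T \<theta>])
  then have "\<theta> n (dv 0 n (t 0)) = 0\<^sub>(T 0 (Suc n))"
   using c \<theta>_dh[of "t 1" n] dh_closed[of "t 1" 0 n] by (simp add: Hom_add[OF \<theta>] dv_closed \<theta>_closed)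
  then have e: "dv 0 (Suc n) (\<theta> (Suc n) (t 0)) = P (Suc n) (t 0)"
   using \<theta>_Suc[OF c(1)] c by (simp add: dv_closed \<theta>_closed)
  have "P (Suc n) (t 0) <: T 0 (Suc n)"
   unfolding e[symmetric] using c by (simp add: dv_closed \<theta>_closed)
  then show ?thesis
   using 0 s_0[OF c(1)] c by (simp add: tot_d_def tot_h_def e sgn_pow_0)
 next
  case (Suc p')
  then have p': "p' \<le> n" using p by simp
  let ?q = "n - p'"
  have q: "Suc n - p' = Suc ?q" using p' by simp
  interpret A: abelian_group "T (Suc p') ?q" by (rule T)
  have c: "t (Suc p') <: T (Suc p') ?q" "t p' <: T p' (Suc ?q)" using Tt_comp[OF t p'] .
  let ?w = "dv (Suc p') ?q (s p' (Suc ?q) (t p'))"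
  have wc: "?w <: T (Suc p') ?q" using c by (simp add: dv_closed s_closed)
  have "s p' ?q (dh p' ?q (t (Suc p')) +\<^sub>(T p' ?q) sgn_pow p' ?q p' (dv p' ?q (t p'))) = 0\<^sub>(T (Suc p') ?q)"
   using z'[OF p'] by (simp add: Hom_zero[OF T T s])
  then have "s p' ?q (dh p' ?q (t (Suc p'))) +\<^sub>(T (Suc p') ?q) sgn_pow (Suc p') ?q p' ?w = 0\<^sub>(T (Suc p') ?q)"
   using c by (simp add: Hom_add[OF s] dh_closed dv_closed sgn_pow_closed sgn_pow_hom[OF s] s_dv)
  then have e: "sgn_pow (Suc p') ?q (Suc p') ?w = s p' ?q (dh p' ?q (t (Suc p')))"
   using c wc A.minus_equality by (simp add: sgn_pow_Suc sgn_pow_closed s_closed dh_closed)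
  show ?thesis
   using Suc p c q s_Suc[OF c(1)] by (simp add: tot_d_def tot_h_def e)
 qed
qed

lemma tot_h_zero:
 assumes t: "t <: Tt 0" and z: "\<eta> (t 0) = 0\<^sub>(T 0 0)"
 shows "tot_d 0 (tot_h 0 t) = t"
proof (rule prod_mod_ext[OF tot_d_closed[OF tot_h_closed[OF t]] t])
 interpret A: abelian_group "T 0 0" by (rule T)
 have c: "t 0 <: T 0 0" using prod_mod_closed[OF t, of 0] by simp
 have e: "dv 0 0 (\<theta> 0 (t 0)) = P 0 (t 0)" using \<theta>_0[OF c] z c by (simp add: dv_closed \<theta>_closed)
 have "P 0 (t 0) <: T 0 0"
  unfolding e[symmetric] using c by (simp add: dv_closed \<theta>_closed)
 then show "tot_d 0 (tot_h 0 t) p = t p" if "p \<le> 0" for p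
  using that s_0[OF c] c by (simp add: tot_d_def tot_h_def e sgn_pow_0)
qed

theorem tot_exact: "exact_at (Tt (Suc (Suc n))) (tot_d (Suc n)) (Tt (Suc n)) (tot_d n) (Tt n)"
 by (rule exact_atI, erule tot_d_closed, erule tot_d_tot_d, rule image_eqI, erule (1) tot_h_cycle[symmetric], erule tot_h_closed)

lemma tot_d_lin:
 assumes lm: "!!p q. lmod R (T p q)" and dhl: "!!p q. dh p q \<in> lhom R (T (Suc p) q) (T p q)"
  and dvl: "!!p q. dv p q \<in> lhom R (T p (Suc q)) (T p q)"
 shows "tot_d n \<in> lhom R (Tt (Suc n)) (Tt n)"
 unfolding tot_d_def[abs_def]
proof (rule prod_mod_into)
 fix p assume p: "p \<le> n"
 have q: "Suc n - p = Suc (n - p)" "Suc n - Suc p = n - p" using p by simp_all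
 have s: "sgn_pow p q k \<in> lhom R (T p q) (T p q)" for q k
  by (rule linI[OF sgn_pow_Hom]) (rule sgn_pow_hom[OF smult_Hom[OF lm], symmetric])
 have h: "(%t. t (Suc p)) \<in> lhom R (Tt (Suc n)) (T (Suc p) (n - p))" "(%t. t p) \<in> lhom R (Tt (Suc n)) (T p (Suc (n - p)))"
  using prod_mod_proj[of "Suc p" "Suc n" R "%p. T p (Suc n - p)"] prod_mod_proj[of p "Suc n" R "%p. T p (Suc n - p)"] p
  by (simp_all add: q)
 show "(%t. dh p (n - p) (t (Suc p)) +\<^sub>(T p (n - p)) sgn_pow p (n - p) p (dv p (n - p) (t p))) \<in> lhom R (Tt (Suc n)) (T p (n - p))"
  by (rule lmod_hom_plus[OF lm lin_comp[OF dhl h(1)] lin_comp[OF s lin_comp[OF dvl h(2)]]])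
qed

end

context galois_Gamma
begin

section \<open>The bimodule \<open>B\<close> and the augmentation\<close>

abbreviation "BB \<equiv> regular_bimodule B"
abbreviation "A0 \<equiv> coinv_Gamma_module K H B"

lemma BB_simps [simp]: "carrier BB = carrier B" "add BB = add B" "0\<^sub>BB = \<zero>" "smult BB = sandwich B"
 "tsum BB = tsum B" "Hom X BB = Hom X B" "Hom BB X = Hom B X"
 by (simp_all add: regular_bimodule_def Hom_def)

lemma A0_simps [simp]: "carrier A0 = carrier A" "add A0 = add B" "0\<^sub>A0 = \<zero>" "smult A0 = sandwich B"
 by (simp_all add: coinv_Gamma_module_def)

lemma sandwich_bilin: "b <: B ==> bilin K B (opp B) B (%x y. x * b * y)"
 by (rule bilinI) (auto simp: lin_opp2 intro!: lin_intro)

lemma sandwich_lin: "b <: B ==> (%z. sandwich B z b) \<in> lhom K E B"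
 unfolding sandwich_def by (rule Ek.lin_lift[OF Bm.left_module_axioms sandwich_bilin])

lemma sandwich_Hom: "b <: B ==> (%z. sandwich B z b) \<in> Hom Et B"
 using lin_Hom[OF sandwich_lin] by simp

lemma sandwich_pure [simp]: "[|x <: B; y <: B; b <: B|] ==> sandwich B (pE x y) b = x * b * y"
 unfolding sandwich_def using Ek.lift_bilin_pure[OF Bm.left_module_axioms sandwich_bilin] by simp

lemma sandwich_closed [simp]: "[|z <: Et; b <: B|] ==> sandwich B z b <: B"
 by (rule Hom_closed[OF sandwich_Hom])

lemma sandwich_lin_r: "z <: Et ==> (%b. sandwich B z b) \<in> lhom K B B"
 unfolding sandwich_def
 by (rule lin_lift_param[OF Ek.tp Bm.left_module_axioms]) (auto intro!: lin_intro)

lemma sandwich_mult: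
 assumes z: "z <: Et" and z': "z' <: Et" and b: "b <: B"
 shows "sandwich B (z \<star> z') b = sandwich B z (sandwich B z' b)"
proof (rule tensor_ext[OF Ek.tp Ba Hom_comp[OF E_mult_Hom(2)[OF z'] sandwich_Hom[OF b]] sandwich_Hom _ z])
 show "sandwich B z' b <: B" using z' b by simp
 fix x y assume "x <: B" "y <: opp B"
 then have x: "x <: B" and y: "y <: B" by simp_all
 have xy: "pE x y <: Et" using x y by simp
 show "sandwich B (pE x y \<star> z') b = sandwich B (pE x y) (sandwich B z' b)"
 proof (rule tensor_ext[OF Ek.tp Ba Hom_comp[OF E_mult_Hom(1)[OF xy] sandwich_Hom[OF b]]
    Hom_comp[OF sandwich_Hom[OF b] lin_Hom[OF sandwich_lin_r[OF xy]]] _ z'])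
  fix x' y' assume "x' <: B" "y' <: opp B"
  then show "sandwich B (pE x y \<star> pE x' y') b = sandwich B (pE x y) (sandwich B (pE x' y') b)"
   using x y b by (simp add: pE_mult B_assoc)
 qed
qed

lemma BB_left_module: "lmod E BB"
proof (intro left_module.intro left_module_axioms.intro Er.ring_axioms)
 show "abgrp BB" using Ba by (simp add: regular_bimodule_def)
qed (use Hom_add[OF sandwich_Hom] lin_add[OF sandwich_lin_r] sandwich_mult in simp_all)

text \<open>On maps that factor through the trivial module the coaction is absorbed by the counit.\<close>

lemma bact_trivial:
 assumes L: "lmod (opp H) L" and e: "e \<in> lhom (opp H) L (trivial_module K H)"
  and a: "a <: B"
 shows "(%l. e l \<odot> a) \<in> lhom K (lk L) (nk BB)"
  and "[|z <: Et; l <: L|] ==> bact L BB z (%l. e l \<odot> a) l = e l \<odot> sandwich B z a"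
proof -
 have ec: "e l <: K" if "l <: L" for l using lin_closed[OF e that] by (simp add: trivial_module_def)
 have es: "e (h .\<^sub>L l) = \<epsilon> h *\<^sub>K e l" if "h <: H" "l <: L" for h l
  using lin_smult[OF e, of h l] that by (simp add: trivial_module_def)
 have eK: "\<epsilon> (c .\<^sub>H 1\<^sub>H) = c" if "c <: K" for c
  using that counit_smult[of c "1\<^sub>H"] cring.cring_simprules(6,14)[OF K_cring] cring.cring_simprules(12)[OF K_cring]
  by (simp add: eps_one)
 show lin: "(%l. e l \<odot> a) \<in> lhom K (lk L) (nk BB)"
 proof (rule linI[OF HomI])
  fix x y assume "x <: lk L" "y <: lk L"
  then show "e (x +\<^sub>(lk L) y) \<odot> a = e x \<odot> a +\<^sub>(nk BB) e y \<odot> a"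
   using lin_add[OF e, of x y] a by (simp add: trivial_module_def Bm.smult_l_distr ec)
 next
  fix c x assume c: "c <: K" "x <: lk L"
  then show "e (c .\<^sub>(lk L) x) \<odot> a = c .\<^sub>(nk BB) (e x \<odot> a)"
   using a ec by (simp add: es eK Hm.smult_closed Bm.smult_closed Bm.smult_assoc1 B.smult_mult_l)
 qed (use a ec in "simp add: Bm.smult_closed")
 assume z: "z <: Et" and l: "l <: L"
 show "bact L BB z (%l. e l \<odot> a) l = e l \<odot> sandwich B z a"
 proof (rule tensor_ext[OF Ek.tp Ba bact_Hom[OF L BB_left_module lin l, simplified] _ _ z])
  show "(%z. e l \<odot> sandwich B z a) \<in> Hom Et B"
   by (rule Hom_comp[OF sandwich_Hom[OF a] smult_Hom[OF Bm.left_module_axioms ec[OF l]]])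
  fix b c assume "b <: B" "c <: opp B"
  then have b: "b <: B" and c: "c <: B" by simp_all
  have g: "(%x. e l \<odot> (x * a * c)) \<in> Hom B B"
   using a c ec[OF l] by (auto intro!: HomI simp: Bm.smult_closed B.l_distr Bm.smult_r_distr)
  have "bact L BB (pE b c) (%l. e l \<odot> a) l = tsum B (%x h. e l \<odot> ((\<epsilon> h \<odot> x) * a * c)) (\<rho> b)"
   unfolding bact_pure[OF L BB_left_module lin l b c] bact1_def BB_simps
  proof (rule rho_cong[OF b])
   fix x h assume x: "x <: B" "h <: H"
   have m: "(\<epsilon> h *\<^sub>K e l) \<odot> y = e l \<odot> (\<epsilon> h \<odot> y)" if "y <: B" for y
    using x ec[OF l] that Bm.smult_assoc1[of "e l" "\<epsilon> h" y] cring.cring_simprules(14)[OF K_cring, of "e l" "\<epsilon> h"] by simp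
   show "sandwich B (pE x c) (e (h .\<^sub>L l) \<odot> a) = e l \<odot> ((\<epsilon> h \<odot> x) * a * c)"
    using x c a l ec by (simp add: es m Bm.smult_closed B.smult_mult_l B.smult_mult_r)
  qed
  also have "... = e l \<odot> (tsum B (%x h. \<epsilon> h \<odot> x) (\<rho> b) * a * c)"
   by (rule rho_hom[OF Ba Ba g b, symmetric]) (simp add: Bm.smult_closed)
  finally show "bact L BB (pE b c) (%l. e l \<odot> a) l = e l \<odot> sandwich B (pE b c) a"
   using a b c by (simp add: coact_counit)
 qed
qed

section \<open>Exactness of \<open>- \<otimes>\<^sub>A B\<close>\<close>

text \<open>The kernel of \<open>g \<otimes> 1\<close> comes from \<open>ker g \<otimes>\<^sub>A B\<close>, and \<open>ker g\<close> is the image of \<open>f\<close>.\<close>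

lemma V_exact:
 assumes M: "lmod G M" and M': "lmod G M'" and M'': "lmod G M''"
  and f: "f \<in> lhom G M M'" and g: "g \<in> lhom G M' M''" and ex: "exact_at M f M' g M''"
 shows "exact_at (kV (rA M)) (Vmap M' f) (kV (rA M')) (Vmap M'' g) (kV (rA M''))"
proof (rule exact_atI)
 note Vf = lin_Hom[OF Vmap_lin[OF M M' f], simplified] and Vg = lin_Hom[OF Vmap_lin[OF M' M'' g], simplified]
 note Va = VMa[OF M''] and fc = lin_closed[OF f] and gc = lin_closed[OF g]
 note img = exact_atD(1)[OF ex]
 have zh: "(%_. 0\<^sub>(VM M'')) \<in> Hom (VM M) (VM M'')"
  by (rule HomI) (simp_all add: abelian_groupE(2,5)[OF Va])
 fix u
 { assume "u <: kV (rA M)"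
 then have u: "u <: VM M" by simp
 show "Vmap M' f u <: kV (rA M')" using Hom_closed[OF Vf u] by simp
 have "Vmap M'' g (Vmap M' f u) = 0\<^sub>(VM M'')"
 proof (rule tensor_ext[OF tpVM[OF M] Va Hom_comp[OF Vf Vg] zh _ u])
  fix m c assume "m <: rA M" "c <: lB"
  then have m: "m <: M" and c: "c <: B" by simp_all
  have "m <: M ==> 0\<^sub>(rA M'') <: rA M''" using abelian_groupE(2)[OF Ma[OF M'']] by simp
  then show "Vmap M'' g (Vmap M' f (pVM M m c)) = 0\<^sub>(VM M'')"
   using m c tensor_pure_zero(1)[OF tpVM[OF M''], of "0\<^sub>(rA M'')" c] fc[OF m]
   by (simp add: Vmap_pure[OF M M' f] Vmap_pure[OF M' M'' g] img)
 qed
 then show "Vmap M'' g (Vmap M' f u) = 0\<^sub>(kV (rA M''))" by simp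
 }
 { assume "u <: kV (rA M')" and z: "Vmap M'' g u = 0\<^sub>(kV (rA M''))"
 then have u: "u <: VM M'" by simp
 let ?S = "{y \<in> carrier (rA M'). g y = 0\<^sub>(rA M'')}"
 let ?Z = "(rA M')\<lparr>carrier := ?S\<rparr>" and ?j = "tmap A (rA M') lB (%x. x) (%x. x)"
 obtain w where w: "w <: V ?Z" and wu: "?j w = u"
  using flat_kernel[OF faithfully_flat rA_rmod[OF M'] rA_rmod[OF M''] rA_hom[OF g] u z[unfolded Vmap_def, simplified]] by (elim bexE)
 interpret rM: left_module "opp A" "rA M'" by (rule rA_rmod[OF M'])
 interpret rM2: left_module "opp A" "rA M''" by (rule rA_rmod[OF M''])
 have gz: "g 0\<^sub>M' = 0\<^sub>M''" by (rule Hom_zero[OF Ma[OF M'] Ma[OF M''] lin_Hom[OF g]])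
 have Z: "lmod (opp A) ?Z"
 proof (rule rM.submodule_left_module)
  show "?S \<subseteq> carrier (rA M')" by (rule Collect_restrict)
  show "0\<^sub>(rA M') \<in> ?S" using gz rM.M.zero_closed by simp
  fix x y assume "x \<in> ?S" "y \<in> ?S"
  then show "x +\<^sub>(rA M') y \<in> ?S"
   using lin_add[OF g] rM.M.a_closed[of x y] rM2.M.l_zero[OF rM2.M.zero_closed] by simp
 next
  fix a x assume "a <: opp A" "x \<in> ?S"
  then show "a .\<^sub>(rA M') x \<in> ?S"
   using lin_smult[OF g] rM.smult_closed[of a x] rM2.smult_zero_r[of a] by simp
 qed
 have iz: "(%x. x) \<in> lhom A ?Z (rA M')" by (auto simp: lmod_hom_def)
 note ia = tmap_Hom[OF tpA[OF Z] tpVM[OF M'] iz lin_id] and ip = tmap_pure[OF tpA[OF Z] tpVM[OF M'] iz lin_id]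
 have "\<exists>v\<in>carrier (VM M). Vmap M' f v = ?j w"
  using w
 proof (rule tensor_induct[OF tpA[OF Z], where Q="%w. \<exists>v\<in>carrier (VM M). Vmap M' f v = ?j w"])
  fix x y assume x: "x <: ?Z" and y: "y <: lB"
  then have "x \<in> f ` carrier M" using ex unfolding exact_at_def by simp
  then obtain m where m: "m <: M" "x = f m" by (elim imageE)
  show "\<exists>v\<in>carrier (VM M). Vmap M' f v = ?j (pt A ?Z lB x y)"
   by (rule bexI[where x="pVM M m y"])
     (use m y ip[OF x y] in "simp_all add: Vmap_pure[OF M M' f] pVM_closed[OF M]")
 next
  fix w w' assume ww: "w <: V ?Z" "w' <: V ?Z"
   and "\<exists>v\<in>carrier (VM M). Vmap M' f v = ?j w"
   and "\<exists>v\<in>carrier (VM M). Vmap M' f v = ?j w'"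
  then obtain v v' where v: "v <: VM M" "Vmap M' f v = ?j w"
   and v': "v' <: VM M" "Vmap M' f v' = ?j w'" by (elim bexE)
  show "\<exists>v\<in>carrier (VM M). Vmap M' f v = ?j (w +\<^sub>(V ?Z) w')"
   by (rule bexI[where x="v +\<^sub>(VM M) v'"])
     (simp_all only: Hom_add[OF Vf v(1) v'(1)] v(2) v'(2) Hom_add[OF ia ww] abelian_groupE(1)[OF VMa[OF M] v(1) v'(1)])
 qed
 then show "u \<in> Vmap M' f ` carrier (kV (rA M))" unfolding wu by (elim bexE) (rule image_eqI, auto) }
qed

text \<open>\<open>A \<otimes>\<^sub>A B = B\<close>\<close>

context
 assumes A0: "lmod G A0"
begin

definition mulA where "mulA = tsum B (%a b. a * b)"

lemma mulA_balanced: "balanced A (rA A0) lB B (%a b. a * b)"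
 by (rule balancedI) (simp_all add: B.l_distr B.r_distr B_assoc)

lemma mulA_lin: "mulA \<in> lhom K (kV (rA A0)) B"
 unfolding mulA_def
 by (rule kV_lift_lin[OF rA_rmod[OF A0] Bm.left_module_axioms mulA_balanced]) (auto intro!: lin_intro)

lemma mulA_Hom: "mulA \<in> Hom (VM A0) B"
 using lin_Hom[OF mulA_lin] by simp

lemma mulA_pure: "[|a <: A; b <: B|] ==> mulA (pVM A0 a b) = a * b"
 unfolding mulA_def using lift_pure[OF tpVM[OF A0] Ba mulA_balanced] by simp

lemma mulA_inverse:
 assumes v: "v <: VM A0" shows "pVM A0 1 (mulA v) = v"
proof (rule tensor_ext[OF tpVM[OF A0] VMa[OF A0] Hom_comp[OF mulA_Hom] Hom_id _ v])
 show "pVM A0 1 \<in> Hom B (VM A0)"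
  by (rule HomI) (simp_all add: pVM_closed[OF A0] pure_add_r[OF tpVM[OF A0], simplified])
 fix a b assume "a <: rA A0" "b <: lB"
 then show "pVM A0 1 (mulA (pVM A0 a b)) = pVM A0 a b"
  using pure_move[OF tpVM[OF A0], of a "1" b] by (simp add: mulA_pure)
qed

lemma mulA_zero:
 assumes v: "v <: VM A0" and z: "mulA v = \<zero>" shows "v = 0\<^sub>(VM A0)"
 using mulA_inverse[OF v] tensor_pure_zero(2)[OF tpVM[OF A0], of "1" "\<zero>"] by (simp add: z)

end

end

section \<open>The total complex\<close>

lemma projective_resolutionD:
 assumes "projective_resolution R P d M"
 shows "lmod R M" "!!n. projective_module R (P n)" "!!n. lmod R (P n)"
  "!!n. d n \<in> lhom R (P (Suc n)) (P n)"
  "!!n. exact_at (P (Suc (Suc n))) (d (Suc n)) (P (Suc n)) (d n) (P n)"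
  "\<exists>aug \<in> lhom R (P 0) M. exact_at (P (Suc 0)) (d 0) (P 0) aug M \<and> aug ` carrier (P 0) = carrier M"
proof -
 note a = assms[unfolded projective_resolution_def]
 show "lmod R M" by (rule conjunct1[OF a])
 show P: "projective_module R (P n)" for n by (rule conjunct1[OF conjunct2[OF a], THEN spec])
 show "lmod R (P n)" for n by (rule conjunct1[OF P[unfolded projective_module_def]])
 show "d n \<in> lhom R (P (Suc n)) (P n)" for n
  by (rule conjunct1[OF conjunct2[OF conjunct2[OF a]], THEN spec])
 show "exact_at (P (Suc (Suc n))) (d (Suc n)) (P (Suc n)) (d n) (P n)" for n
  by (rule conjunct1[OF conjunct2[OF conjunct2[OF conjunct2[OF a]]], THEN spec])
 show "\<exists>aug \<in> lhom R (P 0) M. exact_at (P (Suc 0)) (d 0) (P 0) aug M \<and> aug ` carrier (P 0) = carrier M"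
  by (rule conjunct2[OF conjunct2[OF conjunct2[OF conjunct2[OF a]]]])
qed

locale galois_resolutions = galois_Gamma K H B
 for K :: "('k, 'c) ring_scheme" and H :: "('k, 'h, 'z) hopf_scheme"
  and B :: "('k, 'h, 'b, 'w) comod_alg_scheme" (structure) +
 fixes L :: "nat \<Rightarrow> ('h, 'l) module" and dL :: "nat \<Rightarrow> 'l \<Rightarrow> 'l"
  and C :: "nat \<Rightarrow> (('b, 'b) tens, 'm) module" and dC :: "nat \<Rightarrow> 'm \<Rightarrow> 'm"
  and eL :: "'l \<Rightarrow> 'k" and aC :: "'m \<Rightarrow> 'b"
 assumes L_res: "projective_resolution (opp H) L dL (trivial_module K H)"
  and C_res: "projective_resolution (Gamma_alg K H B) C dC (coinv_Gamma_module K H B)"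
  and eL: "eL \<in> lhom (opp H) (L 0) (trivial_module K H)"
   "exact_at (L (Suc 0)) (dL 0) (L 0) eL (trivial_module K H)" "eL ` carrier (L 0) = carrier (trivial_module K H)"
  and aC: "aC \<in> lhom (Gamma_alg K H B) (C 0) (coinv_Gamma_module K H B)"
   "exact_at (C (Suc 0)) (dC 0) (C 0) aC (coinv_Gamma_module K H B)" "aC ` carrier (C 0) = carrier (coinv_Gamma_module K H B)"
begin

abbreviation "k0 \<equiv> trivial_module K H"

lemmas k0m = projective_resolutionD(1)[OF L_res] and Lm = projective_resolutionD(3)[OF L_res]
 and dL = projective_resolutionD(4)[OF L_res] and L_ex = projective_resolutionD(5)[OF L_res]
 and A0m = projective_resolutionD(1)[OF C_res] and Cp = projective_resolutionD(2)[OF C_res]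
 and Cm = projective_resolutionD(3)[OF C_res]
 and dC = projective_resolutionD(4)[OF C_res] and C_ex = projective_resolutionD(5)[OF C_res]

lemma k0_simps [simp]: "carrier k0 = carrier K" "add k0 = add K" "0\<^sub>k0 = 0\<^sub>K" "smult k0 = (%h c. \<epsilon> h *\<^sub>K c)"
 by (simp_all add: trivial_module_def)

lemma eL_closed [simp]: "l <: L 0 ==> eL l <: K"
 using lin_closed[OF eL(1)] by simp

lemma aC_closed: "m <: C 0 ==> aC m <: A" using lin_closed[OF aC(1)] by simp
lemma aC_B [simp]: "m <: C 0 ==> aC m <: B" using aC_closed by simp

abbreviation "Tb p q \<equiv> TM (L p) (C q)"
abbreviation "T p q \<equiv> TT (L p) (C q)"
abbreviation "dh p q \<equiv> mapL (L p) (C q) (dL p)"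
abbreviation "dv p q \<equiv> mapM (L p) (C q) (dC q)"
abbreviation "ph p q \<equiv> phi (L p) (C q)"
abbreviation "W q \<equiv> VM (C q)"
abbreviation "kW q \<equiv> kV (rA (C q))"
abbreviation "dW q \<equiv> Vmap (C q) (dC q)"

text \<open>The augmentation \<open>l \<otimes> z \<otimes> m \<mapsto> e(l) z a(m)\<close> of the total complex corresponds to a \<open>\<Gamma>\<close>-linear map into
  \<open>Hom(L\<^sub>0, B)\<close>.\<close>

definition "augF m = (\<lambda>l\<in>carrier (L 0). eL l \<odot> aC m)"

lemma augF: "augF \<in> lhom G (C 0) (HL (L 0) BB)"
proof (rule linI[OF HomI])
 note bt = bact_trivial[OF Lm eL(1)]
 fix m assume m: "m <: C 0"
 show "augF m <: HL (L 0) BB"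
  using lin_cong[OF bt(1)[OF aC_B[OF m]] lk_left_module[OF Lm], of "augF m"]
  by (simp add: HL_simps augF_def)
 { fix m' assume m': "m' <: C 0"
  show "augF (m +\<^sub>(C 0) m') = augF m +\<^sub>(HL (L 0) BB) augF m'"
   unfolding augF_def HL_simps(3)
   by (rule restrict_ext) (use m m' lin_add[OF aC(1) m m'] in "simp add: Bm.smult_r_distr") }
 { fix g assume g: "g <: G"
  show "augF (g .\<^sub>(C 0) m) = g .\<^sub>(HL (L 0) BB) augF m"
   unfolding augF_def HL_simps(4)
  proof (rule restrict_ext)
   fix l assume l: "l <: L 0"
   show "eL l \<odot> aC (g .\<^sub>(C 0) m) = bact (L 0) BB g (\<lambda>l\<in>carrier (L 0). eL l \<odot> aC m) l"
    using bact_restrict[OF Lm BB_left_module bt(1)[OF aC_B[OF m]] l, of g] bt(2)[OF aC_B[OF m] _ l, of g] m g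
     lin_smult[OF aC(1) g m] by simp
  qed }
qed

definition "augT = tlift B (%l z m. sandwich B z (augF m l))"

lemma augT_tbal': "tbal (L 0) (C 0) B (%l z m. sandwich B z (augF m l))"
 using HL_tbal[OF Lm BB_left_module Cm augF] by (simp add: tbal_def ebal_def HS_def)

lemmas augT_Hom = tlift_Hom[OF Lm Cm Ba augT_tbal', folded augT_def]

lemma augT_t3: "[|l <: L 0; z <: Et; m <: C 0|] ==>
  augT (t3 (L 0) (C 0) l z m) = sandwich B z (eL l \<odot> aC m)"
 using tlift_t3[OF Lm Cm Ba augT_tbal', folded augT_def] by (simp add: augF_def)

lemma augT_hom: "augT \<in> lhom E (Tb 0 0) BB"
proof (rule linI)
 show "augT \<in> Hom (Tb 0 0) BB" using augT_Hom by simp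
 fix e u assume e: "e <: E" and u: "u <: Tb 0 0"
 then have e': "e <: Et" and u': "u <: T 0 0" by simp_all
 have "augT (e .\<^sub>(Tb 0 0) u) = sandwich B e (augT u)"
  by (rule T_ext[OF Lm Cm Ba Hom_comp[OF TM_smult_Hom[OF Lm Cm e'] augT_Hom]
     Hom_comp[OF augT_Hom lin_Hom[OF sandwich_lin_r[OF e']]] _ u'])
    (use e' in "simp add: TM_smult_t3[OF Lm Cm] augT_t3 sandwich_mult Bm.smult_closed")
 then show "augT (e .\<^sub>(Tb 0 0) u) = e .\<^sub>BB augT u" by simp
qed

definition "epsV u = mulA (Vmap A0 aC u)"

lemma epsV_lin: "epsV \<in> lhom K (kW 0) B"
 unfolding epsV_def[abs_def] by (rule lin_comp[OF mulA_lin[OF A0m] Vmap_lin[OF Cm A0m aC(1)]])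

lemma epsV_Hom: "epsV \<in> Hom (W 0) B" using lin_Hom[OF epsV_lin] by simp

lemma epsV_closed [simp]: "w <: W 0 ==> epsV w <: B" by (rule Hom_closed[OF epsV_Hom])

lemma epsV_pure: "[|m <: C 0; c <: B|] ==> epsV (pVM (C 0) m c) = aC m * c"
 by (simp add: epsV_def Vmap_pure[OF Cm A0m aC(1)] mulA_pure[OF A0m] aC_closed)

lemma augT_phi:
 assumes l: "l <: L 0" and w: "w <: W 0"
 shows "augT (ph 0 0 l w) = eL l \<odot> epsV w"
 by (rule tensor_ext[OF tpVM[OF Cm] Ba Hom_comp[OF phi_Hom[OF Lm Cm l] augT_Hom]
    Hom_comp[OF epsV_Hom smult_Hom[OF Bm.left_module_axioms eL_closed[OF l]]] _ w])
   (use l in "simp add: phi_pure[OF Lm Cm] augT_t3 epsV_pure Bm.smult_closed B.smult_mult_l")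

lemma epsV_exact: "exact_at (kW (Suc 0)) (dW 0) (kW 0) epsV B"
proof -
 note V = V_exact[OF Cm Cm A0m dC aC(1) aC(2)]
 have za: "mulA 0\<^sub>(VM A0) = \<zero>" by (rule Hom_zero[OF VMa[OF A0m] Ba mulA_Hom[OF A0m]])
 have "epsV x = \<zero> \<longleftrightarrow> Vmap A0 aC x = 0\<^sub>(kV (rA A0))" if "x <: kW 0" for x
  using mulA_zero[OF A0m, of "Vmap A0 aC x"] lin_closed[OF Vmap_lin[OF Cm A0m aC(1)] that] za
  by (auto simp: epsV_def)
 then show ?thesis using V unfolding exact_at_def by (simp cong: conj_cong)
qed

lemma epsV_surj: "epsV ` carrier (kW 0) = carrier B"
proof (rule Set.set_eqI, rule iffI)
 fix b assume "b \<in> epsV ` carrier (kW 0)"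
 then show "b <: B" by (elim imageE) simp
next
 fix b assume b: "b <: B"
 have "1 \<in> aC ` carrier (C 0)" unfolding aC(3) by simp
 then obtain m where m: "m <: C 0" "aC m = 1" by (elim imageE) simp
 then show "b \<in> epsV ` carrier (kW 0)"
  using b by (intro image_eqI[where x="pVM (C 0) m b"]) (simp_all add: epsV_pure pVM_closed[OF Cm])
qed

lemma eL_lin: "eL \<in> lhom K (lk (L 0)) (lk k0)"
 using lin_Hom[OF eL(1)] lin_smult[OF eL(1)]
 by (intro linI) (simp_all add: Hom_def Hm.smult_closed)

lemma dL_lin: "dL n \<in> lhom K (lk (L (Suc n))) (lk (L n))"
 using lin_Hom[OF dL] lin_smult[OF dL]
 by (intro linI) (simp_all add: Hm.smult_closed)

text \<open>In terms of \<open>L\<^sub>p \<otimes> (C\<^sub>q \<otimes>\<^sub>A B)\<close> both differentials act on one factor only. The contraction of \<open>L\<close> down to \<open>k\<close>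
  gives \<open>s\<close>, and leaves the summand on which \<open>\<pi>\<close> projects \<open>L\<^sub>0\<close>; there the contraction of \<open>C \<otimes>\<^sub>A B\<close> down to \<open>B\<close> takes over.\<close>

lemma bicomplex_contractible:
 obtains s \<theta> P \<eta> where
  "bicomplex_contraction Tb dh dv s \<theta> P \<eta>"
  and "\<forall>x\<in>carrier (T 0 0). augT x = \<zero> \<longrightarrow> \<eta> x = 0\<^sub>(T 0 0)"
proof -
 have exL: "exact_at (lk (L (Suc (Suc n)))) (dL (Suc n)) (lk (L (Suc n))) (dL n) (lk (L n))" for n
  using L_ex[of n] by (simp add: exact_at_def)
 have exL0: "exact_at (lk (L (Suc 0))) (dL 0) (lk (L 0)) eL (lk k0)" "eL ` carrier (lk (L 0)) = carrier (lk k0)"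
  using eL(2,3) by (simp_all add: exact_at_def)
 obtain s r where s: "!!n. s n \<in> lhom K (lk (L n)) (lk (L (Suc n)))" and r: "r \<in> lhom K (lk k0) (lk (L 0))"
  and s0: "!!x. x <: lk (L 0) ==> dL 0 (s 0 x) +\<^sub>(lk (L 0)) r (eL x) = x"
  and sS: "!!n x. x <: lk (L (Suc n)) ==> dL (Suc n) (s (Suc n) x) +\<^sub>(lk (L (Suc n))) s n (dL n x) = x"
  using linear_contraction[where P="%n. lk (L n)" and d=dL and aug=eL and Z="lk k0",
    OF K_field lk_left_module[OF Lm] lk_left_module[OF k0m] dL_lin eL_lin exL exL0] by metis
 have dV: "dW n \<in> lhom K (kW (Suc n)) (kW n)" for n by (rule Vmap_lin[OF Cm Cm dC])
 have exV: "exact_at (kV (rA (C (Suc (Suc n))))) (dW (Suc n)) (kW (Suc n)) (dW n) (kW n)" for n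
  by (rule V_exact[OF Cm Cm Cm dC dC C_ex])
 obtain t r' where t: "!!n. t n \<in> lhom K (kW n) (kW (Suc n))" and r': "r' \<in> lhom K B (kW 0)"
  and t0: "!!x. x <: kW 0 ==> dW 0 (t 0 x) +\<^sub>(kW 0) r' (epsV x) = x"
  and tS: "!!n x. x <: kW (Suc n) ==> dW (Suc n) (t (Suc n) x) +\<^sub>(kW (Suc n)) t n (dW n x) = x"
  using linear_contraction[where P=kW and d=dW and aug=epsV and Z=B,
    OF K_field kVMm[OF Cm] Bm.left_module_axioms dV epsV_lin exV epsV_exact epsV_surj] by metis
 define \<pi> where "\<pi> x = r (eL x)" for x
 have \<pi>: "\<pi> \<in> lhom K (lk (L 0)) (lk (L 0))" unfolding \<pi>_def[abs_def] by (rule lin_comp[OF r eL_lin])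
 have re: "(%w. r' (epsV w)) \<in> lhom K (kW 0) (kW 0)" by (rule lin_comp[OF r' epsV_lin])
 have sc: "s n x <: L (Suc n)" if "x <: L n" for n x using lin_closed[OF s] that by simp
 have \<pi>c: "\<pi> x <: L 0" if "x <: L 0" for x using lin_closed[OF \<pi>] that by simp
 have tc: "t n w <: W (Suc n)" if "w <: W n" for n w using lin_closed[OF t] that by simp
 have rec: "r' (epsV w) <: W 0" if "w <: W 0" for w using lin_closed[OF re] that by simp
 have dLc: "dL n x <: L n" if "x <: L (Suc n)" for n x using lin_closed[OF dL] that by simp
 have dVc: "dW n w <: W n" if "w <: W (Suc n)" for n w using lin_closed[OF dV] that by simp
 have \<pi>d: "\<pi> (dL 0 x) = 0\<^sub>(L 0)" if "x <: L (Suc 0)" for x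
  using exact_atD(1)[OF eL(2) that] Hom_zero[OF lmod_ab[OF lk_left_module[OF k0m]] lmod_ab[OF lk_left_module[OF Lm]] lin_Hom[OF r]]
  by (simp add: \<pi>_def)
 let ?S = "%p q. cmap (L p) (C q) (L (Suc p)) (C q) (s p) (%w. w)"
 let ?\<theta> = "%q. cmap (L 0) (C q) (L 0) (C (Suc q)) \<pi> (t q)"
 let ?P = "%q. cmap (L 0) (C q) (L 0) (C q) \<pi> (%w. w)"
 let ?\<eta> = "cmap (L 0) (C 0) (L 0) (C 0) \<pi> (%w. r' (epsV w))"
 note Sa = cmap_Hom[OF Lm Cm Lm Cm s lin_id] and Sp = cmap_phi[OF Lm Cm Lm Cm s lin_id]
 note \<theta>a = cmap_Hom[OF Lm Cm Lm Cm \<pi> t] and \<theta>p = cmap_phi[OF Lm Cm Lm Cm \<pi> t]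
 note Pa = cmap_Hom[OF Lm Cm Lm Cm \<pi> lin_id] and Pp = cmap_phi[OF Lm Cm Lm Cm \<pi> lin_id]
 note \<eta>a = cmap_Hom[OF Lm Cm Lm Cm \<pi> re] and \<eta>p = cmap_phi[OF Lm Cm Lm Cm \<pi> re]
 note La = mapL_Hom[OF Lm Lm Cm dL] and Lp = mapL_phi[OF Lm Lm Cm dL]
 note Va = mapM_Hom[OF Lm Cm Cm dC] and Vp = mapM_phi[OF Lm Cm Cm dC]
 note Tg = TTa[OF Lm Cm] and ext = phi_ext[OF Lm Cm]
 have zh: "(%_. 0\<^sub>(T p' q')) \<in> Hom (T p q) (T p' q')" for p q p' q'
  by (rule HomI) (simp_all add: abelian_groupE(2,5)[OF Tg])
 have pl: "(%x. f x +\<^sub>(T p' q') g x) \<in> Hom (T p q) (T p' q')"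
  if f: "f \<in> Hom (T p q) (T p' q')" and g: "g \<in> Hom (T p q) (T p' q')" for f g p q p' q'
 proof -
  interpret A: abelian_group "T p' q'" by (rule Tg)
  show ?thesis by (rule HomI) (simp_all add: Hom_closed[OF f] Hom_closed[OF g] Hom_add[OF f] Hom_add[OF g] A.a_ac)
 qed
 have phz: "ph p q 0\<^sub>(L p) w = 0\<^sub>(T p q)" if "w <: W q" for p q w
  by (rule Hom_zero[OF lmod_ab[OF Lm] Tg phi_param[OF Lm Cm that]])
 have phz': "ph p q l 0\<^sub>(W q) = 0\<^sub>(T p q)" if "l <: L p" for p q l
  by (rule Hom_zero[OF VMa[OF Cm] Tg phi_Hom[OF Lm Cm that]])
 note pal = Hom_add[OF phi_param[OF Lm Cm], symmetric] and par = Hom_add[OF phi_Hom[OF Lm Cm], symmetric]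
 have "bicomplex_contraction Tb dh dv ?S ?\<theta> ?P ?\<eta>"
 proof (rule bicomplex_contraction.intro, unfold TM_simps One_nat_def)
  fix p q
  show "abgrp (T p q)" by (rule Tg)
  show "dh p q \<in> Hom (T (Suc p) q) (T p q)" by (rule La)
  show "dv p q \<in> Hom (T p (Suc q)) (T p q)" by (rule Va)
  show "?S p q \<in> Hom (T p q) (T (Suc p) q)" by (rule Sa)
  show "?\<theta> q \<in> Hom (T 0 q) (T 0 (Suc q))" by (rule \<theta>a)
 next
  fix p q x assume x: "x <: T (Suc (Suc p)) q"
  show "dh p q (dh (Suc p) q x) = 0\<^sub>(T p q)"
   by (rule ext[OF Tg Hom_comp[OF La La] zh _ x]) (simp add: Lp dLc exact_atD(1)[OF L_ex] phz)
 next
  fix p q x assume x: "x <: T p (Suc (Suc q))"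
  show "dv p q (dv p (Suc q) x) = 0\<^sub>(T p q)"
   by (rule ext[OF Tg Hom_comp[OF Va Va] zh _ x]) (simp add: Vp dVc exact_atD(1)[OF exV, simplified] phz')
 next
  fix p q x assume x: "x <: T (Suc p) (Suc q)"
  show "dh p q (dv (Suc p) q x) = dv p q (dh p (Suc q) x)"
   by (rule ext[OF Tg Hom_comp[OF Va La] Hom_comp[OF La Va] _ x]) (simp add: Lp Vp dLc dVc)
 next
  fix p q x assume x: "x <: T p (Suc q)"
  show "?S p q (dv p q x) = dv (Suc p) q (?S p (Suc q) x)"
   by (rule ext[OF Tg Hom_comp[OF Va Sa] Hom_comp[OF Sa Va] _ x]) (simp add: Sp Vp sc dVc)
 next
  fix p q x assume x: "x <: T (Suc p) q"
  show "dh (Suc p) q (?S (Suc p) q x) +\<^sub>(T (Suc p) q) ?S p q (dh p q x) = x"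
   by (rule ext[OF Tg pl[OF Hom_comp[OF Sa La] Hom_comp[OF La Sa]] Hom_id _ x])
     (simp add: Sp Lp sc dLc pal sS[simplified])
 next
  fix q x assume x: "x <: T 0 q"
  show "dh 0 q (?S 0 q x) +\<^sub>(T 0 q) ?P q x = x"
   by (rule ext[OF Tg pl[OF Hom_comp[OF Sa La] Pa] Hom_id _ x])
     (simp add: Sp Lp Pp sc \<pi>c dLc pal s0[simplified, folded \<pi>_def])
 next
  fix q x assume x: "x <: T (Suc 0) q"
  show "?\<theta> q (dh 0 q x) = 0\<^sub>(T 0 (Suc q))"
   by (rule ext[OF Tg Hom_comp[OF La \<theta>a] zh _ x]) (simp add: Lp \<theta>p dLc \<pi>d tc phz)
 next
  fix q x assume x: "x <: T 0 (Suc q)"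
  show "dv 0 (Suc q) (?\<theta> (Suc q) x) +\<^sub>(T 0 (Suc q)) ?\<theta> q (dv 0 q x) = ?P (Suc q) x"
   by (rule ext[OF Tg pl[OF Hom_comp[OF \<theta>a Va] Hom_comp[OF Va \<theta>a]] Pa _ x])
     (simp add: Vp \<theta>p Pp tc dVc \<pi>c par tS[simplified])
 next
  fix x assume x: "x <: T 0 0"
  show "dv 0 0 (?\<theta> 0 x) +\<^sub>(T 0 0) ?\<eta> x = ?P 0 x"
   by (rule ext[OF Tg pl[OF Hom_comp[OF \<theta>a Va] \<eta>a] Pa _ x])
     (simp add: Vp \<theta>p Pp \<eta>p tc rec dVc \<pi>c par t0[simplified])
 qed
 moreover
 have "?\<eta> x = 0\<^sub>(T 0 0)" if x: "x <: T 0 0" and z: "augT x = \<zero>" for x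
 proof -
  have r1: "r 1\<^sub>K <: L 0" using lin_closed[OF r] cring.cring_simprules(6)[OF K_cring] by simp
  have fa: "(%x. ph 0 0 (r 1\<^sub>K) (r' (augT x))) \<in> Hom (T 0 0) (T 0 0)"
   using Hom_comp[OF Hom_comp[OF augT_Hom lin_Hom[OF r', simplified]] phi_Hom[OF Lm Cm r1]] .
  have "?\<eta> x = ph 0 0 (r 1\<^sub>K) (r' (augT x))"
  proof (rule ext[OF Tg \<eta>a fa _ x])
   fix l w assume l: "l <: L 0" and w: "w <: W 0"
   have e: "r (eL l) = eL l .\<^sub>(lk (L 0)) r 1\<^sub>K"
   proof -
    have "(eL l .\<^sub>H 1\<^sub>H) .\<^sub>k0 1\<^sub>K = eL l"
     using l cring.cring_simprules(6)[OF K_cring] cring.cring_simprules(12,14)[OF K_cring]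
     by (simp add: counit_smult eps_one)
    then show ?thesis
     using lin_smult[OF r eL_closed[OF l], of "1\<^sub>K"] cring.cring_simprules(6)[OF K_cring] by simp
   qed
   have "?\<eta> (ph 0 0 l w) = ph 0 0 (eL l .\<^sub>(lk (L 0)) r 1\<^sub>K) (r' (epsV w))" (is "?a = _")
    unfolding \<eta>p[OF l w] \<pi>_def e ..
   also have "... = ph 0 0 (r 1\<^sub>K) (eL l .\<^sub>(kW 0) r' (epsV w))"
    by (rule phi_scalar[OF Lm Cm eL_closed[OF l] r1 rec[OF w]])
   also have "... = ph 0 0 (r 1\<^sub>K) (r' (augT (ph 0 0 l w)))"
    using lin_smult[OF r' eL_closed[OF l] epsV_closed[OF w]] by (simp add: augT_phi[OF l w])
   finally show "?a = ..." .
  qed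
  then show ?thesis
   using Hom_zero[OF Ba VMa[OF Cm] lin_Hom[OF r', simplified]] phz'[OF r1] by (simp add: z)
 qed
 then have "\<forall>x\<in>carrier (T 0 0). augT x = \<zero> \<longrightarrow> ?\<eta> x = 0\<^sub>(T 0 0)"
  by (intro ballI impI)
 ultimately show thesis by (rule that)
qed

lemma Tot_eq: "Tot K H B L C n = prod_mod n (%p. Tb p (n - p))"
 by (simp add: Tot_def prod_mod_def Let_def)

lemma Tot_left_module: "lmod E (Tot K H B L C n)"
 unfolding Tot_eq by (rule prod_mod_left_module[OF Er.ring_axioms TM_left_module[OF Lm Cm]])

lemma Tot_projective: "projective_module E (Tot K H B L C n)"
 unfolding projective_module_def
proof (intro conjI allI impI Tot_left_module)
 fix N N' g f
 assume a: "lmod E N \<and> lmod E N' \<and> g \<in> lhom E N N' \<and> g ` carrier N = carrier N' \<and> f \<in> lhom E (Tot K H B L C n) N'"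
 then have N: "lmod E N" and N': "lmod E N'" and g: "g \<in> lhom E N N'" and s: "g ` carrier N = carrier N'"
  and f: "f \<in> lhom E (prod_mod n (%p. Tb p (n - p))) N'" by (simp_all add: Tot_eq)
 show "\<exists>h\<in>lhom E (Tot K H B L C n) N. \<forall>x\<in>carrier (Tot K H B L C n). g (h x) = f x"
  unfolding Tot_eq
 proof (rule prod_mod_lift[OF Er.ring_axioms TM_left_module[OF Lm Cm] N N' g _ f])
  fix p f assume "f \<in> lhom E (Tb p (n - p)) N'"
  from T_projective_lift[OF Lm Cp N N' g s this]
  show "\<exists>h\<in>lhom E (Tb p (n - p)) N. \<forall>x\<in>carrier (Tb p (n - p)). g (h x) = f x" by simp
 qed
qed

theorem Tot_resolution: "projective_resolution E (Tot K H B L C) (Tot_diff K H B L dL C dC) BB"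
proof -
 obtain s \<theta> P \<eta> where
  bc: "bicomplex_contraction Tb dh dv s \<theta> P \<eta>"
  and \<eta>: "\<forall>x\<in>carrier (T 0 0). augT x = \<zero> \<longrightarrow> \<eta> x = 0\<^sub>(T 0 0)"
  by (rule bicomplex_contractible)
 interpret bc: bicomplex_contraction Tb dh dv s \<theta> P \<eta>
  by (rule bc)
 have D: "Tot_diff K H B L dL C dC n = bc.tot_d n" for n
  unfolding bc.tot_d_def[abs_def] Tot_diff_def[abs_def] bc.sgn_pow_def Let_def unfolding mapL_def mapM_def by simp
 have Dh: "bc.tot_d n \<in> lhom E (bc.Tt (Suc n)) (bc.Tt n)" for n
  by (rule bc.tot_d_lin[OF TM_left_module[OF Lm Cm] mapL_hom[OF Lm Lm Cm dL] mapM_hom[OF Lm Cm Cm dC]])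
 let ?aug = "%t. augT (t 0)"
 have aug: "?aug \<in> lhom E (bc.Tt 0) BB"
  by (rule lin_comp[OF augT_hom]) (use prod_mod_proj[of 0 0 E "%p. Tb p (0 - p)"] in simp)
 have augd: "augT (dh 0 0 u) = \<zero>" if u: "u <: T (Suc 0) 0" for u
 proof (rule phi_ext[OF Lm Cm Ba Hom_comp[OF mapL_Hom[OF Lm Lm Cm dL] augT_Hom] _ _ u])
  show "(%_. \<zero>) \<in> Hom (T (Suc 0) 0) B" by (rule HomI) simp_all
  fix l w assume l: "l <: L (Suc 0)" and w: "w <: W 0"
  show "augT (dh 0 0 (ph (Suc 0) 0 l w)) = \<zero>"
   using l w lin_closed[OF dL l] exact_atD(1)[OF eL(2) l]
   by (simp add: mapL_phi[OF Lm Lm Cm dL] augT_phi Bm.smult_zero_l)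
 qed
 have augv: "augT (dv 0 0 u) = \<zero>" if u: "u <: T 0 (Suc 0)" for u
 proof (rule phi_ext[OF Lm Cm Ba Hom_comp[OF mapM_Hom[OF Lm Cm Cm dC] augT_Hom] _ _ u])
  show "(%_. \<zero>) \<in> Hom (T 0 (Suc 0)) B" by (rule HomI) simp_all
  fix l w assume l: "l <: L 0" and w: "w <: W (Suc 0)"
  show "augT (dv 0 0 (ph 0 (Suc 0) l w)) = \<zero>"
   using l w lin_closed[OF Vmap_lin[OF Cm Cm dC], of w 0] exact_atD(1)[OF epsV_exact, of w]
   by (simp add: mapM_phi[OF Lm Cm Cm dC] augT_phi Bm.smult_zero_r)
 qed
 have ex0: "exact_at (bc.Tt (Suc 0)) (bc.tot_d 0) (bc.Tt 0) ?aug BB"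
 proof (rule exact_atI)
  fix t assume t: "t <: bc.Tt (Suc 0)"
  show "bc.tot_d 0 t <: bc.Tt 0" by (rule bc.tot_d_closed[OF t])
  have c: "t (Suc 0) <: Tb (Suc 0) 0" "t 0 <: Tb 0 (Suc 0)"
   using bc.Tt_comp[OF t, of 0] by simp_all
  show "augT (bc.tot_d 0 t 0) = 0\<^sub>BB"
   using Hom_add[OF augT_Hom, of "dh 0 0 (t (Suc 0))" "dv 0 0 (t 0)"] bc.sgn_pow_0[OF bc.dv_closed[OF c(2)]]
    bc.dh_closed[OF c(1)] bc.dv_closed[OF c(2)] augd[of "t (Suc 0)"] augv[of "t 0"] c by (simp add: bc.tot_d_def)
 next
  fix x assume x: "x <: bc.Tt 0" and "augT (x 0) = 0\<^sub>BB"
  then have z: "augT (x 0) = \<zero>" by simp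
  have "\<eta> (x 0) = 0\<^sub>(Tb 0 0)" using \<eta>[THEN bspec, of "x 0"] bc.Tt_closed[OF x, of 0] z by simp
  from bc.tot_h_zero[OF x this] bc.tot_h_closed[OF x]
  show "x \<in> bc.tot_d 0 ` carrier (bc.Tt (Suc 0))" by (intro image_eqI[where x="bc.tot_h 0 x"]) simp_all
 qed
 have surj: "?aug ` carrier (bc.Tt 0) = carrier BB"
 proof (rule Set.set_eqI, rule iffI)
  fix b assume "b \<in> ?aug ` carrier (bc.Tt 0)"
  then show "b <: BB" using lin_closed[OF aug] by (elim imageE) simp
 next
  fix b assume "b <: BB"
  then have b: "b <: B" by simp
  have "1\<^sub>K \<in> eL ` carrier (L 0)" unfolding eL(3) using cring.cring_simprules(6)[OF K_cring] by simp
  then obtain l where l: "l <: L 0" "eL l = 1\<^sub>K" by (elim imageE) simp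
  have "b \<in> epsV ` carrier (kW 0)" unfolding epsV_surj by (rule b)
  then obtain w where w: "w <: W 0" "b = epsV w" by (elim imageE) simp
  let ?t = "\<lambda>p\<in>{..0::nat}. ph 0 0 l w"
  have "?t <: bc.Tt 0"
   by (rule restrict_prod_mod) (use phi_closed[OF Lm Cm l(1) w(1)] in simp)
  moreover have "?aug ?t = b" using l w b by (simp add: augT_phi Bm.smult_one)
  ultimately show "b \<in> ?aug ` carrier (bc.Tt 0)" by (intro image_eqI[where x="?t"]) simp_all
 qed
 show ?thesis
  unfolding projective_resolution_def
 proof (intro conjI allI)
  show "lmod E BB" by (rule BB_left_module)
  show "projective_module E (Tot K H B L C n)" for n by (rule Tot_projective)
  show "Tot_diff K H B L dL C dC n \<in> lhom E (Tot K H B L C (Suc n)) (Tot K H B L C n)" for n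
   unfolding D Tot_eq by (rule Dh)
  show "exact_at (Tot K H B L C (Suc (Suc n))) (Tot_diff K H B L dL C dC (Suc n)) (Tot K H B L C (Suc n))
    (Tot_diff K H B L dL C dC n) (Tot K H B L C n)" for n
   unfolding D Tot_eq by (rule bc.tot_exact)
  show "\<exists>aug\<in>lhom E (Tot K H B L C 0) BB. exact_at (Tot K H B L C (Suc 0)) (Tot_diff K H B L dL C dC 0) (Tot K H B L C 0) aug BB \<and>
    aug ` carrier (Tot K H B L C 0) = carrier BB"
   unfolding D Tot_eq by (intro bexI[where x="?aug"] conjI ex0 surj aug)
 qed
qed

end

theorem proposition4p2:
 fixes K :: "'k ring"
  and H :: "('k, 'h) hopf"
  and B :: "('k, 'h, 'b) comod_alg"
  and L :: "nat \<Rightarrow> ('h, 'l) module" and dL :: "nat \<Rightarrow> 'l \<Rightarrow> 'l"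
  and C :: "nat \<Rightarrow> (('b, 'b) tens, 'm) module" and dC :: "nat \<Rightarrow> 'm \<Rightarrow> 'm"
 assumes "hopf_algebra K H"
  and "bij_betw (antipode H) (carrier H) (carrier H)"
  and "faithfully_flat_hopf_galois K H B"
  and "projective_resolution (opp H) L dL (trivial_module K H)"
  and "projective_resolution (Gamma_alg K H B) C dC (coinv_Gamma_module K H B)"
 shows "projective_resolution (enveloping K B) (Tot K H B L C) (Tot_diff K H B L dL C dC)
      (regular_bimodule B)"
proof -
 have G: "ring (Gamma_alg K H B)"
  using projective_resolutionD(1)[OF assms(5)] by (simp add: left_module_def)
 obtain eL where eL: "eL \<in> lhom (opp H) (L 0) (trivial_module K H)"
   "exact_at (L (Suc 0)) (dL 0) (L 0) eL (trivial_module K H)" "eL ` carrier (L 0) = carrier (trivial_module K H)"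
  using projective_resolutionD(6)[OF assms(4)] by (elim bexE conjE)
 obtain aC where aC: "aC \<in> lhom (Gamma_alg K H B) (C 0) (coinv_Gamma_module K H B)"
   "exact_at (C (Suc 0)) (dC 0) (C 0) aC (coinv_Gamma_module K H B)" "aC ` carrier (C 0) = carrier (coinv_Gamma_module K H B)"
  using projective_resolutionD(6)[OF assms(5)] by (elim bexE conjE)
 interpret galois_resolutions K H B L dL C dC eL aC
  by (intro galois_resolutions.intro galois_Gamma.intro galois_ext.intro galois_ext_axioms.intro galois_Gamma_axioms.intro
    galois_resolutions_axioms.intro assms(2-5) G eL aC)
 show ?thesis unfolding enveloping_eq by (rule Tot_resolution)
qed

end
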